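(* Let $\mathbf{s}=(s_k)_{k\ge 1}$ be a sequence of positive integers and set $\sigma:=\sigma(\mathbf{s})$. There is a function $$\delta:\mathrm{Sturm}(\mathbf{s})\to[0,\sigma/(1+\sigma)],$$ whose image $\Delta(\mathbf{s})$ is a dense subset of $[0,\sigma/(1+\sigma)]$, with the following property. For each $\xi\in\mathrm{Sturm}(\mathbf{s})$, writing $\delta:=\delta(\xi)$, we have $$\widehat{\omega}_2(\xi)=\widehat{\omega}_2^*(\xi)=1+(1-\delta)(1+\sigma),\qquad \widehat{\lambda}_2(\xi)=\frac{(1-\delta)(1+\sigma)}{1+(1-\delta)(1+\sigma)},$$ $$\omega_2(\xi)=\omega_2^*(\xi)=\frac{2-\delta}{\sigma}+1-\delta,\qquad 1-\delta\le\lambda_2(\xi)\le\max\Big(1-\delta,\frac{1}{1-\delta+\sigma}\Big).$$ If moreover $\delta<h(\sigma)$, where $h(\sigma)=\sigma/2+1-\sqrt{(\sigma/2)^2+1}$, then $$\lambda_2(\xi)=1-\delta\quad\text{and}\quad \widehat{\lambda}_{\min}(\xi)=\frac{(1-\delta)(1+\sigma)}{2+\sigma}.$$ The formula $\lambda_2(\xi)=1-\delta$ still holds if $\delta=h(\sigma)$. (When $\sigma=0$, $\frac{2-\delta}{\sigma}$ is read as $+\infty$.)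
   Context: For a sequence $\mathbf{s}=(s_k)_{k\ge1}$ of positive integers, $\sigma(\mathbf{s}):=\liminf_{k\to\infty}1/[s_{k+1};s_k,\dots,s_1]$, where $[a_0;a_1,\dots]$ denotes a continued fraction. Norms: $\|\cdot\|$ is the largest absolute value of the coefficients of a vector or matrix; $H(P)$ is the largest absolute value of the coefficients of a polynomial $P$. The content of a non-zero integer matrix is the gcd of its coefficients. For a real $2\times2$ matrix $w=\begin{pmatrix}a&b\\c&d\end{pmatrix}$ put $U(w):=-c+(a-d)X+bX^2$. The set $\mathrm{Sturm}(\mathbf{s})$: with $\sigma=\sigma(\mathbf{s})$, it consists of the real numbers $\xi$, neither rational nor quadratic, for which there is a sequence $(w_k)_{k\ge0}$ in $\mathrm{Mat}_{2\times2}(\mathbb{Z})\cap\mathrm{GL}_2(\mathbb{Q})$ such that, denoting by $c_k$ the content of $w_k$, $\widetilde{w}_k:=c_k^{-1}w_k$ and $P_k:=U(\widetilde{w}_k)$: (i) $w_{k+1}=w_k^{s_{k+1}}w_{k-1}$ for each $k\ge1$, and $\det(w_0w_1-w_1w_0)\ne0$; (ii) there is $c>0$ such that $\|w_k^{\ell+1}w_{k-1}\|\ge c\,\|w_k\|\,\|w_k^{\ell}w_{k-1}\|$ for all $k\ge1$ and $0\le\ell\le s_{k+1}$; (iii) $P_k(\xi)/H(P_k)\to0$ as $k\to\infty$; (iv) $|\det(\widetilde{w}_k)|\le\|\widetilde{w}_k\|^{\sigma/(1+\sigma)+o(1)}$ as $k\to\infty$. Exponents, for $\xi\in\mathbb{R}$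 neither rational nor quadratic, with $\Xi=(1,\xi,\xi^2)$, $\wedge$ the cross product and $\cdot$ the scalar product in $\mathbb{R}^3$: - $\lambda_2(\xi)$ (resp. $\widehat{\lambda}_2(\xi)$) is the supremum of the real $\lambda$ such that for arbitrarily large $X$ (resp. for all sufficiently large $X$) there is $x\in\mathbb{Z}^3\setminus\{0\}$ with $\|x\wedge\Xi\|\le X^{-\lambda}$ and $\|x\|\le X$. - $\omega_2(\xi)$ (resp. $\widehat{\omega}_2(\xi)$) is the supremum of the real $\omega$ such that for arbitrarily large $X$ (resp. all sufficiently large $X$) there is $x\in\mathbb{Z}^3\setminus\{0\}$ with $|x\cdot\Xi|\le X^{-\omega}$ and $\|x\|\le X$. - $\omega_2^*(\xi)$ (resp. $\widehat{\omega}_2^*(\xi)$) is the supremum of the real $\omega$ such that for arbitrarily large $X$ (resp. all sufficiently large $X$) there is an algebraic number $\alpha$ of degree at most $2$ with $0<|\xi-\alpha|\le H(\alpha)^{-1}X^{-\omega}$ and $H(\alpha)\le X$, where $H(\alpha)$ is the largest absolute value of the coefficients of the irreducible minimal polynomial of $\alpha$ over $\mathbb{Z}$. - For $0\le\mu<\lambda_2(\xi)$, $\widehat{\lambda}_\mu(\Xi)$ is the supremum of the real $\lambda$ such that for all sufficiently large $X$ there is $x\in\mathbb{Z}^3\setminus\{0\}$ with $\|x\wedge\Xi\|\le\min(X^{-\lambda},\|x\|^{-\mu})$ and $\|x\|\le X$. Then $\widehat{\lambda}_{\min}(\xi):=\lim_{\mu\to\lambda_2(\xi)^-}\widehat{\lambda}_\mu(\Xi)$.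 *)

theory Defs
  imports
    "HOL-Analysis.Analysis"
    "HOL-Analysis.Cross3"
    "HOL-Computational_Algebra.Computational_Algebra"
begin

subsection \<open>The parameter sigma of a sequence\<close>

text \<open>\<open>cfrac [a\<^sub>0, \<dots>, a\<^sub>n]\<close> is the finite continued fraction with partial quotients
  \<open>a\<^sub>0, \<dots>, a\<^sub>n\<close>; the value at the empty list is junk.\<close>

fun cfrac :: "real list \<Rightarrow> real" where
  "cfrac [] = 0"
| "cfrac [a] = a"
| "cfrac (a # b # as) = a + 1 / cfrac (b # as)"

text \<open>Sequences are indexed from 1: the value at index 0 is never used.  For positive terms the
  quantities below lie in \<open>{0..1}\<close>, so the lower limit is finite and passing through
  the extended reals is harmless.\<close>

definition sturm_sigma :: "(nat \<Rightarrow> nat) \<Rightarrow> real" where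
  "sturm_sigma s = real_of_ereal
     (liminf (\<lambda>k. ereal (1 / cfrac (map (\<lambda>i. real (s i)) (rev [1..<k + 2])))))"

subsection \<open>Heights, contents, matrices\<close>

text \<open>The maximum norm of vectors and matrices is the library's \<open>infnorm\<close> (the standard basis of
  \<open>real^'n^'m\<close> consists of the elementary matrices).\<close>

definition poly_height :: "'a::linordered_idom poly \<Rightarrow> 'a" where
  "poly_height p = (MAX i\<in>{..degree p}. \<bar>coeff p i\<bar>)"

text \<open>The product \<open>*\<close> (and with it \<open>A ^ n\<close>) is entrywise on matrices; powers are therefore
  iterates of \<open>**\<close>.\<close>

definition mat_power :: "'a::semiring_1^'n^'n \<Rightarrow> nat \<Rightarrow> 'a^'n^'n" where
  "mat_power A n = (((**) A) ^^ n) (mat 1)"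

abbreviation real_mat :: "int^'n^'m \<Rightarrow> real^'n^'m" where
  "real_mat \<equiv> map_matrix real_of_int"

definition real_vec :: "int^'n \<Rightarrow> real^'n" where
  "real_vec x = (\<chi> i. real_of_int (x $ i))"

definition mat_content :: "int^'n^'m \<Rightarrow> int" where
  "mat_content A = Gcd {A $ i $ j | i j. True}"

definition primitive_part_mat :: "int^'n^'m \<Rightarrow> real^'n^'m" where
  "primitive_part_mat A = (1 / real_of_int (mat_content A)) *\<^sub>R real_mat A"

definition U_poly :: "real^2^2 \<Rightarrow> real poly" where
  "U_poly A = [: - (A $ 2 $ 1), A $ 1 $ 1 - A $ 2 $ 2, A $ 1 $ 2 :]"

subsection \<open>Algebraic numbers\<close>

text \<open>Irreducibility over the integers includes primitivity, and irreducible constants have no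
  roots; so \<open>p\<close> is the minimal polynomial of \<open>\<alpha>\<close> over the integers, unique up to sign.\<close>

definition is_int_minpoly :: "int poly \<Rightarrow> complex \<Rightarrow> bool" where
  "is_int_minpoly p \<alpha> \<longleftrightarrow> irreducible p \<and> poly (map_poly of_int p) \<alpha> = 0"

definition quadratic_real :: "real \<Rightarrow> bool" where
  "quadratic_real \<xi> \<longleftrightarrow> (\<exists>p. is_int_minpoly p (complex_of_real \<xi>) \<and> degree p = 2)"

subsection \<open>The set Sturm\<close>

text \<open>In the third condition, the polynomials are automatically non-zero: the first condition
  implies that no \<open>w k\<close> commutes with \<open>w (Suc k)\<close>, so that no \<open>w k\<close> is scalar.\<close>

definition sturm_sequence :: "(nat \<Rightarrow> nat) \<Rightarrow> real \<Rightarrow> (nat \<Rightarrow> int^2^2) \<Rightarrow> bool" where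
  "sturm_sequence s \<xi> w \<longleftrightarrow>
     (\<forall>k. invertible (map_matrix rat_of_int (w k))) \<and>
     (\<forall>k\<ge>1. w (k + 1) = mat_power (w k) (s (k + 1)) ** w (k - 1)) \<and>
     det (w 0 ** w 1 - w 1 ** w 0) \<noteq> 0 \<and>
     (\<exists>c>0. \<forall>k\<ge>1. \<forall>l\<le>s (k + 1).
        infnorm (real_mat (mat_power (w k) (l + 1) ** w (k - 1))) \<ge>
          c * infnorm (real_mat (w k)) * infnorm (real_mat (mat_power (w k) l ** w (k - 1)))) \<and>
     (\<lambda>k. poly (U_poly (primitive_part_mat (w k))) \<xi> /
           poly_height (U_poly (primitive_part_mat (w k)))) \<longlonglongrightarrow> 0 \<and>
     (\<exists>\<epsilon>. \<epsilon> \<longlonglongrightarrow> 0 \<and>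
        (\<forall>\<^sub>F k in sequentially. \<bar>det (primitive_part_mat (w k))\<bar> \<le>
           infnorm (primitive_part_mat (w k)) powr
             (sturm_sigma s / (1 + sturm_sigma s) + \<epsilon> k)))"

definition Sturm :: "(nat \<Rightarrow> nat) \<Rightarrow> real set" where
  "Sturm s = {\<xi>. \<xi> \<notin> \<rat> \<and> \<not> quadratic_real \<xi> \<and> (\<exists>w. sturm_sequence s \<xi> w)}"

subsection \<open>Exponents of Diophantine approximation\<close>

text \<open>Exponents may be infinite, so suprema are taken in the extended reals.\<close>

definition Xi :: "real \<Rightarrow> real^3" where
  "Xi \<xi> = vector [1, \<xi>, \<xi>\<^sup>2]"

definition lambda_approx :: "real \<Rightarrow> real \<Rightarrow> real \<Rightarrow> bool" where
  "lambda_approx \<xi> l X \<longleftrightarrow> (\<exists>x::int^3. x \<noteq> 0 \<and>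
     infnorm (cross3 (real_vec x) (Xi \<xi>)) \<le> X powr (-l) \<and> infnorm (real_vec x) \<le> X)"

definition omega_approx :: "real \<Rightarrow> real \<Rightarrow> real \<Rightarrow> bool" where
  "omega_approx \<xi> \<omega> X \<longleftrightarrow> (\<exists>x::int^3. x \<noteq> 0 \<and>
     \<bar>real_vec x \<bullet> Xi \<xi>\<bar> \<le> X powr (-\<omega>) \<and> infnorm (real_vec x) \<le> X)"

definition omega_star_approx :: "real \<Rightarrow> real \<Rightarrow> real \<Rightarrow> bool" where
  "omega_star_approx \<xi> \<omega> X \<longleftrightarrow> (\<exists>\<alpha> p. is_int_minpoly p \<alpha> \<and> degree p \<le> 2 \<and>
     0 < cmod (complex_of_real \<xi> - \<alpha>) \<and>
     cmod (complex_of_real \<xi> - \<alpha>) \<le> inverse (real_of_int (poly_height p)) * X powr (-\<omega>) \<and>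
     real_of_int (poly_height p) \<le> X)"

definition lambda_mu_approx :: "real \<Rightarrow> real \<Rightarrow> real \<Rightarrow> real \<Rightarrow> bool" where
  "lambda_mu_approx \<mu> \<xi> l X \<longleftrightarrow> (\<exists>x::int^3. x \<noteq> 0 \<and>
     infnorm (cross3 (real_vec x) (Xi \<xi>)) \<le> min (X powr (-l)) (infnorm (real_vec x) powr (-\<mu>)) \<and>
     infnorm (real_vec x) \<le> X)"

definition lambda2 :: "real \<Rightarrow> ereal" where
  "lambda2 \<xi> = Sup (ereal ` {l. \<exists>\<^sub>F X in at_top. lambda_approx \<xi> l X})"

definition lambda2_hat :: "real \<Rightarrow> ereal" where
  "lambda2_hat \<xi> = Sup (ereal ` {l. \<forall>\<^sub>F X in at_top. lambda_approx \<xi> l X})"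

definition omega2 :: "real \<Rightarrow> ereal" where
  "omega2 \<xi> = Sup (ereal ` {\<omega>. \<exists>\<^sub>F X in at_top. omega_approx \<xi> \<omega> X})"

definition omega2_hat :: "real \<Rightarrow> ereal" where
  "omega2_hat \<xi> = Sup (ereal ` {\<omega>. \<forall>\<^sub>F X in at_top. omega_approx \<xi> \<omega> X})"

definition omega2_star :: "real \<Rightarrow> ereal" where
  "omega2_star \<xi> = Sup (ereal ` {\<omega>. \<exists>\<^sub>F X in at_top. omega_star_approx \<xi> \<omega> X})"

definition omega2_star_hat :: "real \<Rightarrow> ereal" where
  "omega2_star_hat \<xi> = Sup (ereal ` {\<omega>. \<forall>\<^sub>F X in at_top. omega_star_approx \<xi> \<omega> X})"

definition lambda_hat_mu :: "real \<Rightarrow> real \<Rightarrow> ereal" where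
  "lambda_hat_mu \<mu> \<xi> = Sup (ereal ` {l. \<forall>\<^sub>F X in at_top. lambda_mu_approx \<mu> \<xi> l X})"

text \<open>The filter describes real \<open>\<mu>\<close> tending to \<open>lambda2 \<xi>\<close> from below, also when
  \<open>lambda2 \<xi>\<close> is infinite.  The limit exists because \<open>lambda_hat_mu\<close> is decreasing in \<open>\<mu>\<close>.\<close>

definition lambda_min_hat :: "real \<Rightarrow> ereal" where
  "lambda_min_hat \<xi> =
     Lim (filtercomap ereal (at_left (lambda2 \<xi>))) (\<lambda>\<mu>. lambda_hat_mu \<mu> \<xi>)"

definition sturm_h :: "real \<Rightarrow> real" where
  "sturm_h \<sigma> = \<sigma> / 2 + 1 - sqrt ((\<sigma> / 2)\<^sup>2 + 1)"

end

theory Submission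
 imports Defs
begin

text \<open>Put $U_k = U(w_k)$, primitive after division by its content.  With $\Phi_k$ one of two matrices
 depending on the parity of $k$, the matrices $w_k^l w_{k-1} \Phi_k$ are traceless; read as integer points
 they are orthogonal to $U_k$ and are good approximations of $(1,\xi,\xi^2)$, since multiplication by $w_k$
 divides the error by about $\|w_k\| / |\det w_k|$.  The quantities $\log\|w_k\|$, $\log|\det w_k|$ and
 $\log c_k$ are superadditive (up to sign and a constant) along the recurrence
 $q_{k+1} = s_{k+1} q_k + q_{k-1}$ and hence asymptotically proportional to $q_k$; the contents of all other
 points are negligible.  So heights and errors of all these points are known up to $o(1)$ in the exponent
 in terms of $\sigma$ and a single number $\delta$, and the exponents follow because the points
 on either side of $U_k$ span its orthogonal lattice.  For density, explicit symmetric $w_0, w_1$ whose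
 determinants are powers of $4$ give every value of $\delta$ up to an arbitrarily small error.\<close>

text \<open>Nothing bounds \<open>q (k + 1) / q k\<close>: when the partial quotients are unbounded,
  knowing the \<open>w k\<close> up to \<open>o(1)\<close> in the exponent says nothing about the
  products \<open>w k ^ l * w (k - 1)\<close> in between, so every estimate has to be uniform in
  \<open>l\<close>. For the contents this is the main obstacle. Concavity in \<open>l\<close>
  handles small \<open>l\<close>; for large \<open>l\<close> the content of \<open>wt k ^ l\<close>
  is repeated \<open>s (k + 1) div l\<close> times inside a content already known to be small. The
  exponents are computed without matrices, from the asymptotic properties collected in the locale
  \<open>sturm_points\<close>; there all quantities are exponentials of linear expressions in the
  \<open>Q k\<close>. The bound \<open>\<delta> <= \<sigma> / (1 + \<sigma>)\<close>, inherited from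
  the condition on determinants, is what makes \<open>p k\<close> the best form up to almost the
  height of \<open>p (k + 1)\<close>. As \<open>\<sigma>\<close> is only a lower limit, one half of
  each exponent uses a bound valid for all large \<open>k\<close>, the other half a bound valid for
  infinitely many \<open>k\<close>. The number \<open>\<delta>\<close> is picked by choice for each
  \<open>\<xi>\<close>; it is determined by \<open>\<xi>\<close> because \<open>omega2_hat\<close>
  determines it.\<close>

abbreviation eventually_seq :: "(nat \<Rightarrow> bool) \<Rightarrow> bool" (binder "EV " 10) where
 "eventually_seq P \<equiv> eventually P sequentially"

section \<open>The denominators \<open>q k\<close> and the number \<open>\<sigma>\<close>\<close>

fun sturm_q :: "(nat \<Rightarrow> nat) \<Rightarrow> nat \<Rightarrow> real" where
 "sturm_q s 0 = 1"
| "sturm_q s (Suc 0) = real (s 1)"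
| "sturm_q s (Suc (Suc k)) = real (s (Suc (Suc k))) * sturm_q s (Suc k) + sturm_q s k"

locale sturm_seq =
 fixes s :: "nat \<Rightarrow> nat"
 assumes s_pos: "k >= 1 ==> s k > 0"
begin

abbreviation q :: "nat \<Rightarrow> real" where "q \<equiv> sturm_q s"

lemma s_ge_1: "k >= 1 ==> real (s k) >= 1"
 using s_pos[of k] by simp

lemma q_ge_1: "q k >= 1"
proof -
 have "q k >= 1 & q (Suc k) >= 1"
 proof (induction k)
  case 0 then show ?case using s_ge_1[of 1] by simp
 next
  case (Suc k)
  have "1 * 1 <= real (s (Suc (Suc k))) * q (Suc k)"
   by (rule mult_mono) (use Suc s_ge_1[of "Suc (Suc k)"] in auto)
  then show ?case using Suc by simp
 qed
 then show ?thesis ..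
qed

lemma q_pos: "q k > 0"
 using q_ge_1[of k] by linarith

lemma q_rec: "k >= 1 ==> q (k + 1) = real (s (k + 1)) * q k + q (k - 1)"
 by (cases k) auto

lemma q_Suc_ge: "k >= 1 ==> q (k + 1) >= q k + q (k - 1)"
 using q_rec[of k] mult_right_mono[OF s_ge_1[of "k + 1"], of "q k"] q_pos[of k] by simp

lemma q_mono_Suc: "q k <= q (k + 1)"
proof (cases k)
 case 0 then show ?thesis using s_ge_1[of 1] by simp
next
 case (Suc j) then show ?thesis using q_Suc_ge[of k] q_pos[of j] by simp
qed

lemma q_mono: "i <= j ==> q i <= q j"
 by (induction j rule: dec_induct) (use q_mono_Suc order_trans in auto)

lemma q_rec_bounds:
 assumes "k >= 1"
 shows "real (s (k + 1)) * q k <= q (k + 1)" "q (k + 1) <= (real (s (k + 1)) + 1) * q k"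
proof -
 show "real (s (k + 1)) * q k <= q (k + 1)" using q_rec[OF assms] q_pos[of "k - 1"] by simp
 have "q (k - 1) <= q k" using q_mono by simp
 then show "q (k + 1) <= (real (s (k + 1)) + 1) * q k"
  using q_rec[OF assms] by (simp add: algebra_simps)
qed

lemma q_at_top: "filterlim q at_top sequentially"
proof -
 have *: "q k >= real k" for k
 proof (induction k)
  case (Suc k)
  show ?case
  proof (cases "k = 0")
   case False
   then show ?thesis using Suc q_Suc_ge[of k] q_ge_1[of "k - 1"] by simp
  qed (use s_ge_1[of 1] in simp)
 qed simp
 show ?thesis
  by (rule filterlim_at_top_mono[OF filterlim_real_sequentially]) (use * in auto)
qed

lemma eventually_q_ge: "EV k. q k >= C"
 using q_at_top by (simp add: filterlim_at_top)

lemma eventually_const_le_q: "eta > 0 ==> EV k. C <= eta * q k"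
 using eventually_q_ge[of "C / eta"] by eventually_elim (simp add: field_simps)

text \<open>Ratios \<open>f k / q k\<close> dominate convex combinations of their two predecessors in which the last
 one has weight at least one half: the minimum of two consecutive ratios increases to a limit, and
 a ratio far above this limit would lift the next minimum above it.\<close>

lemma superadditive_ratio_converges:
 fixes f :: "nat \<Rightarrow> real"
 assumes f: "!!k. k >= 1 ==> f (k + 1) >= real (s (k + 1)) * f k + f (k - 1)"
  and C: "!!k. f k <= C * q k"
 obtains \<gamma> where "(\<lambda>k. f k / q k) \<longlonglongrightarrow> \<gamma>"
proof -
 define r where "r k = f k / q k" for k
 define c where "c k = real (s (k + 1)) * q k / q (k + 1)" for k
 have fr: "f k = r k * q k" for k using q_pos[of k] by (simp add: r_def)
 have c1: "1 - c k = q (k - 1) / q (k + 1)" if "k >= 1" for k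
  using q_rec[OF that] q_pos[of "k + 1"] by (simp add: c_def field_simps)
 have r_rec: "r (k + 1) >= c k * r k + (1 - c k) * r (k - 1)" if "k >= 1" for k
 proof -
  have "c k * r k + (1 - c k) * r (k - 1) = (real (s (k + 1)) * f k + f (k - 1)) / q (k + 1)"
   unfolding c1[OF that] fr by (simp add: c_def field_simps add_divide_distrib)
  also have "... <= f (k + 1) / q (k + 1)"
   using f[OF that] q_pos[of "k + 1"] by (intro divide_right_mono) auto
  finally show ?thesis by (simp add: r_def)
 qed
 have c_half: "c k >= 1 / 2" "c k <= 1" if "k >= 1" for k
 proof -
  have "q (k - 1) <= 1 * q k" using q_mono[of "k - 1" k] by simp
  also have "... <= real (s (k + 1)) * q k"
   using s_ge_1[of "k + 1"] q_pos[of k] by (intro mult_right_mono) auto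
  finally have "q (k - 1) <= real (s (k + 1)) * q k" .
  then show "c k >= 1 / 2" using q_rec[OF that] q_pos[of "k + 1"] by (simp add: c_def field_simps)
  show "c k <= 1" using c1[OF that] q_pos[of "k + 1"] q_pos[of "k - 1"] by (smt (verit) divide_pos_pos)
 qed
 have r_ge: "r (k + 1) >= t" if "k >= 1" "r k >= t" "r (k - 1) >= t" for k t
 proof -
  have "c k * t + (1 - c k) * t <= c k * r k + (1 - c k) * r (k - 1)"
   by (intro add_mono mult_left_mono) (use that c_half[of k] in auto)
  then show ?thesis using r_rec[of k] that by (simp add: algebra_simps)
 qed
 define M where "M k = min (r k) (r (k + 1))" for k
 have "incseq M"
 proof (rule incseq_SucI)
  fix k show "M k <= M (Suc k)"
   using r_ge[of "k + 1" "M k"] by (auto simp: M_def)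
 qed
 moreover have "r k <= C" for k using C[of k] q_pos[of k] by (simp add: r_def field_simps)
 then have "M k <= C" for k by (simp add: M_def min.coboundedI1)
 ultimately obtain m where m: "M \<longlonglongrightarrow> m" "!!k. M k <= m"
  using incseq_convergent[of M C] by auto
 have "r \<longlonglongrightarrow> m"
 proof (rule LIMSEQ_I)
  fix e :: real assume e: "e > 0"
  \<comment> \<open>Since the weight is at least one half, averaging a ratio above
    \<open>m + 5 * d\<close> with one above \<open>m - d\<close> gives at least
    \<open>m + 2 * d\<close>. Two consecutive ratios would then exceed the limit \<open>m\<close> of
    the minima.\<close>
  define d where "d = e / 6"
  have d: "d > 0" using e by (simp add: d_def)
  obtain K where K: "!!k. k >= K ==> \<bar>M k - m\<bar> < d"
   using LIMSEQ_D[OF m(1) d] by auto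
  have "\<bar>r k - m\<bar> < e" if k: "k >= K + 1" for k
  proof -
   have lo: "r j >= m - d" if "j >= K" for j using K[OF that] by (auto simp: M_def)
   have "~ r k >= m + 5 * d"
   proof
    assume hi: "r k >= m + 5 * d"
    have ch: "c k >= 1 / 2" "c k <= 1" using c_half[of k] k by auto
    have "c k * (m + 5 * d) + (1 - c k) * (m - d) <= c k * r k + (1 - c k) * r (k - 1)"
     by (intro add_mono mult_left_mono) (use hi lo[of "k - 1"] ch k in auto)
    moreover have "c k * (m + 5 * d) + (1 - c k) * (m - d) = m - d + 6 * (c k * d)"
     by (simp add: algebra_simps)
    moreover have "c k * d >= d / 2" using ch d by (simp add: field_simps)
    ultimately have "r (k + 1) >= m + 2 * d" using r_rec[of k] k by auto
    then have "M k >= m + 2 * d" using hi d by (auto simp: M_def)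
    then show False using m(2)[of k] d by auto
   qed
   then show ?thesis using lo[of k] k d by (auto simp: d_def)
  qed
  then show "\<exists>no. \<forall>n\<ge>no. norm (r n - m) < e" by auto
 qed
 then show thesis using that[of m] by (simp add: r_def[abs_def])
qed

text \<open>The word is read backwards, so each new partial quotient is put in front; this is the
  recurrence of \<open>q\<close> divided by its middle term. It turns \<open>\<sigma>\<close> into
  the lower limit of \<open>q k / q (k + 1)\<close>.\<close>

lemma cfrac_eq: "cfrac (map (\<lambda>i. real (s i)) (rev [1..<k + 2])) = q (k + 1) / q k"
proof (induction k)
 case (Suc k)
 have 1: "map (\<lambda>i. real (s i)) (rev [1..<Suc k + 2])
   = real (s (k + 2)) # map (\<lambda>i. real (s i)) (rev [1..<k + 2])"
  by simp
 have 2: "cfrac (a # map (\<lambda>i. real (s i)) (rev [1..<k + 2]))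
   = a + 1 / cfrac (map (\<lambda>i. real (s i)) (rev [1..<k + 2]))" for a
  by simp
 show ?case
  unfolding 1 2 Suc.IH using q_pos[of "k + 1"] q_pos[of k] by (simp add: field_simps)
qed simp

lemma sigma_ratio_bounds: "0 <= q k / q (k + 1)" "q k / q (k + 1) <= 1"
 using q_pos[of k] q_pos[of "k + 1"] q_mono_Suc[of k] by auto

text \<open>All ratios lie between 0 and 1, so the lower limit is finite and
  \<open>real_of_ereal\<close> does not return its default value.\<close>

lemma liminf_ratio: "liminf (\<lambda>k. ereal (q k / q (k + 1))) = ereal (sturm_sigma s)"
proof -
 have "liminf (\<lambda>k. ereal (q k / q (k + 1))) >= 0"
  by (rule Liminf_bounded) (use sigma_ratio_bounds(1) in \<open>auto simp: zero_ereal_def\<close>)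
 moreover have "liminf (\<lambda>k. ereal (q k / q (k + 1))) <= 1"
 proof -
  have "liminf (\<lambda>k. ereal (q k / q (k + 1))) <= liminf (\<lambda>k. ereal 1)"
   by (rule Liminf_mono) (use sigma_ratio_bounds(2) in auto)
  then show ?thesis by (simp add: Liminf_const one_ereal_def)
 qed
 ultimately have "\<bar>liminf (\<lambda>k. ereal (q k / q (k + 1)))\<bar> ~= \<infinity>" by auto
 then show ?thesis
  unfolding sturm_sigma_def cfrac_eq by (simp add: ereal_real)
qed

lemma eventually_sigma:
 assumes "eta > 0"
 shows "EV k. q k >= (sturm_sigma s - eta) * q (k + 1)"
proof -
 have "EV k. ereal (sturm_sigma s - eta) < ereal (q k / q (k + 1))"
  using iffD1[OF le_Liminf_iff, OF eq_refl[OF liminf_ratio[symmetric]],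
    rule_format, of "ereal (sturm_sigma s - eta)"] assms by simp
 then show ?thesis
  by eventually_elim (simp add: pos_less_divide_eq q_pos less_imp_le)
qed

text \<open>Counterpart of \<open>eventually_sigma\<close>: that bound holds at all large
  \<open>k\<close> and serves estimates needed at every scale, while this one supplies the extremal
  indices at which the exponents are attained.\<close>

lemma frequently_sigma:
 assumes "eta > 0"
 shows "\<exists>\<^sub>F k in sequentially. q k <= (sturm_sigma s + eta) * q (k + 1)"
proof -
 have "~ (EV k. ereal (sturm_sigma s + eta) < ereal (q k / q (k + 1)))"
 proof
  assume "EV k. ereal (sturm_sigma s + eta) < ereal (q k / q (k + 1))"
  then have "ereal (sturm_sigma s + eta) <= liminf (\<lambda>k. ereal (q k / q (k + 1)))"
   by (intro Liminf_bounded) (auto elim: eventually_mono)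
  then show False using liminf_ratio assms by auto
 qed
 then have "\<exists>\<^sub>F k in sequentially. ~ ereal (sturm_sigma s + eta) < ereal (q k / q (k + 1))"
  by (simp add: frequently_def)
 then show ?thesis
  by (rule frequently_elim1) (use q_pos in \<open>auto simp: field_simps\<close>)
qed

lemma sigma_nonneg: "sturm_sigma s >= 0"
proof (rule ccontr)
 assume neg: "~ ?thesis"
 then have "\<exists>\<^sub>F k in sequentially. q k <= (sturm_sigma s + - sturm_sigma s / 2) * q (k + 1)"
  using frequently_sigma[of "- sturm_sigma s / 2"] by auto
 then obtain k where "q k <= (sturm_sigma s / 2) * q (k + 1)"
  by (auto dest: frequently_ex)
 moreover have "(sturm_sigma s / 2) * q (k + 1) <= 0"
  using neg q_pos[of "k + 1"] by (intro mult_nonpos_nonneg) auto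
 ultimately show False using q_pos[of k] by linarith
qed

text \<open>For large \<open>k\<close>, \<open>q (k - 1)\<close> is at least about
  \<open>\<sigma> * q k\<close>, hence \<open>q (k + 1)\<close> is at least about
  \<open>(1 + \<sigma>) * q k\<close>; on the other hand \<open>q k\<close> is at least about
  \<open>\<sigma> * q (k + 1)\<close>. So \<open>\<sigma>\<close> is at most the inverse of the
  golden ratio.\<close>

lemma sigma_golden: "sturm_sigma s * (1 + sturm_sigma s) <= 1"
proof (cases "sturm_sigma s = 0")
 case False
 define \<sigma> where "\<sigma> = sturm_sigma s"
 have s0: "\<sigma> > 0" using sigma_nonneg False by (simp add: \<sigma>_def)
 have "\<sigma> * (1 + \<sigma>) <= 1 + e" if e: "e > 0" for e
 proof -
  \<comment> \<open>The bound by \<open>\<sigma>\<close> keeps \<open>\<sigma> - eta\<close>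
    non-negative as a multiplier; the other one makes the total loss
    \<open>eta * (1 + 2 * \<sigma>)\<close> at most \<open>e\<close>.\<close>
  define eta where "eta = min \<sigma> (e / (1 + 2 * \<sigma>))"
  have eta: "eta > 0" "eta <= \<sigma>" "eta * (1 + 2 * \<sigma>) <= e"
   using e s0 by (auto simp: eta_def min_def field_simps)
  obtain K where K: "!!k. k >= K ==> q k >= (\<sigma> - eta) * q (k + 1)"
   using eventually_sigma[OF eta(1)] by (auto simp: eventually_sequentially \<sigma>_def)
  define k where "k = K + 1"
  have a: "q k >= (\<sigma> - eta) * q (k + 1)" "q (k - 1) >= (\<sigma> - eta) * q k"
   using K[of k] K[of "k - 1"] by (auto simp: k_def)
  have b: "q (k + 1) >= (1 + (\<sigma> - eta)) * q k"
   using q_Suc_ge[of k] a(2) by (simp add: k_def algebra_simps)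
  have "(\<sigma> - eta) * ((1 + (\<sigma> - eta)) * q k) <= (\<sigma> - eta) * q (k + 1)"
   using b eta by (intro mult_left_mono) auto
  then have "((\<sigma> - eta) * (1 + (\<sigma> - eta))) * q k <= 1 * q k" using a by (simp add: algebra_simps)
  then have "(\<sigma> - eta) * (1 + (\<sigma> - eta)) <= 1" using q_pos[of k] mult_le_cancel_right_pos by blast
  then have "\<sigma> * (1 + \<sigma>) <= 1 + eta * (1 + 2 * \<sigma>) - eta * eta" by (simp add: algebra_simps)
  then show ?thesis using eta(3) zero_le_square[of eta] by linarith
 qed
 then show ?thesis unfolding \<sigma>_def by (rule field_le_epsilon)
qed simp

lemma sigma_less_1: "sturm_sigma s < 1"
proof (rule ccontr)
 assume "~ ?thesis"
 then have "1 * 2 <= sturm_sigma s * (1 + sturm_sigma s)" by (intro mult_mono) auto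
 then show False using sigma_golden by simp
qed

end

section \<open>Integer points and forms: heights, errors, scalar and cross products\<close>

no_notation fps_nth (infixl \<open>$\<close> 75)

abbreviation hgt :: "int^3 \<Rightarrow> real" where
 "hgt x \<equiv> infnorm (real_vec x)"

abbreviation err :: "real \<Rightarrow> int^3 \<Rightarrow> real" where
 "err \<xi> x \<equiv> infnorm (cross3 (real_vec x) (Xi \<xi>))"

abbreviation lin :: "real \<Rightarrow> int^3 \<Rightarrow> real" where
 "lin \<xi> x \<equiv> \<bar>real_vec x \<bullet> Xi \<xi>\<bar>"

definition dotZ :: "int^3 \<Rightarrow> int^3 \<Rightarrow> int" where
 "dotZ x y = x$1 * y$1 + x$2 * y$2 + x$3 * y$3"

definition crossZ :: "int^3 \<Rightarrow> int^3 \<Rightarrow> int^3" where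
 "crossZ x y = vector [x$2 * y$3 - x$3 * y$2, x$3 * y$1 - x$1 * y$3, x$1 * y$2 - x$2 * y$1]"

definition primitive :: "int^3 \<Rightarrow> bool" where
 "primitive x \<longleftrightarrow> (\<forall>d. (\<forall>i. d dvd x$i) --> is_unit d)"

lemma vec3_eq_iff: "x = y \<longleftrightarrow> x$1 = y$1 & x$2 = y$2 & x$3 = (y::'a^3)$3"
 by (simp add: vec_eq_iff forall_3)

lemma crossZ_nth [simp]:
 "crossZ x y $ 1 = x$2 * y$3 - x$3 * y$2"
 "crossZ x y $ 2 = x$3 * y$1 - x$1 * y$3"
 "crossZ x y $ 3 = x$1 * y$2 - x$2 * y$1"
 by (simp_all add: crossZ_def)

lemma real_vec_nth [simp]: "real_vec x $ i = real_of_int (x $ i)"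
 by (simp add: real_vec_def)

lemma infnorm_le_iff: "infnorm (x::real^3) <= t \<longleftrightarrow> \<bar>x$1\<bar> <= t & \<bar>x$2\<bar> <= t & \<bar>x$3\<bar> <= t"
proof -
 have "infnorm x = Max {\<bar>x$1\<bar>, \<bar>x$2\<bar>, \<bar>x$3\<bar>}"
 proof -
  have "{\<bar>x \<bullet> i\<bar> | i. i \<in> Basis} = {\<bar>x$1\<bar>, \<bar>x$2\<bar>, \<bar>x$3\<bar>}"
   unfolding Basis_vec_def by (force simp: inner_axis UNIV_3)
  then show ?thesis by (simp add: infnorm_def cSup_eq_Max)
 qed
 then show ?thesis by simp
qed

lemma hgt_nth: "\<bar>real_of_int (x$i)\<bar> <= hgt x"
 using component_le_infnorm_cart[of "real_vec x" i] by simp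

lemma hgt_ge_1:
 assumes "x ~= 0"
 shows "hgt x >= 1"
proof -
 obtain i where "x $ i ~= 0" using assms by (auto simp: vec_eq_iff)
 then have "1 <= \<bar>real_of_int (x$i)\<bar>" by linarith
 then show ?thesis using hgt_nth[of x i] by linarith
qed

lemma hgt_nonneg [simp]: "hgt x >= 0" by (rule infnorm_pos_le)

lemma err_nonneg [simp]: "err \<xi> x >= 0" by (rule infnorm_pos_le)

lemma lin_eq: "lin \<xi> x = \<bar>real_of_int (x$1) + real_of_int (x$2) * \<xi> + real_of_int (x$3) * \<xi>\<^sup>2\<bar>"
 by (simp add: inner_vec_def sum_3 Xi_def vector_3)

lemma err_cross_nth:
 "cross3 (real_vec x) (Xi \<xi>) $ 1 = real_of_int (x$2) * \<xi>\<^sup>2 - real_of_int (x$3) * \<xi>"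
 "cross3 (real_vec x) (Xi \<xi>) $ 2 = real_of_int (x$3) - real_of_int (x$1) * \<xi>\<^sup>2"
 "cross3 (real_vec x) (Xi \<xi>) $ 3 = real_of_int (x$1) * \<xi> - real_of_int (x$2)"
 by (simp_all add: cross3_def Xi_def vector_3)

lemma err_le_iff: "err \<xi> x <= t \<longleftrightarrow>
  \<bar>real_of_int (x$2) * \<xi>\<^sup>2 - real_of_int (x$3) * \<xi>\<bar> <= t &
  \<bar>real_of_int (x$3) - real_of_int (x$1) * \<xi>\<^sup>2\<bar> <= t &
  \<bar>real_of_int (x$1) * \<xi> - real_of_int (x$2)\<bar> <= t"
 by (simp only: infnorm_le_iff err_cross_nth)

lemmas err_ge = err_le_iff[THEN iffD1, OF order_refl]

lemma hgt_le_iff: "hgt x <= t \<longleftrightarrow>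
  \<bar>real_of_int (x$1)\<bar> <= t & \<bar>real_of_int (x$2)\<bar> <= t & \<bar>real_of_int (x$3)\<bar> <= t"
 by (simp add: infnorm_le_iff)

lemma abs_mult_le: "\<bar>a\<bar> <= A ==> \<bar>b\<bar> <= B ==> \<bar>a * b\<bar> <= A * (B::real)"
 unfolding abs_mult by (rule mult_mono) auto

lemma abs_diff_le: "\<bar>a\<bar> <= A ==> \<bar>b\<bar> <= B ==> \<bar>a - b\<bar> <= A + (B::real)"
 by linarith

lemma abs_diff3_le: "\<bar>a\<bar> <= A ==> \<bar>b\<bar> <= B ==> \<bar>c\<bar> <= C ==> \<bar>a - b - c\<bar> <= A + B + (C::real)"
 by linarith

text \<open>Subtracting \<open>x$1\<close> times \<open>Xi \<xi>\<close> from \<open>x\<close>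
  leaves coordinates that are components of the cross product with \<open>Xi \<xi>\<close>. The
  bound is used to prove orthogonality: a scalar product is an integer, so it vanishes as soon as
  the bound is below 1.\<close>

lemma dotZ_bound: "\<bar>real_of_int (dotZ p x)\<bar> <= 2 * hgt p * err \<xi> x + hgt x * lin \<xi> p"
proof -
 let ?p = "\<lambda>i. real_of_int (p$i)" and ?x = "\<lambda>i. real_of_int (x$i)"
 have "real_of_int (dotZ p x)
   = ?p 2 * (?x 2 - ?x 1 * \<xi>) + ?p 3 * (?x 3 - ?x 1 * \<xi>\<^sup>2)
    + ?x 1 * (?p 1 + ?p 2 * \<xi> + ?p 3 * \<xi>\<^sup>2)"
  by (simp add: dotZ_def algebra_simps)
 moreover have "\<bar>?p 2 * (?x 2 - ?x 1 * \<xi>)\<bar> <= hgt p * err \<xi> x"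
  using hgt_nth err_ge[of x \<xi>] by (intro abs_mult_le) auto
 moreover have "\<bar>?p 3 * (?x 3 - ?x 1 * \<xi>\<^sup>2)\<bar> <= hgt p * err \<xi> x"
  using hgt_nth err_ge[of x \<xi>] by (intro abs_mult_le) auto
 moreover have "\<bar>?x 1 * (?p 1 + ?p 2 * \<xi> + ?p 3 * \<xi>\<^sup>2)\<bar> <= hgt x * lin \<xi> p"
  using hgt_nth by (intro abs_mult_le) (auto simp: lin_eq)
 ultimately show ?thesis by linarith
qed

lemma hgt_crossZ_le: "hgt (crossZ x y) <= 2 * hgt x * hgt y"
proof -
 have *: "\<bar>real_of_int (x$i) * real_of_int (y$j)\<bar> <= hgt x * hgt y" for i j
  using hgt_nth by (intro abs_mult_le) auto
 show ?thesis
  unfolding hgt_le_iff crossZ_nth of_int_diff of_int_mult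
  by (intro conjI order_trans[OF abs_diff_le[OF * *]]) simp_all
qed

text \<open>Minors of two points do not change when multiples of \<open>Xi \<xi>\<close> are split
  off and their common part cancels, so every minor is a sum of products of one coordinate with one
  error.\<close>

lemma hgt_crossZ_err: "hgt (crossZ x y) <= 2 * (hgt x * err \<xi> y + hgt y * err \<xi> x)"
proof -
 let ?x = "\<lambda>i. real_of_int (x$i)" and ?y = "\<lambda>i. real_of_int (y$i)"
 have a: "\<bar>(?x 2 - ?x 1 * \<xi>) * ?y i\<bar> <= err \<xi> x * hgt y"
   "\<bar>(?x 3 - ?x 1 * \<xi>\<^sup>2) * ?y i\<bar> <= err \<xi> x * hgt y" for i
  using hgt_nth err_ge[of x \<xi>] by (auto intro!: abs_mult_le)
 have b: "\<bar>?x 1 * (?y 2 * \<xi>\<^sup>2 - ?y 3 * \<xi>)\<bar> <= hgt x * err \<xi> y"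
   "\<bar>?x 1 * (?y 3 - ?y 1 * \<xi>\<^sup>2)\<bar> <= hgt x * err \<xi> y"
   "\<bar>?x 1 * (?y 2 - ?y 1 * \<xi>)\<bar> <= hgt x * err \<xi> y"
  using hgt_nth err_ge[of y \<xi>] by (auto intro!: abs_mult_le)
 have 1: "?x 2 * ?y 3 - ?x 3 * ?y 2
   = (?x 2 - ?x 1 * \<xi>) * ?y 3 - (?x 3 - ?x 1 * \<xi>\<^sup>2) * ?y 2 - ?x 1 * (?y 2 * \<xi>\<^sup>2 - ?y 3 * \<xi>)"
  and 2: "?x 3 * ?y 1 - ?x 1 * ?y 3 = (?x 3 - ?x 1 * \<xi>\<^sup>2) * ?y 1 - ?x 1 * (?y 3 - ?y 1 * \<xi>\<^sup>2)"
  and 3: "?x 1 * ?y 2 - ?x 2 * ?y 1 = ?x 1 * (?y 2 - ?y 1 * \<xi>) - (?x 2 - ?x 1 * \<xi>) * ?y 1"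
  by (simp_all add: algebra_simps)
 show ?thesis
  unfolding hgt_le_iff crossZ_nth of_int_diff of_int_mult 1 2 3
  by (intro conjI order_trans[OF abs_diff3_le[OF a(1) a(2) b(1)]]
    order_trans[OF abs_diff_le[OF a(2) b(2)]] order_trans[OF abs_diff_le[OF b(3) a(1)]])
   (simp_all add: algebra_simps)
qed

text \<open>The triple product: \<open>(p x r) x Xi\<close> equals
  \<open>(p . Xi) r - (r . Xi) p\<close>.\<close>

lemma err_crossZ: "err \<xi> (crossZ p r) <= lin \<xi> p * hgt r + lin \<xi> r * hgt p"
proof -
 let ?p = "\<lambda>i. real_of_int (p$i)" and ?r = "\<lambda>i. real_of_int (r$i)"
 let ?P = "?p 1 + ?p 2 * \<xi> + ?p 3 * \<xi>\<^sup>2" and ?R = "?r 1 + ?r 2 * \<xi> + ?r 3 * \<xi>\<^sup>2"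
 have a: "\<bar>?P * ?r i\<bar> <= lin \<xi> p * hgt r" "\<bar>?R * ?p i\<bar> <= lin \<xi> r * hgt p" for i
  using hgt_nth by (auto intro!: abs_mult_le simp: lin_eq)
 have 1: "(?p 3 * ?r 1 - ?p 1 * ?r 3) * \<xi>\<^sup>2 - (?p 1 * ?r 2 - ?p 2 * ?r 1) * \<xi> = ?P * ?r 1 - ?R * ?p 1"
  and 2: "?p 1 * ?r 2 - ?p 2 * ?r 1 - (?p 2 * ?r 3 - ?p 3 * ?r 2) * \<xi>\<^sup>2 = ?P * ?r 2 - ?R * ?p 2"
  and 3: "(?p 2 * ?r 3 - ?p 3 * ?r 2) * \<xi> - (?p 3 * ?r 1 - ?p 1 * ?r 3) = ?P * ?r 3 - ?R * ?p 3"
  by (simp_all add: algebra_simps power2_eq_square)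
 show ?thesis
  unfolding err_le_iff crossZ_nth of_int_diff of_int_mult 1 2 3
  by (intro conjI abs_diff_le a)
qed

lemma primitive_bezout:
 assumes "primitive z"
 obtains u where "dotZ u z = 1"
proof -
 let ?g = "gcd (gcd (z$1) (z$2)) (z$3)"
 have "?g dvd z $ i" for i
  using exhaust_3[of i] by (auto intro: dvd_trans[OF gcd_dvd1])
 then have "is_unit ?g" using assms unfolding primitive_def by blast
 then have "?g = 1" by simp
 moreover obtain a b where ab: "a * z$1 + b * z$2 = gcd (z$1) (z$2)" using bezout_int by blast
 moreover obtain c d where cd: "c * gcd (z$1) (z$2) + d * z$3 = ?g" using bezout_int by blast
 ultimately have "dotZ (vector [c * a, c * b, d]) z = 1"
  by (simp add: dotZ_def) (metis (no_types, opaque_lifting) distrib_left mult.assoc)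
 then show thesis by (rule that)
qed

text \<open>If \<open>u\<close> is a Bezout vector with \<open>dotZ u z = 1\<close>, the multiplier
  is \<open>dotZ u x\<close>.\<close>

lemma parallel_primitive:
 assumes "crossZ x z = 0" "primitive z"
 obtains m where "!!i. x $ i = m * z $ i"
proof -
 obtain u where u: "dotZ u z = 1" using primitive_bezout[OF assms(2)] .
 have c: "x$2 * z$3 = x$3 * z$2" "x$3 * z$1 = x$1 * z$3" "x$1 * z$2 = x$2 * z$1"
  using assms(1) by (auto simp: vec3_eq_iff)
 have "x $ i = dotZ u x * z $ i" for i
 proof -
  have s: "x$i * z$j = x$j * z$i" for j
   using exhaust_3[of i] exhaust_3[of j] c by (auto simp: mult.commute)
  have "dotZ u x * z $ i = u$1 * (x$1 * z$i) + u$2 * (x$2 * z$i) + u$3 * (x$3 * z$i)"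
   by (simp add: dotZ_def algebra_simps)
  also have "... = dotZ u z * x $ i"
   unfolding s[symmetric] by (simp add: dotZ_def algebra_simps)
  finally have "dotZ u x * z $ i = dotZ u z * x $ i" .
  then show ?thesis using u by simp
 qed
 then show thesis by (rule that)
qed

lemma multiple_bounds:
 assumes "!!i. x $ i = m * z $ i" "x ~= 0"
 shows "hgt z <= hgt x" "err \<xi> z <= err \<xi> x" "lin \<xi> z <= lin \<xi> x" "z ~= 0"
proof -
 have "m ~= 0" using assms by (auto simp: vec_eq_iff)
 then have m: "\<bar>real_of_int m\<bar> >= 1" by linarith
 have x: "real_vec x = real_of_int m *\<^sub>R real_vec z"
  using assms(1) by (simp add: vec_eq_iff)
 have *: "t <= \<bar>real_of_int m\<bar> * t" if "t >= 0" for t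
  using mult_right_mono[OF m that] by simp
 show "hgt z <= hgt x" "err \<xi> z <= err \<xi> x" "lin \<xi> z <= lin \<xi> x"
  unfolding x cross_mult_left infnorm_mul inner_scaleR_left abs_mult by (auto intro!: *)
 show "z ~= 0" using assms by (auto simp: vec_eq_iff)
qed

lemma orthogonal_crossZ:
 assumes "dotZ p x = 0" "dotZ p y = 0"
 shows "crossZ (crossZ x y) p = 0"
proof -
 have "crossZ (crossZ x y) p $ i = y$i * dotZ p x - x$i * dotZ p y" for i
  using exhaust_3[of i] by (auto simp: dotZ_def algebra_simps)
 then show ?thesis using assms by (simp add: vec_eq_iff)
qed

text \<open>The cross product of two points orthogonal to \<open>p\<close> is parallel to
  \<open>p\<close>, hence an integral multiple of the primitive \<open>p\<close>. Thus
  \<open>hgt p\<close> is a lower bound for areas in the lattice orthogonal to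
  \<open>p\<close>.\<close>

lemma orthogonal_plane_bound:
 assumes "dotZ p x = 0" "dotZ p y = 0" "primitive p" "crossZ x y ~= 0"
 shows "hgt p <= hgt (crossZ x y)"
 using parallel_primitive[OF orthogonal_crossZ[OF assms(1,2)] assms(3)] multiple_bounds(1) assms(4)
 by metis

lemma crossZ_eq_0_iff: "crossZ x y = 0 \<longleftrightarrow> (\<forall>i j. x$i * y$j = x$j * y$i)"
 by (auto simp: vec3_eq_iff forall_3)

lemma parallel_to_independent:
 assumes "crossZ c p = 0" "crossZ c r = 0" "crossZ p r ~= 0"
 shows "c = 0"
proof -
 obtain i j where ij: "p$i * r$j ~= p$j * r$i" using assms(3) by (auto simp: crossZ_eq_0_iff)
 have cp: "c$a * p$b = c$b * p$a" and cr: "c$a * r$b = c$b * r$a" for a b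
  using assms(1,2) unfolding crossZ_eq_0_iff by blast+
 have "c$k * (p$i * r$j) = c$k * (p$j * r$i)" for k
 proof -
  have "c$k * (p$i * r$j) = (c$k * p$i) * r$j" by (simp only: mult.assoc)
  also have "... = (c$i * r$j) * p$k" unfolding cp[of k i] by (simp only: mult_ac)
  also have "... = (c$j * p$k) * r$i" unfolding cr[of i j] by (simp only: mult_ac)
  also have "... = c$k * (p$j * r$i)" unfolding cp[of j k] by (simp only: mult_ac)
  finally show ?thesis .
 qed
 then show ?thesis using ij by (simp add: vec_eq_iff)
qed

text \<open>The product \<open>crossZ x z\<close> is parallel to both \<open>p\<close> and
  \<open>r\<close>, which are independent.\<close>

lemma crossZ_orthogonal_pair:
 assumes "dotZ p x = 0" "dotZ r x = 0" "dotZ p z = 0" "dotZ r z = 0" "crossZ p r ~= 0"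
 shows "crossZ x z = 0"
 by (rule parallel_to_independent[OF _ _ assms(5)])
  (use assms in \<open>auto intro: orthogonal_crossZ\<close>)

section \<open>Suprema of exponents and the logarithmic scale\<close>

lemma Sup_ereal_eqI:
 assumes "0 < v" "!!l. 0 < l ==> l < v ==> l \<in> S" "!!l. v < l ==> l \<notin> S"
 shows "Sup (ereal ` S) = ereal v"
proof (rule antisym)
 show "Sup (ereal ` S) <= ereal v"
  using assms(3) by (intro Sup_least) (auto simp: not_less[symmetric])
 show "ereal v <= Sup (ereal ` S)"
 proof (rule dense_le)
  fix y assume y: "y < ereal v"
  obtain l where l: "max y 0 < ereal l" "l < v"
   using ereal_dense2[of "max y 0" "ereal v"] y assms(1) by (auto simp: zero_ereal_def)
  then have "ereal l \<in> ereal ` S" using assms(2)[of l] by (auto simp: zero_ereal_def)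
  then have "ereal l <= Sup (ereal ` S)" by (rule Sup_upper)
  then show "y <= Sup (ereal ` S)" using l by (auto intro: order_trans less_imp_le)
 qed
qed

lemma Sup_ereal_leI: "(!!l. v < l ==> l \<notin> S) ==> Sup (ereal ` S) <= ereal v"
 by (intro Sup_least) (auto simp: not_less[symmetric])

lemma Sup_ereal_geI:
 assumes "0 < v" "!!l. 0 < l ==> l < v ==> l \<in> S"
 shows "ereal v <= Sup (ereal ` S)"
proof -
 have "ereal v = Sup (ereal ` {0<..<v})"
  by (rule Sup_ereal_eqI[symmetric]) (use assms in auto)
 also have "... <= Sup (ereal ` S)" using assms(2) by (intro Sup_subset_mono) auto
 finally show ?thesis .
qed

lemma Sup_ereal_infinity:
 assumes "!!l. 0 < l ==> l \<in> S"
 shows "Sup (ereal ` S) = \<infinity>"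
proof (rule ereal_top)
 fix B :: real
 have "ereal (max B 1) <= Sup (ereal ` S)" by (intro Sup_upper imageI assms) simp
 then show "ereal B <= Sup (ereal ` S)" by (rule order_trans[rotated]) simp
qed

text \<open>With \<open>X = exp t\<close>, powers of \<open>X\<close> and all asymptotic sizes
  become exponentials of linear expressions, so that comparisons reduce to linear inequalities in
  \<open>t\<close> and the \<open>Q k\<close>.\<close>

lemma eventually_at_top_exp:
 "(\<forall>\<^sub>F X in at_top. P X) \<longleftrightarrow> (\<forall>\<^sub>F t in at_top. P (exp (t::real)))"
proof
 assume "\<forall>\<^sub>F X in at_top. P X"
 then show "\<forall>\<^sub>F t in at_top. P (exp t)"
  using exp_at_top by (auto simp: filterlim_iff)
next
 assume "\<forall>\<^sub>F t in at_top. P (exp t)"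
 then have "\<forall>\<^sub>F X in at_top. P (exp (ln X))"
  using ln_at_top by (auto simp: filterlim_iff)
 then show "\<forall>\<^sub>F X in at_top. P X"
  using eventually_gt_at_top[of 0] by eventually_elim simp
qed

lemma frequently_at_top_exp:
 "(\<exists>\<^sub>F X in at_top. P X) \<longleftrightarrow> (\<exists>\<^sub>F t in at_top. P (exp (t::real)))"
 unfolding frequently_def eventually_at_top_exp[of "\<lambda>X. ~ P X"] ..

lemma exp_powr: "exp t powr a = exp (a * t)" for t a :: real
 by (simp add: powr_def)

text \<open>The source of nearly every \<open>eta\<close> below: the limiting inequality is strict
  at 0 and survives for small positive \<open>eta\<close>. Several requirements are imposed at once
  by taking \<open>f\<close> to be a minimum.\<close>

lemma exists_small:
 fixes f :: "real \<Rightarrow> real"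
 assumes "isCont f 0" "f 0 > c" "b > 0"
 obtains eta where "0 < eta" "eta < b" "f eta > c"
proof -
 have "\<forall>\<^sub>F x in at_right 0. f x > c"
  using assms(1,2) by (intro order_tendstoD(1)[of f "f 0"])
   (auto simp: continuous_at_imp_continuous_at_within continuous_within[symmetric])
 moreover have "\<forall>\<^sub>F x in at_right 0. x < b" "\<forall>\<^sub>F x::real in at_right 0. 0 < x"
  using assms(3) by (auto simp: eventually_at_right_less eventually_at_right[of 0 b])
 ultimately have "\<forall>\<^sub>F x in at_right 0. 0 < x & x < b & f x > c" by eventually_elim auto
 then show thesis using that eventually_happens' trivial_limit_at_right_real by blast
qed

section \<open>The approximation data of a Sturmian number and its best forms\<close>

text \<open>The approximation theory of a Sturmian number, extracted from its matrices: \<open>p k\<close> is the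
 primitive multiple of the polynomial of the k-th matrix, and \<open>z k l\<close> that of the symmetric matrix
 attached to the product of the l-th power of the k-th matrix with its predecessor.\<close>

locale sturm_points = sturm_seq +
 fixes B \<delta> \<xi> :: real and Q :: "nat \<Rightarrow> real" and p :: "nat \<Rightarrow> int^3" and z :: "nat \<Rightarrow> nat \<Rightarrow> int^3"
 assumes B: "B > 0" and Q_eq: "!!k. Q k = B * sturm_q s k"
  and delta_nonneg: "0 <= \<delta>" and delta_le: "\<delta> <= sturm_sigma s / (1 + sturm_sigma s)"
  and primitive_p: "EV k. primitive (p k)"
  and primitive_z: "EV k. \<forall>l\<in>{1..s (k + 1) + 1}. primitive (z k l)"
  and p_hgt: "!!eta. eta > 0 ==> EV k.
    exp ((1 - eta) * Q k) <= hgt (p k) & hgt (p k) <= exp ((1 + eta) * Q k)"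
  and p_lin: "!!eta. eta > 0 ==> EV k.
    exp (- ((2 - \<delta> + eta) * Q (k + 1) + (1 - \<delta>) * Q k)) <= lin \<xi> (p k) &
    lin \<xi> (p k) <= exp (- ((2 - \<delta> - eta) * Q (k + 1) + (1 - \<delta>) * Q k))"
  and p_lead: "!!eta. eta > 0 ==> EV k. exp ((1 - eta) * Q k) <= \<bar>real_of_int (p k $ 3)\<bar>"
  and p_deriv: "!!eta. eta > 0 ==> EV k.
    exp ((1 - eta) * Q k) <= \<bar>real_of_int (p k $ 2) + 2 * real_of_int (p k $ 3) * \<xi>\<bar>"
  and p_indep: "EV k. crossZ (p k) (p (k + 1)) ~= 0"
  and z_orth: "EV k. (\<forall>l\<in>{1..s (k + 1) + 1}. dotZ (p k) (z k l) = 0) &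
    dotZ (p k) (z (k + 1) 1) = 0"
  and z_hgt: "!!eta. eta > 0 ==> EV k. \<forall>l\<in>{1..s (k + 1) + 1}.
    exp ((1 - eta) * (real l * Q k + Q (k - 1))) <= hgt (z k l) &
    hgt (z k l) <= exp ((1 + eta) * (real l * Q k + Q (k - 1)))"
  and z_err: "!!eta. eta > 0 ==> EV k. \<forall>l\<in>{1..s (k + 1) + 1}.
    exp (- ((1 - \<delta> + eta) * (real l * Q k + Q (k - 1)))) <= err \<xi> (z k l) &
    err \<xi> (z k l) <= exp (- ((1 - \<delta> - eta) * (real l * Q k + Q (k - 1))))"
begin

abbreviation \<sigma> :: real where "\<sigma> \<equiv> sturm_sigma s"

lemma Q_pos: "Q k > 0"
 using B q_pos by (simp add: Q_eq)

lemma Q_rec: "k >= 1 ==> Q (k + 1) = real (s (k + 1)) * Q k + Q (k - 1)"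
 using q_rec[of k] by (simp add: Q_eq algebra_simps)

lemma Q_mono: "i <= j ==> Q i <= Q j"
 using B q_mono by (simp add: Q_eq)

lemma Q_at_top: "filterlim Q at_top sequentially"
 unfolding Q_eq[abs_def] by (rule filterlim_tendsto_pos_mult_at_top[OF tendsto_const B q_at_top])

lemma const_le_exp: "eta > 0 ==> EV k. C <= exp (eta * Q k)"
 using Q_at_top[unfolded filterlim_at_top, rule_format, of "(\<bar>C\<bar> + 1) / eta"]
proof eventually_elim
 case (elim k)
 then have "\<bar>C\<bar> <= eta * Q k" by (simp add: field_simps)
 then show ?case using exp_ge_add_one_self[of "eta * Q k"] by linarith
qed

lemma eventually_Q_sigma: "eta > 0 ==> EV k. Q k >= (\<sigma> - eta) * Q (k + 1)"
 using eventually_sigma[of eta] B by (auto simp: Q_eq elim!: eventually_mono)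

lemma frequently_Q_sigma: "eta > 0 ==> \<exists>\<^sub>F k in sequentially. Q k <= (\<sigma> + eta) * Q (k + 1)"
 using frequently_sigma[of eta] B by (auto simp: Q_eq elim!: frequently_elim1)

lemma delta_sigma: "\<delta> * (1 + \<sigma>) <= \<sigma>"
 using delta_le sigma_nonneg by (simp add: field_simps)

lemma delta_less_half: "\<delta> < 1 / 2"
proof -
 have "\<delta> * (1 + \<sigma>) < (1 / 2) * (1 + \<sigma>)" using delta_sigma sigma_less_1 by simp
 then show ?thesis using sigma_nonneg by simp
qed

text \<open>The place where the upper bound for \<open>\<delta>\<close> enters. Read as
  \<open>(1 - \<delta>) * (Q (k + 1) + Q k) >= (1 - eta) * Q (k + 1)\<close>, it says that the error
  of \<open>z (k + 1) 1\<close> is at most about the inverse of the height of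
  \<open>p (k + 1)\<close>.\<close>

lemma eventually_delta:
 assumes "eta > 0"
 shows "EV k. \<delta> * (Q (k + 1) + Q k) <= Q k + eta * Q (k + 1)"
 using eventually_Q_sigma[OF assms]
proof eventually_elim
 case (elim k)
 let ?U = "Q (k + 1)" and ?u = "Q k"
 have "(1 - \<delta>) * ((\<sigma> - eta) * ?U) <= (1 - \<delta>) * ?u"
  using elim delta_less_half by (intro mult_left_mono) auto
 moreover have "\<delta> * (1 + \<sigma>) * ?U <= \<sigma> * ?U" using delta_sigma Q_pos[of "k + 1"] by (intro mult_right_mono) auto
 moreover have "0 <= \<delta> * eta * ?U" using delta_nonneg assms Q_pos[of "k + 1"] by simp
 ultimately show ?case by (simp add: algebra_simps)
qed

lemma locate:
 assumes "a > 0"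
 shows "\<forall>\<^sub>F t in at_top. \<exists>k\<ge>K. a * Q k <= t & t < a * Q (k + 1)"
 using eventually_ge_at_top[of "a * Q K"]
proof eventually_elim
 case (elim t)
 obtain j where j: "Q j > t / a"
  using Q_at_top[unfolded filterlim_at_top_dense, rule_format, of "t / a"]
  by (auto dest: eventually_happens)
 have j': "t < a * Q j" using j assms by (simp add: field_simps)
 define i where "i = (LEAST i. t < a * Q i)"
 have i: "t < a * Q i" unfolding i_def by (rule LeastI[of "\<lambda>i. t < a * Q i", OF j'])
 have "i > K"
 proof (rule ccontr)
  assume "~ K < i"
  then have "a * Q i <= a * Q K" using Q_mono[of i K] assms by simp
  then show False using i elim by simp
 qed
 moreover have "~ t < a * Q (i - 1)" unfolding i_def
  by (rule not_less_Least) (use \<open>i > K\<close> in \<open>simp add: i_def\<close>)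
 ultimately show ?case using i by (intro exI[of _ "i - 1"]) auto
qed

text \<open>If \<open>x\<close> is not a multiple of \<open>p k\<close>, then
  \<open>y = crossZ x (p k)\<close> is a non-zero point orthogonal to \<open>p k\<close>, too small
  to be a multiple of \<open>z (k + 1) 1\<close>. So \<open>y\<close> and \<open>z (k + 1) 1\<close>
  span an area of at least \<open>hgt (p k)\<close>. As the error of \<open>y\<close> is controlled
  by \<open>lin \<xi> x\<close>, this forces \<open>lin \<xi> x\<close> to be at least about
  \<open>1 / hgt (z (k + 1) 1)\<close>, which exceeds \<open>lin \<xi> (p k)\<close>.\<close>

lemma best_form:
 assumes "\<epsilon> > 0"
 shows "EV k. \<forall>x. x ~= 0 & hgt x <= exp ((1 - \<epsilon>) * Q (k + 1)) --> lin \<xi> (p k) <= lin \<xi> x"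
proof -
 \<comment> \<open>An eighth of \<open>\<epsilon>\<close> covers all error terms against the gain
   \<open>\<epsilon> * Q (k + 1)\<close>. The second bound, positive because
   \<open>\<delta> < 1 / 2\<close>, makes \<open>hgt z * lin p\<close> small without using that
   gain.\<close>
 define eta where "eta = min (\<epsilon> / 8) ((1 - 2 * \<delta>) / 8)"
 have eta: "eta > 0" "8 * eta <= \<epsilon>" "8 * eta <= 1 - 2 * \<delta>"
  using assms delta_less_half by (auto simp: eta_def min_def)
 have z1: "EV k.
   exp ((1 - eta) * (Q (k + 1) + Q k)) <= hgt (z (k + 1) 1) &
   hgt (z (k + 1) 1) <= exp ((1 + eta) * (Q (k + 1) + Q k)) &
   err \<xi> (z (k + 1) 1) <= exp (- ((1 - \<delta> - eta) * (Q (k + 1) + Q k))) & primitive (z (k + 1) 1)"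
  using eventually_all_ge_at_top[OF z_hgt[OF eta(1)]] eventually_all_ge_at_top[OF z_err[OF eta(1)]]
   eventually_all_ge_at_top[OF primitive_z]
 proof eventually_elim
  case (elim k)
  have "k <= k + 1" "(1::nat) \<in> {1..s (k + 1 + 1) + 1}" by auto
  from elim(1)[rule_format, OF this] elim(2)[rule_format, OF this] elim(3)[rule_format, OF this]
  show ?case by simp
 qed
 show ?thesis
  using p_hgt[OF eta(1)] p_lin[OF eta(1)] z1 eventually_delta[OF eta(1)] z_orth primitive_p
   eventually_all_ge_at_top[OF const_le_exp[OF eta(1), of 16]]
 proof eventually_elim
  case (elim k)
  let ?U = "Q (k + 1)" and ?u = "Q k" and ?z = "z (k + 1) 1" and ?p = "p k"
  have pos: "0 < ?u" "?u <= ?U" using Q_pos Q_mono by auto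
  have eu: "eta * ?u <= eta * ?U" "0 <= eta * ?u" "8 * (eta * ?U) <= \<epsilon> * ?U" "\<delta> * ?u <= \<delta> * ?U"
    "8 * eta * ?U <= (1 - 2 * \<delta>) * ?U"
   using pos eta delta_nonneg mult_left_mono[of ?u ?U \<delta>] mult_right_mono[OF eta(2), of ?U] mult_right_mono[OF eta(3), of ?U] by auto
  have dl: "\<delta> * ?U + \<delta> * ?u <= ?u + eta * ?U" using elim(4) by (simp add: algebra_simps)
  have c16: "16 <= exp (eta * ?U)" using elim(7) by auto
  have orth: "dotZ ?p ?z = 0" using elim(5) by auto
  have z: "exp ((1 - eta) * (?U + ?u)) <= hgt ?z" "hgt ?z <= exp ((1 + eta) * (?U + ?u))"
    "err \<xi> ?z <= exp (- ((1 - \<delta> - eta) * (?U + ?u)))" "primitive ?z"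
   using elim(3) by auto
  have pp: "exp ((1 - eta) * ?u) <= hgt ?p" "hgt ?p <= exp ((1 + eta) * ?u)"
    "lin \<xi> ?p <= exp (- ((2 - \<delta> - eta) * ?U + (1 - \<delta>) * ?u))"
   using elim(1,2) by auto
  have zp: "16 * (hgt ?z * lin \<xi> ?p) <= exp (- ((1 - 2 * eta) * ?U) - ?u + \<delta> * (?U + ?u) + eta * ?U + (1 + eta) * ?u)"
  proof -
   have "16 * (hgt ?z * lin \<xi> ?p) <= exp (eta * ?U) *
     (exp ((1 + eta) * (?U + ?u)) * exp (- ((2 - \<delta> - eta) * ?U + (1 - \<delta>) * ?u)))"
    by (intro mult_mono c16 z pp) auto
   also have "... = exp (eta * ?U + ((1 + eta) * (?U + ?u) - ((2 - \<delta> - eta) * ?U + (1 - \<delta>) * ?u)))"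
    by (simp only: exp_add[symmetric] exp_diff[symmetric] diff_conv_add_uminus)
   also have "... <= exp (- ((1 - 2 * eta) * ?U) - ?u + \<delta> * (?U + ?u) + eta * ?U + (1 + eta) * ?u)"
    by (simp add: algebra_simps)
   finally show ?thesis .
  qed
  show ?case
  proof (intro allI impI, elim conjE)
   fix x :: "int^3" assume x: "x ~= 0" "hgt x <= exp ((1 - \<epsilon>) * ?U)"
   define y where "y = crossZ x ?p"
   have hy: "hgt y <= 2 * hgt x * hgt ?p" unfolding y_def by (rule hgt_crossZ_le)
   have ey: "err \<xi> y <= lin \<xi> x * hgt ?p + lin \<xi> ?p * hgt x" unfolding y_def by (rule err_crossZ)
   show "lin \<xi> ?p <= lin \<xi> x"
   proof (cases "y = 0")
    case True
    then show ?thesis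
     using parallel_primitive[of x ?p] multiple_bounds(3)[OF _ x(1)] elim(6) unfolding y_def by metis
   next
    case False
    have py: "dotZ ?p y = 0" by (simp add: y_def dotZ_def algebra_simps)
    have "crossZ y ?z ~= 0"
    proof
     assume "crossZ y ?z = 0"
     then have "hgt ?z <= hgt y"
      using parallel_primitive[of y ?z] multiple_bounds(1)[OF _ False] z(4) by metis
     then have "exp ((1 - eta) * (?U + ?u)) <= 2 * (hgt x * hgt ?p)" using z(1) hy by simp
     also have "... < 16 * (exp ((1 - \<epsilon>) * ?U) * exp ((1 + eta) * ?u))"
     proof -
      have "hgt x * hgt ?p <= exp ((1 - \<epsilon>) * ?U) * exp ((1 + eta) * ?u)"
       by (intro mult_mono x pp) auto
      moreover have "0 < exp ((1 - \<epsilon>) * ?U) * exp ((1 + eta) * ?u)" by simp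
      ultimately show ?thesis by linarith
     qed
     also have "... <= exp (eta * ?U) * (exp ((1 - \<epsilon>) * ?U) * exp ((1 + eta) * ?u))"
      by (intro mult_right_mono c16) auto
     also have "... = exp (eta * ?U + ((1 - \<epsilon>) * ?U + (1 + eta) * ?u))"
      by (simp only: exp_add)
     finally have "(1 - eta) * (?U + ?u) < eta * ?U + ((1 - \<epsilon>) * ?U + (1 + eta) * ?u)" by simp
     then show False using eu pos by (simp only: algebra_simps; linarith)
    qed
    \<comment> \<open>The area inequality. In \<open>main\<close> the first and the last term are at
      most a fraction of \<open>hgt ?p\<close> by \<open>A\<close> and \<open>C\<close>, so the
      middle one, which contains \<open>lin \<xi> x\<close>, has to be large; \<open>D\<close>
      compares it with \<open>lin \<xi> ?p\<close>.\<close>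
    then have "hgt ?p <= hgt (crossZ y ?z)" by (intro orthogonal_plane_bound py orth elim(6))
    also have "... <= 2 * (hgt y * err \<xi> ?z + hgt ?z * err \<xi> y)" by (rule hgt_crossZ_err)
    also have "... <= 2 * ((2 * hgt x * hgt ?p) * err \<xi> ?z
      + hgt ?z * (lin \<xi> x * hgt ?p + lin \<xi> ?p * hgt x))"
     using hy ey by (intro mult_left_mono add_mono mult_right_mono) auto
    finally have main: "hgt ?p <= 4 * (hgt x * err \<xi> ?z) * hgt ?p
      + 2 * (hgt ?z * lin \<xi> x) * hgt ?p + 2 * (hgt ?z * lin \<xi> ?p * hgt x)"
     by (simp add: algebra_simps)
    have A: "16 * (hgt x * err \<xi> ?z) <= 1"
    proof -
     have "16 * (hgt x * err \<xi> ?z) <= exp (eta * ?U) *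
       (exp ((1 - \<epsilon>) * ?U) * exp (- ((1 - \<delta> - eta) * (?U + ?u))))"
      by (intro mult_mono c16 z x) auto
     also have "... = exp (eta * ?U + ((1 - \<epsilon>) * ?U - (1 - \<delta> - eta) * (?U + ?u)))"
      by (simp only: exp_add[symmetric] diff_conv_add_uminus)
     also have "... <= exp 0" using eu dl pos unfolding exp_le_cancel_iff by (simp only: algebra_simps; linarith)
     finally show ?thesis by simp
    qed
    have C: "16 * (hgt ?z * lin \<xi> ?p * hgt x) <= hgt ?p"
    proof -
     have "16 * (hgt ?z * lin \<xi> ?p) * hgt x
       <= exp (- ((1 - 2 * eta) * ?U) - ?u + \<delta> * (?U + ?u) + eta * ?U + (1 + eta) * ?u) * exp ((1 - \<epsilon>) * ?U)"
      by (intro mult_mono zp x) auto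
     also have "... = exp (- ((1 - 2 * eta) * ?U) - ?u + \<delta> * (?U + ?u) + eta * ?U + (1 + eta) * ?u + (1 - \<epsilon>) * ?U)"
      by (simp only: exp_add)
     also have "... <= exp ((1 - eta) * ?u)"
      using eu dl pos unfolding exp_le_cancel_iff by (simp only: algebra_simps; linarith)
     finally show ?thesis using pp by simp
    qed
    have D: "16 * (hgt ?z * lin \<xi> ?p) <= 1"
     using eu dl pos by (intro order_trans[OF zp]) (simp only: exp_le_one_iff algebra_simps; linarith)
    have hp: "hgt ?p > 0" using pp(1) by (smt (verit) exp_gt_zero)
    have "4 * (hgt x * err \<xi> ?z) * hgt ?p <= (1/4) * hgt ?p"
     using A by (intro mult_right_mono) auto
    with main C have "(1 / 4) * hgt ?p <= (2 * (hgt ?z * lin \<xi> x)) * hgt ?p" using hp by linarith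
    then have "1 / 4 <= 2 * (hgt ?z * lin \<xi> x)" using hp by simp
    with D have "hgt ?z * lin \<xi> ?p <= hgt ?z * lin \<xi> x" by linarith
    moreover have "hgt ?z > 0" using z(1) by (smt (verit) exp_gt_zero)
    ultimately show ?thesis by simp
   qed
  qed
 qed
qed

end

section \<open>Integral quadratic forms and algebraic numbers of degree at most two\<close>

lemma poly_degree_le_2:
 assumes "degree f <= 2"
 shows "f = [:coeff f 0, coeff f 1, coeff f 2:]"
proof (rule poly_eqI)
 fix n
 have "n > 2 ==> coeff f n = 0" using assms by (intro coeff_eq_0) auto
 moreover have "n = 0 \<or> n = 1 \<or> n = 2 \<or> (\<exists>m. n = Suc (Suc (Suc m)))" by presburger
 ultimately show "coeff f n = coeff [:coeff f 0, coeff f 1, coeff f 2:] n"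
  by (auto simp: numeral_2_eq_2)
qed

lemma poly_height_ge: "\<bar>coeff f i\<bar> <= poly_height (f :: 'a::linordered_idom poly)"
proof (cases "i <= degree f")
 case True
 then show ?thesis unfolding poly_height_def by (intro Max_ge) auto
next
 case False
 have "\<bar>coeff f (degree f)\<bar> <= poly_height f" unfolding poly_height_def by (intro Max_ge) auto
 with False show ?thesis by (simp add: coeff_eq_0)
qed

lemma poly_height_le: "(!!i. \<bar>coeff f i\<bar> <= c) ==> poly_height (f :: 'a::linordered_idom poly) <= c"
 unfolding poly_height_def by (subst Max_le_iff) auto

lemma of_int_poly_mult:
 "map_poly of_int (f * g) = map_poly of_int f * (map_poly of_int g :: 'a::{comm_ring_1,ring_char_0} poly)"
 by (rule poly_eqI) (simp add: coeff_map_poly coeff_mult)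

lemma of_int_poly_quadratic:
 "poly (map_poly of_int [:a, b, c:]) x = of_int a + of_int b * x + of_int c * (x :: 'a::{comm_ring_1,ring_char_0})\<^sup>2"
 by (simp add: map_poly_pCons algebra_simps power2_eq_square)

lemma lin_eq_cmod:
 "lin \<xi> x = cmod (of_int (x$1) + of_int (x$2) * complex_of_real \<xi> + of_int (x$3) * (complex_of_real \<xi>)\<^sup>2)"
proof -
 have "lin \<xi> x = cmod (complex_of_real
   (real_of_int (x$1) + real_of_int (x$2) * \<xi> + real_of_int (x$3) * \<xi>\<^sup>2))"
  by (simp only: lin_eq norm_of_real)
 then show ?thesis by simp
qed

text \<open>An irreducible factor over the integers that vanishes at \<open>\<alpha>\<close> is a
  minimal polynomial in the sense of \<open>is_int_minpoly\<close>, primitivity being part of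
  irreducibility.\<close>

lemma prime_factor_root:
 fixes f :: "int poly" and \<alpha> :: "'a::field_char_0"
 assumes "f ~= 0" "poly (map_poly of_int f) \<alpha> = 0"
 obtains g where "g dvd f" "irreducible g" "poly (map_poly of_int g) \<alpha> = 0"
proof -
 define A where "A = prime_factorization f"
 have A: "normalize (prod_mset A) = normalize f" "!!x. x \<in># A ==> prime x"
  using assms(1) by (auto simp: A_def prod_mset_prime_factorization_weak in_prime_factors_imp_prime)
 obtain u where u: "prod_mset A = f * u"
  using associatedD2[OF A(1)] by (auto elim: dvdE)
 have "poly (map_poly of_int (prod_mset A)) \<alpha> = 0"
  unfolding u of_int_poly_mult using assms(2) by simp
 moreover have "poly (map_poly of_int (prod_mset A)) \<alpha> = 0 ==> \<exists>g\<in>#A. poly (map_poly of_int g) \<alpha> = 0"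
  by (induction A) (auto simp: of_int_poly_mult)
 ultimately obtain g where g: "g \<in># A" "poly (map_poly of_int g) \<alpha> = 0" by blast
 have "g dvd f" using g(1) by (auto simp: A_def dest: in_prime_factors_imp_dvd)
 moreover have "irreducible g"
  using A(2)[OF g(1)] by (intro prime_elem_imp_irreducible prime_imp_prime_elem)
 ultimately show thesis using g that by blast
qed

text \<open>In degree two the height of a factor is bounded with constant 1. If \<open>f\<close> is
  a product of two linear factors, the leading coefficient of \<open>g\<close> divides that of
  \<open>f\<close>; the constant one divides that of \<open>f\<close>, or, if this vanishes because
  \<open>a = 0\<close>, the middle coefficient of \<open>f\<close>.\<close>

lemma divisor_coeff_le:
 fixes f g :: "int poly"
 assumes f: "degree f = 2" and g: "g dvd f" "degree g > 0" and c: "!!i. \<bar>coeff f i\<bar> <= c"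
 shows "\<bar>coeff g i\<bar> <= c"
proof -
 obtain h where h: "f = g * h" using g(1) by auto
 have nz: "g ~= 0" "h ~= 0" using f h by auto
 have deg: "degree g + degree h = 2" using f h nz by (simp add: degree_mult_eq)
 have absle: "\<bar>a\<bar> <= \<bar>a * b\<bar>" if "b ~= 0" for a b :: int
 proof -
  have "\<bar>b\<bar> >= 1" using that by linarith
  then have "\<bar>a\<bar> * 1 <= \<bar>a\<bar> * \<bar>b\<bar>" by (intro mult_left_mono) auto
  then show ?thesis by (simp add: abs_mult)
 qed
 have "degree g = 2 & degree h = 0 \<or> degree g = 1 & degree h = 1" using deg g(2) by arith
 then show ?thesis
 proof (elim disjE conjE)
  assume "degree h = 0"
  then obtain b where b: "h = [:b:]" by (metis degree_eq_zeroE)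
  then have "coeff f i = coeff g i * b" "b ~= 0" using h nz by auto
  then show ?thesis using absle[of b "coeff g i"] c[of i] by simp
 next
  assume d: "degree g = 1" "degree h = 1"
  obtain u v where uv: "g = [:u, v:]" using d(1) by (metis degree1_coeffs)
  obtain a b where ab: "h = [:a, b:]" using d(2) by (metis degree1_coeffs)
  have b: "b ~= 0" "v ~= 0" using d uv ab by auto
  have ff: "f = [:u * a, u * b + v * a, v * b:]" using h uv ab by (simp add: algebra_simps)
  have "\<bar>v\<bar> <= c" using absle[OF b(1), of v] c[of 2] ff by (simp add: numeral_2_eq_2)
  moreover have "\<bar>u\<bar> <= c"
   using absle[of a u] c[of 0] absle[OF b(1), of u] c[of 1] ff by (cases "a = 0") auto
  moreover have "0 <= c" using c[of 0] by linarith
  ultimately show ?thesis by (auto simp: uv coeff_pCons split: nat.splits)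
 qed
qed

text \<open>Take the root \<open>\<alpha>\<close> nearest to \<open>\<xi>\<close>. The derivative at
  \<open>\<xi>\<close> is the leading coefficient times the sum of the distances to the two roots,
  so \<open>d\<close> is at most twice that coefficient times the distance to the farther root;
  multiplying by the nearer distance gives \<open>2 * lin \<xi> x\<close>. Passing to the
  irreducible factor at \<open>\<alpha>\<close> does not increase the height.\<close>

lemma algebraic_approx_of_form:
 fixes x :: "int^3" and \<xi> :: real
 defines "d \<equiv> \<bar>real_of_int (x$2) + 2 * real_of_int (x$3) * \<xi>\<bar>"
 assumes x3: "x$3 ~= 0" and nz: "lin \<xi> x ~= 0" and d: "d > 0"
 obtains \<alpha> f where "is_int_minpoly f \<alpha>" "degree f <= 2" "0 < cmod (complex_of_real \<xi> - \<alpha>)"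
  "cmod (complex_of_real \<xi> - \<alpha>) <= 2 * lin \<xi> x / d" "real_of_int (poly_height f) <= hgt x"
  "poly_height f > 0"
proof -
 let ?a = "of_int (x$1) :: complex" and ?b = "of_int (x$2) :: complex" and ?c = "of_int (x$3) :: complex"
 define F where "F = [:x$1, x$2, x$3:]"
 define r where "r = csqrt (?b\<^sup>2 - 4 * ?a * ?c)"
 define \<alpha>1 where "\<alpha>1 = (- ?b + r) / (2 * ?c)"
 define \<alpha>2 where "\<alpha>2 = (- ?b - r) / (2 * ?c)"
 have c: "?c ~= 0" using x3 by simp
 have r2: "r\<^sup>2 = ?b\<^sup>2 - 4 * ?a * ?c" unfolding r_def by (rule power2_csqrt)
 have s: "?c * (\<alpha>1 + \<alpha>2) = - ?b" using c by (simp add: \<alpha>1_def \<alpha>2_def field_simps)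
 have pr: "?c * (\<alpha>1 * \<alpha>2) = ?a"
 proof -
  have "4 * ?c * (?c * (\<alpha>1 * \<alpha>2)) = (2 * ?c * \<alpha>1) * (2 * ?c * \<alpha>2)" by (simp add: algebra_simps)
  also have "... = (- ?b + r) * (- ?b - r)" using c by (simp add: \<alpha>1_def \<alpha>2_def)
  also have "... = ?b\<^sup>2 - r\<^sup>2" by (simp add: algebra_simps power2_eq_square)
  also have "... = 4 * ?c * ?a" by (simp add: r2)
  finally show ?thesis using c by simp
 qed
 have fac: "?a + ?b * y + ?c * y\<^sup>2 = ?c * (y - \<alpha>1) * (y - \<alpha>2)" for y
 proof -
  have "?c * (y - \<alpha>1) * (y - \<alpha>2) = ?c * y\<^sup>2 - ?c * (\<alpha>1 + \<alpha>2) * y + ?c * (\<alpha>1 * \<alpha>2)"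
   by (simp add: algebra_simps power2_eq_square)
  then show ?thesis unfolding s pr by simp
 qed
 have evF: "poly (map_poly of_int F) y = ?c * (y - \<alpha>1) * (y - \<alpha>2)" for y
  unfolding F_def of_int_poly_quadratic by (rule fac)
 let ?x = "complex_of_real \<xi>"
 have lin: "lin \<xi> x = cmod ?c * cmod (?x - \<alpha>1) * cmod (?x - \<alpha>2)"
 proof -
  have "lin \<xi> x = cmod (?a + ?b * ?x + ?c * ?x\<^sup>2)" by (rule lin_eq_cmod)
  then show ?thesis unfolding fac by (simp add: norm_mult)
 qed
 have dd: "d <= cmod ?c * (cmod (?x - \<alpha>1) + cmod (?x - \<alpha>2))"
 proof -
  have "d = cmod (complex_of_real (real_of_int (x$2) + 2 * real_of_int (x$3) * \<xi>))"
   by (simp only: d_def norm_of_real)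
  also have "... = cmod (?b + 2 * ?c * ?x)" by simp
  also have "?b + 2 * ?c * ?x = ?c * ((?x - \<alpha>1) + (?x - \<alpha>2))"
   using s by (simp add: algebra_simps)
  finally have "d = cmod ?c * cmod ((?x - \<alpha>1) + (?x - \<alpha>2))" by (simp only: norm_mult)
  also have "... <= cmod ?c * (cmod (?x - \<alpha>1) + cmod (?x - \<alpha>2))"
   by (intro mult_left_mono norm_triangle_ineq) simp
  finally show ?thesis .
 qed
 have main: "0 < cmod (?x - \<alpha>) & cmod (?x - \<alpha>) <= 2 * lin \<xi> x / d & poly (map_poly of_int F) \<alpha> = 0"
  if "\<alpha> = \<alpha>1 & \<beta> = \<alpha>2 \<or> \<alpha> = \<alpha>2 & \<beta> = \<alpha>1" "cmod (?x - \<alpha>) <= cmod (?x - \<beta>)" for \<alpha> \<beta>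
 proof -
  have l: "lin \<xi> x = cmod ?c * cmod (?x - \<alpha>) * cmod (?x - \<beta>)"
   using that(1) by (elim disjE conjE) (simp_all only: lin mult_ac)
  have "d <= cmod ?c * (cmod (?x - \<alpha>) + cmod (?x - \<beta>))"
   using dd that(1) by (auto simp: add.commute)
  also have "... <= 2 * (cmod ?c * cmod (?x - \<beta>))"
   using mult_left_mono[OF that(2), of "cmod ?c"] by (simp add: algebra_simps)
  finally have "cmod (?x - \<alpha>) * d <= cmod (?x - \<alpha>) * (2 * (cmod ?c * cmod (?x - \<beta>)))"
   by (intro mult_left_mono) auto
  also have "... = 2 * lin \<xi> x" unfolding l by (simp add: algebra_simps)
  finally have "cmod (?x - \<alpha>) <= 2 * lin \<xi> x / d" using d by (simp add: field_simps)
  moreover have "cmod (?x - \<alpha>) ~= 0" using nz l by auto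
  ultimately show ?thesis using that(1) evF by auto
 qed
 obtain \<alpha> where \<alpha>: "0 < cmod (?x - \<alpha>)" "cmod (?x - \<alpha>) <= 2 * lin \<xi> x / d" "poly (map_poly of_int F) \<alpha> = 0"
  using main[of \<alpha>1 \<alpha>2] main[of \<alpha>2 \<alpha>1] by (meson linear)
 have F: "F ~= 0" "degree F = 2" using x3 by (auto simp: F_def)
 obtain g where g: "g dvd F" "irreducible g" "poly (map_poly of_int g) \<alpha> = 0"
  using prime_factor_root[OF F(1) \<alpha>(3)] .
 have g0: "g ~= 0" using g(2) by auto
 have "degree g > 0"
 proof (rule ccontr)
  assume "~ ?thesis"
  then obtain b where "g = [:b:]" by (metis degree_eq_zeroE neq0_conv)
  then show False using g(3) g0 by (simp add: map_poly_pCons)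
 qed
 have cF: "\<bar>coeff F i\<bar> <= \<lfloor>hgt x\<rfloor>" for i
  using hgt_nth[of x 1] hgt_nth[of x 2] hgt_nth[of x 3] hgt_nonneg[of x]
  by (auto simp: F_def coeff_pCons le_floor_iff split: nat.splits)
 have "poly_height g <= \<lfloor>hgt x\<rfloor>"
  by (intro poly_height_le divisor_coeff_le[OF F(2) g(1) \<open>degree g > 0\<close> cF])
 moreover have "poly_height g > 0"
  using poly_height_ge[of g "degree g"] g0 by (smt (verit, best) leading_coeff_0_iff)
 moreover have "degree g <= 2" using dvd_imp_degree_le[OF g(1)] F by simp
 ultimately show thesis
  using that[of g \<alpha>] g \<alpha> by (simp add: is_int_minpoly_def le_floor_iff)
qed

text \<open>As \<open>f\<close> vanishes at \<open>\<alpha>\<close>, its value at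
  \<open>\<xi>\<close> is \<open>\<xi> - \<alpha>\<close> times
  \<open>c1 + c2 * (\<xi> + \<alpha>)\<close>, where \<open>c1\<close> and \<open>c2\<close> are
  coefficients of \<open>f\<close>. The distance is at most 1, so \<open>\<alpha>\<close> has
  modulus at most \<open>\<bar>\<xi>\<bar> + 1\<close>, whence the constant; the height cancels
  against the factor \<open>inverse\<close> of the starred condition.\<close>

lemma form_of_algebraic_approx:
 assumes "omega_star_approx \<xi> \<omega> X" "X >= 1" "\<omega> >= 0"
 obtains x where "x ~= 0" "hgt x <= X" "lin \<xi> x <= (2 + 2 * \<bar>\<xi>\<bar>) * X powr (- \<omega>)"
proof -
 obtain \<alpha> f where f: "is_int_minpoly f \<alpha>" "degree f <= 2" "real_of_int (poly_height f) <= X"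
   "cmod (complex_of_real \<xi> - \<alpha>) <= inverse (real_of_int (poly_height f)) * X powr (- \<omega>)"
  using assms(1) unfolding omega_star_approx_def by blast
 define h where "h = real_of_int (poly_height f)"
 define x :: "int^3" where "x = vector [coeff f 0, coeff f 1, coeff f 2]"
 have xn: "x$1 = coeff f 0" "x$2 = coeff f 1" "x$3 = coeff f 2" by (simp_all add: x_def)
 have f0: "f ~= 0" using f(1) by (auto simp: is_int_minpoly_def)
 have hi: "\<bar>real_of_int (coeff f i)\<bar> <= h" for i
  using poly_height_ge[of f i] unfolding h_def by linarith
 have "coeff f (degree f) ~= 0" using f0 by simp
 then have "\<bar>coeff f (degree f)\<bar> >= 1" by linarith
 then have h1: "h >= 1" using poly_height_ge[of f "degree f"] by (simp add: h_def)
 let ?d = "cmod (complex_of_real \<xi> - \<alpha>)"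
 have "X powr (- \<omega>) <= X powr 0" using assms by (intro powr_mono) auto
 then have "X powr (- \<omega>) <= 1" using assms(2) by simp
 moreover have "inverse h * X powr (- \<omega>) <= 1 * X powr (- \<omega>)"
  using h1 by (intro mult_right_mono) (auto simp: inverse_eq_divide)
 ultimately have d1: "?d <= 1" using f(4) by (simp add: h_def)
 have a1: "cmod \<alpha> <= \<bar>\<xi>\<bar> + 1"
  using norm_triangle_sub[of \<alpha> "complex_of_real \<xi>"] d1 by (simp add: norm_minus_commute)
 let ?c = "\<lambda>i. of_int (coeff f i) :: complex"
 have root: "?c 0 + ?c 1 * \<alpha> + ?c 2 * \<alpha>\<^sup>2 = 0"
  using f(1) poly_degree_le_2[OF f(2)] of_int_poly_quadratic[of "coeff f 0" "coeff f 1" "coeff f 2" \<alpha>]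
  by (simp add: is_int_minpoly_def)
 have "lin \<xi> x = cmod (?c 0 + ?c 1 * complex_of_real \<xi> + ?c 2 * (complex_of_real \<xi>)\<^sup>2)"
  unfolding lin_eq_cmod xn ..
 also have "?c 0 + ?c 1 * complex_of_real \<xi> + ?c 2 * (complex_of_real \<xi>)\<^sup>2
   = (?c 0 + ?c 1 * complex_of_real \<xi> + ?c 2 * (complex_of_real \<xi>)\<^sup>2) - (?c 0 + ?c 1 * \<alpha> + ?c 2 * \<alpha>\<^sup>2)"
  unfolding root by simp
 also have "... = (complex_of_real \<xi> - \<alpha>) * (?c 1 + ?c 2 * (complex_of_real \<xi> + \<alpha>))"
  by (simp add: algebra_simps power2_eq_square)
 also have "cmod ... <= ?d * (h + h * (\<bar>\<xi>\<bar> + (\<bar>\<xi>\<bar> + 1)))"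
 proof -
  have "cmod (?c 2 * (complex_of_real \<xi> + \<alpha>)) <= h * (\<bar>\<xi>\<bar> + (\<bar>\<xi>\<bar> + 1))"
   unfolding norm_mult
   by (intro mult_mono order_trans[OF norm_triangle_ineq]) (use hi[of 2] a1 in auto)
  then have "cmod (?c 1 + ?c 2 * (complex_of_real \<xi> + \<alpha>)) <= h + h * (\<bar>\<xi>\<bar> + (\<bar>\<xi>\<bar> + 1))"
   using hi[of 1] by (intro order_trans[OF norm_triangle_ineq] add_mono) auto
  then show ?thesis unfolding norm_mult by (intro mult_left_mono) auto
 qed
 also have "... = (2 + 2 * \<bar>\<xi>\<bar>) * (?d * h)" by (simp add: algebra_simps)
 also have "... <= (2 + 2 * \<bar>\<xi>\<bar>) * X powr (- \<omega>)"
  using f(4) h1 by (intro mult_left_mono) (auto simp: h_def field_simps)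
 finally have "lin \<xi> x <= (2 + 2 * \<bar>\<xi>\<bar>) * X powr (- \<omega>)" .
 moreover have "hgt x <= X" unfolding hgt_le_iff xn using hi f(3) order_trans unfolding h_def by blast
 moreover have "x ~= 0"
 proof
  assume "x = 0"
  then have "coeff f 0 = 0 & coeff f 1 = 0 & coeff f 2 = 0" using xn by auto
  then show False using poly_degree_le_2[OF f(2)] f0 by simp
 qed
 ultimately show thesis using that by blast
qed

text \<open>The constant \<open>2 + 2 * \<bar>\<xi>\<bar>\<close> is absorbed by an arbitrarily
  small loss in the exponent. Hence lower bounds need to be shown only for the starred exponents and
  upper bounds only for the others.\<close>

lemma omega_approx_of_star:
 assumes "0 < \<omega>" "\<omega>' < \<omega>"
 shows "\<forall>\<^sub>F X in at_top. omega_star_approx \<xi> \<omega> X --> omega_approx \<xi> \<omega>' X"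
proof -
 have "\<forall>\<^sub>F X in at_top. X powr (\<omega> - \<omega>') >= 2 + 2 * \<bar>\<xi>\<bar>"
  unfolding eventually_at_top_exp[of "\<lambda>X. X powr (\<omega> - \<omega>') >= 2 + 2 * \<bar>\<xi>\<bar>"] exp_powr
  using eventually_ge_at_top[of "(2 + 2 * \<bar>\<xi>\<bar>) / (\<omega> - \<omega>')"]
 proof eventually_elim
  case (elim t)
  then have "2 + 2 * \<bar>\<xi>\<bar> <= (\<omega> - \<omega>') * t" using assms by (simp add: field_simps)
  then show ?case using exp_ge_add_one_self[of "(\<omega> - \<omega>') * t"] by linarith
 qed
 then show ?thesis using eventually_ge_at_top[of 1]
 proof eventually_elim
  case (elim X)
  show ?case
  proof
   assume "omega_star_approx \<xi> \<omega> X"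
   then obtain x where x: "x ~= 0" "hgt x <= X" "lin \<xi> x <= (2 + 2 * \<bar>\<xi>\<bar>) * X powr (- \<omega>)"
    using form_of_algebraic_approx[of \<xi> \<omega> X] elim assms by auto
   note x(3)
   also have "(2 + 2 * \<bar>\<xi>\<bar>) * X powr (- \<omega>) <= X powr (\<omega> - \<omega>') * X powr (- \<omega>)"
    using elim by (intro mult_right_mono) auto
   also have "... = X powr (- \<omega>')" by (simp add: powr_add[symmetric])
   finally show "omega_approx \<xi> \<omega>' X" using x by (auto simp: omega_approx_def)
  qed
 qed
qed

section \<open>The exponents \<open>omega2\<close>, \<open>omega2_star\<close> and their uniform
  versions\<close>

context sturm_points
begin

text \<open>The root of \<open>p k\<close> nearest to \<open>\<xi>\<close> lies at distance about
  \<open>lin \<xi> (p k)\<close> over the derivative, and the derivative is about as large as the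
  height. The additional multiples of \<open>eta\<close> pay for the factor 2 and for the comparison
  of derivative and height with \<open>exp (Q k)\<close>. Quantifying \<open>t\<close> and
  \<open>\<omega>\<close> inside makes the threshold for \<open>k\<close> independent of
  them.\<close>

lemma omega_star_approx_p:
 assumes "eta > 0"
 shows "EV k. \<forall>t \<omega>. (1 + eta) * Q k <= t &
  \<omega> * t <= (2 - \<delta> - 5 * eta) * Q (k + 1) + (1 - \<delta>) * Q k --> omega_star_approx \<xi> \<omega> (exp t)"
 using p_hgt[OF assms] p_lin[OF assms] p_lead[OF assms] p_deriv[OF assms]
  const_le_exp[OF assms, of 2]
proof eventually_elim
 case (elim k)
 let ?U = "Q (k + 1)" and ?u = "Q k" and ?p = "p k"
 let ?d = "\<bar>real_of_int (p k $ 2) + 2 * real_of_int (p k $ 3) * \<xi>\<bar>"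
 have d: "?d > 0" using elim(4) by (smt (verit) exp_gt_zero)
 have p3: "?p $ 3 ~= 0" using elim(3) by (smt (verit) exp_gt_zero of_int_0)
 have l: "lin \<xi> ?p ~= 0" using elim(2) by (smt (verit) exp_gt_zero)
 obtain \<alpha> f where f: "is_int_minpoly f \<alpha>" "degree f <= 2" "0 < cmod (complex_of_real \<xi> - \<alpha>)"
   "cmod (complex_of_real \<xi> - \<alpha>) <= 2 * lin \<xi> ?p / ?d" "real_of_int (poly_height f) <= hgt ?p"
   "poly_height f > 0"
  using algebraic_approx_of_form[OF p3 l d] .
 have H: "real_of_int (poly_height f) <= exp ((1 + eta) * ?u)" using f(5) elim(1) by linarith
 have small: "2 * lin \<xi> ?p / ?d <= exp (- ((2 - \<delta> - 5 * eta) * ?U + (1 - \<delta>) * ?u)) * exp (- ((1 + eta) * ?u))"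
 proof -
  have "2 * lin \<xi> ?p / ?d <= (exp (eta * ?u) * exp (- ((2 - \<delta> - eta) * ?U + (1 - \<delta>) * ?u))) / exp ((1 - eta) * ?u)"
   using elim by (intro frac_le mult_mono) auto
  also have "... = exp (eta * ?u + - ((2 - \<delta> - eta) * ?U + (1 - \<delta>) * ?u) - (1 - eta) * ?u)"
   by (simp only: exp_add exp_diff)
  also have "... <= exp (- ((2 - \<delta> - 5 * eta) * ?U + (1 - \<delta>) * ?u) + - ((1 + eta) * ?u))"
  proof -
   have "eta * ?u <= eta * ?U" using assms Q_mono[of k "k + 1"] by (intro mult_left_mono) auto
   moreover have "0 <= eta * ?U" using assms Q_pos[of "k + 1"] by simp
   ultimately show ?thesis unfolding exp_le_cancel_iff by (simp only: algebra_simps; linarith)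
  qed
  finally show ?thesis by (simp only: exp_add)
 qed
 show ?case
 proof (intro allI impI, elim conjE)
  fix t \<omega> assume t: "(1 + eta) * ?u <= t" and w: "\<omega> * t <= (2 - \<delta> - 5 * eta) * ?U + (1 - \<delta>) * ?u"
  have "cmod (complex_of_real \<xi> - \<alpha>) <= exp (- ((2 - \<delta> - 5 * eta) * ?U + (1 - \<delta>) * ?u)) * exp (- ((1 + eta) * ?u))"
   using f(4) small by linarith
  also have "... <= exp (- \<omega> * t) * inverse (real_of_int (poly_height f))"
  proof (intro mult_mono)
   show "exp (- ((1 + eta) * ?u)) <= inverse (real_of_int (poly_height f))"
    using H f(6) by (simp add: exp_minus)
  qed (use w in auto)
  finally show "omega_star_approx \<xi> \<omega> (exp t)"
   unfolding omega_star_approx_def exp_powr using f H t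
   by (intro exI[of _ \<alpha>] exI[of _ f]) (auto simp: mult.commute intro: order_trans)
 qed
qed

abbreviation "\<omega>0 \<equiv> 1 + (1 - \<delta>) * (1 + \<sigma>)"

lemma omega0_eq: "\<omega>0 = (2 - \<delta>) + (1 - \<delta>) * \<sigma>"
 by (simp add: algebra_simps)

lemma omega0_pos: "\<omega>0 > 0"
proof -
 have "0 <= (1 - \<delta>) * (1 + \<sigma>)" using delta_less_half sigma_nonneg by (intro mult_nonneg_nonneg) auto
 then show ?thesis by simp
qed

text \<open>Between the heights of \<open>p k\<close> and \<open>p (k + 1)\<close> the form
  \<open>p k\<close> is used. The least favourable \<open>t\<close> is the right end, where the
  bound \<open>Q k >= (\<sigma> - eta) * Q (k + 1)\<close> decides.\<close>

lemma star_hat_lower: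
 assumes "0 < \<omega>" "\<omega> < \<omega>0"
 shows "\<forall>\<^sub>F X in at_top. omega_star_approx \<xi> \<omega> X"
proof -
 \<comment> \<open>The solution of \<open>\<omega> * (1 + eta) = \<omega>0 - 6 * eta\<close>: five
   \<open>eta\<close> are lost in \<open>omega_star_approx_p\<close>, the sixth in the approximation
   of \<open>\<sigma>\<close>.\<close>
 define eta where "eta = (\<omega>0 - \<omega>) / (\<omega> + 6)"
 have eta: "eta > 0" using assms by (simp add: eta_def)
 have eq: "\<omega> * (1 + eta) = \<omega>0 - 6 * eta" using assms by (simp add: eta_def field_simps)
 obtain K where K: "!!k. k >= K ==> (\<forall>t \<omega>. (1 + eta) * Q k <= t &
    \<omega> * t <= (2 - \<delta> - 5 * eta) * Q (k + 1) + (1 - \<delta>) * Q k --> omega_star_approx \<xi> \<omega> (exp t))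
   & Q k >= (\<sigma> - eta) * Q (k + 1)"
  using eventually_conj[OF omega_star_approx_p[OF eta] eventually_Q_sigma[OF eta]]
  by (auto simp: eventually_sequentially)
 show ?thesis unfolding eventually_at_top_exp[of "omega_star_approx \<xi> \<omega>"]
  using locate[of "1 + eta" K]
 proof (rule eventually_mono)
  show "0 < 1 + eta" using eta by simp
  fix t assume "\<exists>k\<ge>K. (1 + eta) * Q k <= t & t < (1 + eta) * Q (k + 1)"
  then obtain k where k: "k >= K" "(1 + eta) * Q k <= t" "t < (1 + eta) * Q (k + 1)" by blast
  have "\<omega> * t <= \<omega> * ((1 + eta) * Q (k + 1))" using k assms by (intro mult_left_mono) auto
  also have "... = (\<omega>0 - 6 * eta) * Q (k + 1)" unfolding eq[symmetric] by simp
  also have "... <= (2 - \<delta> - 5 * eta) * Q (k + 1) + (1 - \<delta>) * Q k"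
  proof -
   have "(1 - \<delta>) * ((\<sigma> - eta) * Q (k + 1)) <= (1 - \<delta>) * Q k"
    using K[OF k(1)] delta_less_half by (intro mult_left_mono) auto
   moreover have "0 <= \<delta> * eta * Q (k + 1)" using eta delta_nonneg Q_pos[of "k + 1"] by simp
   ultimately show ?thesis unfolding omega0_eq by (simp only: algebra_simps; linarith)
  qed
  finally show "omega_star_approx \<xi> \<omega> (exp t)" using K k by blast
 qed
qed

text \<open>Test just below the height of \<open>p (k + 1)\<close>, at indices where
  \<open>Q k / Q (k + 1)\<close> is close to \<open>\<sigma>\<close>; by \<open>best_form\<close> no
  form there does better than \<open>p k\<close>.\<close>

lemma omega_hat_upper:
 assumes "\<omega>0 < \<omega>"
 shows "~ (\<forall>\<^sub>F X in at_top. omega_approx \<xi> \<omega> X)"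
proof
 define eta where "eta = min (1/2) ((\<omega> - \<omega>0) / (2 * (\<omega> + 2)))"
 have w: "\<omega> > 0" using assms omega0_pos by simp
 have eta: "eta > 0" "eta < 1" using assms w by (auto simp: eta_def min_def field_simps)
 have "eta <= (\<omega> - \<omega>0) / (2 * (\<omega> + 2))" by (simp add: eta_def)
 then have "eta * (2 * (\<omega> + 2)) <= \<omega> - \<omega>0" using w by (subst (asm) pos_le_divide_eq) auto
 then have e2: "\<omega> * (1 - eta) > \<omega>0 + 2 * eta"
  using assms by (simp add: algebra_simps)
 assume "\<forall>\<^sub>F X in at_top. omega_approx \<xi> \<omega> X"
 then have ev: "\<forall>\<^sub>F t in at_top. omega_approx \<xi> \<omega> (exp t)"
  by (rule iffD1[OF eventually_at_top_exp])
 have "filterlim (\<lambda>k. (1 - eta) * Q (k + 1)) at_top sequentially"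
  using eta by (intro filterlim_tendsto_pos_mult_at_top[OF tendsto_const]
    filterlim_compose[OF Q_at_top filterlim_add_const_nat_at_top]) auto
 then have "EV k. omega_approx \<xi> \<omega> (exp ((1 - eta) * Q (k + 1)))"
  using ev by (auto simp: filterlim_iff)
 then have "EV k. omega_approx \<xi> \<omega> (exp ((1 - eta) * Q (k + 1))) &
   (\<forall>x. x ~= 0 & hgt x <= exp ((1 - eta) * Q (k + 1)) --> lin \<xi> (p k) <= lin \<xi> x) &
   exp (- ((2 - \<delta> + eta) * Q (k + 1) + (1 - \<delta>) * Q k)) <= lin \<xi> (p k)"
  using best_form[OF eta(1)] p_lin[OF eta(1)] by eventually_elim auto
 from frequently_ex[OF frequently_eventually_conj[OF frequently_Q_sigma[OF eta(1)] this]]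
 obtain k where k: "omega_approx \<xi> \<omega> (exp ((1 - eta) * Q (k + 1)))"
   "!!x. x ~= 0 & hgt x <= exp ((1 - eta) * Q (k + 1)) ==> lin \<xi> (p k) <= lin \<xi> x"
   "exp (- ((2 - \<delta> + eta) * Q (k + 1) + (1 - \<delta>) * Q k)) <= lin \<xi> (p k)"
   "Q k <= (\<sigma> + eta) * Q (k + 1)" by blast
 obtain x where x: "x ~= 0" "lin \<xi> x <= exp (- \<omega> * ((1 - eta) * Q (k + 1)))" "hgt x <= exp ((1 - eta) * Q (k + 1))"
  using k(1) unfolding omega_approx_def exp_powr by blast
 have "exp (- ((2 - \<delta> + eta) * Q (k + 1) + (1 - \<delta>) * Q k)) <= exp (- \<omega> * ((1 - eta) * Q (k + 1)))"
  using k(2)[of x] k(3) x by linarith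
 then have "\<omega> * (1 - eta) * Q (k + 1) <= (2 - \<delta> + eta) * Q (k + 1) + (1 - \<delta>) * Q k" by simp
 also have "... <= (2 - \<delta> + eta) * Q (k + 1) + (1 - \<delta>) * ((\<sigma> + eta) * Q (k + 1))"
  using k(4) delta_less_half by (intro add_left_mono mult_left_mono) auto
 also have "... <= (\<omega>0 + 2 * eta) * Q (k + 1)"
 proof -
  have "0 <= \<delta> * eta * Q (k + 1)" using eta delta_nonneg Q_pos[of "k + 1"] by simp
  then show ?thesis unfolding omega0_eq by (simp only: algebra_simps; linarith)
 qed
 finally show False using e2 Q_pos[of "k + 1"] by simp
qed

text \<open>Test at the height of \<open>p k\<close>, along the indices where
  \<open>Q k / Q (k + 1)\<close> is close to \<open>\<sigma>\<close>. The hypothesis is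
  \<open>\<omega> < (2 - \<delta>) / \<sigma> + 1 - \<delta>\<close> cleared of its denominator, so
  that \<open>\<sigma> = 0\<close> is covered and allows every \<open>\<omega>\<close>.\<close>

lemma star_lower:
 assumes "0 < \<omega>" "(\<omega> - (1 - \<delta>)) * \<sigma> < 2 - \<delta>"
 shows "\<exists>\<^sub>F X in at_top. omega_star_approx \<xi> \<omega> X"
proof -
 \<comment> \<open>The maximum with 0 gives a non-negative factor by which the upper bound for
   \<open>Q k\<close> may be multiplied.\<close>
 let ?f = "\<lambda>eta. (2 - \<delta> - 5 * eta) - max 0 (\<omega> * (1 + eta) - (1 - \<delta>)) * (\<sigma> + eta)"
 have "isCont ?f 0" by (intro continuous_intros)
 moreover have "?f 0 > 0" using assms delta_less_half sigma_nonneg by (auto simp: max_def)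
 ultimately obtain eta where eta: "0 < eta" "?f eta > 0" using exists_small[of ?f 0 1] by auto
 have "\<exists>\<^sub>F k in sequentially. omega_star_approx \<xi> \<omega> (exp ((1 + eta) * Q k))"
  using frequently_eventually_conj[OF frequently_Q_sigma[OF eta(1)] omega_star_approx_p[OF eta(1)]]
 proof (rule frequently_elim1, elim conjE)
  fix k assume *: "\<forall>t \<omega>. (1 + eta) * Q k <= t &
     \<omega> * t <= (2 - \<delta> - 5 * eta) * Q (k + 1) + (1 - \<delta>) * Q k --> omega_star_approx \<xi> \<omega> (exp t)"
   and u: "Q k <= (\<sigma> + eta) * Q (k + 1)"
  let ?c = "\<omega> * (1 + eta) - (1 - \<delta>)"
  have "?c * Q k <= max 0 ?c * Q k" using Q_pos[of k] by (intro mult_right_mono) auto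
  also have "... <= max 0 ?c * ((\<sigma> + eta) * Q (k + 1))" using u by (intro mult_left_mono) auto
  also have "... = (max 0 ?c * (\<sigma> + eta)) * Q (k + 1)" by simp
  also have "... <= (2 - \<delta> - 5 * eta) * Q (k + 1)" using eta(2) Q_pos[of "k + 1"] by (intro mult_right_mono) auto
  finally show "omega_star_approx \<xi> \<omega> (exp ((1 + eta) * Q k))"
   using *[rule_format, of "(1 + eta) * Q k" \<omega>] by (simp add: algebra_simps)
 qed
 moreover have "filterlim (\<lambda>k. exp ((1 + eta) * Q k)) at_top sequentially"
  using eta by (intro filterlim_compose[OF exp_at_top]
    filterlim_tendsto_pos_mult_at_top[OF tendsto_const _ Q_at_top]) auto
 ultimately show ?thesis
  unfolding frequently_def filterlim_iff by blast
qed

text \<open>From almost the height of \<open>p k\<close> to almost that of \<open>p (k + 1)\<close>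
  the form \<open>p k\<close> is best, and it looks best relative to \<open>t\<close> at the left
  end of this range.\<close>

lemma omega_upper:
 assumes "0 < \<sigma>" "(\<omega> - (1 - \<delta>)) * \<sigma> > 2 - \<delta>"
 shows "~ (\<exists>\<^sub>F X in at_top. omega_approx \<xi> \<omega> X)"
proof -
 let ?f = "\<lambda>eta. (\<omega> * (1 - eta) - (1 - \<delta>)) * (\<sigma> - eta) - (2 - \<delta> + eta)"
 have "isCont ?f 0" by (intro continuous_intros)
 moreover have "?f 0 > 0" using assms by auto
 ultimately obtain eta where eta: "0 < eta" "eta < min 1 \<sigma>" "?f eta > 0" using exists_small[of ?f 0 "min 1 \<sigma>"] assms by auto
 have w: "\<omega> > 0"
 proof -
  have "0 < (\<omega> - (1 - \<delta>)) * \<sigma>" using assms(2) delta_less_half by linarith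
  then have "\<omega> - (1 - \<delta>) > 0" using assms(1) zero_less_mult_pos2 by blast
  then show ?thesis using delta_less_half by linarith
 qed
 obtain K where K: "!!k. k >= K ==>
   (\<forall>x. x ~= 0 & hgt x <= exp ((1 - eta) * Q (k + 1)) --> lin \<xi> (p k) <= lin \<xi> x) &
   (exp (- ((2 - \<delta> + eta) * Q (k + 1) + (1 - \<delta>) * Q k)) <= lin \<xi> (p k)) & Q k >= (\<sigma> - eta) * Q (k + 1)"
  using eventually_conj[OF best_form[OF eta(1)] eventually_conj[OF p_lin[OF eta(1)] eventually_Q_sigma[OF eta(1)]]]
  by (auto simp: eventually_sequentially)
 have "\<forall>\<^sub>F t in at_top. ~ omega_approx \<xi> \<omega> (exp t)"
  using locate[of "1 - eta" K]
 proof (rule eventually_mono)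
  show "0 < 1 - eta" using eta by simp
  fix t assume "\<exists>k\<ge>K. (1 - eta) * Q k <= t & t < (1 - eta) * Q (k + 1)"
  then obtain k where k: "k >= K" "(1 - eta) * Q k <= t" "t < (1 - eta) * Q (k + 1)" by blast
  note K = K[OF k(1)]
  show "~ omega_approx \<xi> \<omega> (exp t)"
  proof
   assume "omega_approx \<xi> \<omega> (exp t)"
   then obtain x where x: "x ~= 0" "lin \<xi> x <= exp (- \<omega> * t)" "hgt x <= exp t"
    unfolding omega_approx_def exp_powr by blast
   have "hgt x <= exp ((1 - eta) * Q (k + 1))" using x(3) k(3) by (smt (verit) exp_le_cancel_iff)
   then have "lin \<xi> (p k) <= lin \<xi> x" using K x(1) by blast
   then have "exp (- ((2 - \<delta> + eta) * Q (k + 1) + (1 - \<delta>) * Q k)) <= exp (- \<omega> * t)"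
    using K x(2) by linarith
   then have "\<omega> * t <= (2 - \<delta> + eta) * Q (k + 1) + (1 - \<delta>) * Q k" by simp
   moreover have "\<omega> * ((1 - eta) * Q k) <= \<omega> * t" using k w by (intro mult_left_mono) auto
   ultimately have "(\<omega> * (1 - eta) - (1 - \<delta>)) * Q k <= (2 - \<delta> + eta) * Q (k + 1)" by (simp add: algebra_simps)
   moreover have "(\<omega> * (1 - eta) - (1 - \<delta>)) * ((\<sigma> - eta) * Q (k + 1)) <= (\<omega> * (1 - eta) - (1 - \<delta>)) * Q k"
   proof (intro mult_left_mono)
    have "0 < (\<omega> * (1 - eta) - (1 - \<delta>)) * (\<sigma> - eta)" using eta delta_less_half by linarith
    then show "0 <= \<omega> * (1 - eta) - (1 - \<delta>)" using eta zero_less_mult_pos2 by fastforce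
   qed (use K in auto)
   ultimately have "((\<omega> * (1 - eta) - (1 - \<delta>)) * (\<sigma> - eta)) * Q (k + 1) <= (2 - \<delta> + eta) * Q (k + 1)" by simp
   then show False using eta(3) Q_pos[of "k + 1"] by simp
  qed
 qed
 then have "~ (\<exists>\<^sub>F t in at_top. omega_approx \<xi> \<omega> (exp t))" by (simp add: frequently_def)
 then show ?thesis by (subst frequently_at_top_exp)
qed

theorem omega2_hat_eq: "omega2_hat \<xi> = ereal \<omega>0"
 and omega2_star_hat_eq: "omega2_star_hat \<xi> = ereal \<omega>0"
proof -
 have star_imp: "\<forall>\<^sub>F X in at_top. omega_approx \<xi> \<omega>' X"
  if "\<forall>\<^sub>F X in at_top. omega_star_approx \<xi> \<omega> X" "0 < \<omega>" "\<omega>' < \<omega>" for \<omega> \<omega>'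
  using that(1) omega_approx_of_star[OF that(2,3)] by eventually_elim auto
 show "omega2_hat \<xi> = ereal \<omega>0" unfolding omega2_hat_def
 proof (rule Sup_ereal_eqI)
  fix l assume "0 < l" "l < \<omega>0"
  then obtain l' where "l < l'" "l' < \<omega>0" using dense by blast
  then show "l \<in> {\<omega>. \<forall>\<^sub>F X in at_top. omega_approx \<xi> \<omega> X}"
   using star_imp[OF star_hat_lower, of l' l] \<open>0 < l\<close> by simp
 qed (use omega0_pos omega_hat_upper in auto)
 show "omega2_star_hat \<xi> = ereal \<omega>0" unfolding omega2_star_hat_def
 proof (rule Sup_ereal_eqI)
  fix l assume l: "\<omega>0 < l"
  then obtain l' where l': "l' < l" "\<omega>0 < l'" using dense by blast
  then show "l \<notin> {\<omega>. \<forall>\<^sub>F X in at_top. omega_star_approx \<xi> \<omega> X}"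
   using star_imp[of l l'] omega_hat_upper[of l'] l omega0_pos by auto
 qed (use omega0_pos star_hat_lower in auto)
qed

theorem omega2_eq: "omega2 \<xi> = (if \<sigma> = 0 then \<infinity> else ereal ((2 - \<delta>) / \<sigma> + 1 - \<delta>))"
 and omega2_star_eq: "omega2_star \<xi> = (if \<sigma> = 0 then \<infinity> else ereal ((2 - \<delta>) / \<sigma> + 1 - \<delta>))"
proof -
 have star_imp: "\<exists>\<^sub>F X in at_top. omega_approx \<xi> \<omega>' X"
  if "\<exists>\<^sub>F X in at_top. omega_star_approx \<xi> \<omega> X" "0 < \<omega>" "\<omega>' < \<omega>" for \<omega> \<omega>'
  using frequently_eventually_conj[OF that(1) omega_approx_of_star[OF that(2,3)]]
  by (rule frequently_elim1) auto
 have "omega2 \<xi> = (if \<sigma> = 0 then \<infinity> else ereal ((2 - \<delta>) / \<sigma> + 1 - \<delta>)) &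
   omega2_star \<xi> = (if \<sigma> = 0 then \<infinity> else ereal ((2 - \<delta>) / \<sigma> + 1 - \<delta>))"
 proof (cases "\<sigma> = 0")
  case True
  have st: "\<exists>\<^sub>F X in at_top. omega_star_approx \<xi> \<omega> X" if "0 < \<omega>" for \<omega>
   using star_lower[OF that] True delta_less_half by simp
  have om: "\<exists>\<^sub>F X in at_top. omega_approx \<xi> \<omega> X" if "0 < \<omega>" for \<omega>
   by (rule star_imp[OF st, of "\<omega> + 1"]) (use that in auto)
  have "omega2 \<xi> = \<infinity>" unfolding omega2_def by (rule Sup_ereal_infinity) (use om in simp)
  moreover have "omega2_star \<xi> = \<infinity>" unfolding omega2_star_def by (rule Sup_ereal_infinity) (use st in simp)
  ultimately show ?thesis using True by simp
 next
  case False
  then have s0: "\<sigma> > 0" using sigma_nonneg by simp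
  define v where "v = (2 - \<delta>) / \<sigma> + 1 - \<delta>"
  have lt: "(\<omega> - (1 - \<delta>)) * \<sigma> < 2 - \<delta> \<longleftrightarrow> \<omega> < v" "(\<omega> - (1 - \<delta>)) * \<sigma> > 2 - \<delta> \<longleftrightarrow> v < \<omega>" for \<omega>
   using s0 by (auto simp: v_def field_simps)
  have "(2 - \<delta>) / \<sigma> > 0" using s0 delta_less_half by simp
  then have v0: "v > 0" using delta_less_half by (simp add: v_def)
  have "omega2 \<xi> = ereal v" unfolding omega2_def
  proof (rule Sup_ereal_eqI)
   fix l assume "0 < l" "l < v"
   then obtain l' where "l < l'" "l' < v" using dense by blast
   then show "l \<in> {\<omega>. \<exists>\<^sub>F X in at_top. omega_approx \<xi> \<omega> X}"
    using star_imp[OF star_lower, of l' l] \<open>0 < l\<close> by (simp add: lt)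
  qed (use v0 omega_upper[OF s0] in \<open>auto simp: lt\<close>)
  moreover have "omega2_star \<xi> = ereal v" unfolding omega2_star_def
  proof (rule Sup_ereal_eqI)
   fix l assume l: "v < l"
   then obtain l' where l': "l' < l" "v < l'" using dense by blast
   then show "l \<notin> {\<omega>. \<exists>\<^sub>F X in at_top. omega_star_approx \<xi> \<omega> X}"
    using star_imp[of l l'] omega_upper[OF s0, of l'] l v0 by (auto simp: lt)
  qed (use v0 star_lower in \<open>auto simp: lt\<close>)
  ultimately show ?thesis using False by (simp add: v_def)
 qed
 then show "omega2 \<xi> = (if \<sigma> = 0 then \<infinity> else ereal ((2 - \<delta>) / \<sigma> + 1 - \<delta>))"
  and "omega2_star \<xi> = (if \<sigma> = 0 then \<infinity> else ereal ((2 - \<delta>) / \<sigma> + 1 - \<delta>))" by auto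
qed

end

section \<open>The uniform exponent of simultaneous approximation\<close>

lemma locate_between:
 fixes g :: "nat \<Rightarrow> real"
 assumes "filterlim g at_top sequentially"
 shows "\<forall>\<^sub>F t in at_top. \<exists>k\<ge>K. g k <= t & t < g (k + 1)"
 using eventually_ge_at_top[of "g K"]
proof eventually_elim
 case (elim t)
 have "EV j. t < g j & K < j"
  using assms eventually_gt_at_top[of K] unfolding filterlim_at_top_dense by (auto intro: eventually_conj)
 then obtain j where j: "t < g j & K < j" by (auto dest: eventually_happens)
 \<comment> \<open>The sequence \<open>g\<close> need not be monotone, so \<open>i\<close> is the
   first index beyond \<open>K\<close> at which it exceeds \<open>t\<close>. Its predecessor is
   either smaller than \<open>i\<close> but beyond \<open>K\<close>, or equal to \<open>K\<close>,
   where \<open>g K <= t\<close> is assumed.\<close>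
 define i where "i = (LEAST i. t < g i & K < i)"
 have i: "t < g i & K < i" unfolding i_def by (rule LeastI[of "\<lambda>i. t < g i & K < i", OF j])
 have "~ (t < g (i - 1) & K < i - 1)" unfolding i_def
  by (rule not_less_Least) (use i in \<open>simp add: i_def\<close>)
 moreover have "i - 1 >= K" "i - 1 + 1 = i" using i by auto
 moreover have "g (i - 1) <= t" if "i - 1 = K" using that elim by simp
 ultimately have "g (i - 1) <= t" by fastforce
 then show ?case using i \<open>i - 1 >= K\<close> \<open>i - 1 + 1 = i\<close> by (intro exI[of _ "i - 1"]) auto
qed

text \<open>Box principle for the points of the cube \<open>{0..N}^3\<close>: boxes are indexed by
  the value of \<open>dotZ p\<close>, which takes at most \<open>6 * h * N + 1\<close> values, and
  by the interval of length \<open>Y\<close> containing \<open>x$2 - x$1 * \<xi>\<close>. Two points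
  in one box differ by a point orthogonal to \<open>p\<close>.\<close>

lemma pigeonhole_orthogonal:
 fixes p :: "int^3" and \<xi> :: real and h N :: int
 assumes p: "!!i. \<bar>p $ i\<bar> <= h" and h: "h >= 1" and N: "N >= 1" and hN: "42 * h <= N\<^sup>2"
 obtains x where "x ~= 0" "dotZ p x = 0" "hgt x <= real_of_int N"
  "\<bar>real_of_int (x$2) - real_of_int (x$1) * \<xi>\<bar> <= 28 * (1 + \<bar>\<xi>\<bar>) * real_of_int h / real_of_int N"
proof -
 define V :: "int \<times> int \<times> int \<Rightarrow> int^3" where "V = (\<lambda>(a, b, c). vector [a, b, c])"
 have V: "V t $ 1 = fst t" "V t $ 2 = fst (snd t)" "V t $ 3 = snd (snd t)" for t
  by (auto simp: V_def split: prod.splits)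
 define Y where "Y = 28 * (1 + \<bar>\<xi>\<bar>) * real_of_int h / real_of_int N"
 define A where "A = {0..N} \<times> {0..N} \<times> {0..N}"
 define \<phi> where "\<phi> x = real_of_int (x$2) - real_of_int (x$1) * \<xi>" for x :: "int^3"
 define f where "f t = (dotZ p (V t), \<lfloor>\<phi> (V t) / Y\<rfloor>)" for t
 define M where "M = \<lfloor>(1 + \<bar>\<xi>\<bar>) * real_of_int N / Y\<rfloor> + 1"
 have hr: "real_of_int h >= 1" "real_of_int N >= 1" using h N by auto
 have Y: "Y > 0" using hr by (simp add: Y_def add_pos_nonneg)
 have sub: "f ` A \<subseteq> {- (3 * h * N)..3 * h * N} \<times> {- M..M}"
 proof (rule image_subsetI)
  fix t0 assume "t0 \<in> A"
  then obtain a b c where t: "(a, b, c) \<in> A" and t0: "t0 = (a, b, c)" by (cases t0) auto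
  let ?t = "(a, b, c)"
  have abc: "\<bar>a\<bar> <= N" "\<bar>b\<bar> <= N" "\<bar>c\<bar> <= N" using t by (auto simp: A_def)
  have m: "\<bar>p$i * y\<bar> <= h * N" if "\<bar>y\<bar> <= N" for i y
   unfolding abs_mult using p[of i] that h by (intro mult_mono) auto
  have "\<bar>dotZ p (V ?t)\<bar> <= 3 * h * N"
   using m[OF abc(1), of 1] m[OF abc(2), of 2] m[OF abc(3), of 3] by (simp add: dotZ_def V)
  moreover have "\<bar>\<phi> (V ?t)\<bar> <= (1 + \<bar>\<xi>\<bar>) * real_of_int N"
  proof -
   have "\<bar>real_of_int a * \<xi>\<bar> <= real_of_int N * \<bar>\<xi>\<bar>"
    using abc by (intro abs_mult_le) linarith+
   moreover have "\<bar>real_of_int b\<bar> <= real_of_int N" using abc by linarith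
   ultimately show ?thesis by (simp add: \<phi>_def V algebra_simps; linarith)
  qed
  then have "\<bar>\<phi> (V ?t) / Y\<bar> <= (1 + \<bar>\<xi>\<bar>) * real_of_int N / Y"
   using Y by (simp add: divide_right_mono)
  then have "- M <= \<lfloor>\<phi> (V ?t) / Y\<rfloor> & \<lfloor>\<phi> (V ?t) / Y\<rfloor> <= M" unfolding M_def by linarith
  ultimately show "f t0 \<in> {- (3 * h * N)..3 * h * N} \<times> {- M..M}" by (auto simp: f_def t0)
 qed
 have M0: "M >= 0" using Y hr unfolding M_def by (smt (verit) divide_nonneg_pos mult_nonneg_nonneg zero_le_floor)
 have hN0: "0 <= h * N" using h N by simp
 have "card (f ` A) <= card ({- (3 * h * N)..3 * h * N} \<times> {- M..M})"
  using sub by (intro card_mono) auto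
 also have "... = nat (6 * h * N + 1) * nat (2 * M + 1)" by (simp add: card_cartesian_product algebra_simps)
 finally have "int (card (f ` A)) <= int (nat (6 * h * N + 1) * nat (2 * M + 1))"
  by (simp only: of_nat_le_iff)
 also have "... = (6 * h * N + 1) * (2 * M + 1)" using M0 hN0 by (simp add: mult.assoc)
 \<comment> \<open>The constants 28 and 42 are fixed by this count: twice the number of boxes is at
   most \<open>28 * h * M * N + 14 * h * N\<close>, hence at most \<open>N^3 + 42 * h * N\<close>,
   hence at most \<open>2 * N^3\<close>.\<close>
 also have "... < (N + 1) ^ 3"
 proof -
  have "(1 + \<bar>\<xi>\<bar>) * real_of_int N / Y = real_of_int N * real_of_int N / (28 * real_of_int h)"
  proof -
   define e where "e = 1 + \<bar>\<xi>\<bar>"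
   have "e > 0" by (simp add: e_def add_pos_nonneg)
   then show ?thesis unfolding Y_def e_def[symmetric] using hr by (simp add: field_simps)
  qed
  then have "real_of_int M <= real_of_int N * real_of_int N / (28 * real_of_int h) + 1"
   unfolding M_def by linarith
  then have "real_of_int (28 * h * M) <= real_of_int (N * N + 28 * h)" using hr by (simp add: field_simps)
  then have M28: "28 * h * M <= N * N + 28 * h" by linarith
  have hN1: "1 <= h * N" using h N mult_mono[of 1 h 1 N] by simp
  have "(6 * h * N + 1) * (2 * M + 1) <= (7 * h * N) * (2 * M + 1)"
   using hN1 M0 by (intro mult_right_mono) (simp_all add: mult_ac)
  then have "2 * ((6 * h * N + 1) * (2 * M + 1)) <= (28 * h * M) * N + 14 * h * N" by (simp add: algebra_simps)
  also have "... <= (N * N + 28 * h) * N + 14 * h * N" using M28 N by (intro add_right_mono mult_right_mono) auto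
  also have "... = N * N * N + (42 * h) * N" by (simp add: algebra_simps)
  also have "... <= N * N * N + N\<^sup>2 * N" using hN N by (intro add_left_mono mult_right_mono) auto
  also have "... = 2 * N ^ 3" by (simp add: power2_eq_square power3_eq_cube)
  also have "... < 2 * (N + 1) ^ 3" using N by (simp add: power_strict_mono)
  finally show ?thesis by simp
 qed
 also have "... = int (card A)" using N by (simp add: A_def card_cartesian_product power3_eq_cube)
 finally have "~ inj_on f A" by (intro pigeonhole) simp
 then obtain t t' where tt: "t \<in> A" "t' \<in> A" "t ~= t'" "f t = f t'" unfolding inj_on_def by blast
 define x where "x = V t - V t'"
 have "x ~= 0"
 proof
  assume "x = 0"
  then have "V t = V t'" by (simp add: x_def)
  then have "V t $ 1 = V t' $ 1" "V t $ 2 = V t' $ 2" "V t $ 3 = V t' $ 3" by auto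
  then show False using tt(3) unfolding V by (auto simp: prod_eq_iff)
 qed
 moreover have "dotZ p x = 0" using tt(4) by (simp add: f_def x_def dotZ_def algebra_simps)
 moreover have "\<bar>x $ i\<bar> <= N" for i
  using tt(1,2) exhaust_3[of i] by (auto simp: x_def V A_def)
 then have "hgt x <= real_of_int N" unfolding hgt_le_iff by (simp add: of_int_le_iff[of _ N, where 'a=real, symmetric] del: of_int_le_iff)
 moreover have "\<bar>\<phi> x\<bar> <= Y"
 proof -
  have "\<phi> x = \<phi> (V t) - \<phi> (V t')" by (simp add: \<phi>_def x_def algebra_simps)
  moreover have "\<lfloor>\<phi> (V t) / Y\<rfloor> = \<lfloor>\<phi> (V t') / Y\<rfloor>" using tt(4) by (simp add: f_def)
  then have "\<bar>\<phi> (V t) / Y - \<phi> (V t') / Y\<bar> <= 1" by linarith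
  then have "\<bar>\<phi> (V t) - \<phi> (V t')\<bar> / Y <= 1" using Y by (simp add: diff_divide_distrib[symmetric])
  ultimately show ?thesis using Y by (simp add: field_simps)
 qed
 ultimately show thesis using that unfolding \<phi>_def Y_def by blast
qed

text \<open>Orthogonality to \<open>p\<close> determines \<open>x$3 - x$1 * \<xi>^2\<close> from
  \<open>x$2 - x$1 * \<xi>\<close> and the value of the form at \<open>\<xi>\<close>, at the price
  of dividing by the leading coefficient. This is why lower bounds for \<open>p k $ 3\<close> belong
  to the approximation data.\<close>

lemma err_of_orthogonal:
 assumes "dotZ p x = 0" "\<bar>real_of_int (x$2) - real_of_int (x$1) * \<xi>\<bar> <= Y" "p $ 3 ~= 0" "Y >= 0"
 shows "err \<xi> x <= (1 + \<bar>\<xi>\<bar>)\<^sup>2 * (Y + (hgt p * Y + hgt x * lin \<xi> p) / \<bar>real_of_int (p$3)\<bar>)"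
proof -
 let ?p = "\<lambda>i. real_of_int (p$i)" and ?x = "\<lambda>i. real_of_int (x$i)"
 define a where "a = ?x 2 - ?x 1 * \<xi>"
 define b where "b = ?x 3 - ?x 1 * \<xi>\<^sup>2"
 define Z where "Z = (hgt p * Y + hgt x * lin \<xi> p) / \<bar>?p 3\<bar>"
 have p3: "\<bar>?p 3\<bar> > 0" using assms(3) by simp
 have a: "\<bar>a\<bar> <= Y" using assms(2) by (simp add: a_def)
 have Z0: "Z >= 0" using assms(4) by (simp add: Z_def)
 have "real_of_int (dotZ p x) = 0" using assms(1) by simp
 then have "?p 3 * b = - (?p 2 * a) - ?x 1 * (?p 1 + ?p 2 * \<xi> + ?p 3 * \<xi>\<^sup>2)"
  by (simp add: dotZ_def a_def b_def algebra_simps)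
 moreover have "\<bar>?p 2 * a\<bar> <= hgt p * Y" using hgt_nth a by (intro abs_mult_le) auto
 moreover have "\<bar>?x 1 * (?p 1 + ?p 2 * \<xi> + ?p 3 * \<xi>\<^sup>2)\<bar> <= hgt x * lin \<xi> p"
  using hgt_nth by (intro abs_mult_le) (auto simp: lin_eq)
 ultimately have "\<bar>?p 3 * b\<bar> <= hgt p * Y + hgt x * lin \<xi> p" by linarith
 then have b: "\<bar>b\<bar> <= Z" using p3 by (simp add: Z_def abs_mult field_simps)
 have sq: "(1 + \<bar>\<xi>\<bar>)\<^sup>2 * (Y + Z) = Y + Z + (2 * \<bar>\<xi>\<bar>) * (Y + Z) + \<bar>\<xi>\<bar>\<^sup>2 * (Y + Z)"
  by (simp add: power2_eq_square algebra_simps)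
 have n: "0 <= \<bar>\<xi>\<bar> * Y" "0 <= \<bar>\<xi>\<bar> * Z" "0 <= \<bar>\<xi>\<bar>\<^sup>2 * Y" "0 <= \<bar>\<xi>\<bar>\<^sup>2 * Z" using assms(4) Z0 by auto
 have c: "?x 2 * \<xi>\<^sup>2 - ?x 3 * \<xi> = \<xi>\<^sup>2 * a - \<xi> * b"
  by (simp add: a_def b_def algebra_simps power2_eq_square)
 have "\<bar>\<xi>\<^sup>2 * a\<bar> <= \<bar>\<xi>\<bar>\<^sup>2 * Y" "\<bar>\<xi> * b\<bar> <= \<bar>\<xi>\<bar> * Z" using a b by (auto intro!: abs_mult_le)
 then have 1: "\<bar>?x 2 * \<xi>\<^sup>2 - ?x 3 * \<xi>\<bar> <= \<bar>\<xi>\<bar>\<^sup>2 * Y + \<bar>\<xi>\<bar> * Z" unfolding c by linarith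
 have "err \<xi> x <= (1 + \<bar>\<xi>\<bar>)\<^sup>2 * (Y + Z)"
  unfolding err_le_iff sq using 1 a b n Z0 assms(4)
  by (intro conjI) (simp_all only: a_def b_def algebra_simps abs_minus_commute; linarith)+
 then show ?thesis by (simp add: Z_def)
qed

context sturm_points
begin

lemma eventually_Suc: "(EV k. P k) ==> EV k. P (k + 1)"
 using eventually_sequentially_Suc[of P] by simp

lemma eventually_locate:
 fixes g :: "nat \<Rightarrow> real"
 assumes "filterlim g at_top sequentially" "EV k. P k"
 shows "\<forall>\<^sub>F t in at_top. \<exists>k. P k & g k <= t & t < g (k + 1)"
proof -
 obtain K where "!!k. k >= K ==> P k" using assms(2) by (auto simp: eventually_sequentially)
 then show ?thesis using locate_between[OF assms(1), of K] by (auto elim!: eventually_mono)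
qed

lemma z1_bounds:
 assumes "eta > 0"
 shows "EV k. exp ((1 - eta) * (Q (k + 1) + Q k)) <= hgt (z (k + 1) 1) &
   hgt (z (k + 1) 1) <= exp ((1 + eta) * (Q (k + 1) + Q k)) &
   exp (- ((1 - \<delta> + eta) * (Q (k + 1) + Q k))) <= err \<xi> (z (k + 1) 1) &
   err \<xi> (z (k + 1) 1) <= exp (- ((1 - \<delta> - eta) * (Q (k + 1) + Q k))) & primitive (z (k + 1) 1)"
 using eventually_Suc[OF z_hgt[OF assms]] eventually_Suc[OF z_err[OF assms]] eventually_Suc[OF primitive_z]
proof eventually_elim
 case (elim k)
 have "(1::nat) \<in> {1..s (k + 1 + 1) + 1}" by auto
 from elim(1)[rule_format, OF this] elim(2)[rule_format, OF this] elim(3)[rule_format, OF this]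
 show ?case by simp
qed

text \<open>The point \<open>z (k + 1) 1\<close> lies in both planes orthogonal to
  \<open>p k\<close> and \<open>p (k + 1)\<close>, so it spans their intersection.\<close>

lemma orthogonal_both:
 "EV k. \<forall>x. dotZ (p k) x = 0 & dotZ (p (k + 1)) x = 0 --> crossZ x (z (k + 1) 1) = 0"
 using p_indep z_orth eventually_Suc[OF z_orth]
proof eventually_elim
 case (elim k)
 have "dotZ (p (k + 1)) (z (k + 1) 1) = 0" using elim(3) by auto
 then show ?case using elim crossZ_orthogonal_pair by blast
qed

text \<open>The lattice orthogonal to \<open>p k\<close> has covolume about
  \<open>exp (Q k)\<close>, so one expects in it a point of height at most \<open>exp t\<close> with
  error about \<open>exp (Q k - t)\<close>. The lower end for \<open>t\<close> gives the box
  principle enough room; up to the upper end, about the height of \<open>z (k + 1) 1\<close>, the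
  term coming from \<open>lin \<xi> (p k)\<close> is harmless. The constant \<open>C\<close> is
  chosen before \<open>eta\<close>, so that it can later be absorbed by a power depending on
  \<open>eta\<close>.\<close>

lemma short_vectors_in_plane:
 "\<exists>C>0. \<forall>eta>0. eta < 1 / 2 --> (EV k. \<forall>t. (1 + 4 * eta) * Q k <= t &
  t <= (1 + eta) * (Q (k + 1) + Q k) --> (\<exists>x. x ~= 0 & hgt x <= exp t & err \<xi> x <= C * exp (Q k - t + 8 * eta * t)))"
proof -
 define c where "c = 56 * (1 + \<bar>\<xi>\<bar>)"
 define C where "C = (1 + \<bar>\<xi>\<bar>)\<^sup>2 * (2 * c + 1)"
 have c: "c > 0" by (simp add: c_def add_pos_nonneg)
 have "C > 0" using c by (simp add: C_def add_pos_nonneg)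
 moreover have "EV k. \<forall>t. (1 + 4 * eta) * Q k <= t &
  t <= (1 + eta) * (Q (k + 1) + Q k) --> (\<exists>x. x ~= 0 & hgt x <= exp t & err \<xi> x <= C * exp (Q k - t + 8 * eta * t))"
  if eta: "eta > 0" "eta < 1 / 2" for eta
  using p_hgt[OF eta(1)] p_lin[OF eta(1)] p_lead[OF eta(1)] eventually_delta[OF eta(1)] const_le_exp[OF eta(1), of 500]
 proof eventually_elim
  case (elim k)
  let ?U = "Q (k + 1)" and ?u = "Q k" and ?p = "p k"
  have pos: "0 < ?u" "?u <= ?U" using Q_pos Q_mono by auto
  show ?case
  proof (intro allI impI, elim conjE)
   fix t assume t: "(1 + 4 * eta) * ?u <= t" "t <= (1 + eta) * (?U + ?u)"
   define N where "N = \<lfloor>exp t\<rfloor>"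
   define h where "h = \<lfloor>hgt ?p\<rfloor>"
   have eu: "0 <= eta * ?u" using eta pos by simp
   have tu: "?u <= t" using t(1) eu by (simp add: algebra_simps)
   then have et: "eta * ?u <= eta * t" using eta by (intro mult_left_mono) auto
   have "eta * ?u <= 1 * ?u" using eta pos by (intro mult_right_mono) auto
   then have "exp (eta * ?u) <= exp t" using tu by simp
   then have expt: "500 <= exp t" using elim(5) by linarith
   have N: "N >= 1" "real_of_int N <= exp t" "exp t / 2 <= real_of_int N"
    using expt unfolding N_def by linarith+
   have pn: "\<bar>?p $ i\<bar> <= h" for i
    using hgt_nth[of ?p i] by (simp add: h_def le_floor_iff)
   have h1: "1 <= h"
   proof -
    have "1 <= exp ((1 - eta) * ?u)" using eta pos by simp
    then have "1 <= hgt ?p" using elim(1) by linarith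
    then show ?thesis by (simp add: h_def le_floor_iff)
   qed
   have hh: "real_of_int h <= hgt ?p" by (simp add: h_def)
   have "42 * h <= N\<^sup>2"
   proof -
    have "168 * real_of_int h <= exp (eta * ?u) * exp ((1 + eta) * ?u)"
     using hh elim h1 by (intro mult_mono) auto
    also have "... = exp (eta * ?u + (1 + eta) * ?u)" by (simp only: exp_add)
    also have "... <= exp (t + t)" using t(1) tu eu pos unfolding exp_le_cancel_iff by (simp only: algebra_simps; linarith)
    also have "... = exp t * exp t" by (simp only: exp_add)
    finally have "42 * real_of_int h <= (exp t / 2) * (exp t / 2)" by simp
    also have "... <= real_of_int N * real_of_int N" using N by (intro mult_mono) auto
    finally have "real_of_int (42 * h) <= real_of_int (N\<^sup>2)" by (simp add: power2_eq_square)
    then show ?thesis by linarith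
   qed
   from pigeonhole_orthogonal[where \<xi> = \<xi>, OF pn h1 N(1) this] obtain x where x: "x ~= 0" "dotZ ?p x = 0" "hgt x <= real_of_int N"
    "\<bar>real_of_int (x$2) - real_of_int (x$1) * \<xi>\<bar> <= 28 * (1 + \<bar>\<xi>\<bar>) * real_of_int h / real_of_int N" by metis
   define Y where "Y = c * exp ((1 + eta) * ?u - t)"
   have Y: "28 * (1 + \<bar>\<xi>\<bar>) * real_of_int h / real_of_int N <= Y"
   proof -
    have "28 * (1 + \<bar>\<xi>\<bar>) * real_of_int h / real_of_int N
      <= 28 * (1 + \<bar>\<xi>\<bar>) * exp ((1 + eta) * ?u) / (exp t / 2)"
     using N hh elim(1) h1 by (intro frac_le mult_left_mono mult_nonneg_nonneg) auto
    also have "... = Y" by (simp add: Y_def c_def exp_diff field_simps)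
    finally show ?thesis .
   qed
   have Y0: "Y >= 0" using c by (simp add: Y_def)
   have p3: "?p $ 3 ~= 0" using elim(3) by (smt (verit) exp_gt_zero of_int_0)
   define E where "E = exp (?u - t + 8 * eta * t)"
   have YE: "Y <= c * E"
   proof -
    have "exp ((1 + eta) * ?u - t) <= E" unfolding E_def exp_le_cancel_iff
     using et eu by (simp only: algebra_simps; linarith)
    then show ?thesis using c by (simp add: Y_def)
   qed
   have "err \<xi> x <= (1 + \<bar>\<xi>\<bar>)\<^sup>2 * (Y + (hgt ?p * Y + hgt x * lin \<xi> ?p) / \<bar>real_of_int (?p$3)\<bar>)"
    by (rule err_of_orthogonal) (use x Y p3 Y0 in auto)
   also have "... <= (1 + \<bar>\<xi>\<bar>)\<^sup>2 * (c * E + (c * E + E))"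
   proof (intro mult_left_mono add_mono YE)
    have "hgt ?p * Y / \<bar>real_of_int (?p$3)\<bar> <= exp ((1 + eta) * ?u) * Y / exp ((1 - eta) * ?u)"
     using elim Y0 by (intro frac_le mult_right_mono) auto
    also have "... = c * (exp ((1 + eta) * ?u) * exp ((1 + eta) * ?u - t) / exp ((1 - eta) * ?u))"
     by (simp only: Y_def mult_ac times_divide_eq_left times_divide_eq_right)
    also have "... = c * exp ((1 + eta) * ?u + ((1 + eta) * ?u - t) - (1 - eta) * ?u)"
     by (simp only: exp_add exp_diff)
    also have "... <= c * E" unfolding E_def
     using c by (intro mult_left_mono) (use et eu in \<open>simp_all only: exp_le_cancel_iff algebra_simps; linarith\<close>)+
    finally have 1: "hgt ?p * Y / \<bar>real_of_int (?p$3)\<bar> <= c * E" .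
    have "hgt x * lin \<xi> ?p / \<bar>real_of_int (?p$3)\<bar>
      <= exp t * exp (- ((2 - \<delta> - eta) * ?U + (1 - \<delta>) * ?u)) / exp ((1 - eta) * ?u)"
     using elim x(3) N by (intro frac_le mult_mono) auto
    also have "... = exp (t + - ((2 - \<delta> - eta) * ?U + (1 - \<delta>) * ?u) - (1 - eta) * ?u)"
     by (simp only: exp_add exp_diff)
    also have "... <= E" unfolding E_def exp_le_cancel_iff
    proof -
     define T where "T = ?U + ?u"
     have dl: "\<delta> * T <= ?u + eta * ?U" using elim(4) by (simp add: T_def)
     have e1: "eta * t <= eta * ((1 + eta) * T)" using t(2) eta by (intro mult_left_mono) (auto simp: T_def)
     have Tpos: "T > 0" using pos by (simp add: T_def)
     then have T0: "T > 0" "0 <= eta * T" "0 <= eta * (eta * T)" "eta * (eta * T) <= (1/2) * (eta * T)"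
      using eta by (auto intro!: mult_right_mono)
     \<comment> \<open>The sign of \<open>2 - 8 * eta\<close> decides whether the upper bound for
       \<open>t\<close> can be inserted.\<close>
     have key: "2 * t - 8 * eta * t <= 2 * T - 2 * eta * T"
     proof (cases "eta <= 1 / 4")
      case True
      then have "(2 - 8 * eta) * t <= (2 - 8 * eta) * ((1 + eta) * T)" using t(2) by (intro mult_left_mono) (auto simp: T_def)
      then show ?thesis using T0 by (simp only: algebra_simps; linarith)
     next
      case False
      then have "(8 * eta - 2) * t >= 0" using tu pos by (intro mult_nonneg_nonneg) auto
      moreover have "eta * T <= (1/2) * T" using eta T0(1) by (intro mult_right_mono) auto
      ultimately show ?thesis using T0 by (simp only: algebra_simps; linarith)
     qed
     have "eta * ?U + eta * ?u = eta * T" by (simp add: T_def algebra_simps)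
     then have "t + - ((2 - \<delta> - eta) * ?U + (1 - \<delta>) * ?u) - (1 - eta) * ?u = t - 2 * T + \<delta> * T + eta * T"
      by (simp add: T_def algebra_simps)
     also have "... <= t - 2 * T + ?u + eta * ?U + eta * T" using dl by simp
     also have "... <= ?u - t + 8 * eta * t" using key eu \<open>eta * ?U + eta * ?u = eta * T\<close> by linarith
     finally show "t + - ((2 - \<delta> - eta) * ?U + (1 - \<delta>) * ?u) - (1 - eta) * ?u <= ?u - t + 8 * eta * t" .
    qed
    finally have 2: "hgt x * lin \<xi> ?p / \<bar>real_of_int (?p$3)\<bar> <= E" .
    show "(hgt ?p * Y + hgt x * lin \<xi> ?p) / \<bar>real_of_int (?p$3)\<bar> <= c * E + E"
     using 1 2 by (simp add: add_divide_distrib)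
   qed auto
   also have "... = C * E" by (simp add: C_def algebra_simps)
   finally have "err \<xi> x <= C * E" .
   then show "\<exists>x. x ~= 0 & hgt x <= exp t & err \<xi> x <= C * exp (?u - t + 8 * eta * t)"
    using x N by (intro exI[of _ x]) (auto simp: E_def)
  qed
 qed
 ultimately show ?thesis by (intro exI[of _ C]) blast
qed

text \<open>Up to the height of \<open>z (k + 2) 1\<close> a short vector in the plane orthogonal to
  \<open>p (k + 1)\<close> is taken, beyond it \<open>z (k + 2) 1\<close> itself, until the next
  plane offers something better.\<close>

lemma lambda_hat_lower:
 assumes "0 < l" "l < (\<omega>0 - 1) / \<omega>0"
 shows "\<forall>\<^sub>F X in at_top. lambda_approx \<xi> l X"
proof -
 have l1: "l * \<omega>0 < \<omega>0 - 1" using assms(2) omega0_pos by (simp add: pos_less_divide_eq)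
 then have l2: "l * \<omega>0 < 1 * \<omega>0" by simp
 then have l_lt: "l < 1" using omega0_pos mult_less_cancel_right_pos by blast
 obtain C where C: "C > 0" "!!eta. eta > 0 ==> eta < 1 / 2 ==> EV k. \<forall>t. (1 + 4 * eta) * Q k <= t &
  t <= (1 + eta) * (Q (k + 1) + Q k) --> (\<exists>x. x ~= 0 & hgt x <= exp t & err \<xi> x <= C * exp (Q k - t + 8 * eta * t))"
  using short_vectors_in_plane by blast
 \<comment> \<open>\<open>?f1\<close> serves the short vectors at the left end of the range,
   \<open>?f4\<close> places that end inside the domain of \<open>short_vectors_in_plane\<close>,
   and \<open>?f2\<close>, \<open>?f3\<close> serve the point \<open>z\<close> at the right
   end.\<close>
 let ?f1 = "\<lambda>eta. (1 - l - 9 * eta) * (\<omega>0 - eta) - 1"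
 let ?f2 = "\<lambda>eta. ((1 - \<delta>) * (1 - l) - eta) * (1 + \<sigma> - eta) - l"
 let ?f3 = "\<lambda>eta. (1 - \<delta>) * (1 - l) - eta"
 let ?f4 = "\<lambda>eta. (\<omega>0 - eta) - 1 - 4 * eta"
 let ?f = "\<lambda>eta. min (min (?f1 eta) (?f4 eta)) (min (?f2 eta) (?f3 eta))"
 have "isCont ?f 0" by (intro continuous_intros)
 moreover have "?f 0 > 0"
 proof -
  have "?f1 0 > 0" "?f4 0 > 0" using l1 mult_pos_pos[OF assms(1) omega0_pos] by (simp_all only: algebra_simps; linarith)+
  moreover have "?f2 0 = (1 - l) * \<omega>0 - 1" by (simp add: algebra_simps)
  then have "?f2 0 > 0" using l1 by (simp add: algebra_simps)
  moreover have "?f3 0 > 0" using l_lt delta_less_half by simp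
  ultimately show ?thesis by simp
 qed
 ultimately obtain eta where eta: "0 < eta" "eta < 1 / 2" and f: "?f eta > 0" using exists_small[of ?f 0 "1/2"] by auto
 have f1: "(1 - l - 9 * eta) * (\<omega>0 - eta) > 1" and f2: "((1 - \<delta>) * (1 - l) - eta) * (1 + \<sigma> - eta) > l"
  and f3: "(1 - \<delta>) * (1 - l) > eta" and f4: "\<omega>0 - eta > 1 + 4 * eta"
  using f by auto
 have f1': "1 - l - 9 * eta > 0"
 proof (rule ccontr)
  assume "~ ?thesis"
  then have "(1 - l - 9 * eta) * (\<omega>0 - eta) <= 0" using f4 eta by (intro mult_nonpos_nonneg) linarith+
  then show False using f1 by linarith
 qed
 have ev: "EV k.
   (\<forall>t. (1 + 4 * eta) * Q k <= t & t <= (1 + eta) * (Q (k + 1) + Q k) -->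
    (\<exists>x. x ~= 0 & hgt x <= exp t & err \<xi> x <= C * exp (Q k - t + 8 * eta * t))) &
   hgt (z (k + 1) 1) <= exp ((1 + eta) * (Q (k + 1) + Q k)) &
   err \<xi> (z (k + 1) 1) <= exp (- ((1 - \<delta> - eta) * (Q (k + 1) + Q k))) &
   exp ((1 - eta) * (Q (k + 1) + Q k)) <= hgt (z (k + 1) 1) &
   (\<sigma> - eta) * Q (k + 1) <= Q k & C <= exp (eta * Q k)"
  using C(2)[rule_format, OF eta] z1_bounds[OF eta(1)] eventually_Q_sigma[OF eta(1)] const_le_exp[OF eta(1), of C]
  by eventually_elim (intro conjI; (assumption | elim conjE; assumption))
 \<comment> \<open>\<open>g k\<close> is the logarithmic height at which the expected error
   \<open>exp (Q (k + 1) - t)\<close> of short vectors orthogonal to \<open>p (k + 1)\<close> equals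
   the error of \<open>z (k + 1) 1\<close>; there the choice of points changes.\<close>
 define g where "g k = Q (k + 1) + (1 - \<delta>) * (Q (k + 1) + Q k)" for k
 have g_ge: "g k >= Q (k + 1)" for k
  using Q_pos[of k] Q_pos[of "k + 1"] delta_less_half by (simp add: g_def)
 have glim: "filterlim g at_top sequentially"
  by (rule filterlim_at_top_mono[OF filterlim_compose[OF Q_at_top filterlim_add_const_nat_at_top[of 1]]]) (simp add: g_ge[simplified])
 have "\<forall>\<^sub>F t in at_top. lambda_approx \<xi> l (exp t)"
  using eventually_locate[OF glim eventually_conj[OF eventually_Suc[OF ev] eventually_Q_sigma[OF eta(1)]]]
 proof eventually_elim
  case (elim t)
  then obtain k where K1: "!!t. (1 + 4 * eta) * Q (k + 1) <= t ==> t <= (1 + eta) * (Q (k + 2) + Q (k + 1)) ==>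
    (\<exists>x. x ~= 0 & hgt x <= exp t & err \<xi> x <= C * exp (Q (k + 1) - t + 8 * eta * t))"
   and zz: "hgt (z (k + 2) 1) <= exp ((1 + eta) * (Q (k + 2) + Q (k + 1)))"
    "err \<xi> (z (k + 2) 1) <= exp (- ((1 - \<delta> - eta) * (Q (k + 2) + Q (k + 1))))"
    "exp ((1 - eta) * (Q (k + 2) + Q (k + 1))) <= hgt (z (k + 2) 1)"
    "(\<sigma> - eta) * Q (k + 2) <= Q (k + 1)"
   and Ck: "C <= exp (eta * Q (k + 1))" and K0: "(\<sigma> - eta) * Q (k + 1) <= Q k"
   and k: "g k <= t" "t < g (k + 1)"
   by (auto simp: numeral_2_eq_2)
  let ?u = "Q (k + 1)" and ?U = "Q (k + 2)"
  have pos: "0 < ?u" "?u <= ?U" using Q_pos Q_mono by auto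
  have gk: "(\<omega>0 - eta) * ?u <= g k"
  proof -
   have "(1 - \<delta>) * ((\<sigma> - eta) * ?u) <= (1 - \<delta>) * Q k"
    using K0 delta_less_half by (intro mult_left_mono) auto
   moreover have "0 <= \<delta> * eta * ?u" using eta delta_nonneg pos by simp
   ultimately show ?thesis unfolding g_def by (simp only: algebra_simps; linarith)
  qed
  show "lambda_approx \<xi> l (exp t)"
  proof (cases "t <= (1 + eta) * (?U + ?u)")
   case True
   have t1: "(1 + 4 * eta) * ?u <= t"
    using gk k f4 mult_right_mono[of "1 + 4 * eta" "\<omega>0 - eta" ?u] pos by linarith
   then obtain x where x: "x ~= 0" "hgt x <= exp t" "err \<xi> x <= C * exp (?u - t + 8 * eta * t)"
    using K1 True by blast
   have "?u * 1 <= ?u * ((1 - l - 9 * eta) * (\<omega>0 - eta))" using f1 pos by (intro mult_left_mono) auto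
   also have "... = (1 - l - 9 * eta) * ((\<omega>0 - eta) * ?u)" by simp
   also have "... <= (1 - l - 9 * eta) * t" using f1' gk k by (intro mult_left_mono) auto
   finally have ut: "?u <= (1 - l - 9 * eta) * t" by simp
   have "?u <= t" using g_ge[of k] k by simp
   then have "eta * ?u <= eta * t" using eta by simp
   have "err \<xi> x <= exp (eta * ?u) * exp (?u - t + 8 * eta * t)"
    using Ck by (intro order_trans[OF x(3)] mult_right_mono) auto
   also have "... = exp (eta * ?u + (?u - t + 8 * eta * t))" by (simp only: exp_add)
   also have "... <= exp (- l * t)" unfolding exp_le_cancel_iff
    using ut \<open>eta * ?u <= eta * t\<close> by (simp add: algebra_simps)
   finally show ?thesis using x unfolding lambda_approx_def exp_powr by blast
  next
   case False
   let ?z = "z (k + 2) 1" and ?T = "?U + ?u"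
   have "l * t <= l * (?U + (1 - \<delta>) * ?T)" using k(2) assms(1) by (simp add: g_def numeral_2_eq_2)
   also have "... <= (1 - \<delta> - eta) * ?T"
   proof -
    have "l * ?U <= ((1 - \<delta>) * (1 - l) - eta) * (1 + \<sigma> - eta) * ?U" using f2 pos by (intro mult_right_mono) auto
    also have "... = ((1 - \<delta>) * (1 - l) - eta) * ((1 + \<sigma> - eta) * ?U)" by simp
    also have "... <= ((1 - \<delta>) * (1 - l) - eta) * ?T"
     using f3 zz(4) by (intro mult_left_mono) (auto simp: algebra_simps)
    finally show ?thesis by (simp add: algebra_simps)
   qed
   finally have "exp (- ((1 - \<delta> - eta) * ?T)) <= exp (- l * t)" by simp
   moreover have "exp ((1 + eta) * ?T) <= exp t" using False by simp
   moreover have "?z ~= 0"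
   proof
    assume "?z = 0"
    then have "hgt ?z = 0" by (simp add: real_vec_def zero_vec_def[symmetric] infnorm_0)
    then show False using zz(3) by (smt (verit) exp_gt_zero)
   qed
   ultimately show ?thesis using zz unfolding lambda_approx_def exp_powr by (meson order_trans)
  qed
 qed
 then show ?thesis by (rule iffD2[OF eventually_at_top_exp])
qed

end

lemma exp_diff_le: "exp a <= exp b * y ==> exp (a - b) <= (y :: real)"
 by (simp add: exp_diff pos_divide_le_eq mult.commute)

text \<open>The two hypotheses bound the absolute value of the integer \<open>dotZ p x\<close> by
  2/3.\<close>

lemma dotZ_eq_0I:
 assumes "6 * (hgt p * err \<xi> x) <= 1" "3 * (hgt x * lin \<xi> p) <= 1"
 shows "dotZ p x = 0"
proof -
 have "\<bar>real_of_int (dotZ p x)\<bar> < 1" using dotZ_bound[of p x \<xi>] assms by linarith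
 then show ?thesis by linarith
qed

lemma dotZ_neq_0D:
 assumes "dotZ p x ~= 0" "3 * (hgt x * lin \<xi> p) <= 1"
 shows "1 <= 6 * (hgt p * err \<xi> x)"
 using dotZ_eq_0I[of p x \<xi>] assms by linarith

context sturm_points
begin

text \<open>At \<open>t\<close> slightly below \<open>\<omega>0 * Q (k + 1)\<close> a point with too
  small an error would be orthogonal to \<open>p k\<close> and to \<open>p (k + 1)\<close>, hence a
  multiple of \<open>z (k + 1) 1\<close>. The error of that point is too large whenever
  \<open>Q k / Q (k + 1)\<close> is close to \<open>\<sigma>\<close>.\<close>

lemma lambda_hat_upper:
 assumes "(\<omega>0 - 1) / \<omega>0 < l"
 shows "~ (\<forall>\<^sub>F X in at_top. lambda_approx \<xi> l X)"
proof
 have l1: "\<omega>0 - 1 < l * \<omega>0" using assms omega0_pos by (simp add: pos_divide_less_eq)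
 have w1: "\<omega>0 - 1 >= 1" using delta_sigma by (simp add: algebra_simps)
 \<comment> \<open>\<open>?f1\<close> makes the product of the error with the height of either form
   negligible; \<open>?f2\<close>, strict because \<open>\<sigma> < 1\<close>, makes the value of
   \<open>p (k + 1)\<close> negligible; \<open>?f3\<close> is the final contradiction.\<close>
 let ?f1 = "\<lambda>eta. l * (\<omega>0 - 4 * eta) - 1 - 2 * eta"
 let ?f2 = "\<lambda>eta. 3 - 2 * \<delta> - 2 * eta - (\<omega>0 - 4 * eta)"
 let ?f3 = "\<lambda>eta. l * (\<omega>0 - 4 * eta) - (1 - \<delta> + eta) * (1 + \<sigma> + eta)"
 let ?f = "\<lambda>eta. min (?f1 eta) (min (?f2 eta) (?f3 eta))"
 have "isCont ?f 0" by (intro continuous_intros)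
 moreover have "?f 0 > 0"
 proof -
  have "?f1 0 > 0" using l1 w1 by simp
  moreover have "?f3 0 > 0" using l1 by simp
  moreover have "?f2 0 = (1 - \<delta>) * (1 - \<sigma>)" by (simp add: algebra_simps)
  then have "?f2 0 > 0" using delta_less_half sigma_less_1 by simp
  ultimately show ?thesis by simp
 qed
 ultimately obtain eta where eta: "0 < eta" "eta < 1 / 4" and f: "?f eta > 0" using exists_small[of ?f 0 "1/4"] by auto
 have f1: "l * (\<omega>0 - 4 * eta) > 1 + 2 * eta" and f2: "\<omega>0 - 4 * eta < 3 - 2 * \<delta> - 2 * eta"
  and f3: "(1 - \<delta> + eta) * (1 + \<sigma> + eta) < l * (\<omega>0 - 4 * eta)" using f by auto
 let ?c = "\<omega>0 - 4 * eta"
 have c0: "?c > 0" using w1 eta by linarith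
 assume "\<forall>\<^sub>F X in at_top. lambda_approx \<xi> l X"
 then have ev: "\<forall>\<^sub>F t in at_top. lambda_approx \<xi> l (exp t)" by (rule iffD1[OF eventually_at_top_exp])
 have "filterlim (\<lambda>k. ?c * Q (k + 1)) at_top sequentially"
  by (intro filterlim_tendsto_pos_mult_at_top[OF tendsto_const c0]
    filterlim_compose[OF Q_at_top filterlim_add_const_nat_at_top])
 then have "EV k. lambda_approx \<xi> l (exp (?c * Q (k + 1)))"
  using ev by (auto simp: filterlim_iff)
 then have "EV k. ~ Q k <= (\<sigma> + eta) * Q (k + 1)"
  using p_hgt[OF eta(1)] eventually_Suc[OF p_hgt[OF eta(1)]] p_lin[OF eta(1)] eventually_Suc[OF p_lin[OF eta(1)]]
   orthogonal_both z1_bounds[OF eta(1)] eventually_Q_sigma[OF eta(1)] eventually_Suc[OF const_le_exp[OF eta(1), of 6]]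
 proof eventually_elim
  case (elim k)
  let ?u = "Q k" and ?U = "Q (k + 1)" and ?W = "Q (k + 2)" and ?z = "z (k + 1) 1"
  define t where "t = ?c * ?U"
  have pos: "0 < ?u" "?u <= ?U" "?U <= ?W" using Q_pos Q_mono by auto
  have c6: "6 <= exp (eta * ?U)" using elim(9) by simp
  obtain x where x: "x ~= 0" "err \<xi> x <= exp (- l * t)" "hgt x <= exp t"
   using elim(1) unfolding lambda_approx_def exp_powr t_def by blast
  have lt: "(1 + 2 * eta) * ?U <= l * t" "(1 - \<delta> + eta) * (1 + \<sigma> + eta) * ?U < l * t"
   using f1 f3 pos mult_right_mono[of "1 + 2 * eta" "l * ?c" ?U] mult_strict_right_mono[OF f3, of ?U]
   by (auto simp: t_def mult.assoc)
  have e: "6 * (hgt (p j) * err \<xi> x) <= 1" if "hgt (p j) <= exp ((1 + eta) * Q j)" "Q j <= ?U" for j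
  proof -
   have "6 * (hgt (p j) * err \<xi> x) <= exp (eta * ?U) * (exp ((1 + eta) * Q j) * exp (- l * t))"
    using c6 that x by (intro mult_mono) auto
   also have "... = exp (eta * ?U + ((1 + eta) * Q j + - l * t))" by (simp only: exp_add)
   also have "... <= exp 0"
   proof -
    have "(1 + eta) * Q j <= (1 + eta) * ?U" using that eta by (intro mult_left_mono) auto
    then show ?thesis using lt(1) by (subst exp_le_cancel_iff) (simp add: algebra_simps)
   qed
   finally show ?thesis by simp
  qed
  have 0: "dotZ (p k) x = 0"
  proof (rule dotZ_eq_0I[OF e])
   have "3 * (hgt x * lin \<xi> (p k)) <= exp (eta * ?U) * (exp t * exp (- ((2 - \<delta> - eta) * ?U + (1 - \<delta>) * ?u)))"
    using c6 elim(4) x by (intro mult_mono) auto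
   also have "... = exp (eta * ?U + (t + - ((2 - \<delta> - eta) * ?U + (1 - \<delta>) * ?u)))" by (simp only: exp_add)
   also have "... <= exp 0"
   proof -
    have "(1 - \<delta>) * ((\<sigma> - eta) * ?U) <= (1 - \<delta>) * ?u"
     using elim(8) delta_less_half by (intro mult_left_mono) auto
    moreover have "0 <= \<delta> * eta * ?U" "0 <= eta * ?U" using eta delta_nonneg pos by auto
    ultimately show ?thesis unfolding exp_le_cancel_iff t_def omega0_eq by (simp only: algebra_simps; linarith)
   qed
   finally show "3 * (hgt x * lin \<xi> (p k)) <= 1" by simp
  qed (use elim(2) pos in auto)
  have 1: "dotZ (p (k + 1)) x = 0"
  proof (rule dotZ_eq_0I[OF e])
   have "3 * (hgt x * lin \<xi> (p (k + 1))) <= exp (eta * ?U) * (exp t * exp (- ((2 - \<delta> - eta) * ?W + (1 - \<delta>) * ?U)))"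
    using c6 elim(5) x by (intro mult_mono) (auto simp: numeral_2_eq_2)
   also have "... = exp (eta * ?U + (t + - ((2 - \<delta> - eta) * ?W + (1 - \<delta>) * ?U)))" by (simp only: exp_add)
   also have "... <= exp 0"
   proof -
    have "(2 - \<delta> - eta) * ?U <= (2 - \<delta> - eta) * ?W"
     using pos eta delta_less_half by (intro mult_left_mono) auto
    moreover have "?c * ?U <= (3 - 2 * \<delta> - 2 * eta) * ?U" using f2 pos by (intro mult_right_mono) auto
    ultimately show ?thesis unfolding exp_le_cancel_iff t_def by (simp only: algebra_simps; linarith)
   qed
   finally show "3 * (hgt x * lin \<xi> (p (k + 1))) <= 1" by simp
  qed (use elim(3) pos in auto)
  have "err \<xi> ?z <= err \<xi> x"
   using elim(6) 0 1 parallel_primitive[of x ?z] multiple_bounds(2)[OF _ x(1)] elim(7) by metis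
  then have "exp (- ((1 - \<delta> + eta) * (?U + ?u))) <= exp (- l * t)" using elim(7) x(2) by linarith
  then have *: "l * t <= (1 - \<delta> + eta) * (?U + ?u)" by simp
  show ?case
  proof
   assume "?u <= (\<sigma> + eta) * ?U"
   then have "(1 - \<delta> + eta) * (?U + ?u) <= (1 - \<delta> + eta) * ((1 + \<sigma> + eta) * ?U)"
    using delta_less_half eta by (intro mult_left_mono) (auto simp: algebra_simps)
   then show False using * lt(2) by simp
  qed
 qed
 then show False using frequently_Q_sigma[OF eta(1)] by (simp add: frequently_def)
qed

theorem lambda2_hat_eq: "lambda2_hat \<xi> = ereal ((1 - \<delta>) * (1 + \<sigma>) / (1 + (1 - \<delta>) * (1 + \<sigma>)))"
proof -
 have "(1 - \<delta>) * (1 + \<sigma>) > 0" using delta_less_half sigma_nonneg by (intro mult_pos_pos) auto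
 then have "lambda2_hat \<xi> = ereal ((\<omega>0 - 1) / \<omega>0)"
  unfolding lambda2_hat_def
  by (intro Sup_ereal_eqI) (use lambda_hat_lower lambda_hat_upper in auto)
 then show ?thesis by simp
qed

section \<open>Comparison with the points \<open>z k l\<close>: the exponents \<open>lambda2\<close>
  and \<open>lambda_min_hat\<close>\<close>

abbreviation "\<kappa> \<equiv> 1 / (1 - \<delta> + \<sigma>)"

lemma kappa_pos: "\<kappa> > 0"
 using delta_less_half sigma_nonneg by simp

text \<open>A sufficiently large integer point is either proportional to some \<open>z k l\<close>, or badly
 approximable: it is compared with the forms \<open>p k\<close>, \<open>p (k + 1)\<close> and, when it lies in the plane
 orthogonal to \<open>p k\<close>, with the first \<open>z k l\<close> whose approximation is good enough.\<close>

lemma approx_dichotomy: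
 assumes kap: "\<kappa> < \<kappa>'" and ev0: "EV k. P k"
 shows "\<forall>\<^sub>F t in at_top. \<forall>x. hgt x = exp t --> exp (- \<kappa>' * t) <= err \<xi> x \<or>
  (\<exists>k. P k & (\<exists>l\<in>{1..s (k + 1) + 1}. crossZ x (z k l) = 0))"
proof -
 have d: "1 - \<delta> + \<sigma> > 0" using delta_less_half sigma_nonneg by simp
 have k1: "\<kappa>' * (1 - \<delta> + \<sigma>) > 1" using kap d by (simp add: pos_divide_less_eq)
 have k0: "\<kappa>' > 0" using kappa_pos kap by linarith
 have "\<delta> * \<sigma> <= \<delta> * 1" using delta_nonneg sigma_less_1 by (intro mult_left_mono) auto
 then have ds: "\<delta> * \<sigma> < 1" using delta_less_half by simp
 \<comment> \<open>The truncation at 0 lets \<open>m\<close> multiply inequalities also when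
   \<open>\<sigma> = 0\<close>, where \<open>\<sigma> - eta\<close> is negative.\<close>
 let ?m = "\<lambda>eta. max 0 (\<sigma> - eta)"
 let ?f1 = "\<lambda>eta. \<kappa>' * ((1 - 2 * eta) * ((2 - \<delta>) + (1 - \<delta>) * ?m eta)) - (1 + 2 * eta)"
 let ?f2 = "\<lambda>eta. \<kappa>' * ((1 - \<delta> - eta) * (1 + ?m eta) + ?m eta) - (1 + 3 * eta) * (1 + 2 * eta)"
 let ?f3 = "\<lambda>eta. \<kappa>' * ((1 - 2 * eta) * (3 - 2 * \<delta>)) - (1 + 4 * eta)"
 let ?f4 = "\<lambda>eta. \<kappa>' * ((1 - 2 * eta) * (2 - \<delta>)) - 3 * eta"
 \<comment> \<open>At \<open>eta = 0\<close> this is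
   \<open>\<kappa>' * (1 - \<delta> + \<sigma>) > 1\<close>, the origin of \<open>\<kappa>\<close>.
   Let \<open>u\<close> and \<open>U\<close> be the logarithmic heights of the current and the next
   form. For a point orthogonal to the current form the error is at least \<open>exp (- U)\<close>
   by the next form, or at least \<open>exp (- (t - u) / (1 - \<delta>))\<close> by comparison with
   the points \<open>z\<close>. In the worst case \<open>u = \<sigma> * U\<close> the two bounds
   meet at \<open>U = \<kappa> * t\<close>.\<close>
 let ?f5 = "\<lambda>eta. (1 + 2 * eta) * (\<kappa>' * (1 - \<delta> - eta) - (1 + eta) * (1 + 3 * eta)) + (1 - 2 * eta) * (?m eta * \<kappa>')"
 let ?f6 = "\<lambda>eta. (1 - 2 * eta) * (2 - \<delta>) - 1"
 let ?f7 = "\<lambda>eta. 1 - \<delta> - 4 * eta"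
 let ?f = "\<lambda>eta. min (min (min (?f1 eta) (?f2 eta)) (min (?f3 eta) (?f4 eta))) (min (?f5 eta) (min (?f6 eta) (?f7 eta)))"
 have cont: "isCont ?f 0" by (intro continuous_intros)
 have fpos: "?f 0 > 0"
 proof -
  have s0: "?m 0 = \<sigma>" using sigma_nonneg by simp
  have big: "\<kappa>' * y > 1" if "y >= 1 - \<delta> + \<sigma>" for y
   using k1 mult_left_mono[OF that, of \<kappa>'] k0 by linarith
  have "?f1 0 > 0" using big[of "(2 - \<delta>) + (1 - \<delta>) * \<sigma>"] ds s0 by (simp add: algebra_simps)
  moreover have "?f2 0 > 0" using big[of "(1 - \<delta>) * (1 + \<sigma>) + \<sigma>"] s0 sigma_nonneg delta_less_half
    \<open>\<delta> * \<sigma> <= \<delta> * 1\<close> mult_right_mono[of \<delta> 1 \<sigma>]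
   by (simp add: algebra_simps)
  moreover have "?f3 0 > 0" using big[of "3 - 2 * \<delta>"] sigma_less_1 delta_less_half by simp
  moreover have "?f4 0 > 0" using k0 delta_less_half by simp
  moreover have "?f5 0 > 0" using k1 s0 by (simp add: algebra_simps)
  moreover have "?f6 0 > 0" "?f7 0 > 0" using delta_less_half by auto
  ultimately show ?thesis unfolding min_less_iff_conj by blast
 qed
 obtain eta :: real where eta: "0 < eta" "eta < 1 / 4" and f: "?f eta > 0"
  using exists_small[of ?f 0 "1/4", OF cont fpos] zero_less_divide_1_iff zero_less_numeral by blast
 define m where "m = ?m eta"
 have m0: "m >= 0" by (simp add: m_def)
 have f1: "\<kappa>' * ((1 - 2 * eta) * ((2 - \<delta>) + (1 - \<delta>) * m)) > 1 + 2 * eta"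
  and f2: "\<kappa>' * ((1 - \<delta> - eta) * (1 + m) + m) > (1 + 3 * eta) * (1 + 2 * eta)"
  and f3: "\<kappa>' * ((1 - 2 * eta) * (3 - 2 * \<delta>)) > 1 + 4 * eta"
  and f4: "\<kappa>' * ((1 - 2 * eta) * (2 - \<delta>)) > 3 * eta"
  and f5: "(1 + 2 * eta) * (\<kappa>' * (1 - \<delta> - eta) - (1 + eta) * (1 + 3 * eta)) + (1 - 2 * eta) * (m * \<kappa>') > 0"
  and f6: "(1 - 2 * eta) * (2 - \<delta>) > 1" and f7: "1 - \<delta> - eta > 3 * eta"
  using f[unfolded min_less_iff_conj, folded m_def] by auto
 have Qm: "EV k. m * Q (k + 1) <= Q k"
  using eventually_Q_sigma[OF eta(1)] by eventually_elim (use Q_pos in \<open>auto simp: m_def max_def less_imp_le\<close>)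
 define e where "e k = (2 - \<delta>) * Q (k + 1) + (1 - \<delta>) * Q k" for k
 have e_ge: "e k >= Q (k + 1)" for k
 proof -
  have "0 <= (1 - \<delta>) * (Q (k + 1) + Q k)"
   using Q_pos[of k] Q_pos[of "k + 1"] delta_less_half by (intro mult_nonneg_nonneg) auto
  then show ?thesis unfolding e_def by (simp only: algebra_simps; linarith)
 qed
 \<comment> \<open>\<open>exp (- e k)\<close> is the size of the form \<open>p k\<close> at
   \<open>\<xi>\<close>. Locating \<open>t\<close> between consecutive values of \<open>g\<close>
   makes the product of the height of \<open>x\<close> with the values of the forms at
   \<open>j + 1\<close> and \<open>j + 2\<close> smaller than 1/3, so that non-orthogonality to one
   of them bounds the error of \<open>x\<close> from below.\<close>
 define g where "g k = (1 - 2 * eta) * e k" for k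
 have "filterlim e at_top sequentially"
  by (rule filterlim_at_top_mono[OF filterlim_compose[OF Q_at_top filterlim_add_const_nat_at_top[of 1]]]) (simp add: e_ge[simplified])
 then have glim: "filterlim g at_top sequentially"
  unfolding g_def[abs_def] using eta by (intro filterlim_tendsto_pos_mult_at_top[OF tendsto_const]) auto
 have ev: "EV k.
   (exp ((1 - eta) * Q k) <= hgt (p k) & hgt (p k) <= exp ((1 + eta) * Q k)) &
   hgt (p (k + 1)) <= exp ((1 + eta) * Q (k + 1)) &
   lin \<xi> (p k) <= exp (- (e k - eta * Q (k + 1))) & lin \<xi> (p (k + 1)) <= exp (- (e (k + 1) - eta * Q (k + 2))) &
   primitive (p k) & (\<forall>x. dotZ (p k) x = 0 & dotZ (p (k + 1)) x = 0 --> crossZ x (z (k + 1) 1) = 0) &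
   (\<forall>l\<in>{1..s (k + 1) + 1}. dotZ (p k) (z k l) = 0) &
   (\<forall>l\<in>{1..s (k + 1) + 1}. hgt (z k l) <= exp ((1 + eta) * (real l * Q k + Q (k - 1)))) &
   (\<forall>l\<in>{1..s (k + 1) + 1}. err \<xi> (z k l) <= exp (- ((1 - \<delta> - eta) * (real l * Q k + Q (k - 1))))) &
   6 <= exp (eta * Q k) & m * Q (k + 1) <= Q k & k >= 1 & P k & P (k + 1)"
  using p_hgt[OF eta(1)] eventually_Suc[OF p_hgt[OF eta(1)]] p_lin[OF eta(1)] eventually_Suc[OF p_lin[OF eta(1)]]
   orthogonal_both z_orth z_hgt[OF eta(1)] z_err[OF eta(1)] const_le_exp[OF eta(1), of 6] Qm eventually_ge_at_top[of 1]
   ev0 eventually_Suc[OF ev0] primitive_p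
  by eventually_elim (simp add: e_def algebra_simps)
 show ?thesis
  using eventually_locate[OF glim eventually_conj[OF eventually_Suc[OF ev] Qm]]
 proof eventually_elim
  case (elim t)
  then obtain j where j: "g j <= t" "t < g (j + 1)" "m * Q (j + 1) <= Q j" and
   H: "(exp ((1 - eta) * Q (j + 1)) <= hgt (p (j + 1)) & hgt (p (j + 1)) <= exp ((1 + eta) * Q (j + 1))) &
   hgt (p (j + 2)) <= exp ((1 + eta) * Q (j + 2)) &
   lin \<xi> (p (j + 1)) <= exp (- (e (j + 1) - eta * Q (j + 2))) & lin \<xi> (p (j + 2)) <= exp (- (e (j + 2) - eta * Q (j + 3))) &
   primitive (p (j + 1)) & (\<forall>x. dotZ (p (j + 1)) x = 0 & dotZ (p (j + 2)) x = 0 --> crossZ x (z (j + 2) 1) = 0) &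
   (\<forall>l\<in>{1..s (j + 2) + 1}. dotZ (p (j + 1)) (z (j + 1) l) = 0) &
   (\<forall>l\<in>{1..s (j + 2) + 1}. hgt (z (j + 1) l) <= exp ((1 + eta) * (real l * Q (j + 1) + Q j))) &
   (\<forall>l\<in>{1..s (j + 2) + 1}. err \<xi> (z (j + 1) l) <= exp (- ((1 - \<delta> - eta) * (real l * Q (j + 1) + Q j)))) &
   6 <= exp (eta * Q (j + 1)) & m * Q (j + 2) <= Q (j + 1) & P (j + 1) & P (j + 2)"
   by (auto simp: numeral_2_eq_2 numeral_3_eq_3)
  define k where "k = j + 1"
  let ?u = "Q (j + 1)" and ?U = "Q (j + 2)" and ?W = "Q (j + 3)" and ?v = "Q j"
  let ?p = "p (j + 1)" and ?p' = "p (j + 2)"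
  have hp: "exp ((1 - eta) * ?u) <= hgt ?p" "hgt ?p <= exp ((1 + eta) * ?u)" "hgt ?p' <= exp ((1 + eta) * ?U)"
   and lp: "lin \<xi> ?p <= exp (- (e (j + 1) - eta * ?U))" "lin \<xi> ?p' <= exp (- (e (j + 2) - eta * ?W))"
   and prim: "primitive ?p" and zcross: "!!x. dotZ ?p x = 0 ==> dotZ ?p' x = 0 ==> crossZ x (z (j + 2) 1) = 0"
   and zo: "!!l. l \<in> {1..s (j + 2) + 1} ==> dotZ ?p (z (j + 1) l) = 0"
   and zh: "!!l. l \<in> {1..s (j + 2) + 1} ==> hgt (z (j + 1) l) <= exp ((1 + eta) * (real l * ?u + ?v))"
   and ze: "!!l. l \<in> {1..s (j + 2) + 1} ==> err \<xi> (z (j + 1) l) <= exp (- ((1 - \<delta> - eta) * (real l * ?u + ?v)))"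
   and c6: "6 <= exp (eta * ?u)" and mU: "m * ?U <= ?u" and PP: "P (j + 1)" "P (j + 2)"
   using H by blast+
  have pos: "0 < ?v" "?v <= ?u" "?u <= ?U" "?U <= ?W" "0 < ?u" "0 < ?U" "0 < ?W" using Q_pos Q_mono by auto
  have "exp (eta * ?u) <= exp (eta * ?U)" using pos eta by simp
  then have c6': "6 <= exp (eta * ?U)" using c6 by linarith
  have tg: "t < (1 - 2 * eta) * e (j + 1)" "(1 - 2 * eta) * ((2 - \<delta>) * ?u + (1 - \<delta>) * ?v) <= t"
   using j by (auto simp: g_def e_def)
  have tu: "?u <= t"
  proof -
   have "1 * ?u <= ((1 - 2 * eta) * (2 - \<delta>)) * ?u" using f6 pos by (intro mult_right_mono) auto
   moreover have "0 <= (1 - 2 * eta) * ((1 - \<delta>) * ?v)" using eta delta_less_half pos by (intro mult_nonneg_nonneg) auto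
   ultimately show ?thesis using tg(2) by (simp only: algebra_simps; linarith)
  qed
  have t0: "t > 0" using tu pos by linarith
  have e1: "eta * ?U <= eta * e (j + 1)" using e_ge[of "j + 1"] eta by (simp add: numeral_2_eq_2)
  have e2: "e (j + 1) <= e (j + 2)"
  proof -
   have "(2 - \<delta>) * ?U + (1 - \<delta>) * ?u <= (2 - \<delta>) * ?W + (1 - \<delta>) * ?U"
    using pos delta_less_half by (intro add_mono mult_left_mono) auto
   then show ?thesis by (simp add: e_def numeral_2_eq_2 numeral_3_eq_3)
  qed
  have e3: "eta * ?W <= eta * e (j + 2)" using e_ge[of "j + 2"] eta by (simp add: numeral_2_eq_2 numeral_3_eq_3)
  have e4: "eta * e (j + 1) <= eta * e (j + 2)" "eta * ?U <= eta * ?W" using e2 eta pos by auto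
  show ?case
  proof (intro allI impI)
   fix x assume hx: "hgt x = exp t"
   have x0: "x ~= 0" using hx by (auto simp: real_vec_def zero_vec_def[symmetric] infnorm_0)
   have l1: "3 * (hgt x * lin \<xi> ?p) <= 1"
   proof -
    have "3 * (hgt x * lin \<xi> ?p) <= exp (eta * ?U) * (exp t * exp (- (e (j + 1) - eta * ?U)))"
     using c6' lp hx by (intro mult_mono) auto
    also have "... = exp (eta * ?U + (t + - (e (j + 1) - eta * ?U)))" by (simp only: exp_add)
    also have "... <= exp 0" using tg(1) e1 unfolding exp_le_cancel_iff by (simp only: algebra_simps; linarith)
    finally show ?thesis by simp
   qed
   have l2: "3 * (hgt x * lin \<xi> ?p') <= 1"
   proof -
    have "3 * (hgt x * lin \<xi> ?p') <= exp (eta * ?U) * (exp t * exp (- (e (j + 2) - eta * ?W)))"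
     using c6' lp hx by (intro mult_mono) auto
    also have "... = exp (eta * ?U + (t + - (e (j + 2) - eta * ?W)))" by (simp only: exp_add)
    also have "... <= exp 0"
    proof -
     have "(1 - 2 * eta) * e (j + 1) <= (1 - 2 * eta) * e (j + 2)" using e2 eta by (intro mult_left_mono) auto
     then show ?thesis using tg(1) e3 e4 unfolding exp_le_cancel_iff by (simp only: algebra_simps; linarith)
    qed
    finally show ?thesis by simp
   qed
   have err_lo: "exp (- ((1 + 2 * eta) * Q i)) <= err \<xi> x"
    if "dotZ (p i) x ~= 0" "3 * (hgt x * lin \<xi> (p i)) <= 1" "hgt (p i) <= exp ((1 + eta) * Q i)" "6 <= exp (eta * Q i)" for i
   proof -
    have "1 <= 6 * (hgt (p i) * err \<xi> x)" using dotZ_neq_0D that by blast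
    also have "... <= exp (eta * Q i) * (exp ((1 + eta) * Q i) * err \<xi> x)" using that by (intro mult_mono) auto
    also have "... = exp ((1 + 2 * eta) * Q i) * err \<xi> x" by (simp add: exp_add[symmetric] algebra_simps)
    finally have "exp (0 - (1 + 2 * eta) * Q i) <= err \<xi> x" by (intro exp_diff_le) simp
    then show ?thesis by simp
   qed
   have done_if: "exp (- \<kappa>' * t) <= err \<xi> x" if "exp (- b) <= err \<xi> x" "b <= \<kappa>' * t" for b
   proof -
    have "exp (- \<kappa>' * t) <= exp (- b)" using that(2) by simp
    then show ?thesis using that(1) by linarith
   qed
   show "exp (- \<kappa>' * t) <= err \<xi> x \<or> (\<exists>k. P k & (\<exists>l\<in>{1..s (k + 1) + 1}. crossZ x (z k l) = 0))"
   proof (cases "dotZ ?p x = 0")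
    case False
    have "(1 + 2 * eta) * ?u <= (\<kappa>' * ((1 - 2 * eta) * ((2 - \<delta>) + (1 - \<delta>) * m))) * ?u"
     using f1 pos by (intro mult_right_mono) auto
    also have "... = \<kappa>' * ((1 - 2 * eta) * ((2 - \<delta>) * ?u + (1 - \<delta>) * (m * ?u)))" by (simp add: algebra_simps)
    also have "... <= \<kappa>' * ((1 - 2 * eta) * ((2 - \<delta>) * ?u + (1 - \<delta>) * ?v))"
     using k0 eta delta_less_half j(3) by (intro mult_left_mono add_left_mono) auto
    also have "... <= \<kappa>' * t" using tg(2) k0 by (intro mult_left_mono) auto
    finally show ?thesis using done_if[OF err_lo[OF False l1 hp(2) c6]] by blast
   next
    case True
    show ?thesis
    proof (cases "dotZ ?p' x = 0")
     case True2: True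
     have "crossZ x (z (j + 2) 1) = 0" using zcross True True2 by blast
     moreover have "(1::nat) \<in> {1..s (j + 2 + 1) + 1}" by simp
     ultimately show ?thesis using PP(2) by blast
    next
     case False
     show ?thesis
     proof (cases "(1 + 2 * eta) * ?U <= \<kappa>' * t")
      case True3: True
      then show ?thesis using done_if[OF err_lo[OF False l2 hp(3) c6']] by blast
     next
      case False3: False
      define n where "n l = real l * ?u + ?v" for l :: nat
      \<comment> \<open>\<open>C l\<close> says that \<open>z (j + 1) l\<close> approximates so well
        that the product of the height of \<open>x\<close> with its error is negligible against
        \<open>hgt ?p\<close>. Taking the first such \<open>l\<close> keeps the height of the
        comparison point as small as possible.\<close>
      define C where "C l \<longleftrightarrow> (1 + 3 * eta) * t - ?u <= (1 - \<delta> - eta) * n l" for l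
      have Qr: "?U = real (s (j + 2)) * ?u + ?v" using Q_rec[of "j + 1"] by (simp add: numeral_2_eq_2)
      have mt: "m * (\<kappa>' * t) <= m * ((1 + 2 * eta) * ?U)" using False3 m0 by (intro mult_left_mono) auto
      have C_last: "C (s (j + 2) + 1)"
      proof -
       have nl: "n (s (j + 2) + 1) = ?U + ?u" using Qr by (simp add: n_def algebra_simps)
       have "(1 + 3 * eta) * (\<kappa>' * t) <= (1 + 3 * eta) * ((1 + 2 * eta) * ?U)"
        using False3 eta by (intro mult_left_mono) auto
       also have "... = ((1 + 3 * eta) * (1 + 2 * eta)) * ?U" by simp
       also have "... <= (\<kappa>' * ((1 - \<delta> - eta) * (1 + m) + m)) * ?U" using f2 pos by (intro mult_right_mono) auto
       also have "... = \<kappa>' * ((1 - \<delta> - eta) * (?U + m * ?U) + m * ?U)" by (simp add: algebra_simps)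
       also have "... <= \<kappa>' * ((1 - \<delta> - eta) * (?U + ?u) + ?u)"
        using k0 f7 eta mU by (intro mult_left_mono add_mono) auto
       finally have "\<kappa>' * ((1 + 3 * eta) * t) <= \<kappa>' * ((1 - \<delta> - eta) * (?U + ?u) + ?u)" by (simp add: mult.left_commute)
       then have "(1 + 3 * eta) * t <= (1 - \<delta> - eta) * (?U + ?u) + ?u" using k0 by simp
       then show ?thesis unfolding C_def nl by linarith
      qed
      define l where "l = (LEAST l. 1 <= l & C l)"
      have l: "1 <= l & C l" unfolding l_def by (rule LeastI[of "\<lambda>l. 1 <= l & C l" "s (j + 2) + 1"]) (use C_last in simp)
      have l_le: "l <= s (j + 2) + 1" unfolding l_def by (rule Least_le) (use C_last in simp)
      have lin: "l \<in> {1..s (j + 2) + 1}" using l l_le by simp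
      let ?z = "z (j + 1) l"
      show ?thesis
      proof (cases "crossZ x ?z = 0")
       case True4: True
       then show ?thesis using lin PP(1) by (auto simp: numeral_2_eq_2 intro!: exI[of _ "j + 1"] bexI[of _ l])
      next
       case False4: False
       have "hgt ?p <= hgt (crossZ x ?z)"
        by (rule orthogonal_plane_bound[OF True zo[OF lin] prim False4])
       also have "... <= 2 * (hgt x * err \<xi> ?z) + 2 * (hgt ?z * err \<xi> x)"
        using hgt_crossZ_err[of x ?z \<xi>] by simp
       also have "2 * (hgt x * err \<xi> ?z) <= hgt ?p / 2"
       proof -
        have "6 * (hgt x * err \<xi> ?z) <= exp (eta * ?u) * (exp t * exp (- ((1 - \<delta> - eta) * n l)))"
         using c6 hx ze[OF lin] by (intro mult_mono) (auto simp: n_def)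
        also have "... = exp (eta * ?u + (t + - ((1 - \<delta> - eta) * n l)))" by (simp only: exp_add)
        also have "... <= exp ((1 - eta) * ?u)"
        proof -
         have "eta * ?u <= eta * t" "0 <= eta * t" using tu eta t0 by auto
         then show ?thesis using l unfolding exp_le_cancel_iff C_def by (simp only: algebra_simps; linarith)
        qed
        finally have "6 * (hgt x * err \<xi> ?z) <= hgt ?p" using hp(1) by linarith
        moreover have "0 <= hgt x * err \<xi> ?z" by simp
        ultimately show ?thesis by linarith
       qed
       finally have "hgt ?p <= 4 * (hgt ?z * err \<xi> x)" by simp
       also have "... <= exp (eta * ?u) * (exp ((1 + eta) * n l) * err \<xi> x)"
        using c6 zh[OF lin] by (intro mult_mono) (auto simp: n_def)
       finally have "exp ((1 - eta) * ?u) <= exp (eta * ?u) * (exp ((1 + eta) * n l) * err \<xi> x)"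
        using hp(1) by linarith
       also have "... = exp (eta * ?u + (1 + eta) * n l) * err \<xi> x" by (simp add: exp_add)
       finally have "exp ((1 - eta) * ?u - (eta * ?u + (1 + eta) * n l)) <= err \<xi> x"
        by (rule exp_diff_le)
       moreover have "(1 - eta) * ?u - (eta * ?u + (1 + eta) * n l) = - ((1 + eta) * n l - (1 - 2 * eta) * ?u)"
        by (simp add: algebra_simps)
       ultimately have lo: "exp (- ((1 + eta) * n l - (1 - 2 * eta) * ?u)) <= err \<xi> x" by (simp only:)
       have "(1 + eta) * n l - (1 - 2 * eta) * ?u <= \<kappa>' * t"
       proof (cases "l = 1")
        case True5: True
        \<comment> \<open>For \<open>l = 1\<close> minimality carries no information, and the lower
          end of the range of \<open>t\<close> is used instead. As \<open>?v <= ?u\<close> and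
          \<open>c >= 0\<close>, the required inequality reduces to
          \<open>c + c' >= 0\<close>.\<close>
        define c where "c = \<kappa>' * ((1 - 2 * eta) * (2 - \<delta>)) - 3 * eta"
        define c' where "c' = \<kappa>' * ((1 - 2 * eta) * (1 - \<delta>)) - (1 + eta)"
        have cc: "c >= 0" "c + c' >= 0" using f4 f3 by (auto simp: c_def c'_def algebra_simps)
        have "0 <= (c + c') * ?v" using cc pos by (intro mult_nonneg_nonneg) auto
        also have "... <= c * ?u + c' * ?v" using cc pos mult_left_mono[of ?v ?u c] by (simp add: algebra_simps)
        finally have "0 <= c * ?u + c' * ?v" .
        then have "(1 + eta) * n l - (1 - 2 * eta) * ?u <= \<kappa>' * ((1 - 2 * eta) * ((2 - \<delta>) * ?u + (1 - \<delta>) * ?v))"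
         by (simp add: n_def True5 c_def c'_def algebra_simps)
        also have "... <= \<kappa>' * t" using tg(2) k0 by (intro mult_left_mono) auto
        finally show ?thesis .
       next
        case False5: False
        then have l2': "l >= 2" using l by simp
        \<comment> \<open>Minimality of \<open>l\<close> bounds \<open>n (l - 1)\<close> from above,
          and \<open>n l - ?u = n (l - 1)\<close> is up to \<open>eta\<close> the exponent in
          \<open>lo\<close>.\<close>
        have "~ (1 <= l - 1 & C (l - 1))" unfolding l_def
         by (rule not_less_Least) (use l in \<open>simp add: l_def\<close>)
        then have nC: "(1 - \<delta> - eta) * n (l - 1) < (1 + 3 * eta) * t - ?u"
         using l2' unfolding C_def by force
        have n1: "n l = n (l - 1) + ?u" using l2' by (simp add: n_def of_nat_diff algebra_simps)
        let ?d = "1 - \<delta> - eta"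
        have d0: "?d > 0" using f7 eta by linarith
        have "?d * ((1 + eta) * n l - (1 - 2 * eta) * ?u) = (1 + eta) * (?d * n (l - 1)) + ?d * (3 * eta * ?u)"
         by (simp add: n1 algebra_simps)
        also have "... <= (1 + eta) * ((1 + 3 * eta) * t - ?u) + 1 * (3 * eta * ?u)"
         using nC eta delta_nonneg pos by (intro add_mono mult_left_mono mult_right_mono) auto
        also have "... = (1 + eta) * (1 + 3 * eta) * t - (1 - 2 * eta) * ?u" by (simp add: algebra_simps)
        also have "... <= ?d * (\<kappa>' * t)"
        proof -
         have "(1 - 2 * eta) * (m * (\<kappa>' * t)) <= (1 - 2 * eta) * (m * ((1 + 2 * eta) * ?U))"
          by (rule mult_left_mono[OF mt]) (use eta in simp)
         also have "... = (1 + 2 * eta) * ((1 - 2 * eta) * (m * ?U))" by (simp add: algebra_simps)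
         also have "... <= (1 + 2 * eta) * ((1 - 2 * eta) * ?u)"
          using mU eta by (intro mult_left_mono) auto
         finally have a: "(1 - 2 * eta) * (m * (\<kappa>' * t)) <= (1 + 2 * eta) * ((1 - 2 * eta) * ?u)" .
         have "0 <= ((1 + 2 * eta) * (\<kappa>' * ?d - (1 + eta) * (1 + 3 * eta)) + (1 - 2 * eta) * (m * \<kappa>')) * t"
          using f5 t0 by simp
         also have "... = (1 + 2 * eta) * (?d * (\<kappa>' * t) - (1 + eta) * (1 + 3 * eta) * t) + (1 - 2 * eta) * (m * (\<kappa>' * t))"
          by (simp add: algebra_simps)
         also have "... <= (1 + 2 * eta) * (?d * (\<kappa>' * t) - (1 + eta) * (1 + 3 * eta) * t) + (1 + 2 * eta) * ((1 - 2 * eta) * ?u)"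
          using a by simp
         also have "... = (1 + 2 * eta) * (?d * (\<kappa>' * t) - (1 + eta) * (1 + 3 * eta) * t + (1 - 2 * eta) * ?u)"
          by (simp only: distrib_left)
         finally have "0 <= ?d * (\<kappa>' * t) - (1 + eta) * (1 + 3 * eta) * t + (1 - 2 * eta) * ?u"
          using eta by (simp add: zero_le_mult_iff)
         then show ?thesis by linarith
        qed
        finally show ?thesis using d0 by simp
       qed
       then show ?thesis using done_if[OF lo] by blast
      qed
     qed
    qed
   qed
  qed
 qed
qed

end

lemma frequently_along_sequence:
 assumes "EV k. P (f k)" "filterlim f F sequentially"
 shows "\<exists>\<^sub>F X in F. P X"
 unfolding frequently_def
proof
 assume "\<forall>\<^sub>F X in F. ~ P X"
 then have "EV k. ~ P (f k)" using assms(2) unfolding filterlim_iff by blast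
 with assms(1) have "\<forall>\<^sub>F k::nat in sequentially. False" by eventually_elim blast
 then show False by simp
qed

lemma primitive_neq_0: "primitive x ==> x ~= 0"
 unfolding primitive_def by (auto dest!: spec[of _ 2])

context sturm_points
begin

text \<open>At a single large \<open>k\<close> a point of height at most \<open>R\<close> cannot be
  orthogonal to both \<open>p k\<close> and \<open>p (k + 1)\<close>, since it would be a multiple
  of \<open>z (k + 1) 1\<close>, whose height exceeds \<open>R\<close>. Non-orthogonality to a fixed
  form then bounds the error from below. So points with tiny error are high, and asymptotic
  statements apply to them.\<close>

lemma err_positive_below:
 assumes "R > 0"
 obtains c where "c > 0" "!!x. x ~= 0 ==> hgt x <= R ==> err \<xi> x > c"
proof -
 have h: "(1::real) / 2 > 0" by simp
 have A: "EV k. 3 * R * lin \<xi> (p k) <= 1"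
  using p_lin[OF h] eventually_Suc[OF const_le_exp[OF zero_less_one, of "3 * R"]]
 proof eventually_elim
  case (elim k)
  have "exp (Q (k + 1)) * lin \<xi> (p k) <= exp (Q (k + 1)) * exp (- ((2 - \<delta> - 1 / 2) * Q (k + 1) + (1 - \<delta>) * Q k))"
   using elim by (intro mult_left_mono) auto
  also have "... = exp (Q (k + 1) + - ((2 - \<delta> - 1 / 2) * Q (k + 1) + (1 - \<delta>) * Q k))" by (simp only: exp_add)
  also have "... <= exp 0"
  proof -
   have "0 <= (1 / 2 - \<delta>) * Q (k + 1)" "0 <= (1 - \<delta>) * Q k"
    using delta_less_half Q_pos[of k] Q_pos[of "k + 1"] by (auto intro!: mult_nonneg_nonneg)
   then show ?thesis unfolding exp_le_cancel_iff by (simp only: algebra_simps; linarith)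
  qed
  finally have "exp (Q (k + 1)) * lin \<xi> (p k) <= 1" by simp
  moreover have "3 * R * lin \<xi> (p k) <= exp (Q (k + 1)) * lin \<xi> (p k)"
   using elim(2) by (intro mult_right_mono) auto
  ultimately show ?case by linarith
 qed
 have B: "EV k. R < hgt (z (k + 1) 1)"
  using z1_bounds[OF h] eventually_Suc[OF const_le_exp[OF h, of "R + 1"]]
 proof eventually_elim
  case (elim k)
  have "exp (1 / 2 * Q (k + 1)) <= exp ((1 - 1 / 2) * (Q (k + 1) + Q k))" using Q_pos[of k] by simp
  then show ?case using elim by linarith
 qed
 have "EV k. 3 * R * lin \<xi> (p k) <= 1 & 3 * R * lin \<xi> (p (k + 1)) <= 1 & R < hgt (z (k + 1) 1)
   & primitive (z (k + 1) 1) & (\<forall>x. dotZ (p k) x = 0 & dotZ (p (k + 1)) x = 0 --> crossZ x (z (k + 1) 1) = 0)"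
  using A eventually_Suc[OF A] B z1_bounds[OF h] orthogonal_both by eventually_elim blast
 then obtain k where k: "3 * R * lin \<xi> (p k) <= 1" "3 * R * lin \<xi> (p (k + 1)) <= 1" "R < hgt (z (k + 1) 1)"
   "primitive (z (k + 1) 1)" "!!x. dotZ (p k) x = 0 ==> dotZ (p (k + 1)) x = 0 ==> crossZ x (z (k + 1) 1) = 0"
  by (auto dest: eventually_happens)
 define M where "M = 1 + hgt (p k) + hgt (p (k + 1))"
 have M: "M > 0" by (simp add: M_def add_pos_nonneg)
 show thesis
 proof (rule that[of "1 / (7 * M)"])
  fix x :: "int^3" assume x: "x ~= 0" "hgt x <= R"
  have s: "3 * (hgt x * lin \<xi> (p i)) <= 1" if "3 * R * lin \<xi> (p i) <= 1" for i
  proof -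
   have "hgt x * lin \<xi> (p i) <= R * lin \<xi> (p i)" using x by (intro mult_right_mono) auto
   then show ?thesis using that by linarith
  qed
  have "dotZ (p k) x ~= 0 \<or> dotZ (p (k + 1)) x ~= 0"
  proof (rule ccontr)
   assume "~ ?thesis"
   then have "crossZ x (z (k + 1) 1) = 0" using k(5) by blast
   then have "hgt (z (k + 1) 1) <= hgt x"
    using parallel_primitive[of x "z (k + 1) 1"] multiple_bounds(1)[OF _ x(1)] k(4) by metis
   then show False using k(3) x by linarith
  qed
  then obtain i where i: "i = k \<or> i = k + 1" "dotZ (p i) x ~= 0" by blast
  have "1 <= 6 * (hgt (p i) * err \<xi> x)" using i s k by (intro dotZ_neq_0D) auto
  also have "... <= 6 * (M * err \<xi> x)" using i(1) by (intro mult_left_mono mult_right_mono) (auto simp: M_def)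
  finally have "1 / 6 <= M * err \<xi> x" by simp
  then have "1 / 7 < M * err \<xi> x" by simp
  then show "1 / (7 * M) < err \<xi> x" using M by (simp add: field_simps)
 qed (use M in simp)
qed

lemma good_points_large:
 assumes "l > 0"
 shows "\<forall>\<^sub>F T in at_top. \<forall>x. x ~= 0 & err \<xi> x <= exp (- l * T) --> exp t0 < hgt x"
proof -
 obtain c where c: "c > 0" "!!x. x ~= 0 ==> hgt x <= exp t0 ==> err \<xi> x > c"
  using err_positive_below[of "exp t0"] by auto
 show ?thesis using eventually_ge_at_top[of "- ln c / l"]
 proof eventually_elim
  case (elim T)
  then have "- ln c <= l * T" using assms by (simp add: field_simps)
  then have "exp (- l * T) <= exp (ln c)" by (simp only: exp_le_cancel_iff; simp)
  then have "exp (- l * T) <= c" using c(1) by simp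
  then show ?case using c(2) by (meson linorder_not_less order_trans)
 qed
qed

text \<open>Points approximating better than the exponent \<open>\<kappa>'\<close> may be replaced
  by some \<open>z k l\<close> without increasing height or error. The free predicate
  \<open>P\<close> carries over whichever asymptotic estimates are wanted for that
  \<open>k\<close>.\<close>

lemma good_points_proportional:
 assumes "\<kappa> < \<kappa>'" and ev: "EV k. P k" and "l > 0"
 shows "\<forall>\<^sub>F T in at_top. \<forall>x. x ~= 0 & err \<xi> x <= exp (- l * T) & err \<xi> x < hgt x powr (- \<kappa>') -->
  (\<exists>k l. P k & l \<in> {1..s (k + 1) + 1} & z k l ~= 0 & hgt (z k l) <= hgt x & err \<xi> (z k l) <= err \<xi> x)"
proof -
 obtain t0 where t0: "!!t x. t >= t0 ==> hgt x = exp t ==> exp (- \<kappa>' * t) <= err \<xi> x \<or>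
  (\<exists>k. (P k & (\<forall>l\<in>{1..s (k + 1) + 1}. primitive (z k l))) & (\<exists>l\<in>{1..s (k + 1) + 1}. crossZ x (z k l) = 0))"
  using approx_dichotomy[OF assms(1) eventually_conj[OF ev primitive_z]]
  unfolding eventually_at_top_linorder by blast
 show ?thesis using good_points_large[OF assms(3), of t0]
 proof eventually_elim
  case (elim T)
  show ?case
  proof (intro allI impI, elim conjE)
   fix x assume x: "x ~= 0" "err \<xi> x <= exp (- l * T)" "err \<xi> x < hgt x powr (- \<kappa>')"
   have h: "exp t0 < hgt x" using elim x by blast
   define t where "t = ln (hgt x)"
   have hx: "hgt x > 0" using h by (smt (verit) exp_gt_zero)
   then have ht: "hgt x = exp t" by (simp add: t_def)
   then have "t >= t0" using h by simp
   moreover have "~ exp (- \<kappa>' * t) <= err \<xi> x" using x(3) unfolding ht exp_powr by simp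
   ultimately obtain k l where kl: "P k" "l \<in> {1..s (k + 1) + 1}" "primitive (z k l)" "crossZ x (z k l) = 0"
    using t0[of t x] ht by blast
   obtain m where m: "!!i. x $ i = m * z k l $ i" using parallel_primitive[OF kl(4,3)] by blast
   show "\<exists>k l. P k & l \<in> {1..s (k + 1) + 1} & z k l ~= 0 & hgt (z k l) <= hgt x & err \<xi> (z k l) <= err \<xi> x"
    using kl multiple_bounds[OF m x(1)] by blast
  qed
 qed
qed

theorem lambda2_lower: "ereal (1 - \<delta>) <= lambda2 \<xi>"
 unfolding lambda2_def
proof (rule Sup_ereal_geI)
 show "0 < 1 - \<delta>" using delta_less_half by simp
 fix l assume l: "0 < l" "l < 1 - \<delta>"
 let ?f = "\<lambda>eta. (1 - \<delta> - eta) - l * (1 + eta)"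
 have cont: "isCont ?f 0" by (intro continuous_intros)
 have fpos: "?f 0 > 0" using l by simp
 obtain eta :: real where eta: "0 < eta" "eta < 1" and f: "?f eta > 0"
  using exists_small[of ?f 0 1, OF cont fpos] zero_less_one by blast
 have "EV k. lambda_approx \<xi> l (exp ((1 + eta) * (Q (k + 1) + Q k)))"
  using z1_bounds[OF eta(1)]
 proof eventually_elim
  case (elim k)
  let ?n = "Q (k + 1) + Q k"
  have n: "?n > 0" using Q_pos by (simp add: add_pos_pos)
  have "l * (1 + eta) * ?n <= (1 - \<delta> - eta) * ?n" using f n by (intro mult_right_mono) auto
  then have "exp (- ((1 - \<delta> - eta) * ?n)) <= exp (- l * ((1 + eta) * ?n))" by (simp add: mult.assoc)
  moreover have "z (k + 1) 1 ~= 0" using elim primitive_neq_0 by blast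
  ultimately show ?case using elim unfolding lambda_approx_def exp_powr by (meson order_trans)
 qed
 moreover have "filterlim (\<lambda>k. exp ((1 + eta) * (Q (k + 1) + Q k))) at_top sequentially"
 proof (rule filterlim_compose[OF exp_at_top], rule filterlim_tendsto_pos_mult_at_top[OF tendsto_const])
  show "filterlim (\<lambda>k. Q (k + 1) + Q k) at_top sequentially"
   by (rule filterlim_at_top_mono[OF Q_at_top]) (use Q_pos in \<open>simp add: less_imp_le\<close>)
 qed (use eta in simp)
 ultimately have "\<exists>\<^sub>F X in at_top. lambda_approx \<xi> l X" by (rule frequently_along_sequence)
 then show "l \<in> {l. \<exists>\<^sub>F X in at_top. lambda_approx \<xi> l X}" by simp
qed

text \<open>An exponent above \<open>\<kappa>\<close> can only be reached by the points
  \<open>z k l\<close>, and their exponent tends to \<open>1 - \<delta>\<close>.\<close>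

theorem lambda2_upper: "lambda2 \<xi> <= ereal (max (1 - \<delta>) \<kappa>)"
 unfolding lambda2_def
proof (rule Sup_ereal_leI)
 fix l assume l: "max (1 - \<delta>) \<kappa> < l"
 obtain \<kappa>' where \<kappa>': "\<kappa> < \<kappa>'" "\<kappa>' < l" using l dense by (metis max_less_iff_conj)
 have l0: "l > 0" using less_trans[OF kappa_pos] l by (simp only: max_less_iff_conj)
 let ?f = "\<lambda>eta. l * (1 - eta) - (1 - \<delta> + eta)"
 have cont: "isCont ?f 0" by (intro continuous_intros)
 have fpos: "?f 0 > 0" using l by simp
 obtain eta :: real where eta: "0 < eta" "eta < 1" and f: "?f eta > 0"
  using exists_small[of ?f 0 1, OF cont fpos] zero_less_one by blast
 have "\<forall>\<^sub>F T in at_top. ~ lambda_approx \<xi> l (exp T)"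
  using good_points_proportional[OF \<kappa>'(1) eventually_conj[OF z_hgt[OF eta(1)] z_err[OF eta(1)]] l0]
   good_points_large[OF l0, of 0]
 proof eventually_elim
  case (elim T)
  show ?case
  proof
   assume "lambda_approx \<xi> l (exp T)"
   then obtain x where x: "x ~= 0" "err \<xi> x <= exp (- l * T)" "hgt x <= exp T"
    unfolding lambda_approx_def exp_powr by blast
   define t where "t = ln (hgt x)"
   have h1: "1 < hgt x" using elim(2) x by auto
   then have ht: "hgt x = exp t" and t0: "t > 0" by (auto simp: t_def)
   have tT: "t <= T" using x(3) ht by simp
   have et: "err \<xi> x <= exp (- l * t)"
    using x(2) mult_left_mono[OF tT, of l] l0 by (smt (verit) exp_le_cancel_iff minus_mult_left)
   have "\<kappa>' * t < l * t" using \<kappa>' t0 by simp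
   then have "err \<xi> x < hgt x powr (- \<kappa>')" unfolding ht exp_powr using et
    by (smt (verit) exp_less_cancel_iff minus_mult_left)
   then obtain k j where kl: "(\<forall>l\<in>{1..s (k + 1) + 1}.
    exp ((1 - eta) * (real l * Q k + Q (k - 1))) <= hgt (z k l) &
    hgt (z k l) <= exp ((1 + eta) * (real l * Q k + Q (k - 1)))) & (\<forall>l\<in>{1..s (k + 1) + 1}.
    exp (- ((1 - \<delta> + eta) * (real l * Q k + Q (k - 1)))) <= err \<xi> (z k l) &
    err \<xi> (z k l) <= exp (- ((1 - \<delta> - eta) * (real l * Q k + Q (k - 1)))))"
    "j \<in> {1..s (k + 1) + 1}" "hgt (z k j) <= hgt x" "err \<xi> (z k j) <= err \<xi> x"
    using elim(1) x(1,2) by blast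
   define n where "n = real j * Q k + Q (k - 1)"
   have n0: "n > 0" using Q_pos[of k] Q_pos[of "k - 1"] by (simp add: n_def add_nonneg_pos)
   have zh: "exp ((1 - eta) * n) <= hgt (z k j)" and ze: "exp (- ((1 - \<delta> + eta) * n)) <= err \<xi> (z k j)"
    using kl(1,2) unfolding n_def by blast+
   have "exp ((1 - eta) * n) <= exp t" using zh kl(3) ht by linarith
   then have nt: "(1 - eta) * n <= t" by simp
   have "exp (- ((1 - \<delta> + eta) * n)) <= exp (- l * t)" using ze kl(4) et by linarith
   then have "l * t <= (1 - \<delta> + eta) * n" by simp
   moreover have "l * ((1 - eta) * n) <= l * t" using nt l0 by (intro mult_left_mono) auto
   ultimately have "(l * (1 - eta)) * n <= (1 - \<delta> + eta) * n" by simp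
   then show False using f n0 by simp
  qed
 qed
 then have "~ (\<exists>\<^sub>F T in at_top. lambda_approx \<xi> l (exp T))" by (simp add: frequently_def)
 then show "l \<notin> {l. \<exists>\<^sub>F X in at_top. lambda_approx \<xi> l X}"
  using frequently_at_top_exp[of "lambda_approx \<xi> l"] by simp
qed

text \<open>Completing the square: \<open>sturm_h \<sigma>\<close> is the root of
  \<open>(1 - \<delta>) * (1 - \<delta> + \<sigma>) = 1\<close> for which
  \<open>1 - \<delta> + \<sigma> / 2\<close> is positive.\<close>

lemma kappa_le_iff: "\<kappa> <= 1 - \<delta> \<longleftrightarrow> \<delta> <= sturm_h \<sigma>" "\<kappa> < 1 - \<delta> \<longleftrightarrow> \<delta> < sturm_h \<sigma>"
proof -
 define y where "y = 1 - \<delta> + \<sigma> / 2"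
 have y: "y > 0" using delta_less_half sigma_nonneg by (simp add: y_def)
 have d: "1 - \<delta> + \<sigma> > 0" using delta_less_half sigma_nonneg by simp
 have eq: "(1 - \<delta>) * (1 - \<delta> + \<sigma>) = y\<^sup>2 - (\<sigma> / 2)\<^sup>2" by (simp add: y_def power2_eq_square algebra_simps)
 have r: "y = sqrt (y\<^sup>2)" using y by simp
 have h: "\<delta> <= sturm_h \<sigma> \<longleftrightarrow> sqrt ((\<sigma> / 2)\<^sup>2 + 1) <= y" "\<delta> < sturm_h \<sigma> \<longleftrightarrow> sqrt ((\<sigma> / 2)\<^sup>2 + 1) < y"
  by (auto simp: sturm_h_def y_def)
 show "\<kappa> <= 1 - \<delta> \<longleftrightarrow> \<delta> <= sturm_h \<sigma>"
  unfolding h pos_divide_le_eq[OF d] eq by (subst (2) r) (simp only: real_sqrt_le_iff, auto)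
 show "\<kappa> < 1 - \<delta> \<longleftrightarrow> \<delta> < sturm_h \<sigma>"
  unfolding h pos_divide_less_eq[OF d] eq by (subst (2) r) (simp only: real_sqrt_less_iff, auto)
qed

theorem lambda2_eq: "\<delta> <= sturm_h \<sigma> ==> lambda2 \<xi> = ereal (1 - \<delta>)"
 using lambda2_lower lambda2_upper kappa_le_iff(1) by (simp add: max_def antisym split: if_splits)

text \<open>From its own height to that of its successor the point \<open>z k l\<close> is used. The
  quotient of these two logarithmic heights is smallest for \<open>l = 1\<close>, where it is at
  least about \<open>(1 + \<sigma>) / (2 + \<sigma>)\<close>. The side condition holds because every
  \<open>z k l\<close> has exponent close to \<open>1 - \<delta>\<close>.\<close>

lemma lambda_hat_mu_lower:
 assumes mu: "0 < \<mu>" "\<mu> < 1 - \<delta>" and l: "0 < l" "l < (1 - \<delta>) * (1 + \<sigma>) / (2 + \<sigma>)"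
 shows "\<forall>\<^sub>F X in at_top. lambda_mu_approx \<mu> \<xi> l X"
proof -
 have l1: "l * (2 + \<sigma>) < (1 - \<delta>) * (1 + \<sigma>)" using l(2) sigma_nonneg by (simp add: pos_less_divide_eq)
 let ?f1 = "\<lambda>eta. (1 - \<delta> - eta) - \<mu> * (1 + eta)"
 let ?f2 = "\<lambda>eta. (1 - \<delta> - eta) * (1 + \<sigma> - eta) - l * (1 + eta) * (2 + \<sigma> - eta)"
 let ?f = "\<lambda>eta. min (?f1 eta) (?f2 eta)"
 have cont: "isCont ?f 0" by (intro continuous_intros)
 have fpos: "?f 0 > 0" using mu l1 by simp
 obtain eta :: real where eta: "0 < eta" "eta < 1 / 4" and f: "?f eta > 0"
  using exists_small[of ?f 0 "1/4", OF cont fpos] zero_less_divide_1_iff zero_less_numeral by blast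
 have f1: "\<mu> * (1 + eta) < 1 - \<delta> - eta" and f2: "l * (1 + eta) * (2 + \<sigma> - eta) < (1 - \<delta> - eta) * (1 + \<sigma> - eta)"
  using f by auto
 define g where "g k = (1 + eta) * (Q (k + 1) + Q k)" for k
 have "filterlim (\<lambda>k. Q (k + 1) + Q k) at_top sequentially"
  by (rule filterlim_at_top_mono[OF Q_at_top]) (use Q_pos in \<open>simp add: less_imp_le\<close>)
 then have glim: "filterlim g at_top sequentially"
  unfolding g_def[abs_def] using eta by (intro filterlim_tendsto_pos_mult_at_top[OF tendsto_const]) auto
 have "\<forall>\<^sub>F t in at_top. lambda_mu_approx \<mu> \<xi> l (exp t)"
  using eventually_locate[OF glim eventually_conj[OF eventually_Q_sigma[OF eta(1)]
    eventually_Suc[OF eventually_conj[OF z_hgt[OF eta(1)] eventually_conj[OF z_err[OF eta(1)] primitive_z]]]]]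
 proof eventually_elim
  case (elim t)
  then obtain j where j: "(\<sigma> - eta) * Q (j + 1) <= Q j" "g j <= t" "t < g (j + 1)"
   and zh: "!!l. l \<in> {1..s (j + 2) + 1} ==> hgt (z (j + 1) l) <= exp ((1 + eta) * (real l * Q (j + 1) + Q j))"
   and ze: "!!l. l \<in> {1..s (j + 2) + 1} ==> err \<xi> (z (j + 1) l) <= exp (- ((1 - \<delta> - eta) * (real l * Q (j + 1) + Q j)))"
   and zp: "!!l. l \<in> {1..s (j + 2) + 1} ==> primitive (z (j + 1) l)"
   by (auto simp: numeral_2_eq_2)
  let ?u = "Q (j + 1)" and ?U = "Q (j + 2)" and ?v = "Q j"
  have pos: "0 < ?v" "?v <= ?u" "0 < ?u" using Q_pos Q_mono by auto
  define n where "n i = real i * ?u + ?v" for i :: nat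
  define C where "C i \<longleftrightarrow> t < (1 + eta) * n (i + 1)" for i
  have Qr: "?U = real (s (j + 2)) * ?u + ?v" using Q_rec[of "j + 1"] by (simp add: numeral_2_eq_2)
  have "n (s (j + 2) + 1) = ?U + ?u" using Qr by (simp add: n_def algebra_simps)
  then have Cs: "C (s (j + 2))" using j(3) unfolding C_def by (simp add: g_def numeral_2_eq_2)
  define i where "i = (LEAST i. C i)"
  have Ci: "C i" unfolding i_def by (rule LeastI[of C, OF Cs])
  have i_le: "i <= s (j + 2)" unfolding i_def by (rule Least_le[of C, OF Cs])
  have n1: "(1 + eta) * n 1 <= t" using j(2) by (simp add: g_def n_def add.commute)
  have i1: "i >= 1"
  proof (rule ccontr)
   assume "~ i >= 1"
   then have "i = 0" by simp
   then show False using Ci n1 by (simp add: C_def)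
  qed
  have "~ C (i - 1)" unfolding i_def by (rule not_less_Least) (use i1 in \<open>simp add: i_def\<close>)
  then have ni: "(1 + eta) * n i <= t" using i1 by (simp add: C_def)
  have iin: "i \<in> {1..s (j + 2) + 1}" using i1 i_le by simp
  let ?z = "z (j + 1) i"
  have z0: "?z ~= 0" using zp[OF iin] by (rule primitive_neq_0)
  have n0: "n i > 0" using pos by (simp add: n_def add_nonneg_pos)
  have h: "hgt ?z <= exp ((1 + eta) * n i)" and e: "err \<xi> ?z <= exp (- ((1 - \<delta> - eta) * n i))"
   using zh[OF iin] ze[OF iin] by (auto simp: n_def)
  have "err \<xi> ?z <= exp (- l * t)"
  proof -
   have nn: "n (i + 1) = n i + ?u" by (simp add: n_def algebra_simps)
   have "(1 + \<sigma> - eta) * ?u <= n i"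
   proof -
    have "1 * ?u <= real i * ?u" using i1 pos by (intro mult_right_mono) auto
    then show ?thesis using j(1) unfolding n_def by (simp only: algebra_simps; linarith)
   qed
   then have a: "l * (1 + eta) * ((1 + \<sigma> - eta) * ?u) <= l * (1 + eta) * n i" using l eta by (intro mult_left_mono) auto
   have b0: "1 + \<sigma> - eta > 0" using sigma_nonneg eta by linarith
   have "(1 + \<sigma> - eta) * (l * t) <= (1 + \<sigma> - eta) * (l * ((1 + eta) * n (i + 1)))"
    using Ci b0 l unfolding C_def by (intro mult_left_mono) auto
   also have "... = (1 + \<sigma> - eta) * (l * (1 + eta) * n i) + l * (1 + eta) * ((1 + \<sigma> - eta) * ?u)"
    unfolding nn by (simp add: algebra_simps)
   also have "... <= (1 + \<sigma> - eta) * (l * (1 + eta) * n i) + l * (1 + eta) * n i" using a by simp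
   also have "... = (l * (1 + eta) * (2 + \<sigma> - eta)) * n i" by (simp add: algebra_simps)
   also have "... <= ((1 - \<delta> - eta) * (1 + \<sigma> - eta)) * n i" using f2 n0 by (intro mult_right_mono) auto
   finally have "(1 + \<sigma> - eta) * (l * t) <= (1 + \<sigma> - eta) * ((1 - \<delta> - eta) * n i)" by (simp only: mult_ac)
   then have "l * t <= (1 - \<delta> - eta) * n i" using b0 by simp
   then have "exp (- ((1 - \<delta> - eta) * n i)) <= exp (- l * t)" by simp
   then show ?thesis using e by linarith
  qed
  moreover have "err \<xi> ?z <= hgt ?z powr (- \<mu>)"
  proof -
   have hz: "hgt ?z >= 1" using z0 by (rule hgt_ge_1)
   have "(\<mu> * (1 + eta)) * n i <= (1 - \<delta> - eta) * n i" using f1 n0 by (intro mult_right_mono) auto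
   then have "exp (- ((1 - \<delta> - eta) * n i)) <= exp ((1 + eta) * n i) powr (- \<mu>)" by (simp add: exp_powr mult.assoc)
   also have "... <= hgt ?z powr (- \<mu>)" using h hz mu by (intro powr_mono2') auto
   finally show ?thesis using e by linarith
  qed
  moreover have "hgt ?z <= exp t"
  proof -
   have "exp ((1 + eta) * n i) <= exp t" using ni by simp
   then show ?thesis using h by linarith
  qed
  ultimately show ?case using z0 unfolding lambda_mu_approx_def exp_powr by auto
 qed
 then show ?thesis by (rule iffD2[OF eventually_at_top_exp])
qed

text \<open>Since \<open>\<mu>\<close> exceeds \<open>\<kappa>\<close>, the admissible points are
  multiples of the \<open>z j i\<close>. Just below the height of \<open>z (k + 1) 2\<close> nothing
  better than \<open>z (k + 1) 1\<close> is available, which is worst when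
  \<open>Q k / Q (k + 1)\<close> is close to \<open>\<sigma>\<close>.\<close>

lemma lambda_hat_mu_upper:
 assumes mu: "\<kappa> < \<mu>" and l: "(1 - \<delta>) * (1 + \<sigma>) / (2 + \<sigma>) < l"
 shows "~ (\<forall>\<^sub>F X in at_top. lambda_mu_approx \<mu> \<xi> l X)"
proof
 have l1: "(1 - \<delta>) * (1 + \<sigma>) < l * (2 + \<sigma>)" using l sigma_nonneg by (simp add: pos_divide_less_eq)
 have "(1 - \<delta>) * (1 + \<sigma>) / (2 + \<sigma>) > 0" using delta_less_half sigma_nonneg by simp
 then have l0: "l > 0" using l by linarith
 obtain \<kappa>' where \<kappa>': "\<kappa> < \<kappa>'" "\<kappa>' < \<mu>" using mu dense by blast
 let ?f = "\<lambda>eta. l * (1 - 3 * eta) * (2 + \<sigma> + eta) - (1 - \<delta> + eta) * (1 + \<sigma> + eta)"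
 have cont: "isCont ?f 0" by (intro continuous_intros)
 have fpos: "?f 0 > 0" using l1 by simp
 obtain eta :: real where eta: "0 < eta" "eta < 1 / 4" and f: "?f eta > 0"
  using exists_small[of ?f 0 "1/4", OF cont fpos] zero_less_divide_1_iff zero_less_numeral by blast
 assume "\<forall>\<^sub>F X in at_top. lambda_mu_approx \<mu> \<xi> l X"
 then have ev: "\<forall>\<^sub>F t in at_top. lambda_mu_approx \<mu> \<xi> l (exp t)" by (rule iffD1[OF eventually_at_top_exp])
 define T where "T k = (1 - 3 * eta) * (2 * Q (k + 1) + Q k)" for k
 have "filterlim (\<lambda>k. 2 * Q (k + 1) + Q k) at_top sequentially"
  by (rule filterlim_at_top_mono[OF Q_at_top]) (use Q_pos in \<open>simp add: less_imp_le\<close>)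
 then have Tlim: "filterlim T at_top sequentially"
  unfolding T_def[abs_def] using eta by (intro filterlim_tendsto_pos_mult_at_top[OF tendsto_const]) auto
 define P where "P k \<longleftrightarrow> k >= 1 & (\<forall>l\<in>{1..s (k + 1) + 1}.
    exp ((1 - eta) * (real l * Q k + Q (k - 1))) <= hgt (z k l) &
    hgt (z k l) <= exp ((1 + eta) * (real l * Q k + Q (k - 1)))) & (\<forall>l\<in>{1..s (k + 1) + 1}.
    exp (- ((1 - \<delta> + eta) * (real l * Q k + Q (k - 1)))) <= err \<xi> (z k l) &
    err \<xi> (z k l) <= exp (- ((1 - \<delta> - eta) * (real l * Q k + Q (k - 1)))))" for k
 have evP: "EV k. P k" unfolding P_def
  by (intro eventually_conj eventually_ge_at_top z_hgt z_err eta)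
 have ev2: "\<forall>\<^sub>F t in at_top. lambda_mu_approx \<mu> \<xi> l (exp t) &
   (\<forall>x. x ~= 0 & err \<xi> x <= exp (- l * t) & err \<xi> x < hgt x powr (- \<kappa>') -->
   (\<exists>k l. P k & l \<in> {1..s (k + 1) + 1} & z k l ~= 0 & hgt (z k l) <= hgt x & err \<xi> (z k l) <= err \<xi> x)) &
   (\<forall>x. x ~= 0 & err \<xi> x <= exp (- l * t) --> exp 0 < hgt x)"
  by (intro eventually_conj ev good_points_proportional[OF \<kappa>'(1) evP l0] good_points_large[OF l0, of 0])
 have "EV k. ~ Q k <= (\<sigma> + eta) * Q (k + 1)"
  using Tlim[unfolded filterlim_iff, rule_format, OF ev2]
 proof eventually_elim
  case (elim k)
  let ?u = "Q (k + 1)" and ?v = "Q k"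
  have pos: "0 < ?v" "?v <= ?u" "0 < ?u" using Q_pos Q_mono by auto
  obtain x where x: "x ~= 0" "err \<xi> x <= exp (- l * T k)" "err \<xi> x <= hgt x powr (- \<mu>)" "hgt x <= exp (T k)"
   using conjunct1[OF elim] unfolding lambda_mu_approx_def exp_powr by auto
  have h1: "1 < hgt x" using elim x by auto
  have "hgt x powr (- \<mu>) < hgt x powr (- \<kappa>')" using h1 \<kappa>' by (intro powr_less_mono) auto
  then have "err \<xi> x < hgt x powr (- \<kappa>')" using x(3) by linarith
  then obtain j i where P: "P j" and ji': "i \<in> {1..s (j + 1) + 1}" "hgt (z j i) <= hgt x" "err \<xi> (z j i) <= err \<xi> x"
   using conjunct1[OF conjunct2[OF elim]] x(1,2) by blast
  then have ji: "j >= 1" "i \<in> {1..s (j + 1) + 1}" "hgt (z j i) <= hgt x" "err \<xi> (z j i) <= err \<xi> x"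
   by (auto simp: P_def)
  have zh: "exp ((1 - eta) * (real i * Q j + Q (j - 1))) <= hgt (z j i)"
   and ze: "exp (- ((1 - \<delta> + eta) * (real i * Q j + Q (j - 1)))) <= err \<xi> (z j i)"
   using P ji(2) unfolding P_def by blast+
  define n where "n = real i * Q j + Q (j - 1)"
  have "exp ((1 - eta) * n) <= exp (T k)" using zh ji(3) x(4) unfolding n_def by linarith
  then have "(1 - eta) * n <= (1 - 3 * eta) * (2 * ?u + ?v)" by (simp add: T_def)
  also have "... < (1 - eta) * (2 * ?u + ?v)" using eta pos by (intro mult_strict_right_mono) auto
  finally have n2: "n < 2 * ?u + ?v" using eta by simp
  have i1: "1 <= i" "i <= s (j + 1) + 1" using ji(2) by auto
  have iQ: "1 * Q j <= real i * Q j" using i1 Q_pos[of j] by (intro mult_right_mono) auto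
  \<comment> \<open>No logarithmic height \<open>i * Q j + Q (j - 1)\<close> lies strictly between
    those of \<open>z (k + 1) 1\<close> and \<open>z (k + 1) 2\<close>: the points with smaller
    \<open>j\<close> end at the former, those with larger \<open>j\<close> start at the latter or
    later.\<close>
  have n1: "n <= ?u + ?v"
  proof -
   consider "j < k + 1" | "j = k + 1" | "j >= k + 2" by linarith
   then show ?thesis
   proof cases
    case 1
    have "real i * Q j <= (real (s (j + 1)) + 1) * Q j" using i1 Q_pos[of j] by (intro mult_right_mono) auto
    then have "n <= Q (j + 1) + Q j" using Q_rec[OF ji(1)] by (simp add: n_def algebra_simps)
    also have "... <= ?u + ?v" using 1 by (intro add_mono Q_mono) auto
    finally show ?thesis .
   next
    case 2
    have "i = 1"
    proof (rule ccontr)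
     assume "i ~= 1"
     then have "2 * Q j <= real i * Q j" using i1 Q_pos[of j] by (intro mult_right_mono) auto
     then show False using n2 2 by (simp add: n_def)
    qed
    then show ?thesis using 2 by (simp add: n_def)
   next
    case 3
    have "1 * ?u <= real (s (k + 2)) * ?u" using s_ge_1[of "k + 2"] pos by (intro mult_right_mono) auto
    then have "?u + ?v <= Q (k + 2)" using Q_rec[of "k + 1"] by (simp add: numeral_2_eq_2)
    also have "... <= Q j" using 3 by (intro Q_mono)
    finally have "?u + ?v <= Q j" .
    moreover have "?u <= Q (j - 1)" using 3 by (intro Q_mono) auto
    ultimately have "2 * ?u + ?v <= n" using iQ unfolding n_def by linarith
    then show ?thesis using n2 by linarith
   qed
  qed
  have "exp (- ((1 - \<delta> + eta) * n)) <= exp (- l * T k)" using ze ji(4) x(2) unfolding n_def by linarith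
  then have "l * T k <= (1 - \<delta> + eta) * n" by simp
  also have "... <= (1 - \<delta> + eta) * (?u + ?v)" using n1 delta_less_half eta by (intro mult_left_mono) auto
  finally have A: "l * T k <= (1 - \<delta> + eta) * (?u + ?v)" .
  show ?case
  proof
   assume v: "?v <= (\<sigma> + eta) * ?u"
   have a0: "2 + \<sigma> + eta > 0" using sigma_nonneg eta by simp
   have B: "(2 + \<sigma> + eta) * (?u + ?v) <= (1 + \<sigma> + eta) * (2 * ?u + ?v)"
    using v by (simp only: algebra_simps; linarith)
   have "(2 + \<sigma> + eta) * (l * T k) <= (2 + \<sigma> + eta) * ((1 - \<delta> + eta) * (?u + ?v))" using A a0 by (intro mult_left_mono) auto
   also have "... = (1 - \<delta> + eta) * ((2 + \<sigma> + eta) * (?u + ?v))" by simp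
   also have "... <= (1 - \<delta> + eta) * ((1 + \<sigma> + eta) * (2 * ?u + ?v))" using B delta_less_half eta by (intro mult_left_mono) auto
   finally have "(l * (1 - 3 * eta) * (2 + \<sigma> + eta)) * (2 * ?u + ?v) <= ((1 - \<delta> + eta) * (1 + \<sigma> + eta)) * (2 * ?u + ?v)"
    unfolding T_def by (simp only: mult_ac)
   moreover have "2 * ?u + ?v > 0" using pos by simp
   ultimately show False using f by (simp add: mult_le_cancel_right)
  qed
 qed
 then show False using frequently_Q_sigma[OF eta(1)] by (simp add: frequently_def)
qed

text \<open>For \<open>\<delta> < sturm_h \<sigma>\<close> there is an interval of
  \<open>\<mu>\<close> between \<open>\<kappa>\<close> and \<open>1 - \<delta>\<close>, and
  \<open>lambda_hat_mu\<close> is constant on it.\<close>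

theorem lambda_min_hat_eq:
 assumes "\<delta> < sturm_h \<sigma>"
 shows "lambda_min_hat \<xi> = ereal ((1 - \<delta>) * (1 + \<sigma>) / (2 + \<sigma>))"
proof -
 define F where "F = filtercomap ereal (at_left (ereal (1 - \<delta>)))"
 have k1: "\<kappa> < 1 - \<delta>" using assms kappa_le_iff(2) by simp
 have l2: "lambda2 \<xi> = ereal (1 - \<delta>)" using lambda2_eq assms by simp
 have v0: "(1 - \<delta>) * (1 + \<sigma>) / (2 + \<sigma>) > 0" using delta_less_half sigma_nonneg by simp
 have eq: "lambda_hat_mu \<mu> \<xi> = ereal ((1 - \<delta>) * (1 + \<sigma>) / (2 + \<sigma>))" if "\<kappa> < \<mu>" "\<mu> < 1 - \<delta>" for \<mu>
  unfolding lambda_hat_mu_def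
 proof (rule Sup_ereal_eqI[OF v0])
  have "0 < \<mu>" using that(1) kappa_pos by linarith
  then show "l \<in> {l. \<forall>\<^sub>F X in at_top. lambda_mu_approx \<mu> \<xi> l X}"
   if "0 < l" "l < (1 - \<delta>) * (1 + \<sigma>) / (2 + \<sigma>)" for l
   using lambda_hat_mu_lower[OF _ \<open>\<mu> < 1 - \<delta>\<close> that] by blast
 qed (use lambda_hat_mu_upper[OF that(1)] in blast)
 have "\<forall>\<^sub>F y in at_left (ereal (1 - \<delta>)). ereal \<kappa> < y & y < ereal (1 - \<delta>)"
  using k1 by (auto simp: eventually_at_left[of "ereal \<kappa>"] intro: exI[of _ "ereal \<kappa>"])
 then have "\<forall>\<^sub>F \<mu> in F. \<kappa> < \<mu> & \<mu> < 1 - \<delta>"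
  unfolding F_def eventually_filtercomap by force
 then have "\<forall>\<^sub>F \<mu> in F. lambda_hat_mu \<mu> \<xi> = ereal ((1 - \<delta>) * (1 + \<sigma>) / (2 + \<sigma>))"
  by eventually_elim (use eq in auto)
 then have "((\<lambda>\<mu>. lambda_hat_mu \<mu> \<xi>) \<longlongrightarrow> ereal ((1 - \<delta>) * (1 + \<sigma>) / (2 + \<sigma>))) F"
  by (rule tendsto_eventually)
 \<comment> \<open>The limit is determined by convergence only along a non-trivial filter.\<close>
 moreover have "F ~= bot"
 proof
  assume "F = bot"
  then have "eventually (\<lambda>_. False) F" by simp
  then obtain P where P: "eventually P (at_left (ereal (1 - \<delta>)))" "!!\<mu>. ~ P (ereal \<mu>)"
   unfolding F_def eventually_filtercomap by auto
  then obtain b where b: "b < ereal (1 - \<delta>)" "!!y. b < y ==> y < ereal (1 - \<delta>) ==> P y"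
   using eventually_at_left[of "ereal \<kappa>" "ereal (1 - \<delta>)" P] k1 by auto
  then show False using P(2) ereal_dense2 by blast
 qed
 ultimately show ?thesis unfolding lambda_min_hat_def l2 F_def by (intro tendsto_Lim) auto
qed

end

section \<open>The ring of integral 2 by 2 matrices\<close>

datatype mat2 = Mat2 (m11: int) (m12: int) (m21: int) (m22: int)

lemma mat2_eq_iff: "A = B \<longleftrightarrow> m11 A = m11 B & m12 A = m12 B & m21 A = m21 B & m22 A = m22 B"
 by (cases A; cases B) auto

text \<open>With the matrix product as \<open>*\<close>, powers are matrix powers,
  \<open>of_int c\<close> is the scalar matrix, and the general rules for rings apply.\<close>

instantiation mat2 :: ring_1
begin

definition "0 = Mat2 0 0 0 0"
definition "1 = Mat2 1 0 0 1"
definition "A + B = Mat2 (m11 A + m11 B) (m12 A + m12 B) (m21 A + m21 B) (m22 A + m22 B)"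
definition "A - B = Mat2 (m11 A - m11 B) (m12 A - m12 B) (m21 A - m21 B) (m22 A - m22 B)"
definition "- A = Mat2 (- m11 A) (- m12 A) (- m21 A) (- m22 A)"
definition "A * B = Mat2 (m11 A * m11 B + m12 A * m21 B) (m11 A * m12 B + m12 A * m22 B)
  (m21 A * m11 B + m22 A * m21 B) (m21 A * m12 B + m22 A * m22 B)"

instance
 by standard (simp_all add: zero_mat2_def one_mat2_def plus_mat2_def minus_mat2_def uminus_mat2_def
   times_mat2_def mat2_eq_iff algebra_simps)

end

lemma mat2_entries [simp]:
 "m11 0 = 0" "m12 0 = 0" "m21 0 = 0" "m22 0 = 0"
 "m11 1 = 1" "m12 1 = 0" "m21 1 = 0" "m22 1 = 1"
 "m11 (A + B) = m11 A + m11 B" "m12 (A + B) = m12 A + m12 B"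
 "m21 (A + B) = m21 A + m21 B" "m22 (A + B) = m22 A + m22 B"
 "m11 (A - B) = m11 A - m11 B" "m12 (A - B) = m12 A - m12 B"
 "m21 (A - B) = m21 A - m21 B" "m22 (A - B) = m22 A - m22 B"
 "m11 (- A) = - m11 A" "m12 (- A) = - m12 A" "m21 (- A) = - m21 A" "m22 (- A) = - m22 A"
 by (simp_all add: zero_mat2_def one_mat2_def plus_mat2_def minus_mat2_def uminus_mat2_def)

lemma mat2_mult_entries:
 "m11 (A * B) = m11 A * m11 B + m12 A * m21 B" "m12 (A * B) = m11 A * m12 B + m12 A * m22 B"
 "m21 (A * B) = m21 A * m11 B + m22 A * m21 B" "m22 (A * B) = m21 A * m12 B + m22 A * m22 B"
 by (simp_all add: times_mat2_def)

lemma of_int_mat2 [simp]: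
 "m11 (of_int c) = c" "m12 (of_int c) = 0" "m21 (of_int c) = 0" "m22 (of_int c) = c"
proof -
 have "of_int c = Mat2 c 0 0 c"
  by (induction c rule: int_induct[where k = 0]) (simp_all add: mat2_eq_iff)
 then show "m11 (of_int c) = c" "m12 (of_int c) = 0" "m21 (of_int c) = 0" "m22 (of_int c) = c" by simp_all
qed

definition tr :: "mat2 \<Rightarrow> int" where "tr A = m11 A + m22 A"
definition mdet :: "mat2 \<Rightarrow> int" where "mdet A = m11 A * m22 A - m12 A * m21 A"
definition adj :: "mat2 \<Rightarrow> mat2" where "adj A = Mat2 (m22 A) (- m12 A) (- m21 A) (m11 A)"

lemmas mat2_simps = mat2_eq_iff mat2_mult_entries tr_def mdet_def adj_def algebra_simps

lemma mult_adj: "A * adj A = of_int (mdet A)" "adj A * A = of_int (mdet A)"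
 by (simp_all add: mat2_simps)

lemma mdet_mult [simp]: "mdet (A * B) = mdet A * mdet B" by (simp add: mat2_simps)
lemma adj_mult: "adj (A * B) = adj B * adj A" by (simp add: mat2_simps)
lemma adj_adj [simp]: "adj (adj A) = A" by (simp add: mat2_simps)
lemma mdet_adj [simp]: "mdet (adj A) = mdet A" by (simp add: mat2_simps)
lemma mdet_1 [simp]: "mdet 1 = 1" by (simp add: mdet_def)
lemma mdet_0 [simp]: "mdet 0 = 0" by (simp add: mdet_def)
lemma mdet_uminus [simp]: "mdet (- A) = mdet A" by (simp add: mdet_def)
lemma mdet_of_int [simp]: "mdet (of_int c) = c\<^sup>2" by (simp add: mdet_def power2_eq_square)
lemma mdet_power [simp]: "mdet (A ^ n) = mdet A ^ n" by (induction n) auto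
lemma tr_mult_commute: "tr (A * B) = tr (B * A)" by (simp add: mat2_simps)
lemma tr_0 [simp]: "tr 0 = 0" by (simp add: tr_def)
lemma tr_add [simp]: "tr (A + B) = tr A + tr B" by (simp add: tr_def)
lemma tr_diff [simp]: "tr (A - B) = tr A - tr B" by (simp add: tr_def)
lemma tr_uminus [simp]: "tr (- A) = - tr A" by (simp add: tr_def)
lemma tr_of_int_mult [simp]: "tr (of_int c * A) = c * tr A" by (simp add: mat2_simps)
lemma tr_adj [simp]: "tr (adj A) = tr A" by (simp add: tr_def adj_def)
lemma cayley_hamilton: "A * A = of_int (tr A) * A - of_int (mdet A)" by (simp add: mat2_simps)
lemma add_adj: "A + adj A = of_int (tr A)" by (simp add: mat2_simps)

lemma traceless_adj: "tr M = 0 ==> adj M = - M"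
 using add_adj[of M] by (simp add: add_eq_0_iff)

lemma traceless_square: "tr M = 0 ==> M * M = - of_int (mdet M)"
 using cayley_hamilton[of M] by simp

lemma mult_of_int_left: "A * (of_int c * B) = of_int c * (A * (B :: 'a::ring_1))"
 by (metis mult.assoc mult_of_int_commute)

lemma of_int_mat2_mult_left_cancel:
 assumes "c ~= 0" "of_int c * A = of_int c * (B :: mat2)"
 shows "A = B"
 using assms by (auto simp: mat2_eq_iff mat2_mult_entries)

text \<open>A traceless matrix is the negative of its adjugate, so \<open>w * M = M * adj w\<close>,
  and \<open>M * M\<close> is scalar.\<close>

lemma traceless_conj:
 assumes "tr M = 0" "tr (w * M) = 0"
 shows "M * (w * M) = of_int (- mdet M) * adj w"
proof -
 have "w * M = - adj (w * M)" using traceless_adj[OF assms(2)] by simp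
 also have "... = M * adj w" using traceless_adj[OF assms(1)] by (simp add: adj_mult)
 finally have "M * (w * M) = (M * M) * adj w" by (simp add: mult.assoc)
 then show ?thesis using traceless_square[OF assms(1)] by simp
qed

section \<open>Forms and points attached to matrices; the recurrence\<close>

definition U_vec :: "mat2 \<Rightarrow> int^3" where "U_vec A = vector [- m21 A, m11 A - m22 A, m12 A]"
text \<open>For a traceless \<open>M\<close>, multiplying on the right by the matrix with rows
  \<open>(0, 1)\<close> and \<open>(-1, 0)\<close> gives the symmetric matrix with rows
  \<open>(x1, x2)\<close> and \<open>(x2, x3)\<close>, where \<open>x1, x2, x3\<close> are the
  coordinates of \<open>X_vec M\<close>; in particular
  \<open>mdet M = x1 * x3 - x2^2\<close>.\<close>

definition X_vec :: "mat2 \<Rightarrow> int^3" where "X_vec M = vector [- m12 M, m11 M, m21 M]"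

lemma U_vec_nth [simp]: "U_vec A $ 1 = - m21 A" "U_vec A $ 2 = m11 A - m22 A" "U_vec A $ 3 = m12 A"
 by (simp_all add: U_vec_def)

lemma X_vec_nth [simp]: "X_vec A $ 1 = - m12 A" "X_vec A $ 2 = m11 A" "X_vec A $ 3 = m21 A"
 by (simp_all add: X_vec_def)

text \<open>Orthogonality of a form and a point becomes the vanishing of a trace, which cyclic
  invariance provides.\<close>

lemma dotZ_U_X: "tr M = 0 ==> dotZ (U_vec A) (X_vec M) = tr (A * M)"
proof -
 assume "tr M = 0"
 then have "m22 M = - m11 M" by (simp add: tr_def)
 then show ?thesis by (simp add: dotZ_def tr_def mat2_mult_entries algebra_simps)
qed

text \<open>Independence of two forms thus means that their matrices do not commute.\<close>

lemma crossZ_U_U: "crossZ (U_vec A) (U_vec B) = - X_vec (A * B - B * A)"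
 by (simp add: vec3_eq_iff mat2_mult_entries algebra_simps)

text \<open>The symmetric approximation matrices of the paper are represented by traceless matrices.
 The factor \<open>Phi k\<close>, which depends only on the parity of \<open>k\<close>, makes \<open>w k ^ l * w (k - 1) * Phi k\<close>
 traceless; it comes from the multiplicative commutator of \<open>w 1\<close> and \<open>w 0\<close>.\<close>

locale mat_rec = sturm_seq +
 fixes w :: "nat \<Rightarrow> mat2"
 assumes det_nz: "mdet (w k) ~= 0"
  and rec: "k >= 1 ==> w (k + 1) = w k ^ s (k + 1) * w (k - 1)"
  and comm: "mdet (w 0 * w 1 - w 1 * w 0) ~= 0"
begin

definition E :: "nat \<Rightarrow> mat2" where "E k = w k * w (k - 1) - w (k - 1) * w k"
definition "m0 = mdet (w 1 * w 0)"
definition "e0 = mdet (E 1)"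
text \<open>Up to the factor \<open>m0\<close> this is the identity minus the multiplicative
  commutator of \<open>w 1\<close> and \<open>w 0\<close>; hence \<open>w 1 * w 0 * Phi0\<close> is
  \<open>m0\<close> times the additive commutator \<open>E 1\<close>, a traceless matrix.\<close>

definition "Phi0 = adj (w 1 * w 0) * E 1"
definition Phi :: "nat \<Rightarrow> mat2" where "Phi k = (if odd k then Phi0 else adj Phi0)"
definition T :: "nat \<Rightarrow> nat \<Rightarrow> mat2" where "T k l = w k ^ l * w (k - 1) * Phi k"

lemma m0_nz: "m0 ~= 0" using det_nz by (simp add: m0_def)

lemma e0_nz: "e0 ~= 0"
proof -
 have "E 1 = - (w 0 * w 1 - w 1 * w 0)" by (simp add: E_def)
 then have "e0 = mdet (w 0 * w 1 - w 1 * w 0)" unfolding e0_def by (metis mdet_uminus)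
 then show ?thesis using comm by simp
qed

lemma tr_E [simp]: "tr (E k) = 0" by (simp add: E_def tr_mult_commute)

lemma adj_Phi: "adj (Phi k) = Phi (k + 1)" by (simp add: Phi_def)

lemma Phi_add_2 [simp]: "Phi (Suc (Suc k)) = Phi k" by (simp add: Phi_def)

lemma mdet_Phi: "mdet (Phi k) = m0 * e0" by (simp add: Phi_def Phi0_def m0_def e0_def)

lemma mdet_Phi_nz: "mdet (Phi k) ~= 0" using mdet_Phi m0_nz e0_nz by simp

lemma Phi_mult: "Phi k * Phi (k + 1) = of_int (m0 * e0)" "Phi (k + 1) * Phi k = of_int (m0 * e0)"
 using mult_adj[of "Phi k"] unfolding adj_Phi mdet_Phi .

text \<open>Polarization of the determinant: for \<open>X\<close> and \<open>Y\<close> of equal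
  determinant both \<open>tr (adj X * (X - Y))\<close> and \<open>mdet (X - Y)\<close> equal twice
  that determinant minus \<open>tr (adj X * Y)\<close>.\<close>

lemma tr_Phi: "tr (Phi k) = e0"
proof -
 have "tr (adj X * (X - Y)) = mdet (X - Y)" if "mdet X = mdet Y" for X Y
  using that by (simp add: tr_def mdet_def adj_def mat2_mult_entries algebra_simps)
 then have "tr Phi0 = e0" unfolding Phi0_def e0_def E_def by simp
 then show ?thesis by (simp add: Phi_def)
qed

text \<open>The matrices \<open>w 1 * w 0\<close> and \<open>w 0 * w 1\<close> have the same trace
  and determinant, and for such pairs Cayley-Hamilton turns the adjugate of
  \<open>adj X * (X - Y)\<close> into an expression in \<open>adj Y\<close>. This starts the second
  half of the induction in \<open>w_Phi\<close>.\<close>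

lemma Phi_2: "Phi 2 = - (adj (w 0 * w 1) * E 1)"
proof -
 have "adj (adj X * (X - Y)) = - (adj Y * (X - Y))" if "tr X = tr Y" "mdet X = mdet Y" for X Y
 proof -
  have "adj Y = of_int (tr X) - Y" using add_adj[of Y] that by (simp add: eq_diff_eq add.commute)
  then have "adj Y * X = of_int (tr X) * X - Y * X" by (simp only: left_diff_distrib)
  moreover have "- (adj Y * (X - Y)) = - (adj Y * X) + adj Y * Y" by (simp add: algebra_simps)
  ultimately have "- (adj Y * (X - Y)) = - (of_int (tr X) * X - Y * X) + adj Y * Y" by simp
  also have "... = - (of_int (tr X) * X - of_int (mdet X)) + Y * X"
   using that by (simp add: mult_adj)
  also have "... = - ((X - Y) * X)" unfolding cayley_hamilton[symmetric] by (simp add: algebra_simps)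
  also have "... = adj (X - Y) * X"
  proof -
   have "adj (X - Y) = - (X - Y)" by (rule traceless_adj) (simp add: that)
   then show ?thesis by (simp only: mult_minus_left)
  qed
  finally show ?thesis by (simp add: adj_mult)
 qed
 then show ?thesis by (simp add: Phi_def Phi0_def E_def tr_mult_commute)
qed

text \<open>The power of \<open>w k\<close> in \<open>w (k + 1)\<close> commutes with
  \<open>w k\<close> and factors out on the left; what remains is the commutator in the opposite
  order.\<close>

lemma E_Suc:
 assumes "k >= 1"
 shows "E (k + 1) = - (w k ^ s (k + 1) * E k)"
proof -
 have "w k * w (k + 1) = w k ^ s (k + 1) * (w k * w (k - 1))"
  unfolding rec[OF assms] by (simp add: mult.assoc[symmetric] power_commutes)
 moreover have "w (k + 1) * w k = w k ^ s (k + 1) * (w (k - 1) * w k)"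
  unfolding rec[OF assms] by (simp add: mult.assoc)
 ultimately show ?thesis by (simp add: E_def right_diff_distrib)
qed

text \<open>The two identities feed each other: the induction step multiplies on the left by a power
  of \<open>w k\<close> and exchanges their roles, matching the period two of \<open>Phi\<close> and
  the sign in \<open>E_Suc\<close>.\<close>

lemma w_Phi:
 assumes "k >= 1"
 shows "w k * w (k - 1) * Phi k = of_int m0 * E k & w (k - 1) * w k * Phi (k + 1) = - (of_int m0 * E k)"
 using assms
proof (induction k rule: dec_induct)
 case base
 have "w 1 * w 0 * Phi 1 = of_int m0 * E 1"
  by (simp add: Phi_def Phi0_def mult.assoc[symmetric] mult_adj m0_def del: mdet_mult)
 moreover have "w 0 * w 1 * Phi 2 = - (of_int m0 * E 1)"
  using mult_adj(1)[of "w 0 * w 1"] by (simp add: Phi_2 mult.assoc[symmetric] m0_def mult.commute)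
 ultimately show ?case by (simp add: numeral_2_eq_2)
next
 case (step k)
 have k: "k >= 1" using step by simp
 let ?p = "w k ^ s (k + 1)"
 have "w (k + 1) * w k * Phi (k + 1) = ?p * (w (k - 1) * w k * Phi (k + 1))" using rec[OF k] by (simp add: mult.assoc)
 also have "... = ?p * (- (of_int m0 * E k))" using step by simp
 also have "... = of_int m0 * E (k + 1)" using E_Suc[OF k] by (simp add: mult_of_int_left)
 finally have 1: "w (k + 1) * w k * Phi (k + 1) = of_int m0 * E (k + 1)" .
 have "w k * w (k + 1) * Phi (k + 2) = ?p * (w k * w (k - 1) * Phi k)"
  using rec[OF k] by (simp add: mult.assoc[symmetric] power_commutes)
 also have "... = ?p * (of_int m0 * E k)" using step by simp
 also have "... = - (of_int m0 * E (k + 1))" using E_Suc[OF k] by (simp add: mult_of_int_left)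
 finally show ?case using 1 by simp
qed

lemma mdet_E: "k >= 1 ==> m0 * mdet (E k) = mdet (w k) * mdet (w (k - 1)) * e0"
proof -
 assume "k >= 1"
 then have "mdet (w k * w (k - 1) * Phi k) = mdet (of_int m0 * E k)" using w_Phi by simp
 then have "m0 * (m0 * mdet (E k)) = m0 * (mdet (w k) * mdet (w (k - 1)) * e0)"
  by (auto simp: mdet_Phi power2_eq_square mult_ac)
 then show ?thesis using m0_nz by (metis mult_left_cancel)
qed

lemma E_nz: "k >= 1 ==> E k ~= 0"
 using mdet_E[of k] det_nz e0_nz by auto

lemma T_Suc: "T k (Suc l) = w k * T k l" by (simp add: T_def mult.assoc)

lemma T_1: "k >= 1 ==> T k 1 = of_int m0 * E k" using w_Phi by (simp add: T_def)

lemma T_last: "k >= 1 ==> T k (s (k + 1)) = w (k + 1) * Phi k"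
 using rec[of k] by (simp add: T_def)

lemma T_0: "T (Suc k) 0 = w k * Phi (k + 1)" by (simp add: T_def)

text \<open>The points of index \<open>k\<close> end, up to sign, where those of index
  \<open>k + 1\<close> begin, so that all points form one chain.\<close>

lemma T_joint:
 assumes "k >= 1"
 shows "T k (s (k + 1) + 1) = - T (k + 1) 1"
proof -
 have "T k (s (k + 1) + 1) = w k * (w (k + 1) * Phi k)" using T_last[OF assms] by (simp add: T_Suc)
 also have "... = - (of_int m0 * E (k + 1))" using w_Phi[of "k + 1"] by (simp add: mult.assoc)
 also have "... = - T (k + 1) 1" using T_1[of "k + 1"] by simp
 finally show ?thesis .
qed

text \<open>For positive \<open>l\<close> the matrix is \<open>m0\<close> times a power of
  \<open>w k\<close> times the commutator \<open>E k\<close>, whose trace vanishes by cyclic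
  invariance. For \<open>l = 0\<close> one first multiplies by \<open>mdet (w k)\<close>, which is
  not zero.\<close>

lemma tr_T:
 assumes "k >= 1"
 shows "tr (T k l) = 0"
proof (cases l)
 case 0
 have "of_int (mdet (w k)) * T k 0 = adj (w k) * T k 1" by (simp add: T_Suc mult_adj mult.assoc[symmetric])
 then have "tr (of_int (mdet (w k)) * T k 0) = m0 * tr (adj (w k) * E k)"
  unfolding T_1[OF assms] by (simp only: mult_of_int_left tr_of_int_mult)
 moreover have "tr (adj (w k) * E k) = 0"
 proof -
  have "tr (adj A * (A * B - B * A)) = 0" for A B by (simp add: mat2_simps)
  then show ?thesis by (simp add: E_def)
 qed
 ultimately show ?thesis using det_nz 0 by simp
next
 case (Suc j)
 have "T k l = w k ^ j * T k 1" by (simp add: Suc T_def mult.assoc[symmetric] power_commutes)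
 then have "tr (T k l) = m0 * tr (w k ^ j * E k)"
  unfolding T_1[OF assms] by (simp only: mult_of_int_left tr_of_int_mult)
 also have "tr (w k ^ j * E k) = tr (w k ^ j * w k * w (k - 1)) - tr (w k ^ j * w (k - 1) * w k)"
  by (simp add: E_def algebra_simps)
 also have "tr (w k ^ j * w (k - 1) * w k) = tr (w k * (w k ^ j * w (k - 1)))" by (rule tr_mult_commute)
 also have "... = tr (w k ^ j * w k * w (k - 1))" by (simp add: mult.assoc[symmetric] power_commutes)
 finally show ?thesis by simp
qed

lemma tr_w_T: "k >= 1 ==> tr (w k * T k l) = 0"
 using tr_T[of k "Suc l"] by (simp add: T_Suc)

lemma tr_w_T_next: "k >= 1 ==> tr (w k * T (k + 1) 1) = 0"
 using tr_w_T[of k "s (k + 1) + 1"] T_joint[of k] by simp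

text \<open>\<open>T (k + 1) 2\<close> leaves the plane orthogonal to the form of
  \<open>w k\<close>, which contains \<open>T (k + 1) 1\<close>. By Cayley-Hamilton only the
  component along \<open>T (k + 1) 0\<close> contributes. This exact value is the source of the
  two-sided estimate for the form at \<open>\<xi>\<close>.\<close>

lemma tr_w_T_2:
 assumes "k >= 1"
 shows "tr (w k * T (k + 1) 2) = mdet (w k) * mdet (w (k + 1)) * e0"
proof -
 let ?w = "w (k + 1)" and ?T = "T (k + 1)"
 have CH: "?T 2 = of_int (tr ?w) * ?T 1 - of_int (mdet ?w) * ?T 0"
 proof -
  have "?T 2 = (?w * ?w) * ?T 0" by (simp add: T_Suc numeral_2_eq_2 mult.assoc)
  also have "... = of_int (tr ?w) * ?T 1 - of_int (mdet ?w) * ?T 0"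
   unfolding cayley_hamilton by (simp add: algebra_simps T_Suc)
  finally show ?thesis .
 qed
 have comm: "w k * (of_int c * A) = of_int c * (w k * A)" for c A
  by (rule mult_of_int_left)
 have "tr (w k * ?T 0) = - mdet (w k) * e0"
 proof -
  have "w k * ?T 0 = (w k * w k) * Phi (k + 1)" by (simp add: T_0 mult.assoc)
  also have "... = of_int (tr (w k)) * ?T 0 - of_int (mdet (w k)) * Phi (k + 1)"
   unfolding cayley_hamilton by (simp add: algebra_simps T_0)
  finally show ?thesis using tr_T[of "k + 1" 0] by (simp add: tr_Phi)
 qed
 then show ?thesis using tr_w_T_next[OF assms]
  unfolding CH right_diff_distrib comm by simp
qed

end

section \<open>Norms of matrices and their errors at \<open>\<xi>\<close>\<close>

definition nrm :: "mat2 \<Rightarrow> real" where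
 "nrm A = real_of_int (max (max \<bar>m11 A\<bar> \<bar>m12 A\<bar>) (max \<bar>m21 A\<bar> \<bar>m22 A\<bar>))"

lemma nrm_ge:
 "\<bar>real_of_int (m11 A)\<bar> <= nrm A" "\<bar>real_of_int (m12 A)\<bar> <= nrm A"
 "\<bar>real_of_int (m21 A)\<bar> <= nrm A" "\<bar>real_of_int (m22 A)\<bar> <= nrm A"
 by (simp_all only: nrm_def of_int_abs[symmetric] of_int_le_iff le_max_iff_disj order_refl simp_thms)

lemma nrm_leI:
 assumes "\<bar>real_of_int (m11 A)\<bar> <= t" "\<bar>real_of_int (m12 A)\<bar> <= t"
  "\<bar>real_of_int (m21 A)\<bar> <= t" "\<bar>real_of_int (m22 A)\<bar> <= t"
 shows "nrm A <= t"
 using assms unfolding nrm_def by (auto simp: max_def)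

lemma nrm_nonneg [simp]: "nrm A >= 0"
 using nrm_ge(1)[of A] by linarith

lemma nrm_ge_1: "A ~= 0 ==> nrm A >= 1"
proof -
 assume "A ~= 0"
 then have "m11 A ~= 0 \<or> m12 A ~= 0 \<or> m21 A ~= 0 \<or> m22 A ~= 0" by (auto simp: mat2_eq_iff)
 then have "\<bar>m11 A\<bar> >= 1 \<or> \<bar>m12 A\<bar> >= 1 \<or> \<bar>m21 A\<bar> >= 1 \<or> \<bar>m22 A\<bar> >= 1" by linarith
 then show ?thesis unfolding nrm_def by linarith
qed

lemma nrm_mult: "nrm (A * B) <= 2 * nrm A * nrm B"
proof -
 have *: "\<bar>a * b + c * d\<bar> <= 2 * nrm A * nrm B"
  if "\<bar>a\<bar> <= nrm A" "\<bar>b\<bar> <= nrm B" "\<bar>c\<bar> <= nrm A" "\<bar>d\<bar> <= nrm B" for a b c d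
  using abs_mult_le[OF that(1,2)] abs_mult_le[OF that(3,4)] by linarith
 show ?thesis
  by (rule nrm_leI) (simp_all add: mat2_mult_entries * nrm_ge)
qed

lemma nrm_adj [simp]: "nrm (adj A) = nrm A"
 unfolding nrm_def adj_def by (simp add: max.commute max.left_commute)

lemma nrm_uminus [simp]: "nrm (- A) = nrm A"
 unfolding nrm_def by simp

lemma nrm_of_int_mult [simp]: "nrm (of_int c * A) = \<bar>real_of_int c\<bar> * nrm A"
proof -
 have e: "max (max \<bar>m11 (of_int c * A)\<bar> \<bar>m12 (of_int c * A)\<bar>) (max \<bar>m21 (of_int c * A)\<bar> \<bar>m22 (of_int c * A)\<bar>)
   = \<bar>c\<bar> * max (max \<bar>m11 A\<bar> \<bar>m12 A\<bar>) (max \<bar>m21 A\<bar> \<bar>m22 A\<bar>)"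
  by (simp add: mat2_mult_entries abs_mult max_mult_distrib_left)
 show ?thesis unfolding nrm_def e by (simp only: of_int_mult of_int_abs)
qed

lemma abs_mdet_le: "\<bar>real_of_int (mdet A)\<bar> <= 2 * (nrm A)\<^sup>2"
proof -
 have "\<bar>real_of_int (m11 A) * real_of_int (m22 A)\<bar> <= nrm A * nrm A"
  "\<bar>real_of_int (m12 A) * real_of_int (m21 A)\<bar> <= nrm A * nrm A"
  by (intro abs_mult_le nrm_ge)+
 then show ?thesis by (simp add: mdet_def power2_eq_square)
qed

text \<open>\<open>y1\<close> and \<open>y2\<close> are the coordinates of \<open>A\<close> applied
  to \<open>(1, \<xi>)\<close>. For a traceless matrix with point \<open>(x1, x2, x3)\<close> they
  are \<open>x2 - x1 * \<xi>\<close> and \<open>x3 - x2 * \<xi>\<close>, so \<open>rho\<close> is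
  comparable with the error of the point.\<close>

definition y1 :: "real \<Rightarrow> mat2 \<Rightarrow> real" where "y1 \<xi> A = real_of_int (m11 A) + real_of_int (m12 A) * \<xi>"
definition y2 :: "real \<Rightarrow> mat2 \<Rightarrow> real" where "y2 \<xi> A = real_of_int (m21 A) + real_of_int (m22 A) * \<xi>"
definition rho :: "real \<Rightarrow> mat2 \<Rightarrow> real" where "rho \<xi> A = max \<bar>y1 \<xi> A\<bar> \<bar>y2 \<xi> A\<bar>"
definition val :: "real \<Rightarrow> mat2 \<Rightarrow> real" where
 "val \<xi> A = - real_of_int (m21 A) + (real_of_int (m11 A) - real_of_int (m22 A)) * \<xi> + real_of_int (m12 A) * \<xi>\<^sup>2"

lemma rho_ge: "\<bar>y1 \<xi> A\<bar> <= rho \<xi> A" "\<bar>y2 \<xi> A\<bar> <= rho \<xi> A" "0 <= rho \<xi> A"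
 by (auto simp: rho_def)

lemma rho_uminus [simp]: "rho \<xi> (- A) = rho \<xi> A"
proof -
 have "y1 \<xi> (- A) = - y1 \<xi> A" "y2 \<xi> (- A) = - y2 \<xi> A" by (simp_all add: y1_def y2_def)
 then show ?thesis by (simp add: rho_def)
qed

lemma lin_U_vec: "lin \<xi> (U_vec A) = \<bar>val \<xi> A\<bar>"
 by (simp add: lin_eq val_def)

lemma traceless_entries: "tr M = 0 ==> real_of_int (m22 M) = - real_of_int (m11 M)"
 by (simp add: tr_def eq_neg_iff_add_eq_0 add.commute of_int_add[symmetric] del: of_int_add)

text \<open>For a traceless \<open>M\<close> the second column is \<open>m12 M\<close> times
  \<open>(1, \<xi>)\<close> up to \<open>y1 \<xi> M\<close>. Applying \<open>S\<close> to this
  column shows that a small product \<open>S * M\<close> forces a small error of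
  \<open>S\<close>.\<close>

lemma rho_image:
 assumes "tr M = 0"
 shows "\<bar>real_of_int (m12 M)\<bar> * rho \<xi> S <= nrm (S * M) + nrm S * rho \<xi> M"
proof -
 have 1: "m12 M * y1 \<xi> S = m12 (S * M) + m12 S * y1 \<xi> M"
  and 2: "m12 M * y2 \<xi> S = m22 (S * M) + m22 S * y1 \<xi> M"
  by (simp_all add: y1_def y2_def mat2_mult_entries traceless_entries[OF assms] algebra_simps)
 have "\<bar>m12 S * y1 \<xi> M\<bar> <= nrm S * rho \<xi> M" "\<bar>m22 S * y1 \<xi> M\<bar> <= nrm S * rho \<xi> M"
  by (intro abs_mult_le nrm_ge rho_ge)+
 then have "\<bar>m12 M * y1 \<xi> S\<bar> <= nrm (S * M) + nrm S * rho \<xi> M" "\<bar>m12 M * y2 \<xi> S\<bar> <= nrm (S * M) + nrm S * rho \<xi> M"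
  using nrm_ge[of "S * M"] unfolding 1 2 by linarith+
 then show ?thesis unfolding rho_def by (simp add: abs_mult max_def)
qed

lemma nrm_le_rho:
 assumes "tr M = 0"
 shows "nrm M <= (1 + \<bar>\<xi>\<bar>)\<^sup>2 * (\<bar>real_of_int (m12 M)\<bar> + rho \<xi> M)"
proof -
 let ?b = "\<bar>real_of_int (m12 M)\<bar>" and ?r = "rho \<xi> M" and ?x = "\<bar>\<xi>\<bar>"
 have e: "(1 + ?x)\<^sup>2 * (?b + ?r) = ?b + ?r + 2 * (?x * ?b) + 2 * (?x * ?r) + ?x * (?x * ?b) + ?x * (?x * ?r)"
  by (simp add: power2_eq_square algebra_simps)
 have n: "0 <= ?b" "0 <= ?r" "0 <= ?x * ?b" "0 <= ?x * ?r" "0 <= ?x * (?x * ?b)" "0 <= ?x * (?x * ?r)"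
  using rho_ge(3) by auto
 have a: "\<bar>real_of_int (m11 M)\<bar> <= ?r + ?x * ?b"
 proof -
  have "real_of_int (m11 M) = y1 \<xi> M - \<xi> * m12 M" by (simp add: y1_def)
  moreover have "\<bar>\<xi> * m12 M\<bar> = ?x * ?b" by (simp add: abs_mult)
  ultimately show ?thesis using rho_ge(1)[of \<xi> M] by linarith
 qed
 have "\<bar>real_of_int (m21 M)\<bar> <= ?r + ?x * (?r + ?x * ?b)"
 proof -
  have "real_of_int (m21 M) = y2 \<xi> M + \<xi> * m11 M" by (simp add: y2_def traceless_entries[OF assms])
  moreover have "\<bar>\<xi> * m11 M\<bar> <= ?x * (?r + ?x * ?b)" by (rule abs_mult_le) (use a in auto)
  ultimately show ?thesis using rho_ge(2)[of \<xi> M] by linarith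
 qed
 then have c: "\<bar>real_of_int (m21 M)\<bar> <= ?r + ?x * ?r + ?x * (?x * ?b)" by (simp add: algebra_simps)
 have d: "\<bar>real_of_int (m22 M)\<bar> = \<bar>real_of_int (m11 M)\<bar>" using traceless_entries[OF assms] by simp
 show ?thesis unfolding e by (rule nrm_leI) (use a c d n in linarith)+
qed

text \<open>The determinant expresses \<open>y2\<close> through \<open>y1\<close>; so it is enough
  to control the approximation in one coordinate.\<close>

lemma y2_bound:
 assumes "tr M = 0"
 shows "\<bar>real_of_int (m12 M)\<bar> * \<bar>y2 \<xi> M\<bar> <= \<bar>real_of_int (mdet M)\<bar> + nrm M * \<bar>y1 \<xi> M\<bar>"
proof -
 have "m12 M * y2 \<xi> M = - (real_of_int (mdet M) + m11 M * y1 \<xi> M)"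
  by (simp add: y1_def y2_def mdet_def traceless_entries[OF assms] algebra_simps)
 then have "\<bar>m12 M * y2 \<xi> M\<bar> <= \<bar>real_of_int (mdet M)\<bar> + \<bar>m11 M * y1 \<xi> M\<bar>" by linarith
 moreover have "\<bar>m11 M * y1 \<xi> M\<bar> <= nrm M * \<bar>y1 \<xi> M\<bar>" by (intro abs_mult_le nrm_ge) simp
 ultimately show ?thesis by (simp add: abs_mult)
qed

text \<open>For small error \<open>M\<close> is nearly determined by \<open>m12 M\<close>, and its
  pairing with the form of \<open>A\<close> is nearly \<open>- m12 M\<close> times the value of that
  form at \<open>\<xi>\<close>.\<close>

lemma tr_val_bound:
 assumes "tr M = 0"
 shows "\<bar>real_of_int (tr (A * M)) + m12 M * val \<xi> A\<bar> <= (3 + \<bar>\<xi>\<bar>) * (nrm A * rho \<xi> M)"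
proof -
 have "real_of_int (tr (A * M)) + m12 M * val \<xi> A
   = m11 A * y1 \<xi> M - m22 A * y1 \<xi> M + m12 A * y2 \<xi> M + \<xi> * (m12 A * y1 \<xi> M)"
  by (simp add: tr_def val_def y1_def y2_def mat2_mult_entries traceless_entries[OF assms] algebra_simps power2_eq_square)
 moreover have "\<bar>m11 A * y1 \<xi> M\<bar> <= nrm A * rho \<xi> M" "\<bar>m22 A * y1 \<xi> M\<bar> <= nrm A * rho \<xi> M"
  "\<bar>m12 A * y2 \<xi> M\<bar> <= nrm A * rho \<xi> M" and "\<bar>\<xi> * (m12 A * y1 \<xi> M)\<bar> <= \<bar>\<xi>\<bar> * (nrm A * rho \<xi> M)"
  by (intro abs_mult_le nrm_ge rho_ge order_refl)+
 moreover have "(3 + \<bar>\<xi>\<bar>) * (nrm A * rho \<xi> M) = 3 * (nrm A * rho \<xi> M) + \<bar>\<xi>\<bar> * (nrm A * rho \<xi> M)"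
  by (simp add: algebra_simps)
 ultimately show ?thesis by linarith
qed

lemma val_bound: "\<bar>val \<xi> A\<bar> <= 2 * (1 + \<bar>\<xi>\<bar>)\<^sup>2 * nrm A"
proof -
 let ?n = "nrm A" and ?x = "\<bar>\<xi>\<bar>"
 have "\<bar>real_of_int (m11 A) * \<xi>\<bar> <= ?n * ?x" "\<bar>real_of_int (m22 A) * \<xi>\<bar> <= ?n * ?x"
  "\<bar>real_of_int (m12 A) * \<xi>\<^sup>2\<bar> <= ?n * ?x\<^sup>2" by (intro abs_mult_le nrm_ge; simp)+
 moreover have "val \<xi> A = - real_of_int (m21 A) + m11 A * \<xi> - m22 A * \<xi> + m12 A * \<xi>\<^sup>2"
  by (simp add: val_def algebra_simps)
 moreover have "2 * (1 + ?x)\<^sup>2 * ?n = 2 * ?n + 4 * (?n * ?x) + 2 * (?n * ?x\<^sup>2)"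
  by (simp add: power2_eq_square algebra_simps)
 moreover have "0 <= ?n" "0 <= ?n * ?x" "0 <= ?n * ?x\<^sup>2" by auto
 ultimately show ?thesis using nrm_ge(3)[of A] by linarith
qed

lemma val_traceless_mult: "tr M = 0 ==> val \<xi> (M * A) = y1 \<xi> M * y2 \<xi> A - y2 \<xi> M * y1 \<xi> A"
 by (simp add: val_def y1_def y2_def mat2_mult_entries traceless_entries algebra_simps power2_eq_square)

lemma wedge_adj: "y1 \<xi> A * y2 \<xi> (adj A) - y2 \<xi> A * y1 \<xi> (adj A) = tr A * val \<xi> A"
 by (simp add: val_def y1_def y2_def adj_def tr_def algebra_simps power2_eq_square)

section \<open>Consequences of the multiplicative growth condition\<close>

text \<open>The hypothesis on \<open>c\<close> is the multiplicative growth condition of the definition of Sturmian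
 numbers.\<close>

locale mat_growth = mat_rec +
 fixes c :: real
 assumes c: "0 < c" "c <= 1"
  and growth: "k >= 1 ==> l <= s (k + 1) ==>
   c * nrm (w k) * nrm (w k ^ l * w (k - 1)) <= nrm (w k ^ (l + 1) * w (k - 1))"
  and small: "(\<lambda>k. \<bar>real_of_int (mdet (w k))\<bar> / (nrm (w k))\<^sup>2) \<longlonglongrightarrow> 0"
begin

abbreviation dd :: "nat \<Rightarrow> real" where "dd k \<equiv> \<bar>real_of_int (mdet (w k))\<bar>"
abbreviation W :: "nat \<Rightarrow> real" where "W k \<equiv> nrm (w k)"
abbreviation NPhi :: real where "NPhi \<equiv> nrm Phi0"
abbreviation F :: real where "F \<equiv> \<bar>real_of_int (m0 * e0)\<bar>"
text \<open>The denominator pays for passing from the products of the \<open>w k\<close> to the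
  matrices \<open>T k l\<close> and back, at a cost of \<open>2 * NPhi\<close> each way.\<close>

definition c1 :: real where "c1 = c / (4 * NPhi\<^sup>2)"

lemma nrm_Phi [simp]: "nrm (Phi k) = NPhi" by (simp add: Phi_def)

lemma F_ge_1: "F >= 1"
proof -
 have "m0 * e0 ~= 0" using m0_nz e0_nz by simp
 then show ?thesis by linarith
qed

lemma w_nz: "w k ~= 0" using det_nz[of k] by auto

lemma W_ge_1: "W k >= 1" using w_nz by (rule nrm_ge_1)

lemma W_pos: "W k > 0" using W_ge_1[of k] by linarith

lemma dd_ge_1: "dd k >= 1"
 using det_nz[of k] by linarith

lemma NPhi_ge_1: "NPhi >= 1"
proof (rule nrm_ge_1)
 show "Phi0 ~= 0" using mdet_Phi_nz[of 1] by (auto simp: Phi_def)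
qed

lemma c1_pos: "c1 > 0" using c NPhi_ge_1 by (simp add: c1_def)

lemma T_nrm_le: "nrm (T k l) <= 2 * NPhi * nrm (w k ^ l * w (k - 1))"
 using nrm_mult[of "w k ^ l * w (k - 1)" "Phi k"] by (simp add: T_def mult_ac)

text \<open>Multiplying by the adjugate of \<open>Phi k\<close> recovers the product up to the
  scalar \<open>m0 * e0\<close>, a non-zero integer.\<close>

lemma T_nrm_ge: "nrm (w k ^ l * w (k - 1)) <= 2 * NPhi * nrm (T k l)"
proof -
 have "T k l * Phi (k + 1) = w k ^ l * w (k - 1) * of_int (m0 * e0)"
  unfolding T_def mult.assoc Phi_mult(1) ..
 also have "... = of_int (m0 * e0) * (w k ^ l * w (k - 1))" by (rule mult_of_int_commute[symmetric])
 finally have "F * nrm (w k ^ l * w (k - 1)) <= 2 * nrm (T k l) * NPhi"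
  using nrm_mult[of "T k l" "Phi (k + 1)"] by (simp del: of_int_mult)
 moreover have "1 * nrm (w k ^ l * w (k - 1)) <= F * nrm (w k ^ l * w (k - 1))"
  using F_ge_1 by (intro mult_right_mono) auto
 ultimately show ?thesis by (simp add: mult_ac)
qed

lemma mdet_T: "\<bar>real_of_int (mdet (T k l))\<bar> = dd k ^ l * dd (k - 1) * F"
 by (simp add: T_def mdet_Phi abs_mult power_abs)

lemma T_nz: "T k l ~= 0"
proof -
 have "mdet (T k l) ~= 0" using det_nz mdet_Phi_nz by (simp add: T_def)
 then show ?thesis by auto
qed

lemma T_nrm_pos: "nrm (T k l) > 0" using nrm_ge_1[OF T_nz[of k l]] by linarith

lemma T_growth:
 assumes "k >= 1" "l <= s (k + 1)"
 shows "c1 * W k * nrm (T k l) <= nrm (T k (l + 1))"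
proof -
 have "c * W k * nrm (T k l) <= c * W k * (2 * NPhi * nrm (w k ^ l * w (k - 1)))"
  using c by (intro mult_left_mono T_nrm_le) auto
 also have "... = 2 * NPhi * (c * W k * nrm (w k ^ l * w (k - 1)))" by simp
 also have "... <= 2 * NPhi * nrm (w k ^ (l + 1) * w (k - 1))" using growth[OF assms] by (intro mult_left_mono) auto
 also have "... <= 2 * NPhi * (2 * NPhi * nrm (T k (l + 1)))" by (intro mult_left_mono T_nrm_ge) auto
 finally have "c * W k * nrm (T k l) <= (4 * NPhi\<^sup>2) * nrm (T k (l + 1))" by (simp add: power2_eq_square)
 then show ?thesis using NPhi_ge_1 by (simp add: c1_def field_simps)
qed

lemma T_upper: "nrm (T k (l + 1)) <= 2 * W k * nrm (T k l)"
 using nrm_mult[of "w k" "T k l"] by (simp add: T_Suc)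

text \<open>The expected order of the distance from \<open>\<xi>\<close> to the quotient of the
  first two coordinates of the point of \<open>T k l\<close>.\<close>

definition D :: "nat \<Rightarrow> nat \<Rightarrow> real" where "D k l = \<bar>real_of_int (mdet (T k l))\<bar> / (nrm (T k l))\<^sup>2"

lemma D_nonneg: "D k l >= 0" by (simp add: D_def)

lemma D_Suc:
 assumes "k >= 1" "l <= s (k + 1)"
 shows "D k (l + 1) <= D k l * (dd k / (W k)\<^sup>2) / c1\<^sup>2"
proof -
 have "D k (l + 1) = dd k * \<bar>real_of_int (mdet (T k l))\<bar> / (nrm (T k (l + 1)))\<^sup>2"
  by (simp add: D_def T_Suc abs_mult)
 also have "... <= dd k * \<bar>real_of_int (mdet (T k l))\<bar> / (c1 * W k * nrm (T k l))\<^sup>2"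
  using T_growth[OF assms] c1_pos W_pos T_nrm_pos by (intro divide_left_mono power_mono mult_pos_pos zero_less_power) auto
 also have "... = D k l * (dd k / (W k)\<^sup>2) / c1\<^sup>2" by (simp add: D_def power_mult_distrib mult_ac)
 finally show ?thesis .
qed

text \<open>Up to a scalar, \<open>T k l\<close> has the left factor \<open>T (k + 1) 0\<close>,
  whose square is scalar. Multiplying by this matrix once more therefore leaves only its determinant
  and the cofactor \<open>R\<close>, which is smaller than \<open>T k l\<close> by about the factor
  \<open>W k\<close>.\<close>

lemma factor_through:
 assumes "k >= 1" "l >= 1"
 defines "R \<equiv> Phi k * (w k ^ (l - 1) * w (k - 1)) * Phi k"
 shows "T (k + 1) 0 * R = of_int (m0 * e0) * T k l"
  and "of_int (m0 * e0) * (T (k + 1) 0 * T k l) = of_int (- mdet (T (k + 1) 0)) * R"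
  and "of_int (m0 * e0) * (T k l * T (k + 1) 0) = of_int (- mdet (T (k + 1) 0)) * adj R"
proof -
 let ?M = "T (k + 1) 0"
 have trM: "tr ?M = 0" and trT: "tr (T k l) = 0" using assms(1) by (auto intro: tr_T)
 have "?M * R = w k * (Phi (k + 1) * Phi k) * (w k ^ (l - 1) * w (k - 1) * Phi k)"
  by (simp add: T_def R_def mult.assoc)
 also have "... = of_int (m0 * e0) * (w k * (w k ^ (l - 1) * w (k - 1) * Phi k))"
  unfolding Phi_mult(2) by (simp only: mult.assoc mult_of_int_left)
 also have "w k * (w k ^ (l - 1) * w (k - 1) * Phi k) = T k l"
  using assms(2) by (cases l) (auto simp: T_def mult.assoc)
 finally show 1: "?M * R = of_int (m0 * e0) * T k l" .
 have "of_int (m0 * e0) * (?M * T k l) = ?M * (?M * R)" unfolding 1 by (rule mult_of_int_left[symmetric])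
 also have "... = of_int (- mdet ?M) * R" using traceless_square[OF trM] by (simp add: mult.assoc[symmetric])
 finally show "of_int (m0 * e0) * (?M * T k l) = of_int (- mdet ?M) * R" .
 then have h: "adj (of_int (m0 * e0) * (?M * T k l)) = adj (of_int (- mdet ?M) * R)" by (simp only:)
 have a: "adj (of_int a * A) = of_int a * adj A" for a A by (simp add: mat2_simps)
 have "adj (?M * T k l) = T k l * ?M" using traceless_adj[OF trM] traceless_adj[OF trT] by (simp add: adj_mult)
 then show "of_int (m0 * e0) * (T k l * ?M) = of_int (- mdet ?M) * adj R" using h unfolding a by (simp only:)
qed

definition c2 :: real where "c2 = 8 * NPhi ^ 3 / c"

text \<open>Compared with the trivial bound for the norm of a product this gains the factor
  \<open>dd k / (W k)^2\<close>, up to constants.\<close>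

lemma product_bound:
 assumes "k >= 1" "1 <= l" "l <= s (k + 1) + 1"
 shows "nrm (T (k + 1) 0 * T k l) <= c2 * dd k * nrm (T k l) / W k"
  and "nrm (T k l * T (k + 1) 0) <= c2 * dd k * nrm (T k l) / W k"
proof -
 let ?v = "w k ^ (l - 1) * w (k - 1)" and ?M = "T (k + 1) 0"
 let ?R = "Phi k * ?v * Phi k"
 have "nrm ?R <= 2 * (2 * NPhi * nrm ?v) * NPhi"
  using nrm_mult[of "Phi k * ?v" "Phi k"] nrm_mult[of "Phi k" ?v] NPhi_ge_1
  by (smt (verit) mult_left_mono mult_right_mono nrm_Phi)
 also have "... = 4 * NPhi\<^sup>2 * nrm ?v" by (simp add: power2_eq_square)
 finally have R: "nrm ?R <= 4 * NPhi\<^sup>2 * nrm ?v" .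
 have "c * W k * nrm ?v <= nrm (w k ^ l * w (k - 1))" using growth[OF assms(1), of "l - 1"] assms by simp
 also have "... <= 2 * NPhi * nrm (T k l)" by (rule T_nrm_ge)
 finally have "nrm ?v <= 2 * NPhi * nrm (T k l) / (c * W k)" using c W_pos[of k] by (simp add: field_simps)
 then have "4 * NPhi\<^sup>2 * nrm ?v <= 4 * NPhi\<^sup>2 * (2 * NPhi * nrm (T k l) / (c * W k))" by (intro mult_left_mono) auto
 with R have R2: "nrm ?R <= c2 * nrm (T k l) / W k"
  by (simp add: c2_def power2_eq_square power3_eq_cube field_simps)
 have dM: "\<bar>real_of_int (- mdet ?M)\<bar> = dd k * F" using mdet_T[of "k + 1" 0] by simp
 have F0: "F > 0" using F_ge_1 by linarith
 have *: "nrm A <= c2 * dd k * nrm (T k l) / W k"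
  if "of_int (m0 * e0) * A = of_int (- mdet ?M) * B" "nrm B = nrm ?R" for A B
 proof -
  have "F * nrm A = dd k * F * nrm ?R"
   using arg_cong[OF that(1), of nrm] unfolding nrm_of_int_mult dM that(2) .
  then have "nrm A = dd k * nrm ?R" using F0 by simp
  also have "... <= dd k * (c2 * nrm (T k l) / W k)" using R2 by (intro mult_left_mono) auto
  finally show ?thesis by (simp add: mult_ac)
 qed
 show "nrm (?M * T k l) <= c2 * dd k * nrm (T k l) / W k"
  by (rule *[OF factor_through(2)[OF assms(1,2)]]) simp
 show "nrm (T k l * ?M) <= c2 * dd k * nrm (T k l) / W k"
  by (rule *[OF factor_through(3)[OF assms(1,2)]]) simp
qed

lemma c2_pos: "c2 > 0" using c NPhi_ge_1 by (simp add: c2_def)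

end

section \<open>Convergence of the points to \<open>\<xi>\<close> and sharp error bounds\<close>

locale mat_limit = mat_growth +
 fixes \<xi> :: real
 assumes rho0: "(\<lambda>k. rho \<xi> (T (k + 1) 0) / W k) \<longlonglongrightarrow> 0"
begin

definition K :: real where "K = (1 + \<bar>\<xi>\<bar>)\<^sup>2"

lemma K_ge_1: "K >= 1"
 using power_mono[of 1 "1 + \<bar>\<xi>\<bar>" 2] by (simp add: K_def)

lemma M_nrm: "W k <= 2 * NPhi * nrm (T (k + 1) 0)"
 using T_nrm_ge[of "k + 1" 0] by simp

lemma lead_of_small_rho:
 assumes "tr M = 0" "2 * K * rho \<xi> M <= nrm M"
 shows "nrm M <= 2 * K * \<bar>real_of_int (m12 M)\<bar>"
 using nrm_le_rho[OF assms(1), of \<xi>] assms(2) by (simp add: K_def algebra_simps)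

lemma eventually_less:
 assumes "f \<longlonglongrightarrow> 0" "(\<epsilon>::real) > 0"
 shows "EV k. f k < \<epsilon>"
 using order_tendstoD(2)[OF assms(1)] assms(2) by blast

lemma M_lead: "EV k. nrm (T (k + 1) 0) <= 2 * K * \<bar>real_of_int (m12 (T (k + 1) 0))\<bar>"
proof -
 have "1 / (4 * K * NPhi) > 0" using K_ge_1 NPhi_ge_1 by simp
 from eventually_less[OF rho0 this] show ?thesis
 proof eventually_elim
  case (elim k)
  then have "rho \<xi> (T (k + 1) 0) * (4 * K * NPhi) <= W k"
   using W_pos[of k] K_ge_1 NPhi_ge_1 by (simp add: field_simps)
  also have "... <= 2 * NPhi * nrm (T (k + 1) 0)" by (rule M_nrm)
  finally have "(2 * NPhi) * (2 * K * rho \<xi> (T (k + 1) 0)) <= (2 * NPhi) * nrm (T (k + 1) 0)" by (simp add: mult_ac)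
  then have "2 * K * rho \<xi> (T (k + 1) 0) <= nrm (T (k + 1) 0)" using NPhi_ge_1 by simp
  then show ?case using tr_T[of "k + 1" 0] by (intro lead_of_small_rho) auto
 qed
qed

text \<open>\<open>rho_image\<close> with \<open>M = T (k + 1) 0\<close>: the product is small by
  \<open>product_bound\<close> and the error of \<open>M\<close> by hypothesis. Both contributions
  are proportional to \<open>nrm (T k l)\<close>, which gives uniformity in
  \<open>l\<close>.\<close>

lemma rho_T_small:
 assumes "\<epsilon> > 0"
 shows "EV k. \<forall>l\<in>{1..s (k + 1) + 1}. rho \<xi> (T k l) <= \<epsilon> * nrm (T k l)"
proof -
 have "(\<lambda>k. 4 * K * NPhi * (c2 * (dd k / (W k)\<^sup>2) + rho \<xi> (T (k + 1) 0) / W k)) \<longlonglongrightarrow> 4 * K * NPhi * (c2 * 0 + 0)"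
  by (intro tendsto_intros small rho0)
 then have "EV k. 4 * K * NPhi * (c2 * (dd k / (W k)\<^sup>2) + rho \<xi> (T (k + 1) 0) / W k) < \<epsilon>"
  using assms by (intro eventually_less) auto
 then show ?thesis using M_lead eventually_ge_at_top[of 1]
 proof eventually_elim
  case (elim k)
  show ?case
  proof
   fix l assume l: "l \<in> {1..s (k + 1) + 1}"
   let ?M = "T (k + 1) 0" and ?T = "T k l"
   have Wp: "W k > 0" by (rule W_pos)
   have "W k * rho \<xi> ?T <= 2 * NPhi * (2 * K * \<bar>real_of_int (m12 ?M)\<bar>) * rho \<xi> ?T"
    using M_nrm[of k] elim(2) NPhi_ge_1 rho_ge(3)
    by (intro mult_right_mono order_trans[OF M_nrm] mult_left_mono) auto
   also have "... = 4 * K * NPhi * (\<bar>real_of_int (m12 ?M)\<bar> * rho \<xi> ?T)" by simp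
   also have "... <= 4 * K * NPhi * (nrm (?T * ?M) + nrm ?T * rho \<xi> ?M)"
    using K_ge_1 NPhi_ge_1 tr_T[of "k + 1" 0] by (intro mult_left_mono rho_image) auto
   also have "... <= 4 * K * NPhi * (c2 * dd k * nrm ?T / W k + nrm ?T * rho \<xi> ?M)"
    using product_bound(2)[OF elim(3), of l] l K_ge_1 NPhi_ge_1 by (intro mult_left_mono add_right_mono) auto
   also have "... = W k * (nrm ?T * (4 * K * NPhi * (c2 * (dd k / (W k)\<^sup>2) + rho \<xi> ?M / W k)))"
    using Wp by (simp add: field_simps power2_eq_square)
   also have "... <= W k * (nrm ?T * \<epsilon>)" using elim(1) Wp by (intro mult_left_mono) auto
   finally show "rho \<xi> ?T <= \<epsilon> * nrm ?T" using Wp by (simp add: mult_ac)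
  qed
 qed
qed

lemma T_lead: "EV k. \<forall>l\<in>{1..s (k + 1) + 1}. nrm (T k l) <= 2 * K * \<bar>real_of_int (m12 (T k l))\<bar>"
proof -
 have "1 / (2 * K) > 0" using K_ge_1 by simp
 from rho_T_small[OF this] eventually_ge_at_top[of 1] show ?thesis
 proof eventually_elim
  case (elim k)
  show ?case
  proof
   fix l assume "l \<in> {1..s (k + 1) + 1}"
   then have "rho \<xi> (T k l) <= 1 / (2 * K) * nrm (T k l)" using elim by blast
   then have "2 * K * rho \<xi> (T k l) <= nrm (T k l)" using K_ge_1 by (simp add: field_simps)
   then show "nrm (T k l) <= 2 * K * \<bar>real_of_int (m12 (T k l))\<bar>"
    using tr_T elim by (intro lead_of_small_rho) auto
  qed
 qed
qed

text \<open>The quotient of the second by the first coordinate of \<open>X_vec (T k l)\<close>, a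
  rational approximation to \<open>\<xi>\<close>.\<close>

definition \<zeta> :: "nat \<Rightarrow> nat \<Rightarrow> real" where "\<zeta> k l = - real_of_int (m11 (T k l)) / real_of_int (m12 (T k l))"

lemma zeta_dist:
 assumes "nrm (T k l) <= 2 * K * \<bar>real_of_int (m12 (T k l))\<bar>"
 shows "\<bar>real_of_int (m12 (T k l))\<bar> * \<bar>\<zeta> k l - \<xi>\<bar> = \<bar>y1 \<xi> (T k l)\<bar>" and "m12 (T k l) ~= 0"
proof -
 show nz: "m12 (T k l) ~= 0" using assms T_nrm_pos[of k l] by auto
 then have "m12 (T k l) * (\<zeta> k l - \<xi>) = - y1 \<xi> (T k l)" by (simp add: \<zeta>_def y1_def field_simps)
 then show "\<bar>real_of_int (m12 (T k l))\<bar> * \<bar>\<zeta> k l - \<xi>\<bar> = \<bar>y1 \<xi> (T k l)\<bar>"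
  unfolding abs_mult[symmetric] by simp
qed

definition c3 :: real where "c3 = 4 * K\<^sup>2 / c1"

lemma c3_pos: "c3 > 0" using K_ge_1 c1_pos by (simp add: c3_def)

text \<open>The difference of two such quotients has as numerator the upper right entry of the
  product of the two traceless matrices, and by \<open>traceless_conj\<close> this product is only a
  determinant times \<open>adj (w k)\<close>.\<close>

lemma zeta_step:
 assumes k: "k >= 1" "l <= s (k + 1)"
  and a: "nrm (T k l) <= 2 * K * \<bar>real_of_int (m12 (T k l))\<bar>"
  and b: "nrm (T k (l + 1)) <= 2 * K * \<bar>real_of_int (m12 (T k (l + 1)))\<bar>"
 shows "\<bar>\<zeta> k (l + 1) - \<zeta> k l\<bar> <= c3 * D k l"
proof -
 let ?M = "T k l" and ?N = "T k (l + 1)"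
 let ?b = "real_of_int (m12 ?M)" and ?b' = "real_of_int (m12 ?N)"
 have nz: "?b ~= 0" "?b' ~= 0" using zeta_dist(2)[OF a] zeta_dist(2)[OF b] by auto
 have tr: "tr ?M = 0" "tr ?N = 0" using tr_T k by auto
 have MN: "?M * ?N = of_int (- mdet ?M) * adj (w k)"
  using traceless_conj[OF tr(1), of "w k"] tr_w_T[OF k(1)] by (simp add: T_Suc)
 have "nrm (?M * ?N) = \<bar>real_of_int (mdet ?M)\<bar> * W k" unfolding MN nrm_of_int_mult by simp
 then have num: "\<bar>real_of_int (m12 (?M * ?N))\<bar> <= \<bar>real_of_int (mdet ?M)\<bar> * W k" using nrm_ge(2)[of "?M * ?N"] by simp
 have "\<zeta> k (l + 1) - \<zeta> k l = m12 (?M * ?N) / (?b * ?b')"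
  using nz traceless_entries[OF tr(2)] by (simp add: \<zeta>_def mat2_mult_entries field_simps)
 then have "\<bar>\<zeta> k (l + 1) - \<zeta> k l\<bar> = \<bar>real_of_int (m12 (?M * ?N))\<bar> / (\<bar>?b\<bar> * \<bar>?b'\<bar>)" by (simp add: abs_mult)
 also have "... <= \<bar>real_of_int (mdet ?M)\<bar> * W k / (nrm ?M / (2 * K) * (c1 * W k * nrm ?M / (2 * K)))"
 proof (intro frac_le num mult_mono)
  show "nrm ?M / (2 * K) <= \<bar>?b\<bar>" using a K_ge_1 by (simp add: field_simps)
  have "c1 * W k * nrm ?M <= 2 * K * \<bar>?b'\<bar>" using T_growth[OF k] b by linarith
  then show "c1 * W k * nrm ?M / (2 * K) <= \<bar>?b'\<bar>" using K_ge_1 by (simp add: field_simps)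
  show "0 < nrm ?M / (2 * K) * (c1 * W k * nrm ?M / (2 * K))" using T_nrm_pos K_ge_1 c1_pos W_pos by (intro mult_pos_pos divide_pos_pos) auto
 qed (use c1_pos K_ge_1 in auto)
 also have "... = c3 * D k l" using W_pos[of k] by (simp add: c3_def D_def power2_eq_square field_simps)
 finally show ?thesis .
qed

text \<open>The distance of \<open>\<zeta> k l\<close> to \<open>\<xi>\<close>, diminished by a multiple of \<open>D k l\<close>, increases along the
 chain of all \<open>(k, l)\<close> and tends to a limit that is at most 0.\<close>

lemma zeta_bound: "EV k. \<forall>l\<in>{1..s (k + 1) + 1}. \<bar>\<zeta> k l - \<xi>\<bar> <= 2 * c3 * D k l"
proof -
 define g where "g k l = \<bar>\<zeta> k l - \<xi>\<bar> - 2 * c3 * D k l" for k l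
 \<comment> \<open>This threshold makes \<open>D\<close> decrease by a factor of at least 2 at each
   step, so the sum of all later steps is at most \<open>2 * c3 * D k l\<close>.\<close>
 have "c1\<^sup>2 / 2 > 0" using c1_pos by simp
 from eventually_less[OF small this] T_lead eventually_ge_at_top[of 1]
 have "EV k. k >= 1 & (\<forall>l\<in>{1..s (k + 1)}. g k l <= g k (l + 1))"
 proof eventually_elim
  case (elim k)
  have "g k l <= g k (l + 1)" if l: "l \<in> {1..s (k + 1)}" for l
  proof -
   have "D k (l + 1) <= D k l * (dd k / (W k)\<^sup>2) / c1\<^sup>2" using D_Suc[of k l] elim l by simp
   also have "... <= D k l * (c1\<^sup>2 / 2) / c1\<^sup>2"
    using elim(1) D_nonneg by (intro divide_right_mono mult_left_mono) auto
   also have "... = D k l / 2" using c1_pos by simp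
   finally have D2: "D k (l + 1) <= D k l / 2" .
   have "\<bar>\<zeta> k (l + 1) - \<zeta> k l\<bar> <= c3 * D k l" by (rule zeta_step) (use elim l in auto)
   moreover have "c3 * D k (l + 1) <= c3 * (D k l / 2)" using D2 c3_pos by (intro mult_left_mono) auto
   ultimately show ?thesis unfolding g_def by (simp add: algebra_simps)
  qed
  then show ?case using elim(3) by blast
 qed
 then obtain k0 where k0: "!!k. k >= k0 ==> k >= 1 & (\<forall>l\<in>{1..s (k + 1)}. g k l <= g k (l + 1))"
  by (auto simp: eventually_sequentially)
 have joint: "g k (s (k + 1) + 1) = g (k + 1) 1" if "k >= k0" for k
  using T_joint[of k] k0[OF that] by (simp add: g_def \<zeta>_def D_def)
 have step_chain: "g k l <= g (k + 1) 1" if "k >= k0" "1 <= l" "l <= s (k + 1) + 1" for k l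
 proof -
  have up: "g k n <= g k (n + 1)" if "1 <= n" "n <= s (k + 1)" for n
   using k0[OF \<open>k >= k0\<close>] that by auto
  have "g k n <= g k (s (k + 1) + 1)" if "n <= s (k + 1) + 1" "1 <= n" for n
   using that
  proof (induction rule: inc_induct)
   case (step n)
   have "g k n <= g k (n + 1)" using up step by simp
   also have "... <= g k (s (k + 1) + 1)" using step by simp
   finally show ?case .
  qed simp
  then have "g k l <= g k (s (k + 1) + 1)" using that by blast
  then show ?thesis using joint[OF that(1)] by simp
 qed
 have mono: "g k 1 <= g j 1" if "k >= k0" "k <= j" for k j
  using that(2)
 proof (induction rule: dec_induct)
  case (step n)
  have "g n 1 <= g (n + 1) 1" using step_chain[of n 1] step that by simp
  with step show ?case by simp
 qed simp
 have lim: "g k 1 <= 0" if k: "k >= k0" for k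
 proof (rule field_le_epsilon)
  fix \<epsilon> :: real assume e: "\<epsilon> > 0"
  then have "\<epsilon> / (2 * K) > 0" using K_ge_1 by simp
  from rho_T_small[OF this] T_lead eventually_ge_at_top[of k]
  have "EV j. g k 1 <= \<epsilon>"
  proof eventually_elim
   case (elim j)
   have lead: "nrm (T j 1) <= 2 * K * \<bar>real_of_int (m12 (T j 1))\<bar>" using elim by auto
   have "\<bar>real_of_int (m12 (T j 1))\<bar> * \<bar>\<zeta> j 1 - \<xi>\<bar> <= rho \<xi> (T j 1)"
    unfolding zeta_dist(1)[OF lead] by (rule rho_ge)
   also have "... <= \<epsilon> / (2 * K) * nrm (T j 1)" using elim by auto
   also have "... <= \<epsilon> / (2 * K) * (2 * K * \<bar>real_of_int (m12 (T j 1))\<bar>)" using lead e K_ge_1 by (intro mult_left_mono) auto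
   also have "... = \<bar>real_of_int (m12 (T j 1))\<bar> * \<epsilon>" using K_ge_1 by simp
   finally have "\<bar>\<zeta> j 1 - \<xi>\<bar> <= \<epsilon>" using zeta_dist(2)[OF lead] by simp
   moreover have "0 <= 2 * c3 * D j 1" using c3_pos D_nonneg by simp
   ultimately have "g j 1 <= \<epsilon>" by (simp add: g_def)
   then show ?case using mono[OF k elim(3)] by simp
  qed
  then show "g k 1 <= 0 + \<epsilon>" by simp
 qed
 show ?thesis using eventually_ge_at_top[of k0]
 proof eventually_elim
  case (elim k)
  show ?case
  proof
   fix l assume "l \<in> {1..s (k + 1) + 1}"
   then have "g k l <= g (k + 1) 1" using step_chain elim by auto
   also have "... <= 0" using lim elim by simp
   finally show "\<bar>\<zeta> k l - \<xi>\<bar> <= 2 * c3 * D k l" by (simp add: g_def)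
  qed
 qed
qed

definition c4 :: real where "c4 = 2 * K * (1 + 2 * c3)"

lemma c4_pos: "c4 > 0" using K_ge_1 c3_pos by (simp add: c4_def)

text \<open>The bound for \<open>y1\<close> is \<open>zeta_bound\<close> multiplied by
  \<open>m12\<close>; the one for \<open>y2\<close> follows through the determinant.\<close>

lemma rho_T_bound: "EV k. \<forall>l\<in>{1..s (k + 1) + 1}. rho \<xi> (T k l) <= c4 * \<bar>real_of_int (mdet (T k l))\<bar> / nrm (T k l)"
 using zeta_bound T_lead eventually_ge_at_top[of 1]
proof eventually_elim
 case (elim k)
 show ?case
 proof
  fix l assume l: "l \<in> {1..s (k + 1) + 1}"
  let ?M = "T k l"
  let ?b = "\<bar>real_of_int (m12 ?M)\<bar>" and ?d = "\<bar>real_of_int (mdet ?M)\<bar>" and ?n = "nrm ?M"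
  have n: "?n > 0" by (rule T_nrm_pos)
  have lead: "?n <= 2 * K * ?b" using elim l by auto
  have b: "?b > 0" using zeta_dist(2)[OF lead] by simp
  have "\<bar>y1 \<xi> ?M\<bar> = ?b * \<bar>\<zeta> k l - \<xi>\<bar>" using zeta_dist(1)[OF lead] by simp
  also have "... <= ?n * (2 * c3 * D k l)" using elim(1) l nrm_ge by (intro mult_mono) auto
  also have "... = 2 * c3 * ?d / ?n" using n by (simp add: D_def power2_eq_square field_simps)
  finally have y1: "\<bar>y1 \<xi> ?M\<bar> <= 2 * c3 * ?d / ?n" .
  have "?n * \<bar>y1 \<xi> ?M\<bar> <= 2 * c3 * ?d" using y1 n by (simp add: field_simps)
  then have "?b * \<bar>y2 \<xi> ?M\<bar> <= ?d + 2 * c3 * ?d" using y2_bound[of ?M \<xi>] tr_T[OF elim(3)] by simp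
  then have "2 * K * (?b * \<bar>y2 \<xi> ?M\<bar>) <= 2 * K * (?d + 2 * c3 * ?d)" using K_ge_1 by (intro mult_left_mono) auto
  moreover have "?n * \<bar>y2 \<xi> ?M\<bar> <= 2 * K * ?b * \<bar>y2 \<xi> ?M\<bar>" using lead by (intro mult_right_mono) auto
  ultimately have "?n * \<bar>y2 \<xi> ?M\<bar> <= c4 * ?d" by (simp add: c4_def algebra_simps)
  then have y2: "\<bar>y2 \<xi> ?M\<bar> <= c4 * ?d / ?n" using n by (simp add: field_simps)
  have "1 * (1 + 2 * c3) <= 2 * K * (1 + 2 * c3)" using K_ge_1 c3_pos by (intro mult_right_mono) auto
  then have "2 * c3 <= c4" by (simp add: c4_def)
  then have "2 * c3 * ?d / ?n <= c4 * ?d / ?n" using n by (intro divide_right_mono mult_right_mono) auto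
  then show "rho \<xi> ?M <= c4 * ?d / ?n" using y1 y2 unfolding rho_def by simp
 qed
qed

text \<open>The exact pairing of the form of \<open>w k\<close> with \<open>T (k + 1) 2\<close> is
  compared with \<open>- m12\<close> times its value at \<open>\<xi>\<close>. The discrepancy is
  negligible because it carries the factor \<open>dd (k + 1) / (W (k + 1))^2\<close>, which tends to
  0; as \<open>m12\<close> is comparable with the norm of \<open>T (k + 1) 2\<close>, the value is
  known up to a constant.\<close>

lemma val_estimate:
 obtains A where "A > 0"
  "EV k. dd k * dd (k + 1) <= A * ((W (k + 1))\<^sup>2 * W k * \<bar>val \<xi> (w k)\<bar>)"
  "EV k. (W (k + 1))\<^sup>2 * W k * \<bar>val \<xi> (w k)\<bar> <= A * (dd k * dd (k + 1))"
proof -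
 define E where "E = \<bar>real_of_int e0\<bar>"
 have E1: "E >= 1" unfolding E_def using e0_nz by linarith
 define c5 where "c5 = (3 + \<bar>\<xi>\<bar>) * c4 * F * (2 * NPhi / c1\<^sup>2)"
 define c6 where "c6 = 2 * NPhi / c1\<^sup>2"
 define A where "A = 16 * NPhi + 4 * E * K * c6"
 have c6: "c6 > 0" using NPhi_ge_1 c1_pos by (simp add: c6_def)
 have A: "A > 0" "A >= 16 * NPhi" "A >= 4 * E * K * c6"
  using NPhi_ge_1 E1 K_ge_1 c6 by (auto simp: A_def add_pos_nonneg)
 have "(\<lambda>k. c5 * (dd k / (W k)\<^sup>2)) \<longlonglongrightarrow> c5 * 0" by (intro tendsto_intros small)
 then have "EV k. c5 * (dd (k + 1) / (W (k + 1))\<^sup>2) < 1 / 2"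
  using eventually_less[of "\<lambda>k. c5 * (dd k / (W k)\<^sup>2)" "1/2"] eventually_sequentially_Suc[of "\<lambda>k. c5 * (dd k / (W k)\<^sup>2) < 1 / 2"] by simp
 moreover have "EV k. \<forall>l\<in>{1..s (k + 2) + 1}. nrm (T (k + 1) l) <= 2 * K * \<bar>real_of_int (m12 (T (k + 1) l))\<bar>"
  using T_lead eventually_sequentially_Suc[of "\<lambda>k. \<forall>l\<in>{1..s (k + 1) + 1}. nrm (T k l) <= 2 * K * \<bar>real_of_int (m12 (T k l))\<bar>"] by simp
 moreover have "EV k. \<forall>l\<in>{1..s (k + 2) + 1}. rho \<xi> (T (k + 1) l) <= c4 * \<bar>real_of_int (mdet (T (k + 1) l))\<bar> / nrm (T (k + 1) l)"
  using rho_T_bound eventually_sequentially_Suc[of "\<lambda>k. \<forall>l\<in>{1..s (k + 1) + 1}. rho \<xi> (T k l) <= c4 * \<bar>real_of_int (mdet (T k l))\<bar> / nrm (T k l)"] by simp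
 ultimately have "EV k. dd k * dd (k + 1) <= A * ((W (k + 1))\<^sup>2 * W k * \<bar>val \<xi> (w k)\<bar>) &
   (W (k + 1))\<^sup>2 * W k * \<bar>val \<xi> (w k)\<bar> <= A * (dd k * dd (k + 1))"
  using eventually_ge_at_top[of 1]
 proof eventually_elim
  case (elim k)
  let ?T = "T (k + 1) 2" and ?Z = "(W (k + 1))\<^sup>2 * W k"
  let ?v = "\<bar>val \<xi> (w k)\<bar>" and ?b = "\<bar>real_of_int (m12 (T (k + 1) 2))\<bar>"
  \<comment> \<open>The index 2 lies in the admissible range because \<open>s (k + 2)\<close> is at
    least 1.\<close>
  have two: "2 \<in> {1..s (k + 2) + 1}" using s_pos[of "k + 2"] by simp
  have lead: "nrm ?T <= 2 * K * ?b" and rT: "rho \<xi> ?T <= c4 * \<bar>real_of_int (mdet ?T)\<bar> / nrm ?T" using elim two by auto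
  have s1: "1 <= s (k + 1 + 1)" using s_pos[of "k + 1 + 1"] by simp
  have Z: "?Z > 0" using W_pos by (intro mult_pos_pos zero_less_power)
  have T0: "W k <= 2 * NPhi * nrm (T (k + 1) 0)" "nrm (T (k + 1) 0) <= 2 * NPhi * W k" using M_nrm T_nrm_le[of "k + 1" 0] by auto
  have t1: "c1 * W (k + 1) * nrm (T (k + 1) 0) <= nrm (T (k + 1) 1)" using T_growth[of "k + 1" 0] by simp
  have t2: "c1 * W (k + 1) * nrm (T (k + 1) 1) <= nrm ?T" using T_growth[of "k + 1" 1] s1 by (simp add: numeral_2_eq_2)
  have lo: "?Z <= c6 * nrm ?T"
  proof -
   have "c1\<^sup>2 * ?Z <= c1\<^sup>2 * ((W (k + 1))\<^sup>2 * (2 * NPhi * nrm (T (k + 1) 0)))" using T0(1) by (intro mult_left_mono) auto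
   also have "... = 2 * NPhi * (c1 * W (k + 1) * (c1 * W (k + 1) * nrm (T (k + 1) 0)))" by (simp add: power2_eq_square)
   also have "... <= 2 * NPhi * (c1 * W (k + 1) * nrm (T (k + 1) 1))" using t1 c1_pos by (intro mult_left_mono) auto
   also have "... <= 2 * NPhi * nrm ?T" using t2 by (intro mult_left_mono) auto
   finally show ?thesis using c1_pos by (simp add: c6_def field_simps)
  qed
  have hi: "nrm ?T <= 8 * NPhi * ?Z"
  proof -
   have "nrm ?T <= 2 * W (k + 1) * nrm (T (k + 1) 1)" using T_upper[of "k + 1" 1] by (simp add: numeral_2_eq_2)
   also have "... <= 2 * W (k + 1) * (2 * W (k + 1) * nrm (T (k + 1) 0))" using T_upper[of "k + 1" 0] by (intro mult_left_mono) auto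
   also have "... <= 2 * W (k + 1) * (2 * W (k + 1) * (2 * NPhi * W k))" using T0(2) by (intro mult_left_mono) auto
   also have "... = 8 * NPhi * ?Z" by (simp add: power2_eq_square)
   finally show ?thesis .
  qed
  let ?P = "dd k * dd (k + 1)"
  have P: "?P > 0" using dd_ge_1[of k] dd_ge_1[of "k + 1"] by (intro mult_pos_pos) linarith+
  have trv: "\<bar>real_of_int (tr (w k * ?T))\<bar> = ?P * E" using tr_w_T_2[OF elim(4)] by (simp add: abs_mult E_def)
  have "\<bar>real_of_int (tr (w k * ?T)) + m12 ?T * val \<xi> (w k)\<bar> <= (3 + \<bar>\<xi>\<bar>) * (W k * rho \<xi> ?T)"
   by (rule tr_val_bound) (rule tr_T, simp)
  also have "... <= (3 + \<bar>\<xi>\<bar>) * (W k * (c4 * (dd (k + 1) ^ 2 * dd k * F) * (c6 / ?Z)))"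
  proof (intro mult_left_mono order_trans[OF rT])
   have "1 / nrm ?T <= c6 / ?Z" using lo Z T_nrm_pos[of "k + 1" 2] by (simp add: field_simps)
   then have "c4 * (dd (k + 1) ^ 2 * dd k * F) * (1 / nrm ?T) <= c4 * (dd (k + 1) ^ 2 * dd k * F) * (c6 / ?Z)"
    using c4_pos F_ge_1 by (intro mult_left_mono) auto
   then show "c4 * \<bar>real_of_int (mdet ?T)\<bar> / nrm ?T <= c4 * (dd (k + 1) ^ 2 * dd k * F) * (c6 / ?Z)"
    unfolding mdet_T by simp
  qed auto
  also have "... = ?P * (c5 * (dd (k + 1) / (W (k + 1))\<^sup>2))"
  proof -
   have "a * (x * (b * (d'\<^sup>2 * d * f) * (g / (y * x)))) = d * d' * (a * b * f * g * (d' / y))"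
    if "x ~= 0" for a b d d' f g x y :: real
    using that by (simp add: power2_eq_square)
   then show ?thesis unfolding c5_def c6_def[symmetric] using W_pos[of k] by (metis less_irrefl)
  qed
  also have "... <= ?P * (1 / 2)" using elim(1) P by (intro mult_left_mono) auto
  finally have "\<bar>real_of_int (tr (w k * ?T)) + m12 ?T * val \<xi> (w k)\<bar> <= ?P / 2" by simp
  moreover have "\<bar>m12 ?T * val \<xi> (w k)\<bar> = ?b * ?v" by (simp add: abs_mult)
  ultimately have bv: "?P * E - ?P / 2 <= ?b * ?v" "?b * ?v <= ?P * E + ?P / 2" using trv by linarith+
  have PE: "?P * 1 <= ?P * E" using E1 P by (intro mult_left_mono) auto
  have "?P <= 2 * (?b * ?v)" using bv(1) PE by linarith
  also have "... <= 2 * (nrm ?T * ?v)" using nrm_ge(2)[of ?T] by (intro mult_left_mono mult_right_mono) auto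
  also have "... <= 2 * (8 * NPhi * ?Z * ?v)" using hi by (intro mult_left_mono mult_right_mono) auto
  also have "... = 16 * NPhi * (?Z * ?v)" by simp
  also have "... <= A * (?Z * ?v)" using A Z by (intro mult_right_mono) auto
  finally have 1: "?P <= A * (?Z * ?v)" .
  have "?Z * ?v <= c6 * nrm ?T * ?v" using lo by (intro mult_right_mono) auto
  also have "... <= c6 * (2 * K * ?b) * ?v" using lead c6 by (intro mult_right_mono mult_left_mono) auto
  also have "... = 2 * K * c6 * (?b * ?v)" by simp
  also have "... <= 2 * K * c6 * (2 * (?P * E))"
  proof (rule mult_left_mono)
   show "?b * ?v <= 2 * (?P * E)" using bv(2) PE P by linarith
   show "0 <= 2 * K * c6" using c6 K_ge_1 by simp
  qed
  also have "... = 4 * E * K * c6 * ?P" by simp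
  also have "... <= A * ?P" using A P by (intro mult_right_mono) auto
  finally show ?case using 1 by simp
 qed
 then show thesis using that[OF A(1)] unfolding eventually_conj_iff by blast
qed

text \<open>Up to the scalar \<open>m0 * e0\<close>, \<open>w k\<close> is
  \<open>T (k + 1) 0 * Phi k\<close>. Since the first factor has small relative error, the leading
  coefficient and the derivative of the form of \<open>w k\<close> are close to multiples of
  \<open>m12 (T (k + 1) 0)\<close>. The multipliers depend only on \<open>Phi k\<close>, hence take
  just two values each, and these are not zero by hypothesis.\<close>

lemma lead_deriv_estimate:
 assumes Phi1: "!!k. \<xi> * m12 (Phi k) - m22 (Phi k) ~= 0" and Phi2: "!!k. val \<xi> (Phi k) ~= 0"
 obtains A where "A > 0" "EV k. A * W k <= \<bar>real_of_int (m12 (w k))\<bar>"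
  "EV k. A * W k <= \<bar>real_of_int (m11 (w k) - m22 (w k)) + 2 * real_of_int (m12 (w k)) * \<xi>\<bar>"
proof -
 define u where "u k = min \<bar>\<xi> * m12 (Phi k) - m22 (Phi k)\<bar> \<bar>val \<xi> (Phi k)\<bar>" for k
 define \<mu> where "\<mu> = min (u 1) (u 2)"
 have u: "u k > 0" for k using Phi1 Phi2 by (simp add: u_def)
 have \<mu>: "\<mu> > 0" using u by (simp add: \<mu>_def)
 have \<mu>_le: "\<mu> <= u k" for k
 proof -
  have "u k = u 1 \<or> u k = u 2" by (simp add: u_def Phi_def)
  then show ?thesis by (auto simp: \<mu>_def)
 qed
 define A where "A = \<mu> / (8 * K * NPhi * F)"
 have F0: "F > 0" using F_ge_1 by linarith
 have A: "A > 0" using \<mu> K_ge_1 NPhi_ge_1 F0 by (simp add: A_def)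
 have "\<mu> / (8 * K * NPhi * (4 + \<bar>\<xi>\<bar>) * NPhi) > 0" using \<mu> K_ge_1 NPhi_ge_1 by (intro divide_pos_pos mult_pos_pos) auto
 from eventually_less[OF rho0 this] M_lead
 have "EV k. A * W k <= \<bar>real_of_int (m12 (w k))\<bar> &
  A * W k <= \<bar>real_of_int (m11 (w k) - m22 (w k)) + 2 * real_of_int (m12 (w k)) * \<xi>\<bar>"
 proof eventually_elim
  case (elim k)
  let ?M = "T (k + 1) 0" and ?G = "Phi k"
  let ?b = "real_of_int (m12 ?M)" and ?r = "rho \<xi> ?M" and ?f = "real_of_int (m0 * e0)"
  have tr: "tr ?M = 0" by (rule tr_T) simp
  have fw: "?M * ?G = of_int (m0 * e0) * w k"
   unfolding T_0 by (simp only: T_0 Suc_eq_plus1[symmetric] mult.assoc Phi_mult(2)[unfolded Suc_eq_plus1[symmetric]]) (simp only: mult_of_int_commute)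
  have e: "?f * m12 (w k) = m12 (?M * ?G)" "?f * m11 (w k) = m11 (?M * ?G)" "?f * m22 (w k) = m22 (?M * ?G)"
   unfolding fw mat2_mult_entries of_int_mat2 by simp_all
  have 1: "?f * m12 (w k) = - ?b * (\<xi> * m12 ?G - m22 ?G) + y1 \<xi> ?M * m12 ?G"
   unfolding e by (simp add: mat2_mult_entries y1_def algebra_simps)
  have 2: "?f * (real_of_int (m11 (w k) - m22 (w k)) + 2 * real_of_int (m12 (w k)) * \<xi>)
    = - ?b * val \<xi> ?G + y1 \<xi> ?M * (m11 ?G + m22 ?G + \<xi> * m12 ?G) - y2 \<xi> ?M * m12 ?G"
  proof -
   have "?f * (real_of_int (m11 (w k) - m22 (w k)) + 2 * real_of_int (m12 (w k)) * \<xi>)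
    = ?f * m11 (w k) - ?f * m22 (w k) + 2 * \<xi> * (?f * m12 (w k))" by (simp add: algebra_simps)
   also have "... = - ?b * val \<xi> ?G + y1 \<xi> ?M * (m11 ?G + m22 ?G + \<xi> * m12 ?G) - y2 \<xi> ?M * m12 ?G"
    unfolding e by (simp add: mat2_mult_entries y1_def y2_def val_def traceless_entries[OF tr, simplified] algebra_simps power2_eq_square)
   finally show ?thesis .
  qed
  have G: "\<bar>real_of_int (m12 ?G)\<bar> <= NPhi" "\<bar>real_of_int (m11 ?G)\<bar> <= NPhi" "\<bar>real_of_int (m22 ?G)\<bar> <= NPhi"
   using nrm_ge[of ?G] by auto
  have s1: "\<bar>y1 \<xi> ?M * m12 ?G\<bar> <= ?r * NPhi" "\<bar>y2 \<xi> ?M * m12 ?G\<bar> <= ?r * NPhi"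
   by (intro abs_mult_le rho_ge G)+
  have s2: "\<bar>y1 \<xi> ?M * (m11 ?G + m22 ?G + \<xi> * m12 ?G)\<bar> <= ?r * (2 * NPhi + \<bar>\<xi>\<bar> * NPhi)"
  proof (intro abs_mult_le rho_ge)
   have "\<bar>\<xi> * m12 ?G\<bar> <= \<bar>\<xi>\<bar> * NPhi" by (intro abs_mult_le G) simp
   then show "\<bar>real_of_int (m11 ?G + m22 ?G) + \<xi> * m12 ?G\<bar> <= 2 * NPhi + \<bar>\<xi>\<bar> * NPhi" using G by simp
  qed
  have rn: "0 <= ?r * NPhi" "0 <= \<bar>\<xi>\<bar> * (?r * NPhi)" using rho_ge(3) NPhi_ge_1 by auto
  have small_r: "?r * NPhi * (4 + \<bar>\<xi>\<bar>) <= \<mu> * W k / (8 * K * NPhi)"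
  proof -
   define y where "y = 4 + \<bar>\<xi>\<bar>"
   have y: "y > 0" by (simp add: y_def add_pos_nonneg)
   have "?r <= \<mu> / (8 * K * NPhi * y * NPhi) * W k"
    using elim(1) W_pos[of k] by (simp add: y_def[symmetric] pos_divide_less_eq less_imp_le)
   then have "?r * (NPhi * y) <= \<mu> / (8 * K * NPhi * y * NPhi) * W k * (NPhi * y)"
    using y by (intro mult_right_mono) auto
   also have "... = \<mu> * W k / (8 * K * NPhi)" using y NPhi_ge_1 by simp
   finally show ?thesis by (simp add: y_def mult_ac)
  qed
  have "W k <= 2 * NPhi * (2 * K * \<bar>?b\<bar>)"
   using M_nrm[of k] elim(2) NPhi_ge_1 by (intro order_trans[OF M_nrm] mult_left_mono) auto
  then have "\<mu> * W k / (4 * K * NPhi) <= \<bar>?b\<bar> * \<mu>" using \<mu> K_ge_1 NPhi_ge_1 by (simp add: field_simps)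
  then have bb: "2 * (\<mu> * W k / (8 * K * NPhi)) <= \<bar>?b\<bar> * \<mu>" by simp
  have low: "\<bar>?b\<bar> * \<mu> <= \<bar>- ?b * (\<xi> * m12 ?G - m22 ?G)\<bar>" "\<bar>?b\<bar> * \<mu> <= \<bar>- ?b * val \<xi> ?G\<bar>"
   using \<mu>_le[of k] by (auto simp: abs_mult u_def intro!: mult_left_mono)
  have fin: "\<bar>?f\<bar> * (A * W k) = \<mu> * W k / (8 * K * NPhi)" using F0 by (simp add: A_def field_simps)
  have "\<bar>?f\<bar> * (A * W k) <= \<bar>?f * m12 (w k)\<bar>"
  proof -
   have "?r * NPhi <= ?r * NPhi * (4 + \<bar>\<xi>\<bar>)" using rn by (simp add: algebra_simps)
   then show ?thesis unfolding fin 1 using low(1) s1(1) bb small_r by linarith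
  qed
  moreover have "\<bar>?f\<bar> * (A * W k) <= \<bar>?f * (real_of_int (m11 (w k) - m22 (w k)) + 2 * real_of_int (m12 (w k)) * \<xi>)\<bar>"
  proof -
   have "?r * (2 * NPhi + \<bar>\<xi>\<bar> * NPhi) + ?r * NPhi <= ?r * NPhi * (4 + \<bar>\<xi>\<bar>)" using rn by (simp add: algebra_simps)
   then show ?thesis unfolding fin 2 using low(2) s1(2) s2 bb small_r by linarith
  qed
  ultimately show ?case using F0 unfolding abs_mult by (simp add: mult_le_cancel_left)
 qed
 then show thesis using that[OF A] unfolding eventually_conj_iff by blast
qed

end

section \<open>Small errors from small values of the forms\<close>

lemma val_of_int_mult [simp]: "val \<xi> (of_int c * A) = c * val \<xi> A"
 by (simp add: val_def mat2_mult_entries algebra_simps)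

lemma val_adj [simp]: "val \<xi> (adj A) = - val \<xi> A"
 by (simp add: val_def adj_def algebra_simps)

lemma rho_le_nrm: "rho \<xi> A <= (1 + \<bar>\<xi>\<bar>) * nrm A"
proof -
 have "\<bar>real_of_int (m12 A) * \<xi>\<bar> <= nrm A * \<bar>\<xi>\<bar>" "\<bar>real_of_int (m22 A) * \<xi>\<bar> <= nrm A * \<bar>\<xi>\<bar>"
  by (intro abs_mult_le nrm_ge order_refl)+
 then have "\<bar>y1 \<xi> A\<bar> <= nrm A + nrm A * \<bar>\<xi>\<bar>" "\<bar>y2 \<xi> A\<bar> <= nrm A + nrm A * \<bar>\<xi>\<bar>"
  unfolding y1_def y2_def using nrm_ge[of A] by linarith+
 then show ?thesis by (simp add: rho_def algebra_simps)
qed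

context mat_growth
begin

text \<open>If \<open>Phi\<close> were scalar, all \<open>w k\<close> would be traceless, so that their squares would be scalar;
 this is incompatible with the growth condition.\<close>

lemma U_vec_Phi_nz: "U_vec (Phi k) ~= 0"
proof
 assume "U_vec (Phi k) = 0"
 then have 0: "m21 Phi0 = 0" "m12 Phi0 = 0" "m11 Phi0 = m22 Phi0"
  by (auto simp: vec3_eq_iff Phi_def adj_def split: if_splits)
 define g where "g = m11 Phi0"
 have Phig: "Phi j = of_int g" for j using 0 by (simp add: Phi_def g_def mat2_eq_iff adj_def)
 have g0: "g ~= 0" using mdet_Phi_nz[of 0] unfolding Phig by auto
 have tr0: "tr (w j) = 0" for j
 proof -
  have "tr (w j * of_int g) = 0" using tr_T[of "j + 1" 0] by (simp add: T_0 Phig)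
  then have "g * tr (w j) = 0" by (simp only: mult_of_int_commute[symmetric] tr_of_int_mult)
  then show ?thesis using g0 by simp
 qed
 have "c\<^sup>2 <= dd j / (W j)\<^sup>2" if j: "j >= 1" for j
 proof -
  have s1: "1 <= s (j + 1)" using s_pos[of "j + 1"] by simp
  have "w j ^ 2 * w (j - 1) = of_int (- mdet (w j)) * w (j - 1)"
   using traceless_square[OF tr0[of j]] by (simp add: power2_eq_square)
  then have n: "nrm (w j ^ 2 * w (j - 1)) = dd j * W (j - 1)" by (simp only: nrm_of_int_mult) simp
  have "c * W j * W (j - 1) <= nrm (w j * w (j - 1))" using growth[OF j, of 0] by simp
  then have "c * W j * (c * W j * W (j - 1)) <= c * W j * nrm (w j * w (j - 1))" using c by (intro mult_left_mono) auto
  also have "... <= dd j * W (j - 1)" using growth[OF j s1] n by (simp add: numeral_2_eq_2)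
  finally have "(c\<^sup>2 * (W j)\<^sup>2) * W (j - 1) <= dd j * W (j - 1)" by (simp add: power2_eq_square mult_ac)
  then have "c\<^sup>2 * (W j)\<^sup>2 <= dd j" using W_pos[of "j - 1"] by simp
  then show ?thesis using W_pos[of j] by (simp add: field_simps)
 qed
 moreover have "EV j. dd j / (W j)\<^sup>2 < c\<^sup>2"
  using order_tendstoD(2)[OF small, of "c\<^sup>2"] c by simp
 then have "EV j. dd j / (W j)\<^sup>2 < c\<^sup>2 & j >= 1" using eventually_ge_at_top by (rule eventually_conj)
 then obtain j where "dd j / (W j)\<^sup>2 < c\<^sup>2" "j >= 1" by (auto dest: eventually_happens)
 ultimately show False by fastforce
qed

text \<open>The vector \<open>(y1, y2)\<close> of \<open>T (k + 1) 0\<close> is measured against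
  those of \<open>Phi k\<close> and \<open>Phi (k + 1)\<close>, whose determinant has constant
  absolute value \<open>\<nu>\<close>. The component \<open>\<alpha>\<close> is small by hypothesis.
  The other one, \<open>\<beta>\<close>, cannot be controlled directly, but the product of two
  consecutive ones is small, so at one of any two consecutive indices the whole vector is small;
  \<open>step\<close> carries smallness from \<open>k + 1\<close> back to \<open>k\<close>.\<close>

lemma rho_limit:
 assumes lim: "(\<lambda>k. val \<xi> (w k) / W k) \<longlonglongrightarrow> 0" and irr: "!!r. r ~= 0 ==> lin \<xi> r ~= 0"
 shows "(\<lambda>k. rho \<xi> (T (k + 1) 0) / W k) \<longlonglongrightarrow> 0"
proof -
 let ?M = "\<lambda>k. T (k + 1) 0"
 define K where "K = (1 + \<bar>\<xi>\<bar>)\<^sup>2"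
 have K1: "K >= 1" using power_mono[of 1 "1 + \<bar>\<xi>\<bar>" 2] by (simp add: K_def)
 define wedge where "wedge A B = y1 \<xi> A * y2 \<xi> B - y2 \<xi> A * y1 \<xi> B" for A B
 define \<alpha> where "\<alpha> k = \<bar>wedge (?M k) (Phi k)\<bar> / W k" for k
 define \<beta> where "\<beta> k = \<bar>wedge (?M k) (Phi (k + 1))\<bar> / W k" for k
 define r where "r k = rho \<xi> (?M k) / W k" for k
 define \<nu> where "\<nu> = \<bar>real_of_int e0 * val \<xi> Phi0\<bar>"
 define R where "R = (1 + \<bar>\<xi>\<bar>) * NPhi"
 define C' where "C' = 4 * K * NPhi * (2 * NPhi * (c2 + 1))"
 have R: "R > 0" using NPhi_ge_1 by (simp add: R_def add_pos_nonneg)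
 have C': "C' > 0" using K1 NPhi_ge_1 c2_pos by (simp add: C'_def)
 have rhoPhi: "rho \<xi> (Phi k) <= R" for k using rho_le_nrm[of \<xi> "Phi k"] by (simp add: R_def)
 have "lin \<xi> (U_vec Phi0) ~= 0" using irr[OF U_vec_Phi_nz[of 1]] by (simp add: Phi_def)
 then have "val \<xi> Phi0 ~= 0" unfolding lin_U_vec by simp
 then have \<nu>: "\<nu> > 0" using e0_nz by (simp add: \<nu>_def)
 have wedgePhi: "\<bar>wedge (Phi k) (Phi (k + 1))\<bar> = \<nu>" for k
 proof -
  have "wedge (Phi k) (Phi (k + 1)) = tr (Phi k) * val \<xi> (Phi k)"
   using wedge_adj[of \<xi> "Phi k"] unfolding adj_Phi wedge_def .
  moreover have "\<bar>val \<xi> (Phi k)\<bar> = \<bar>val \<xi> Phi0\<bar>" by (simp add: Phi_def)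
  ultimately show ?thesis by (simp add: tr_Phi \<nu>_def abs_mult)
 qed
 have \<alpha>_eq: "\<alpha> k = F * \<bar>val \<xi> (w k) / W k\<bar>" for k
 proof -
  have "?M k * Phi k = w k * of_int (m0 * e0)"
   by (simp only: T_0 Suc_eq_plus1[symmetric] mult.assoc Phi_mult(2)[unfolded Suc_eq_plus1[symmetric]])
  also have "... = of_int (m0 * e0) * w k" by (rule mult_of_int_commute[symmetric])
  finally have "val \<xi> (?M k * Phi k) = real_of_int (m0 * e0) * val \<xi> (w k)" by (simp only: val_of_int_mult)
  then have "wedge (?M k) (Phi k) = real_of_int (m0 * e0) * val \<xi> (w k)"
   using val_traceless_mult[of "?M k" \<xi> "Phi k"] tr_T[of "k + 1" 0] by (simp add: wedge_def)
  then show ?thesis using W_pos[of k] by (simp add: \<alpha>_def abs_mult)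
 qed
 have \<alpha>0: "\<alpha> \<longlonglongrightarrow> 0"
  unfolding \<alpha>_eq[abs_def] using tendsto_mult_right_zero[OF tendsto_rabs_zero[OF lim]] .
 have Mn: "nrm (?M k) <= 2 * NPhi * W k" "W k <= 2 * NPhi * nrm (?M k)" for k
  using T_nrm_le[of "k + 1" 0] T_nrm_ge[of "k + 1" 0] by auto
 have prod: "nrm (?M k * ?M (k + 1)) <= c2 * dd k * (2 * NPhi * W (k + 1)) / W k" if k: "k >= 1" for k
 proof -
  have "?M (k + 1) = T k (s (k + 1))" using T_last[OF k] by (simp add: T_0[of "Suc k", simplified])
  then have "nrm (?M k * ?M (k + 1)) <= c2 * dd k * nrm (?M (k + 1)) / W k"
   using product_bound(1)[OF k, of "s (k + 1)"] s_pos[of "k + 1"] by simp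
  also have "... <= c2 * dd k * (2 * NPhi * W (k + 1)) / W k"
   using Mn(1)[of "k + 1"] c2_pos W_pos[of k] by (intro divide_right_mono mult_left_mono) auto
  finally show ?thesis .
 qed
 have \<omega>: "\<bar>wedge (?M k) (?M (k + 1))\<bar> / (W k * W (k + 1)) <= 4 * K * NPhi * c2 * (dd k / (W k)\<^sup>2)" if k: "k >= 1" for k
 proof -
  have "wedge (?M k) (?M (k + 1)) = val \<xi> (?M k * ?M (k + 1))"
   using val_traceless_mult[of "?M k" \<xi> "?M (k + 1)"] tr_T[of "k + 1" 0] by (simp add: wedge_def)
  then have "\<bar>wedge (?M k) (?M (k + 1))\<bar> <= 2 * K * nrm (?M k * ?M (k + 1))" using val_bound[of \<xi>] by (simp add: K_def)
  also have "... <= 2 * K * (c2 * dd k * (2 * NPhi * W (k + 1)) / W k)" using prod[OF k] K1 by (intro mult_left_mono) auto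
  finally have "\<bar>wedge (?M k) (?M (k + 1))\<bar> / (W k * W (k + 1)) <= 2 * K * (c2 * dd k * (2 * NPhi * W (k + 1)) / W k) / (W k * W (k + 1))"
   using W_pos[of k] W_pos[of "k + 1"] by (intro divide_right_mono) auto
  also have "... = 4 * K * NPhi * c2 * (dd k / (W k)\<^sup>2)"
  proof -
   have "2 * a * (b * d * (2 * f * y) / x) / (x * y) = 4 * a * f * b * (d / x\<^sup>2)" if "x > 0" "y > 0" for a b d f x y :: real
    using that by (simp add: power2_eq_square field_simps)
   then show ?thesis using W_pos by blast
  qed
  finally show ?thesis .
 qed
 have \<beta>\<beta>: "\<beta> k * \<beta> (k + 1) <= \<nu> * (4 * K * NPhi * c2 * (dd k / (W k)\<^sup>2)) + \<alpha> k * \<alpha> (k + 1)" if k: "k >= 1" for k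
 proof -
  let ?y = "?M k" and ?y' = "?M (k + 1)" and ?n = "Phi k" and ?n' = "Phi (k + 1)"
  \<comment> \<open>The Pluecker relation for four vectors in the plane. The second factor on the
    left is the one occurring in \<open>\<beta> (k + 1)\<close> since
    \<open>Phi (k + 2) = Phi k\<close>.\<close>
  have "wedge ?y ?n' * wedge ?y' ?n = wedge ?y ?n * wedge ?y' ?n' - wedge ?y ?y' * wedge ?n ?n'"
   unfolding wedge_def by (simp add: algebra_simps)
  then have "\<bar>wedge ?y ?n'\<bar> * \<bar>wedge ?y' ?n\<bar> <= \<bar>wedge ?y ?n\<bar> * \<bar>wedge ?y' ?n'\<bar> + \<bar>wedge ?y ?y'\<bar> * \<nu>"
   unfolding wedgePhi[symmetric, of k] abs_mult[symmetric] by linarith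
  then have "(\<bar>wedge ?y ?n'\<bar> * \<bar>wedge ?y' ?n\<bar>) / (W k * W (k + 1))
    <= (\<bar>wedge ?y ?n\<bar> * \<bar>wedge ?y' ?n'\<bar> + \<bar>wedge ?y ?y'\<bar> * \<nu>) / (W k * W (k + 1))"
   using W_pos[of k] W_pos[of "k + 1"] by (intro divide_right_mono) auto
  also have "... = \<alpha> k * \<alpha> (k + 1) + \<nu> * (\<bar>wedge ?y ?y'\<bar> / (W k * W (k + 1)))"
   by (simp add: \<alpha>_def add_divide_distrib)
  also have "... <= \<alpha> k * \<alpha> (k + 1) + \<nu> * (4 * K * NPhi * c2 * (dd k / (W k)\<^sup>2))"
   using \<omega>[OF k] \<nu> by (intro add_left_mono mult_left_mono) auto
  finally show ?thesis by (simp add: \<beta>_def)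
 qed
 have r_le: "\<nu> * r k <= R * (\<alpha> k + \<beta> k)" for k
 proof -
  let ?y = "?M k" and ?n = "Phi k" and ?n' = "Phi (k + 1)"
  \<comment> \<open>Cramer's rule in the basis given by \<open>Phi k\<close> and
    \<open>Phi (k + 1)\<close>.\<close>
  have 1: "wedge ?n ?n' * y1 \<xi> ?y = wedge ?y ?n' * y1 \<xi> ?n - wedge ?y ?n * y1 \<xi> ?n'"
   and 2: "wedge ?n ?n' * y2 \<xi> ?y = wedge ?y ?n' * y2 \<xi> ?n - wedge ?y ?n * y2 \<xi> ?n'"
   unfolding wedge_def by (simp_all add: algebra_simps)
  have yPhi: "\<bar>y1 \<xi> (Phi j)\<bar> <= R" "\<bar>y2 \<xi> (Phi j)\<bar> <= R" for j using rhoPhi[of j] rho_ge[of \<xi> "Phi j"] by auto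
  have b: "\<bar>x * a - y * b\<bar> <= R * (\<bar>y\<bar> + \<bar>x\<bar>)" if "\<bar>a\<bar> <= R" "\<bar>b\<bar> <= R" for x a y b :: real
   using abs_mult_le[OF order_refl that(1), of x] abs_mult_le[OF order_refl that(2), of y] by (simp add: algebra_simps; linarith)
  have "\<nu> * \<bar>y1 \<xi> ?y\<bar> <= R * (\<bar>wedge ?y ?n\<bar> + \<bar>wedge ?y ?n'\<bar>)" "\<nu> * \<bar>y2 \<xi> ?y\<bar> <= R * (\<bar>wedge ?y ?n\<bar> + \<bar>wedge ?y ?n'\<bar>)"
   unfolding wedgePhi[symmetric, of k] abs_mult[symmetric] 1 2 by (rule b[OF yPhi(1) yPhi(1)], rule b[OF yPhi(2) yPhi(2)])
  then have "\<nu> * rho \<xi> ?y <= R * (\<bar>wedge ?y ?n\<bar> + \<bar>wedge ?y ?n'\<bar>)" unfolding rho_def by (auto simp: max_def)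
  then have "\<nu> * rho \<xi> ?y / W k <= R * (\<bar>wedge ?y ?n\<bar> + \<bar>wedge ?y ?n'\<bar>) / W k" using W_pos[of k] by (intro divide_right_mono) auto
  then show ?thesis by (simp add: r_def \<alpha>_def \<beta>_def add_divide_distrib distrib_left)
 qed
 have r0: "r k >= 0" for k using W_pos[of k] rho_ge(3) by (simp add: r_def)
 \<comment> \<open>Here \<open>rho_image\<close> is applied with the later matrix as
   \<open>M\<close>; the product of two consecutive matrices is small by
   \<open>prod\<close>.\<close>
 have step: "r k <= C' * (dd k / (W k)\<^sup>2 + r (k + 1))" if k: "k >= 1" and small_r: "r (k + 1) <= 1 / (4 * K * NPhi)" for k
 proof -
  let ?y = "?M k" and ?y' = "?M (k + 1)" and ?b = "\<bar>real_of_int (m12 (?M (k + 1)))\<bar>"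
  have Wp: "W k > 0" "W (k + 1) > 0" using W_pos by auto
  have rr: "rho \<xi> ?y' = r (k + 1) * W (k + 1)" "rho \<xi> ?y = r k * W k" using Wp by (auto simp: r_def)
  have "K * rho \<xi> ?y' <= K * (1 / (4 * K * NPhi) * W (k + 1))" unfolding rr using small_r K1 Wp by (intro mult_left_mono mult_right_mono) auto
  also have "... = W (k + 1) / (4 * NPhi)" using K1 by simp
  also have "... <= nrm ?y' / 2" using Mn(2)[of "k + 1"] NPhi_ge_1 by (simp add: field_simps)
  finally have "nrm ?y' <= 2 * (K * ?b)"
   using nrm_le_rho[of ?y' \<xi>] tr_T[of "k + 2" 0] by (simp add: K_def algebra_simps)
  then have "W (k + 1) <= 2 * NPhi * (2 * (K * ?b))" using NPhi_ge_1 by (intro order_trans[OF Mn(2)] mult_left_mono) auto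
  then have b: "W (k + 1) <= 4 * K * NPhi * ?b" by (simp add: mult_ac)
  have "W (k + 1) * rho \<xi> ?y <= 4 * K * NPhi * ?b * rho \<xi> ?y" using b rho_ge(3) by (intro mult_right_mono) auto
  also have "... = 4 * K * NPhi * (?b * rho \<xi> ?y)" by simp
  also have "... <= 4 * K * NPhi * (nrm (?y * ?y') + nrm ?y * rho \<xi> ?y')"
   using K1 NPhi_ge_1 tr_T[of "k + 2" 0] by (intro mult_left_mono rho_image) auto
  also have "... <= 4 * K * NPhi * (c2 * dd k * (2 * NPhi * W (k + 1)) / W k + 2 * NPhi * W k * (r (k + 1) * W (k + 1)))"
   unfolding rr(1) using K1 NPhi_ge_1 prod[OF k] Mn(1)[of k] r0[of "k + 1"] Wp by (intro mult_left_mono add_mono mult_right_mono) auto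
  also have "... = (W k * W (k + 1)) * (4 * K * NPhi * (2 * NPhi * (c2 * (dd k / (W k)\<^sup>2) + r (k + 1))))"
   using Wp by (simp add: power2_eq_square field_simps)
  also have "... <= (W k * W (k + 1)) * (4 * K * NPhi * (2 * NPhi * ((c2 + 1) * (dd k / (W k)\<^sup>2 + r (k + 1)))))"
  proof -
   have "c2 * x + y <= (c2 + 1) * (x + y)" if "x >= 0" "y >= 0" for x y
    using that c2_pos by (simp add: algebra_simps)
   from this[of "dd k / (W k)\<^sup>2" "r (k + 1)"]
   have "c2 * (dd k / (W k)\<^sup>2) + r (k + 1) <= (c2 + 1) * (dd k / (W k)\<^sup>2 + r (k + 1))"
    using r0[of "k + 1"] by (simp only: divide_nonneg_nonneg abs_ge_zero zero_le_power2)
   then show ?thesis using Wp K1 NPhi_ge_1 by (intro mult_left_mono) auto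
  qed
  also have "... = (W k * W (k + 1)) * (C' * (dd k / (W k)\<^sup>2 + r (k + 1)))" by (simp add: C'_def)
  finally have "(W k * W (k + 1)) * r k <= (W k * W (k + 1)) * (C' * (dd k / (W k)\<^sup>2 + r (k + 1)))"
   unfolding rr(2) by (simp add: mult_ac)
  then show ?thesis using Wp mult_pos_pos[OF Wp] by (simp only: mult_le_cancel_left_pos)
 qed
 have "r \<longlonglongrightarrow> 0"
 proof (rule LIMSEQ_I)
  fix \<epsilon> :: real assume e: "\<epsilon> > 0"
  define eta where "eta = min (min (1 / (4 * K * NPhi)) (\<epsilon> / 2)) (\<epsilon> / (4 * C'))"
  have eta: "eta > 0" "eta <= 1 / (4 * K * NPhi)" "eta <= \<epsilon> / 2" "eta <= \<epsilon> / (4 * C')"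
   using e K1 NPhi_ge_1 C' by (auto simp: eta_def)
  define \<tau> where "\<tau> = eta * \<nu> / (2 * R)"
  have \<tau>: "\<tau> > 0" using eta \<nu> R by (simp add: \<tau>_def)
  have good: "r k <= eta" if "\<alpha> k < \<tau>" "\<beta> k < \<tau>" for k
  proof -
   have "\<nu> * r k <= R * (\<tau> + \<tau>)" using r_le[of k] that R by (smt (verit) mult_left_mono)
   also have "... = \<nu> * eta" using R by (simp add: \<tau>_def)
   finally show ?thesis using \<nu> by simp
  qed
  have A: "EV k. \<alpha> k < \<tau>" using order_tendstoD(2)[OF \<alpha>0 \<tau>] .
  have \<alpha>1: "(\<lambda>k. \<alpha> (k + 1)) \<longlonglongrightarrow> 0" using LIMSEQ_ignore_initial_segment[OF \<alpha>0, of 1] .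
  have "(\<lambda>k. \<nu> * (4 * K * NPhi * c2 * (dd k / (W k)\<^sup>2)) + \<alpha> k * \<alpha> (k + 1)) \<longlonglongrightarrow> \<nu> * (4 * K * NPhi * c2 * 0) + 0 * 0"
   by (intro tendsto_intros small \<alpha>0 \<alpha>1)
  then have B: "EV k. \<nu> * (4 * K * NPhi * c2 * (dd k / (W k)\<^sup>2)) + \<alpha> k * \<alpha> (k + 1) < \<tau> * \<tau>"
   by (rule order_tendstoD(2)) (use \<tau> in simp)
  have "(\<lambda>k. C' * (dd k / (W k)\<^sup>2)) \<longlonglongrightarrow> C' * 0" by (intro tendsto_intros small)
  then have D: "EV k. C' * (dd k / (W k)\<^sup>2) < \<epsilon> / 4"
   by (rule order_tendstoD(2)) (use e in simp)
  have "EV k. norm (r k - 0) < \<epsilon>"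
   using A order_tendstoD(2)[OF \<alpha>1 \<tau>] B D eventually_ge_at_top[of 1]
  proof eventually_elim
   case (elim k)
   have "\<beta> k * \<beta> (k + 1) < \<tau> * \<tau>" using \<beta>\<beta>[OF elim(5)] elim(3) by linarith
   moreover have "\<beta> j >= 0" for j using W_pos[of j] by (simp add: \<beta>_def)
   ultimately have "\<beta> k < \<tau> \<or> \<beta> (k + 1) < \<tau>" using \<tau> by (meson linorder_not_less mult_mono order_less_imp_le)
   then have "r k < \<epsilon>"
   proof
    assume "\<beta> k < \<tau>"
    then show ?thesis using good[OF elim(1)] eta e by linarith
   next
    assume "\<beta> (k + 1) < \<tau>"
    then have r1: "r (k + 1) <= eta" using good elim(2) by blast
    then have "r k <= C' * (dd k / (W k)\<^sup>2 + r (k + 1))" using step[OF elim(5)] eta by linarith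
    also have "... <= C' * (dd k / (W k)\<^sup>2) + C' * (\<epsilon> / (4 * C'))"
     using r1 eta C' by (simp only: distrib_left) (intro add_left_mono mult_left_mono, auto)
    also have "C' * (\<epsilon> / (4 * C')) = \<epsilon> / 4" using C' by simp
    finally show ?thesis using elim(4) e by linarith
   qed
   then show ?case using r0[of k] by simp
  qed
  then show "\<exists>n0. \<forall>n\<ge>n0. norm (r n - 0) < \<epsilon>" by (simp add: eventually_sequentially)
 qed
 then show ?thesis by (simp add: r_def[abs_def])
qed

end

section \<open>Divisibility of contents\<close>

definition cont :: "mat2 \<Rightarrow> int" where
 "cont A = gcd (gcd (m11 A) (m12 A)) (gcd (m21 A) (m22 A))"

lemma dvd_cont_iff: "c dvd cont A \<longleftrightarrow> c dvd m11 A & c dvd m12 A & c dvd m21 A & c dvd m22 A"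
 by (auto simp: cont_def)

lemma dvd_cont_eq: "c dvd cont A \<longleftrightarrow> (\<exists>B. A = of_int c * B)"
proof
 assume "c dvd cont A"
 then have "c dvd m11 A" "c dvd m12 A" "c dvd m21 A" "c dvd m22 A" by (simp_all add: dvd_cont_iff)
 then obtain x y z t where "m11 A = c * x" "m12 A = c * y" "m21 A = c * z" "m22 A = c * t"
  by (elim dvdE)
 then have "A = of_int c * Mat2 x y z t" by (simp add: mat2_eq_iff mat2_mult_entries)
 then show "\<exists>B. A = of_int c * B" ..
qed (auto simp: dvd_cont_iff mat2_mult_entries)

lemma cont_nonneg [simp]: "cont A >= 0" by (simp add: cont_def)

lemma cont_pos: "A ~= 0 ==> cont A > 0"
 using cont_nonneg[of A] by (cases "cont A = 0") (auto simp: cont_def mat2_eq_iff)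

lemma cont_of_int_mult [simp]: "cont (of_int c * A) = \<bar>c\<bar> * cont A"
 by (simp add: cont_def mat2_mult_entries gcd_mult_left abs_mult)

lemma cont_uminus [simp]: "cont (- A) = cont A" by (simp add: cont_def)

lemma cont_of_int [simp]: "cont (of_int c) = \<bar>c\<bar>" by (simp add: cont_def)

lemma cont_1 [simp]: "cont 1 = 1" by (simp add: cont_def)

lemma scalar_mult_scalar: "(of_int c * A) * (of_int d * B) = of_int (c * d) * (A * B :: mat2)"
 by (simp add: mat2_eq_iff mat2_mult_entries algebra_simps)

lemma scalar_power: "(of_int c * A) ^ n = of_int (c ^ n) * (A ^ n :: mat2)"
 by (induction n) (simp_all only: power_0 power_Suc scalar_mult_scalar of_int_1 mult_1_left)

lemma dvd_cont_mult: "c dvd cont A ==> d dvd cont B ==> c * d dvd cont (A * B)"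
proof -
 assume "c dvd cont A" "d dvd cont B"
 then obtain A' B' where "A = of_int c * A'" "B = of_int d * B'" unfolding dvd_cont_eq by blast
 then have "A * B = of_int (c * d) * (A' * B')" by (simp only: scalar_mult_scalar)
 then show ?thesis unfolding dvd_cont_eq by blast
qed

lemma dvd_cont_mult_left: "c dvd cont A ==> c dvd cont (A * B)"
 using dvd_cont_mult[of c A 1 B] by simp

lemma dvd_cont_mult_right: "d dvd cont B ==> d dvd cont (A * B)"
 using dvd_cont_mult[of 1 A d B] by simp

lemmas cont_dvd_left = dvd_cont_mult_left[OF dvd_refl]
lemmas cont_dvd_right = dvd_cont_mult_right[OF dvd_refl]

lemma dvd_cont_add: "c dvd cont A ==> c dvd cont B ==> c dvd cont (A + B)"
 by (simp add: dvd_cont_iff)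

lemma dvd_cont_diff: "c dvd cont A ==> c dvd cont B ==> c dvd cont (A - B)"
 by (simp add: dvd_cont_iff)

lemma dvd_cont_power: "c dvd cont A ==> c ^ n dvd cont (A ^ n)"
 by (induction n) (simp_all add: dvd_cont_mult)

lemma dvd_cont_of_int_mult: "c dvd cont (of_int d * A) \<longleftrightarrow> c dvd d * cont A"
proof -
 have "\<bar>d\<bar> * cont A = \<bar>d * cont A\<bar>" by (simp add: abs_mult)
 then show ?thesis by (simp only: cont_of_int_mult dvd_abs_iff)
qed

lemmas of_int_dvd_cancel = dvd_cont_of_int_mult[THEN iffD1]
lemmas dvd_of_int_cont = dvd_cont_of_int_mult[THEN iffD2]

lemma cont_cancel_right: "cont (A * B) dvd mdet B * cont A"
proof -
 have "cont (A * B) dvd cont (A * B * adj B)" by (rule dvd_cont_mult_left) simp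
 also have "A * B * adj B = of_int (mdet B) * A" by (simp add: mat2_simps)
 finally show ?thesis by (simp only: dvd_cont_of_int_mult)
qed

lemma cont_cancel_left: "cont (A * B) dvd mdet A * cont B"
proof -
 have "cont (A * B) dvd cont (adj A * (A * B))" by (rule dvd_cont_mult_right) simp
 also have "adj A * (A * B) = of_int (mdet A) * B" by (simp add: mult.assoc[symmetric] mult_adj)
 finally show ?thesis by (simp only: dvd_cont_of_int_mult)
qed

lemma dvd_gcd_mult:
 fixes n a b x :: int
 assumes "n dvd a * x" "n dvd b * x"
 shows "n dvd gcd a b * x"
proof -
 obtain u v where uv: "u * a + v * b = gcd a b" using bezout_int by blast
 have "gcd a b * x = u * (a * x) + v * (b * x)" unfolding uv[symmetric] by (simp add: algebra_simps)
 then show ?thesis using assms by simp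
qed

text \<open>The logarithms of the contents of \<open>a ^ l * b\<close> form a concave sequence in \<open>l\<close>, up to a
 defect which is the logarithm of the greatest common divisor of trace and determinant.\<close>

lemma cont_concave:
 "cont (a * (a * c)) * cont c dvd gcd (tr a) (mdet a) * (cont (a * c))\<^sup>2"
proof -
 let ?n = "cont (a * (a * c))" and ?M = "cont (a * c)" and ?r = "cont c"
 have rM: "?r dvd ?M" by (rule dvd_cont_mult_right) simp
 have nM: "?n dvd mdet a * ?M" by (rule cont_cancel_left)
 have 1: "?n * ?r dvd mdet a * ?M\<^sup>2" using mult_dvd_mono[OF nM rM] by (simp add: power2_eq_square mult.assoc)
 have ch: "of_int (tr a) * (a * c) = a * (a * c) + of_int (mdet a) * c"
 proof -
  have "a * (a * c) = (a * a) * c" by (simp add: mult.assoc)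
  then show ?thesis unfolding cayley_hamilton by (simp add: algebra_simps)
 qed
 have "?n * ?r dvd cont (of_int ?M * (a * (a * c)))"
  by (rule dvd_of_int_cont) (use rM in \<open>simp add: mult.commute mult_dvd_mono\<close>)
 moreover have "?n * ?r dvd cont (of_int ?M * (of_int (mdet a) * c))"
 proof -
  have "?n * ?r dvd (?M * mdet a) * ?r" using mult_dvd_mono[OF nM dvd_refl[of ?r]] by (simp only: mult.commute[of ?M])
  then have "?n * ?r dvd cont (of_int (?M * mdet a) * c)" by (rule dvd_of_int_cont)
  then show ?thesis by (simp only: of_int_mult mult.assoc)
 qed
 ultimately have "?n * ?r dvd cont (of_int ?M * (of_int (tr a) * (a * c)))"
  unfolding ch distrib_left by (rule dvd_cont_add)
 then have "?n * ?r dvd cont (of_int (?M * tr a) * (a * c))" by (simp only: of_int_mult mult.assoc)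
 then have "?n * ?r dvd ?M * tr a * ?M" by (rule of_int_dvd_cancel)
 then have 2: "?n * ?r dvd tr a * ?M\<^sup>2" by (simp add: power2_eq_square mult_ac)
 show ?thesis by (rule dvd_gcd_mult[OF 2 1])
qed

text \<open>By Cayley-Hamilton the greatest common divisor of trace and determinant divides the
  square of the matrix.\<close>

lemma gcd_power_dvd_cont: "gcd (tr a) (mdet a) ^ (n div 2) dvd cont (a ^ n)"
proof -
 have "gcd (tr a) (mdet a) dvd cont (a ^ 2)"
  unfolding power2_eq_square cayley_hamilton
  by (intro dvd_cont_diff dvd_of_int_cont) simp_all
 then have "gcd (tr a) (mdet a) ^ (n div 2) dvd cont ((a ^ 2) ^ (n div 2))" by (rule dvd_cont_power)
 also have "(a ^ 2) ^ (n div 2) * a ^ (n mod 2) = a ^ n"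
  by (simp only: power_mult[symmetric] power_add[symmetric] mult_div_mod_eq)
 then have "cont ((a ^ 2) ^ (n div 2)) dvd cont (a ^ n)" by (metis cont_dvd_left)
 finally show ?thesis .
qed

lemma cont_power_div_dvd: "cont (a ^ l) ^ (n div l) dvd cont (a ^ n)"
proof -
 have "cont (a ^ l) ^ (n div l) dvd cont ((a ^ l) ^ (n div l))" by (rule dvd_cont_power) simp
 also have "(a ^ l) ^ (n div l) * a ^ (n mod l) = a ^ n"
  by (simp only: power_mult[symmetric] power_add[symmetric] mult_div_mod_eq)
 then have "cont ((a ^ l) ^ (n div l)) dvd cont (a ^ n)" by (metis cont_dvd_left)
 finally show ?thesis .
qed

text \<open>A form of Fricke's identity: modulo the trace and the determinant of \<open>a\<close>,
  the square of \<open>tr (a * b)\<close> is the negative of the determinant of the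
  commutator.\<close>

lemma trace_identity:
 "(tr (a * b))\<^sup>2 = tr a * (tr b * tr (a * b) - tr a * mdet b)
   + mdet a * (4 * mdet b - (tr b)\<^sup>2) - mdet (a * b - b * a)"
 by (simp add: mat2_simps power2_eq_square)

lemma gcd_dvd_sq:
 fixes g m z :: int
 assumes "g dvd m * z\<^sup>2"
 shows "g dvd (gcd g (m * z))\<^sup>2"
proof -
 obtain u v where uv: "u * g + v * (m * z) = gcd g (m * z)" using bezout_int by blast
 have "(gcd g (m * z))\<^sup>2 = g * (u * u * g + 2 * u * v * m * z) + (m * z\<^sup>2) * (v\<^sup>2 * m)"
  unfolding uv[symmetric] by (simp add: power2_eq_square algebra_simps)
 then show ?thesis using assms by simp
qed

lemma dvd_cont_combination:
 assumes "h dvd m * z" "h dvd d"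
 shows "h dvd cont (of_int m * (of_int z * A - of_int d * B))"
proof -
 have "of_int m * (of_int z * A - of_int d * B) = of_int (m * z) * A - of_int (m * d) * B"
  by (simp add: mat2_eq_iff mat2_mult_entries algebra_simps)
 then show ?thesis using assms by (simp only:) (intro dvd_cont_diff dvd_of_int_cont; simp)
qed

lemma product_square: "(a * b) * (a * b) = of_int (tr (a * b)) * (a * b) - of_int (mdet a * mdet b) * 1"
 using cayley_hamilton[of "a * b"] by simp

lemma product_sandwich: "a * b * a = of_int (tr (a * b)) * a - of_int (mdet a) * adj b"
 by (simp add: mat2_simps)

text \<open>Up to the factor \<open>m\<close>, such an \<open>h\<close> divides
  \<open>a * b * a\<close> and the square of \<open>a * b\<close>. For \<open>n = 1\<close> the
  former is the whole product; otherwise the factors \<open>a * b\<close> are grouped in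
  pairs.\<close>

lemma common_divisor_dvd_cont:
 assumes h: "h dvd mdet a" "h dvd m * tr (a * b)" and p: "p = (if n = 1 then 1 else n div 2)"
 shows "h ^ p dvd m ^ p * cont ((a * b) ^ n * a)"
proof (cases "n = 1")
 case True
 have "h dvd cont (of_int m * (a * b * a))"
  unfolding product_sandwich by (rule dvd_cont_combination) (use h in simp_all)
 then have "h dvd m * cont (a * b * a)" by (rule of_int_dvd_cancel)
 then show ?thesis using True p by simp
next
 case False
 have "h dvd cont (of_int m * ((a * b) * (a * b)))"
  unfolding product_square by (rule dvd_cont_combination) (use h in simp_all)
 then have "h ^ p dvd cont ((of_int m * (a * b)\<^sup>2) ^ p)" by (intro dvd_cont_power) (simp add: power2_eq_square)
 also have "(of_int m * (a * b)\<^sup>2) ^ p = of_int (m ^ p) * ((a * b)\<^sup>2) ^ p"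
  by (rule scalar_power)
 finally have 1: "h ^ p dvd m ^ p * cont (((a * b)\<^sup>2) ^ p)" by (rule of_int_dvd_cancel)
 have "((a * b)\<^sup>2) ^ p * (a * b) ^ (n mod 2) = (a * b) ^ n"
  using False p by (simp only: power_mult[symmetric] power_add[symmetric] mult_div_mod_eq if_False)
 then have "(a * b) ^ n * a = ((a * b)\<^sup>2) ^ p * ((a * b) ^ (n mod 2) * a)" by (simp add: mult.assoc[symmetric])
 then have "cont (((a * b)\<^sup>2) ^ p) dvd cont ((a * b) ^ n * a)" by (metis cont_dvd_left)
 then have "m ^ p * cont (((a * b)\<^sup>2) ^ p) dvd m ^ p * cont ((a * b) ^ n * a)" by (rule mult_dvd_mono[OF dvd_refl])
 then show ?thesis by (rule dvd_trans[OF 1])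
qed

definition prim :: "mat2 \<Rightarrow> mat2" where
 "prim A = Mat2 (m11 A div cont A) (m12 A div cont A) (m21 A div cont A) (m22 A div cont A)"

lemma cont_prim: "of_int (cont A) * prim A = A"
 using dvd_cont_iff[of "cont A" A] by (simp add: prim_def mat2_eq_iff mat2_mult_entries)

lemma cont_prim_1:
 assumes "A ~= 0"
 shows "cont (prim A) = 1"
proof -
 have "cont A * cont (prim A) = cont A" using cont_prim[of A] cont_of_int_mult[of "cont A" "prim A"] by simp
 then show ?thesis using cont_pos[OF assms] by simp
qed

context mat_rec
begin

abbreviation cw :: "nat \<Rightarrow> int" where "cw k \<equiv> cont (w k)"
definition wt :: "nat \<Rightarrow> mat2" where "wt k = prim (w k)"
text \<open>The content produced by multiplying primitive matrices. Its value \<open>X k\<close> at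
  \<open>l = s (k + 1)\<close> is the factor newly split off when the recurrence passes to
  \<open>w (k + 1)\<close>.\<close>

definition M :: "nat \<Rightarrow> nat \<Rightarrow> int" where "M k l = cont (wt k ^ l * wt (k - 1))"
abbreviation X :: "nat \<Rightarrow> int" where "X k \<equiv> M k (s (k + 1))"
definition g :: "nat \<Rightarrow> int" where "g k = gcd (tr (wt k)) (mdet (wt k))"

lemma w_nonzero: "w k ~= 0" using det_nz[of k] by auto

lemma cw_pos: "cw k > 0" using cont_pos[OF w_nonzero] .

lemma w_eq: "w k = of_int (cw k) * wt k" by (simp add: wt_def cont_prim)

lemma cont_wt: "cont (wt k) = 1" unfolding wt_def by (rule cont_prim_1[OF w_nonzero])

lemma mdet_w_eq: "mdet (w k) = (cw k)\<^sup>2 * mdet (wt k)" by (subst w_eq) simp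

lemma mdet_wt_nz: "mdet (wt k) ~= 0" using mdet_w_eq[of k] det_nz[of k] by auto

lemma M_pos: "M k l > 0"
proof -
 have "mdet (wt k ^ l * wt (k - 1)) ~= 0" using mdet_wt_nz by simp
 then have "wt k ^ l * wt (k - 1) ~= 0" by (metis mdet_0)
 then show ?thesis unfolding M_def by (rule cont_pos)
qed

lemma g_pos: "g k > 0" using mdet_wt_nz[of k] by (simp add: g_def)

lemma w_power_wt: "w k ^ l * w (k - 1) = of_int (cw k ^ l * cw (k - 1)) * (wt k ^ l * wt (k - 1))"
 by (subst w_eq[of k], subst w_eq[of "k - 1"]) (simp only: scalar_power scalar_mult_scalar)

lemma wt_rec:
 assumes "k >= 1"
 shows "cw (k + 1) = cw k ^ s (k + 1) * cw (k - 1) * X k"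
  and "wt k ^ s (k + 1) * wt (k - 1) = of_int (X k) * wt (k + 1)"
proof -
 let ?C = "cw k ^ s (k + 1) * cw (k - 1)" and ?Y = "wt k ^ s (k + 1) * wt (k - 1)"
 have C: "?C > 0" using cw_pos[of k] cw_pos[of "k - 1"] by simp
 have *: "w (k + 1) = of_int ?C * ?Y" using rec[OF assms] w_power_wt by simp
 have "cw (k + 1) = \<bar>?C\<bar> * cont ?Y" unfolding * by (rule cont_of_int_mult)
 then show 1: "cw (k + 1) = ?C * X k" using C unfolding M_def by (simp only: abs_of_pos)
 have "of_int ?C * ?Y = of_int (cw (k + 1)) * wt (k + 1)" using * w_eq[of "k + 1"] by simp
 also have "... = of_int ?C * (of_int (X k) * wt (k + 1))" unfolding 1 by (simp only: of_int_mult mult.assoc)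
 finally have 2: "of_int ?C * ?Y = of_int ?C * (of_int (X k) * wt (k + 1))" .
 have "?C ~= 0" using C by linarith
 from of_int_mat2_mult_left_cancel[OF this 2] show "?Y = of_int (X k) * wt (k + 1)" .
qed

lemma M_0 [simp]: "M k 0 = 1" by (simp add: M_def cont_wt)

lemma M_dvd_mono: "i <= j ==> M k i dvd M k j"
proof -
 assume "i <= j"
 then have "wt k ^ j * wt (k - 1) = wt k ^ (j - i) * (wt k ^ i * wt (k - 1))"
  by (simp add: mult.assoc[symmetric] power_add[symmetric])
 then show ?thesis unfolding M_def by (metis cont_dvd_right)
qed

lemma M_concave: "M k (l + 2) * M k l dvd g k * (M k (l + 1))\<^sup>2"
 using cont_concave[of "wt k" "wt k ^ l * wt (k - 1)"]
 by (simp add: M_def g_def mult.assoc numeral_2_eq_2)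

lemma M_dvd_power: "M k l dvd mdet (wt (k - 1)) * cont (wt k ^ l)"
 unfolding M_def by (rule cont_cancel_right)

lemma cont_power_dvd_X: "cont (wt k ^ l) ^ (s (k + 1) div l) dvd X k"
 unfolding M_def by (rule dvd_trans[OF cont_power_div_dvd dvd_cont_mult_left]) simp

lemma g_power_dvd_X: "g k ^ (s (k + 1) div 2) dvd X k"
 unfolding M_def g_def by (rule dvd_trans[OF gcd_power_dvd_cont dvd_cont_mult_left]) simp

text \<open>The identity \<open>mdet_E\<close> has the same degree in \<open>w k\<close>, and in
  \<open>w (k - 1)\<close>, on both sides, so the contents cancel.\<close>

lemma mdet_commutator_wt:
 assumes "k >= 1"
 shows "m0 * mdet (wt k * wt (k - 1) - wt (k - 1) * wt k) = mdet (wt k) * mdet (wt (k - 1)) * e0"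
proof -
 let ?C = "cw k * cw (k - 1)" and ?e = "wt k * wt (k - 1) - wt (k - 1) * wt k"
 have C: "?C ~= 0" using cw_pos[of k] cw_pos[of "k - 1"] by simp
 have "E k = (of_int (cw k) * wt k) * (of_int (cw (k - 1)) * wt (k - 1))
   - (of_int (cw (k - 1)) * wt (k - 1)) * (of_int (cw k) * wt k)"
  by (simp only: E_def w_eq[symmetric])
 also have "... = of_int ?C * ?e"
  by (simp only: scalar_mult_scalar mult.commute[of "cw (k - 1)"] right_diff_distrib)
 finally have "E k = of_int ?C * ?e" .
 then have "mdet (E k) = ?C\<^sup>2 * mdet ?e" by (simp only: mdet_mult mdet_of_int)
 then have "m0 * (?C\<^sup>2 * mdet ?e) = (cw k)\<^sup>2 * mdet (wt k) * ((cw (k - 1))\<^sup>2 * mdet (wt (k - 1))) * e0"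
  using mdet_E[OF assms] unfolding mdet_w_eq by simp
 then have "?C\<^sup>2 * (m0 * mdet ?e) = ?C\<^sup>2 * (mdet (wt k) * mdet (wt (k - 1)) * e0)"
  by (simp add: power_mult_distrib mult_ac)
 then show ?thesis using C by simp
qed

text \<open>When \<open>s (k + 1) = 1\<close>, a common divisor of trace and determinant of \<open>wt k\<close> also divides, up to
 \<open>m0\<close>, the square of the trace of \<open>wt k * wt (k - 1)\<close>, and so forces content two steps later.\<close>

lemma g_bound_1:
 assumes k: "k >= 1" and s1: "s (k + 1) = 1"
  and p: "p = (if s (k + 2) = 1 then 1 else s (k + 2) div 2)"
 obtains h where "h > 0" "g k dvd h\<^sup>2" "h ^ p dvd m0 ^ p * (X k ^ s (k + 2) * X (k + 1))"
proof -
 let ?a = "wt k" and ?b = "wt (k - 1)"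
 let ?z = "tr (?a * ?b)"
 define h where "h = gcd (g k) (m0 * ?z)"
 have ga: "g k dvd tr ?a" "g k dvd mdet ?a" by (auto simp: g_def)
 have "m0 * ?z\<^sup>2 = tr ?a * (m0 * (tr ?b * ?z - tr ?a * mdet ?b)) + mdet ?a * (m0 * (4 * mdet ?b - (tr ?b)\<^sup>2))
   - mdet ?a * (mdet ?b * e0)"
  using mdet_commutator_wt[OF k] unfolding trace_identity by (simp add: algebra_simps)
 also have "g k dvd ..." using ga by (intro dvd_add dvd_diff dvd_mult2)
 finally have 1: "g k dvd h\<^sup>2" unfolding h_def by (rule gcd_dvd_sq)
 have hd: "h dvd mdet ?a" "h dvd m0 * ?z" using ga by (auto simp: h_def intro: dvd_trans)
 have "h ^ p dvd m0 ^ p * cont ((?a * ?b) ^ s (k + 2) * ?a)" by (rule common_divisor_dvd_cont[OF hd p])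
 also have "?a * ?b = of_int (X k) * wt (k + 1)" using wt_rec(2)[OF k] s1 by simp
 also have "(of_int (X k) * wt (k + 1)) ^ s (k + 2) * ?a = of_int (X k ^ s (k + 2)) * (wt (k + 1) ^ s (k + 2) * ?a)"
  by (simp only: scalar_power mult.assoc)
 also have "cont ... = X k ^ s (k + 2) * X (k + 1)"
  unfolding cont_of_int_mult using M_pos[of k "s (k + 1)"] by (simp add: M_def[of "Suc k"])
 finally have "h ^ p dvd m0 ^ p * (X k ^ s (k + 2) * X (k + 1))" .
 moreover have "h > 0" using g_pos[of k] by (simp add: h_def)
 ultimately show ?thesis using 1 that by blast
qed

text \<open>The products \<open>wt k ^ s (k + 1) * wt (k - 1) * wt k\<close> and
  \<open>wt k ^ (s (k + 1) + 1) * wt (k - 1)\<close> agree up to sign after multiplication by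
  \<open>Phi (k + 1)\<close> and \<open>Phi k\<close> respectively. So the content at the start of
  the next index is controlled by the one at the end of this index, up to the determinant of
  \<open>Phi k\<close>.\<close>

lemma M_1_dvd:
 assumes k: "k >= 1"
 shows "X k * M (k + 1) 1 dvd m0 * e0 * M k (s (k + 1) + 1)"
proof -
 let ?a = "wt k" and ?b = "wt (k - 1)"
 have C: "cw k * cw (k - 1) ~= 0" using cw_pos[of k] cw_pos[of "k - 1"] by simp
 have ba: "w (k - 1) * w k * Y = of_int (cw k * cw (k - 1)) * (?b * ?a * Y)" for Y
 proof -
  have "w (k - 1) * w k = of_int (cw (k - 1) * cw k) * (?b * ?a)" by (simp only: scalar_mult_scalar[symmetric] w_eq[symmetric])
  then show ?thesis by (simp only: mult.assoc mult.commute[of "cw (k - 1)"])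
 qed
 have ab: "w k * w (k - 1) * Y = of_int (cw k * cw (k - 1)) * (?a * ?b * Y)" for Y
 proof -
  have "w k * w (k - 1) = of_int (cw k * cw (k - 1)) * (?a * ?b)" by (simp only: scalar_mult_scalar[symmetric] w_eq[symmetric])
  then show ?thesis by (simp only: mult.assoc)
 qed
 have "of_int (cw k * cw (k - 1)) * (?b * ?a * Phi (k + 1)) = w (k - 1) * w k * Phi (k + 1)"
  by (simp only: ab ba)
 also have "... = - (w k * w (k - 1) * Phi k)" using w_Phi[OF k] by simp
 also have "... = of_int (cw k * cw (k - 1)) * (- (?a * ?b * Phi k))"
  by (simp only: ab ba mult_minus_right)
 finally have sw: "?b * ?a * Phi (k + 1) = - (?a * ?b * Phi k)" by (rule of_int_mat2_mult_left_cancel[OF C])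
 let ?x = "?a ^ s (k + 1)"
 have x: "?x * ?b * ?a = of_int (X k) * (wt (k + 1) * wt k)" using wt_rec(2)[OF k] by (simp add: mult.assoc)
 have y: "?x * (?a * ?b) = ?a ^ (s (k + 1) + 1) * ?b"
  by (simp only: power_add power_one_right mult.assoc)
 have xM: "X k * M (k + 1) 1 = cont (?x * ?b * ?a)"
  unfolding x cont_of_int_mult using M_pos[of k "s (k + 1)"] by (simp add: M_def[of "Suc k"])
 have "cont (?x * ?b * ?a) dvd cont (?x * ?b * ?a * Phi (k + 1))" by (rule cont_dvd_left)
 also have "?x * ?b * ?a * Phi (k + 1) = - (?x * (?a * ?b) * Phi k)"
  using sw by (simp add: mult.assoc)
 also have "cont ... = cont (?x * (?a * ?b) * Phi k)" by simp
 finally have 1: "X k * M (k + 1) 1 dvd cont (?x * (?a * ?b) * Phi k)"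
  unfolding xM .
 have "cont (?x * (?a * ?b) * Phi k) dvd mdet (Phi k) * cont (?x * (?a * ?b))" by (rule cont_cancel_right)
 then have "cont (?x * (?a * ?b) * Phi k) dvd m0 * e0 * M k (s (k + 1) + 1)" by (simp only: mdet_Phi y M_def)
 with 1 show ?thesis by (rule dvd_trans)
qed

text \<open>A divisor \<open>u\<close> of the coefficients of \<open>U_vec (wt k)\<close> makes \<open>wt k\<close> scalar modulo \<open>u\<close>, hence is
 coprime to its determinant, while \<open>u\<^sup>2\<close> divides the determinant of every commutator with \<open>wt k\<close>.\<close>

lemma U_content_bound:
 assumes k: "k >= 1"
  and u: "u dvd m12 (wt (k + 1))" "u dvd m21 (wt (k + 1))" "u dvd m11 (wt (k + 1)) - m22 (wt (k + 1))"
 shows "u\<^sup>2 dvd e0 * (X k)\<^sup>2"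
proof -
 let ?a = "wt (k + 1)" and ?b = "wt k"
 have cop: "coprime u (mdet ?a)"
 proof (rule ccontr)
  assume "~ coprime u (mdet ?a)"
  then have "~ is_unit (gcd u (mdet ?a))" by (simp add: coprime_iff_gcd_eq_1)
  moreover have "gcd u (mdet ?a) ~= 0" using mdet_wt_nz by simp
  ultimately obtain p where p: "prime p" "p dvd u" "p dvd mdet ?a" by (metis gcd_greatest_iff prime_divisor_exists)
  have d: "p dvd m12 ?a" "p dvd m21 ?a" "p dvd m11 ?a - m22 ?a" using p u dvd_trans by blast+
  have "m11 ?a * m11 ?a = mdet ?a + m11 ?a * (m11 ?a - m22 ?a) + m12 ?a * m21 ?a"
   by (simp add: mdet_def algebra_simps)
  then have "p dvd m11 ?a * m11 ?a" using d p by (metis dvd_add dvd_mult dvd_mult2)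
  then have 1: "p dvd m11 ?a" using p by (simp add: prime_dvd_mult_iff)
  then have "p dvd m22 ?a" using d(3) by (metis dvd_diff_commute dvd_diff diff_diff_eq2 add_diff_cancel_left')
  then have "p dvd cont ?a" using 1 d by (simp add: dvd_cont_iff)
  then show False using cont_wt p by (simp add: not_prime_unit)
 qed
 have "u\<^sup>2 dvd mdet (?a * ?b - ?b * ?a)"
 proof -
  obtain x y z where xyz: "m12 ?a = u * x" "m21 ?a = u * y" "m11 ?a - m22 ?a = u * z" using u by (auto simp: dvd_def)
  then have m: "m11 ?a = m22 ?a + u * z" by simp
  have "?a * ?b - ?b * ?a = of_int u * (Mat2 z x y 0 * ?b - ?b * Mat2 z x y 0)"
   by (simp add: mat2_eq_iff mat2_mult_entries xyz[simplified] m[simplified] algebra_simps)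
  then have "mdet (?a * ?b - ?b * ?a) = u\<^sup>2 * mdet (Mat2 z x y 0 * ?b - ?b * Mat2 z x y 0)"
   by (simp only: mdet_mult mdet_of_int)
  then show ?thesis by simp
 qed
 then have "u\<^sup>2 dvd m0 * mdet (?a * ?b - ?b * ?a)" by simp
 then have "u\<^sup>2 dvd mdet ?a * (mdet ?b * e0)" using mdet_commutator_wt[of "k + 1"] by (simp add: mult.assoc)
 then have ub: "u\<^sup>2 dvd mdet ?b * e0" using cop by (simp add: coprime_dvd_mult_right_iff)
 \<comment> \<open>Determinants in \<open>wt_rec\<close> show that \<open>mdet ?b\<close> divides
   \<open>(X k)^2 * mdet ?a\<close>; the second factor is then removed by coprimality with
   \<open>u\<close>.\<close>
 have "mdet (wt k ^ s (k + 1) * wt (k - 1)) = mdet (of_int (X k) * ?a)" using wt_rec(2)[OF k] by simp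
 then have "mdet ?b ^ s (k + 1) * mdet (wt (k - 1)) = (X k)\<^sup>2 * mdet ?a" by simp
 moreover have "mdet ?b dvd mdet ?b ^ s (k + 1)" using s_pos[of "k + 1"] by (intro dvd_power) auto
 ultimately have "mdet ?b dvd (X k)\<^sup>2 * mdet ?a" by (metis dvd_mult2)
 then have "u\<^sup>2 dvd ((X k)\<^sup>2 * mdet ?a) * e0" by (intro dvd_trans[OF ub] mult_dvd_mono dvd_refl)
 then have "u\<^sup>2 dvd mdet ?a * (e0 * (X k)\<^sup>2)" by (simp add: mult_ac)
 then show ?thesis using cop by (simp add: coprime_dvd_mult_right_iff)
qed

end

section \<open>Contents are negligible on the scale of \<open>q\<close>\<close>

context sturm_seq
begin

definition sublin :: "(nat \<Rightarrow> real) \<Rightarrow> bool" where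
 "sublin f \<longleftrightarrow> (\<forall>eta>0. EV k. f k <= eta * q k)"

lemma sublinD: "sublin f ==> eta > 0 ==> EV k. f k <= eta * q k"
 by (simp add: sublin_def)

lemma ratio_approx:
 assumes "(\<lambda>k. f k / q k) \<longlonglongrightarrow> c" "eta > 0"
 shows "EV k. \<bar>f k - c * q k\<bar> <= eta * q k"
 using tendstoD[OF assms]
proof eventually_elim
 case (elim k)
 have "f k - c * q k = (f k / q k - c) * q k" using q_pos[of k] by (simp add: field_simps)
 then have "\<bar>f k - c * q k\<bar> = \<bar>f k / q k - c\<bar> * q k" using q_pos[of k] by (simp add: abs_mult)
 also have "... <= eta * q k" using elim q_pos[of k] by (intro mult_right_mono) (auto simp: dist_real_def)
 finally show ?case .
qed

lemma const_div_q: "(\<lambda>k. C / q k) \<longlonglongrightarrow> 0"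
 by (rule real_tendsto_divide_at_top[OF tendsto_const q_at_top])

lemma eventually_next: "EV k. P k ==> EV k. P (k + 1)"
 using eventually_sequentially_Suc[of P] by simp

lemma eventually_previous:
 assumes "EV k. P k"
 shows "EV k. P (k - 1)"
proof -
 have "EV k. P (Suc k - 1)" using assms by simp
 then show ?thesis unfolding eventually_sequentially_Suc[of "\<lambda>k. P (k - 1)"] .
qed

end

lemma ln_square: "0 < x ==> ln (x\<^sup>2) = 2 * ln (x :: real)"
 by (simp add: ln_realpow)

lemma ln_le_ln: "0 < x ==> x <= y ==> ln x <= ln (y :: real)"
 by simp

context mat_rec
begin

text \<open>\<open>2 * nrm\<close> is submultiplicative, so its logarithm is bounded by a solution
  of the recurrence of \<open>q\<close>.\<close>

lemma ln_nrm_bound: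
 obtains C where "C > 0" "!!k. ln (2 * nrm (w k)) <= C * q k"
proof -
 have n1: "nrm (w k) >= 1" for k by (rule nrm_ge_1[OF w_nonzero])
 define f where "f k = ln (2 * nrm (w k))" for k
 have power: "2 * nrm (A ^ l * B) <= (2 * nrm A) ^ l * (2 * nrm B)" for A B l
 proof (induction l)
  case (Suc l)
  have "nrm (A ^ Suc l * B) <= 2 * nrm A * nrm (A ^ l * B)" using nrm_mult[of A "A ^ l * B"] by (simp add: mult.assoc)
  also have "2 * nrm A * nrm (A ^ l * B) <= nrm A * ((2 * nrm A) ^ l * (2 * nrm B))"
   using mult_left_mono[OF Suc, of "nrm A"] by (simp add: mult_ac)
  finally show ?case by (simp add: mult_ac)
 qed simp
 have f0: "f k >= 0" for k using n1[of k] by (simp add: f_def)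
 have step: "f (k + 1) <= real (s (k + 1)) * f k + f (k - 1)" if "k >= 1" for k
 proof -
  have "f (k + 1) <= ln ((2 * nrm (w k)) ^ s (k + 1) * (2 * nrm (w (k - 1))))"
   unfolding f_def
  proof (rule ln_le_ln)
   show "2 * nrm (w (k + 1)) <= (2 * nrm (w k)) ^ s (k + 1) * (2 * nrm (w (k - 1)))"
    unfolding rec[OF that] by (rule power)
  qed (use n1[of "k + 1"] in linarith)
  also have "... = real (s (k + 1)) * f k + f (k - 1)"
   using n1[of k] n1[of "k - 1"] by (simp add: f_def ln_mult_pos ln_realpow distrib_left)
  finally show ?thesis .
 qed
 define C where "C = 1 + max (f 0) (f 1)"
 have C: "f 0 <= C" "f 1 <= C" "C > 0" using f0[of 0] by (auto simp: C_def)
 have "f k <= C * q k & f (Suc k) <= C * q (Suc k)" for k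
 proof (induction k)
  case 0
  have "C * 1 <= C * q (Suc 0)" using C q_ge_1[of 1] by (intro mult_left_mono) auto
  then have "f (Suc 0) <= C * q (Suc 0)" using C by (simp only: One_nat_def)
  then show ?case using C by simp
 next
  case (Suc k)
  have "f (Suc k + 1) <= real (s (Suc k + 1)) * f (Suc k) + f k" using step[of "Suc k"] by simp
  also have "... <= real (s (Suc k + 1)) * (C * q (Suc k)) + C * q k"
   using Suc by (intro add_mono mult_left_mono) auto
  also have "... = C * q (Suc k + 1)" using q_rec[of "Suc k"] by (simp add: algebra_simps)
  finally show ?case using Suc by simp
 qed
 then show ?thesis using that[of C] C(3) unfolding f_def by blast
qed

abbreviation LM :: "nat \<Rightarrow> nat \<Rightarrow> real" where "LM k l \<equiv> ln (real_of_int (M k l))"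
abbreviation LX :: "nat \<Rightarrow> real" where "LX k \<equiv> LM k (s (k + 1))"
abbreviation Lg :: "nat \<Rightarrow> real" where "Lg k \<equiv> ln (real_of_int (g k))"

lemma M_ge_1: "real_of_int (M k l) >= 1" using M_pos[of k l] by linarith
lemma g_ge_1: "real_of_int (g k) >= 1" using g_pos[of k] by linarith
lemma cw_ge_1: "real_of_int (cw k) >= 1" using cw_pos[of k] by linarith
lemma LM_nonneg: "LM k l >= 0" using M_ge_1[of k l] by simp
lemma Lg_nonneg: "Lg k >= 0" using g_ge_1[of k] by simp

lemma ln_cw_limit:
 obtains \<gamma> where "(\<lambda>k. ln (real_of_int (cw k)) / q k) \<longlonglongrightarrow> \<gamma>"
proof -
 obtain C where C: "C > 0" "!!k. ln (2 * nrm (w k)) <= C * q k" using ln_nrm_bound by blast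
 have "ln (real_of_int (cw (k + 1))) >= real (s (k + 1)) * ln (real_of_int (cw k)) + ln (real_of_int (cw (k - 1)))" if "k >= 1" for k
  using wt_rec(1)[OF that] cw_ge_1[of k] cw_ge_1[of "k - 1"] M_ge_1[of k "s (k + 1)"]
  by (simp add: ln_mult_pos ln_realpow del: ln_ge_zero_iff)
 moreover have "ln (real_of_int (cw k)) <= C * q k" for k
 proof -
  have "nrm (w k) = real_of_int (cw k) * nrm (wt k)"
   using nrm_of_int_mult[of "cw k" "wt k"] w_eq[of k] cw_pos[of k] by simp
  moreover have "wt k ~= 0" using mdet_wt_nz[of k] by auto
  then have "nrm (wt k) >= 1" by (rule nrm_ge_1)
  ultimately have "real_of_int (cw k) <= 2 * nrm (w k)"
   using mult_left_mono[of 1 "nrm (wt k)" "real_of_int (cw k)"] cw_ge_1[of k] by linarith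
  then have "ln (real_of_int (cw k)) <= ln (2 * nrm (w k))" using cw_ge_1[of k] by simp
  then show ?thesis using C(2)[of k] by linarith
 qed
 ultimately show ?thesis using superadditive_ratio_converges[of "\<lambda>k. ln (real_of_int (cw k))" C] that by blast
qed

text \<open>\<open>LX k\<close> is the defect in the superadditivity of the logarithms of the
  contents \<open>cw\<close>. Their ratios to \<open>q\<close> converge, so the defect is negligible
  against \<open>q (k + 1)\<close>.\<close>

lemma LX_small:
 assumes "eta > 0"
 shows "EV k. LX k <= eta * q (k + 1)"
proof -
 define f where "f k = ln (real_of_int (cw k))" for k
 obtain \<gamma> where \<gamma>: "(\<lambda>k. f k / q k) \<longlonglongrightarrow> \<gamma>" unfolding f_def using ln_cw_limit by blast
 have "eta / 2 > 0" using assms by simp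
 note ev = ratio_approx[OF \<gamma> this]
 note ev1 = eventually_next[OF ev] and ev2 = eventually_previous[OF ev]
 show ?thesis using ev ev1 ev2 eventually_ge_at_top[of 1]
 proof eventually_elim
  case (elim k)
  let ?S = "real (s (k + 1))"
  have LX: "LX k = f (k + 1) - ?S * f k - f (k - 1)"
   unfolding f_def wt_rec(1)[OF elim(4)] using cw_ge_1[of k] cw_ge_1[of "k - 1"] M_ge_1[of k "s (k + 1)"]
   by (simp add: ln_mult_pos ln_realpow)
  have "?S * (\<gamma> * q k - eta / 2 * q k) <= ?S * f k"
   using elim(1) unfolding abs_le_iff by (intro mult_left_mono; linarith)
  then have "LX k <= \<gamma> * (q (k + 1) - ?S * q k - q (k - 1)) + eta / 2 * (q (k + 1) + ?S * q k + q (k - 1))"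
   unfolding LX using elim(2,3) unfolding abs_le_iff by (simp only: algebra_simps; linarith)
  also have "... = eta * q (k + 1)" using q_rec[OF elim(4)] by (simp add: algebra_simps)
  finally show ?case .
 qed
qed

lemma dvd_ln_le:
 fixes a b :: int
 assumes "a dvd b" "a > 0" "b > 0"
 shows "ln (real_of_int a) <= ln (real_of_int b)"
 using zdvd_imp_le[OF assms(1,3)] assms(2) by simp

text \<open>The bound for \<open>X k\<close> is relative to \<open>q (k + 1)\<close> and has to be
  improved to one relative to \<open>q k\<close>. If \<open>s (k + 1) >= 2\<close>, a power of
  \<open>g k\<close> with exponent comparable to \<open>s (k + 1)\<close> divides
  \<open>X k\<close>. If \<open>s (k + 1) = 1\<close>, \<open>q (k + 1)\<close> is at most
  \<open>2 * q k\<close>, and \<open>g_bound_1\<close> provides a divisor \<open>h\<close> whose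
  powers occur in the contents two steps later.\<close>

lemma Lg_sublin: "sublin Lg"
 unfolding sublin_def
proof (intro allI impI)
 fix eta :: real assume eta: "eta > 0"
 \<comment> \<open>With one hundredth here the contributions in the second case add up to
   \<open>15 / 100 * eta\<close> for the logarithm of \<open>h\<close>; the passage from
   \<open>h\<close> to \<open>g k\<close> doubles it.\<close>
 have X: "EV k. LX k <= eta / 100 * q (k + 1)" using LX_small[of "eta / 100"] eta by simp
 have X1: "EV k. LX (k + 1) <= eta / 100 * q (k + 2)"
  using X eventually_sequentially_Suc[of "\<lambda>k. LX k <= eta / 100 * q (k + 1)"] by simp
 have m: "EV k. ln \<bar>real_of_int m0\<bar> <= eta / 100 * q k"
  using eta by (intro eventually_const_le_q) simp
 show "EV k. Lg k <= eta * q k"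
  using X X1 m eventually_ge_at_top[of 1]
 proof eventually_elim
  case (elim k)
  have qk: "q k > 0" "q (k + 1) > 0" by (rule q_pos)+
  show ?case
  proof (cases "s (k + 1) = 1")
   case False
   define n where "n = s (k + 1) div 2"
   have s2: "s (k + 1) >= 2" using False s_pos[of "k + 1"] by linarith
   then have n: "n >= 1" "s (k + 1) <= 3 * n" unfolding n_def by linarith+
   have "real n * Lg k = ln (real_of_int (g k ^ n))" using g_ge_1[of k] by (simp add: ln_realpow)
   also have "... <= LX k" using g_power_dvd_X[of k] g_pos[of k] M_pos by (intro dvd_ln_le) (auto simp: n_def)
   also have "... <= eta / 100 * ((real (s (k + 1)) + 1) * q k)"
    by (rule order_trans[OF elim(1) mult_left_mono[OF q_rec_bounds(2)[OF elim(4)]]]) (use eta in simp)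
   also have "... <= eta / 100 * (real n * 4 * q k)" using n qk eta by (intro mult_left_mono mult_right_mono) auto
   also have "... <= real n * (eta * q k)" using n qk eta by simp
   finally show ?thesis using n by simp
  next
   case True
   define p where "p = (if s (k + 2) = 1 then 1 else s (k + 2) div 2)"
   have s2: "s (k + 2) >= 1" using s_pos[of "k + 2"] by linarith
   then have p: "p >= 1" "s (k + 2) <= 3 * p" unfolding p_def by (auto split: if_splits)
   obtain h where h: "h > 0" "g k dvd h\<^sup>2" "h ^ p dvd m0 ^ p * (X k ^ s (k + 2) * X (k + 1))"
    using g_bound_1[OF elim(4) True p_def] .
   have m: "real_of_int \<bar>m0\<bar> >= 1" "\<bar>m0\<bar> > 0" using m0_nz by linarith+
   have q2: "q (k + 2) <= real p * 4 * q (k + 1)"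
   proof -
    have "q (k + 2) <= (real (s (k + 2)) + 1) * q (k + 1)" using q_rec_bounds(2)[of "k + 1"] by simp
    also have "... <= (real p * 4) * q (k + 1)" using p qk by (intro mult_right_mono) linarith+
    finally show ?thesis .
   qed
   have q1: "q (k + 1) <= 2 * q k" using q_rec_bounds(2)[OF elim(4)] True by simp
   have eq: "\<bar>m0 ^ p * (X k ^ s (k + 2) * X (k + 1))\<bar> = \<bar>m0\<bar> ^ p * (X k ^ s (k + 2) * X (k + 1))"
    using M_pos[of k "s (k + 1)"] M_pos[of "k + 1" "s (k + 2)"] by (simp add: abs_mult power_abs)
   have "h ^ p dvd \<bar>m0 ^ p * (X k ^ s (k + 2) * X (k + 1))\<bar>" using h(3) by (simp only: dvd_abs_iff)
   then have "h ^ p dvd \<bar>m0\<bar> ^ p * (X k ^ s (k + 2) * X (k + 1))" by (simp only: eq)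
   then have "ln (real_of_int (h ^ p)) <= ln (real_of_int (\<bar>m0\<bar> ^ p * (X k ^ s (k + 2) * X (k + 1))))"
    using h(1) m(2) M_pos by (intro dvd_ln_le) auto
   moreover have "ln (real_of_int (h ^ p)) = real p * ln (real_of_int h)" using h(1) by (simp add: ln_realpow)
   moreover have "ln (real_of_int (\<bar>m0\<bar> ^ p * (X k ^ s (k + 2) * X (k + 1))))
     = real p * ln \<bar>real_of_int m0\<bar> + (real (s (k + 2)) * LX k + LX (k + 1))"
    using m M_ge_1[of k "s (k + 1)"] M_ge_1[of "k + 1" "s (k + 2)"] by (simp add: ln_mult_pos ln_realpow)
   ultimately have base: "real p * ln (real_of_int h) <= real p * ln \<bar>real_of_int m0\<bar> + (real (s (k + 2)) * LX k + LX (k + 1))"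
    by simp
   have i1: "real (s (k + 2)) * LX k <= (3 * real p) * LX k" using p LM_nonneg by (intro mult_right_mono) auto
   have i2: "(3 * real p) * LX k <= (3 * real p) * (eta / 100 * (2 * q k))"
   proof (intro mult_left_mono)
    have "eta / 100 * q (k + 1) <= eta / 100 * (2 * q k)" using q1 eta by (intro mult_left_mono) auto
    then show "LX k <= eta / 100 * (2 * q k)" using elim(1) by linarith
   qed simp
   have i3: "LX (k + 1) <= eta / 100 * (real p * 4 * (2 * q k))"
   proof -
    have "real p * 4 * q (k + 1) <= real p * 4 * (2 * q k)" using q1 by (intro mult_left_mono) auto
    then have "q (k + 2) <= real p * 4 * (2 * q k)" using q2 by linarith
    then have "eta / 100 * q (k + 2) <= eta / 100 * (real p * 4 * (2 * q k))" using eta by (intro mult_left_mono) auto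
    then show ?thesis using elim(2) by linarith
   qed
   have i4: "real p * ln \<bar>real_of_int m0\<bar> <= real p * (eta / 100 * q k)" using elim(3) by (intro mult_left_mono) auto
   have "real p * (eta / 100 * q k) + (3 * real p * (eta / 100 * (2 * q k)) + eta / 100 * (real p * 4 * (2 * q k)))
     = real p * (15 / 100 * (eta * q k))" by (simp add: algebra_simps)
   moreover have "real p * (15 / 100 * (eta * q k)) <= real p * (eta / 2 * q k)"
    using mult_pos_pos[OF eta qk(1)] by (intro mult_left_mono) auto
   ultimately have "real p * ln (real_of_int h) <= real p * (eta / 2 * q k)" using base i1 i2 i3 i4 by linarith
   then have hh: "ln (real_of_int h) <= eta / 2 * q k" using p by simp
   have "Lg k <= ln (real_of_int (h\<^sup>2))" using h g_pos[of k] by (intro dvd_ln_le) auto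
   also have "... = 2 * ln (real_of_int h)" using h(1) by (simp add: ln_realpow)
   finally show ?thesis using hh by simp
  qed
 qed
qed

lemma LM_concave: "LM k (Suc (Suc l)) - LM k (Suc l) <= LM k (Suc l) - LM k l + Lg k"
proof -
 have "ln (real_of_int (M k (l + 2) * M k l)) <= ln (real_of_int (g k * (M k (l + 1))\<^sup>2))"
  using M_concave[of k l] by (intro dvd_ln_le mult_pos_pos zero_less_power M_pos g_pos)
 then show ?thesis
  using M_ge_1[of k "l + 2"] M_ge_1[of k l] M_ge_1[of k "l + 1"] g_ge_1[of k]
  by (simp add: ln_mult_pos ln_realpow)
qed

lemma LM_increment: "LM k (Suc l) - LM k l <= LM k 1 + real l * Lg k"
proof (induction l)
 case (Suc l)
 then show ?case using LM_concave[of k l] by (simp add: algebra_simps)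
qed simp

lemma LM_linear: "LM k l <= real l * (LM k 1 + real l * Lg k)"
proof (induction l)
 case (Suc l)
 have "LM k (Suc l) <= LM k l + LM k 1 + real l * Lg k" using LM_increment[of k l] by simp
 also have "... <= real (Suc l) * (LM k 1 + real (Suc l) * Lg k)"
 proof -
  have "real (Suc l) * (LM k 1 + real (Suc l) * Lg k)
    = real l * (LM k 1 + real l * Lg k) + LM k 1 + real l * Lg k + (real l * Lg k + Lg k)" by (simp add: algebra_simps)
  moreover have "real l * Lg k >= 0" using Lg_nonneg[of k] by simp
  ultimately show ?thesis using Suc Lg_nonneg[of k] by linarith
 qed
 finally show ?case .
qed simp

lemma LM_mono: "i <= j ==> LM k i <= LM k j"
 by (intro dvd_ln_le M_dvd_mono M_pos)

text \<open>By \<open>M_1_dvd\<close>, \<open>LX k + LM (k + 1) 1\<close> is at most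
  \<open>LM k (s (k + 1) + 1)\<close> up to a constant. By concavity the last increment is at most
  \<open>LM k 1\<close> plus \<open>s (k + 1)\<close> times the small defect, so \<open>LX k\<close>
  cancels; finally \<open>LM k 1 <= LX k\<close>.\<close>

lemma LM_1_sublin: "sublin (\<lambda>k. LM k 1)"
 unfolding sublin_def
proof (intro allI impI)
 fix eta :: real assume eta: "eta > 0"
 then have e3: "eta / 3 > 0" by simp
 have me: "\<bar>m0 * e0\<bar> > 0" using m0_nz e0_nz by simp
 have "EV k. LM (k + 1) 1 <= eta * q (k + 1)"
  using LX_small[OF e3] sublinD[OF Lg_sublin e3] eventually_const_le_q[OF e3, of "ln \<bar>real_of_int (m0 * e0)\<bar>"]
   eventually_ge_at_top[of 1]
 proof eventually_elim
  case (elim k)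
  let ?S = "s (k + 1)"
  have "X k * M (k + 1) 1 dvd \<bar>m0 * e0\<bar> * M k (?S + 1)"
  proof -
   have "\<bar>m0 * e0\<bar> * M k (?S + 1) = \<bar>m0 * e0 * M k (?S + 1)\<bar>" using M_pos[of k "?S + 1"] by (simp add: abs_mult)
   then show ?thesis using M_1_dvd[of k] elim by (simp only: dvd_abs_iff)
  qed
  then have "ln (real_of_int (X k * M (k + 1) 1)) <= ln (real_of_int (\<bar>m0 * e0\<bar> * M k (?S + 1)))"
   using me M_pos by (intro dvd_ln_le mult_pos_pos)
  moreover have "ln (real_of_int (X k * M (k + 1) 1)) = LX k + LM (k + 1) 1"
   unfolding of_int_mult using M_ge_1[of k ?S] M_ge_1[of "k + 1" 1] by (intro ln_mult_pos; linarith)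
  moreover have "ln (real_of_int (\<bar>m0 * e0\<bar> * M k (?S + 1))) = ln (real_of_int \<bar>m0 * e0\<bar>) + LM k (?S + 1)"
   unfolding of_int_mult[of "\<bar>m0 * e0\<bar>"] using M_ge_1[of k "?S + 1"] me by (intro ln_mult_pos; linarith)
  ultimately have "LX k + LM (k + 1) 1 <= ln \<bar>real_of_int (m0 * e0)\<bar> + LM k (?S + 1)"
   by (simp only: of_int_abs)
  moreover have "LM k (?S + 1) <= LX k + LM k 1 + real ?S * Lg k" using LM_increment[of k ?S] by simp
  moreover have "LM k 1 <= LX k" using s_pos[of "k + 1"] by (intro LM_mono) auto
  moreover have "real ?S * Lg k <= eta / 3 * q (k + 1)"
  proof -
   have "real ?S * Lg k <= real ?S * (eta / 3 * q k)" using elim by (intro mult_left_mono) auto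
   also have "... = eta / 3 * (real ?S * q k)" by simp
   also have "... <= eta / 3 * q (k + 1)" using eta q_rec_bounds(1)[of k] elim by (intro mult_left_mono) auto
   finally show ?thesis .
  qed
  moreover have "eta / 3 * q k <= eta / 3 * q (k + 1)" using eta q_mono_Suc by (intro mult_left_mono) auto
  ultimately show ?case using elim(1,3) by linarith
 qed
 then show "EV k. LM k 1 <= eta * q k"
  using eventually_sequentially_Suc[of "\<lambda>k. LM k 1 <= eta * q k"] by simp
qed

text \<open>For \<open>l\<close> up to a fixed \<open>l0\<close> concavity gives the bound, since
  the accumulated defect is at most \<open>l0 * Lg k\<close>. For larger \<open>l\<close> the
  content of \<open>wt k ^ l\<close> occurs \<open>s (k + 1) div l\<close> times in
  \<open>X k\<close> and is therefore small; replacing it by \<open>M k l\<close> costs the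
  determinant of \<open>wt (k - 1)\<close>, whose logarithm is a bounded multiple of
  \<open>q k\<close>, negligible against \<open>l * q k\<close>. The last index
  \<open>s (k + 1) + 1\<close> needs one more increment.\<close>

lemma LM_small:
 assumes eta: "eta > 0"
 shows "EV k. \<forall>l\<in>{1..s (k + 1) + 1}. LM k l <= eta * (real l * q k)"
proof -
 obtain C where C: "C > 0" "!!k. ln (2 * nrm (w k)) <= C * q k" using ln_nrm_bound by blast
 have det: "ln \<bar>real_of_int (mdet (wt k))\<bar> <= 2 * C * q k" for k
 proof -
  have "wt k ~= 0" using mdet_wt_nz[of k] by auto
  then have n: "nrm (wt k) >= 1" by (rule nrm_ge_1)
  have "nrm (w k) = real_of_int (cw k) * nrm (wt k)"
   using nrm_of_int_mult[of "cw k" "wt k"] w_eq[of k] cw_pos[of k] by simp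
  then have nw: "nrm (wt k) <= nrm (w k)" using mult_right_mono[OF cw_ge_1, of "nrm (wt k)" k] n by simp
  have "\<bar>real_of_int (mdet (wt k))\<bar> <= 2 * (nrm (wt k))\<^sup>2" by (rule abs_mdet_le)
  also have "... <= (2 * nrm (w k))\<^sup>2"
  proof -
   have "(nrm (wt k))\<^sup>2 <= (nrm (w k))\<^sup>2" using power_mono[OF nw, of 2] by simp
   moreover have "(2 * nrm (w k))\<^sup>2 = 4 * (nrm (w k))\<^sup>2" by (simp add: power_mult_distrib)
   ultimately show ?thesis using zero_le_power2[of "nrm (wt k)"] by linarith
  qed
  finally have "ln \<bar>real_of_int (mdet (wt k))\<bar> <= ln ((2 * nrm (w k))\<^sup>2)"
   using mdet_wt_nz[of k] by (subst ln_le_cancel_iff) (use n nw in auto)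
  also have "... = 2 * ln (2 * nrm (w k))" by (rule ln_square) (use n nw in linarith)
  also have "... <= 2 * (C * q k)" using C(2)[of k] by simp
  finally show ?thesis by simp
 qed
 define \<theta> where "\<theta> = eta / 3"
 have \<theta>: "\<theta> > 0" using eta by (simp add: \<theta>_def)
 \<comment> \<open>Beyond this threshold the cost \<open>2 * C * q k\<close> of the determinant is
   at most half of \<open>\<theta> * (l * q k)\<close>.\<close>
 obtain n0 :: nat where n0: "4 * C / \<theta> <= real n0" using real_arch_simple by blast
 define l0 where "l0 = Suc n0"
 have l0: "real l0 >= 4 * C / \<theta>" "l0 >= 1" using n0 by (auto simp: l0_def)
 define \<tau> where "\<tau> = \<theta> / (2 * real l0)"
 have \<tau>: "\<tau> > 0" "\<tau> * real l0 <= \<theta> / 2" "\<tau> <= \<theta>" using \<theta> l0 by (auto simp: \<tau>_def field_simps)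
 have \<theta>': "\<theta> / 16 > 0" "\<theta> / 2 > 0" using \<theta> by simp_all
 show ?thesis
  using LX_small[OF \<theta>'(1)] sublinD[OF Lg_sublin \<tau>(1)] sublinD[OF LM_1_sublin \<theta>'(2)] eventually_ge_at_top[of 1]
 proof eventually_elim
  case (elim k)
  have qk: "q k > 0" by (rule q_pos)
  let ?S = "s (k + 1)"
  have S1: "?S >= 1" using s_pos[of "k + 1"] by simp
  have le_s: "LM k l <= \<theta> * (real l * q k)" if l: "l >= 1" "l <= ?S" for l
  proof (cases "l <= l0")
   case True
   have "real l * Lg k <= real l0 * (\<tau> * q k)" using True elim Lg_nonneg[of k] by (intro mult_mono) auto
   also have "... <= \<theta> / 2 * q k" using mult_right_mono[OF \<tau>(2), of "q k"] qk by (simp add: mult_ac)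
   finally have "LM k 1 + real l * Lg k <= \<theta> * q k" using elim by simp
   then have "real l * (LM k 1 + real l * Lg k) <= real l * (\<theta> * q k)" by (intro mult_left_mono) auto
   then show ?thesis using LM_linear[of k l] by (simp add: mult_ac)
  next
   case False
   define n where "n = ?S div l"
   have n: "n >= 1" using l by (simp add: n_def div_greater_zero_iff Suc_le_eq)
   have nS: "?S + 1 <= 2 * n * l"
   proof -
    have "?S = n * l + ?S mod l" by (simp add: n_def)
    moreover have "?S mod l < l" using l by simp
    moreover have "l <= n * l" using n by simp
    ultimately show ?thesis by linarith
   qed
   define P where "P = cont (wt k ^ l)"
   have "mdet (wt k ^ l) ~= 0" using mdet_wt_nz by simp
   then have "wt k ^ l ~= 0" by (metis mdet_0)
   then have P: "P > 0" unfolding P_def by (rule cont_pos)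
   have "real n * ln (real_of_int P) = ln (real_of_int (P ^ n))" using P by (simp add: ln_realpow)
   also have "... <= LX k"
    using cont_power_dvd_X[of k l] P M_pos unfolding P_def[symmetric] n_def[symmetric] by (intro dvd_ln_le) auto
   also have "... <= \<theta> / 16 * q (k + 1)" using elim by simp
   also have "... <= \<theta> / 16 * ((real ?S + 1) * q k)"
    using q_rec_bounds(2)[OF elim(4)] \<theta> by (intro mult_left_mono) auto
   also have "... <= \<theta> / 16 * ((2 * real n * real l) * q k)"
   proof -
    have "real (?S + 1) <= real (2 * n * l)" using nS of_nat_le_iff by blast
    then show ?thesis using \<theta> qk by (intro mult_left_mono mult_right_mono) auto
   qed
   finally have "real n * ln (real_of_int P) <= real n * (\<theta> / 8 * (real l * q k))" by (simp add: mult_ac)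
   then have lP: "ln (real_of_int P) <= \<theta> / 8 * (real l * q k)" using n by simp
   have "M k l dvd \<bar>mdet (wt (k - 1))\<bar> * P"
   proof -
    have "\<bar>mdet (wt (k - 1))\<bar> * P = \<bar>mdet (wt (k - 1)) * P\<bar>" using P by (simp add: abs_mult)
    then show ?thesis using M_dvd_power[of k l] unfolding P_def by (simp only: dvd_abs_iff)
   qed
   then have "LM k l <= ln (real_of_int (\<bar>mdet (wt (k - 1))\<bar> * P))"
    using M_pos P mdet_wt_nz[of "k - 1"] by (intro dvd_ln_le mult_pos_pos) auto
   also have "... = ln \<bar>real_of_int (mdet (wt (k - 1)))\<bar> + ln (real_of_int P)"
    using P mdet_wt_nz[of "k - 1"] by (simp add: ln_mult_pos)
   also have "... <= 2 * C * q k + \<theta> / 8 * (real l * q k)"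
   proof -
    have "2 * C * q (k - 1) <= 2 * C * q k" using C q_mono[of "k - 1" k] by (intro mult_left_mono) auto
    then show ?thesis using det[of "k - 1"] lP by linarith
   qed
   also have "2 * C * q k <= \<theta> / 2 * (real l * q k)"
   proof -
    have "4 * C / \<theta> <= real l" using l0 False by linarith
    then have "4 * C <= \<theta> * real l" using \<theta> by (simp add: field_simps)
    then have "4 * C * q k <= \<theta> * real l * q k" using qk by (intro mult_right_mono) auto
    then show ?thesis by simp
   qed
   also have "\<theta> / 2 * (real l * q k) + \<theta> / 8 * (real l * q k) <= \<theta> * (real l * q k)" using \<theta> qk by (simp add: field_simps)
   finally show ?thesis by simp
  qed
  show "\<forall>l\<in>{1..?S + 1}. LM k l <= eta * (real l * q k)"
  proof
   fix l assume l: "l \<in> {1..?S + 1}"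
   show "LM k l <= eta * (real l * q k)"
   proof (cases "l <= ?S")
    case True
    have "\<theta> * (real l * q k) <= eta * (real l * q k)" using eta qk by (intro mult_right_mono) (auto simp: \<theta>_def)
    moreover have "LM k l <= \<theta> * (real l * q k)" using le_s[of l] True l by simp
    ultimately show ?thesis by linarith
   next
    case False
    then have l: "l = Suc ?S" using l by auto
    have "\<tau> * q k <= \<theta> * q k" using mult_right_mono[OF \<tau>(3), of "q k"] qk by linarith
    then have "Lg k <= \<theta> * q k" using elim(2) by linarith
    then have "real ?S * Lg k <= real ?S * (\<theta> * q k)" by (intro mult_left_mono) auto
    also have "... = \<theta> * (real ?S * q k)" by simp
    finally have 1: "real ?S * Lg k <= \<theta> * (real ?S * q k)" .
    have "LM k l <= LM k ?S + LM k 1 + real ?S * Lg k" using LM_increment[of k ?S] unfolding l by linarith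
    then have "LM k l <= \<theta> * (real ?S * q k) + \<theta> / 2 * q k + \<theta> * (real ?S * q k)"
     using 1 le_s[OF S1 order_refl] elim(3) by linarith
    also have "... <= 3 * \<theta> * (real l * q k)" using \<theta> qk unfolding l by (simp add: algebra_simps)
    finally show ?thesis by (simp add: \<theta>_def)
   qed
  qed
 qed
qed

end

section \<open>Primitive points and two-sided estimates\<close>

definition vcont :: "int^3 \<Rightarrow> int" where "vcont x = gcd (x$1) (gcd (x$2) (x$3))"
definition vprim :: "int^3 \<Rightarrow> int^3" where "vprim x = (\<chi> i. x$i div vcont x)"

lemma dvd_vcont_iff: "d dvd vcont x \<longleftrightarrow> (\<forall>i. d dvd x$i)"
 by (simp add: vcont_def forall_3)

lemma vcont_pos: "x ~= 0 ==> vcont x > 0"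
proof -
 assume "x ~= 0"
 then have "vcont x ~= 0" by (auto simp: vcont_def vec3_eq_iff)
 moreover have "vcont x >= 0" by (simp add: vcont_def)
 ultimately show ?thesis by simp
qed

lemma vprim_nth: "x$i = vcont x * vprim x $ i"
 using dvd_vcont_iff[of "vcont x" x] by (simp add: vprim_def)

lemma primitive_vprim:
 assumes "x ~= 0"
 shows "primitive (vprim x)"
 unfolding primitive_def
proof (intro allI impI)
 fix d assume d: "\<forall>i. d dvd vprim x $ i"
 have "vcont x * d dvd x $ i" for i
  using d vprim_nth[of x i] by (metis mult_dvd_mono dvd_refl)
 then have "vcont x * d dvd vcont x" by (simp add: dvd_vcont_iff)
 then show "is_unit d" using vcont_pos[OF assms] by simp
qed

lemma real_vec_vprim: "real_vec x = real_of_int (vcont x) *\<^sub>R real_vec (vprim x)"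
 using vprim_nth[of x] by (simp add: vec_eq_iff)

lemma vprim_scale:
 assumes "x ~= 0"
 shows "hgt x = real_of_int (vcont x) * hgt (vprim x)"
  and "err \<xi> x = real_of_int (vcont x) * err \<xi> (vprim x)"
  and "lin \<xi> x = real_of_int (vcont x) * lin \<xi> (vprim x)"
proof -
 have v: "real_of_int (vcont x) > 0" using vcont_pos[OF assms] by simp
 show "hgt x = real_of_int (vcont x) * hgt (vprim x)"
  unfolding real_vec_vprim[of x] infnorm_mul using v by simp
 show "err \<xi> x = real_of_int (vcont x) * err \<xi> (vprim x)"
  unfolding real_vec_vprim[of x] cross_mult_left infnorm_mul using v by simp
 show "lin \<xi> x = real_of_int (vcont x) * lin \<xi> (vprim x)"
  unfolding real_vec_vprim[of x] inner_scaleR_left abs_mult using v by simp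
qed

lemma dotZ_vprim: "dotZ x y = 0 ==> x ~= 0 ==> y ~= 0 ==> dotZ (vprim x) (vprim y) = 0"
proof -
 assume a: "dotZ x y = 0" "x ~= 0" "y ~= 0"
 have "dotZ x y = vcont x * (vcont y * dotZ (vprim x) (vprim y))"
  unfolding dotZ_def vprim_nth[of x] vprim_nth[of y] by (simp add: algebra_simps)
 then show ?thesis using a vcont_pos[OF a(2)] vcont_pos[OF a(3)] by simp
qed

lemma crossZ_vprim: "crossZ x y ~= 0 ==> crossZ (vprim x) (vprim y) ~= 0"
proof
 assume a: "crossZ x y ~= 0" "crossZ (vprim x) (vprim y) = 0"
 have "x$i * y$j = x$j * y$i" for i j
 proof -
  have "vprim x $ i * vprim y $ j = vprim x $ j * vprim y $ i" using a(2) crossZ_eq_0_iff by blast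
  then have "(vcont x * vcont y) * (vprim x $ i * vprim y $ j) = (vcont x * vcont y) * (vprim x $ j * vprim y $ i)" by simp
  then show ?thesis unfolding vprim_nth[of x] vprim_nth[of y] by (simp only: mult_ac)
 qed
 then have "crossZ x y = 0" using crossZ_eq_0_iff by blast
 then show False using a by simp
qed

lemma hgt_X_vec:
 assumes "tr M = 0"
 shows "hgt (X_vec M) = nrm M"
proof (rule antisym)
 show "hgt (X_vec M) <= nrm M" unfolding hgt_le_iff using nrm_ge[of M] by simp
 have "\<bar>real_of_int (m12 M)\<bar> <= hgt (X_vec M)" "\<bar>real_of_int (m11 M)\<bar> <= hgt (X_vec M)" "\<bar>real_of_int (m21 M)\<bar> <= hgt (X_vec M)"
  using hgt_nth[of "X_vec M" 1] hgt_nth[of "X_vec M" 2] hgt_nth[of "X_vec M" 3] by simp_all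
 then show "nrm M <= hgt (X_vec M)" using traceless_entries[OF assms] by (intro nrm_leI) auto
qed

lemma err_X_vec_le:
 assumes "tr M = 0"
 shows "err \<xi> (X_vec M) <= (1 + \<bar>\<xi>\<bar>) * rho \<xi> M"
proof -
 note m = traceless_entries[OF assms]
 have y: "\<bar>y1 \<xi> M\<bar> <= rho \<xi> M" "\<bar>y2 \<xi> M\<bar> <= rho \<xi> M" using rho_ge by auto
 have "\<bar>\<xi> * y1 \<xi> M\<bar> <= \<bar>\<xi>\<bar> * rho \<xi> M" "\<bar>\<xi> * y2 \<xi> M\<bar> <= \<bar>\<xi>\<bar> * rho \<xi> M" using y by (auto simp: abs_mult intro!: mult_left_mono)
 moreover have "(1 + \<bar>\<xi>\<bar>) * rho \<xi> M = rho \<xi> M + \<bar>\<xi>\<bar> * rho \<xi> M" by (simp add: algebra_simps)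
 moreover have "0 <= \<bar>\<xi>\<bar> * rho \<xi> M" using rho_ge(3) by simp
 moreover have "real_of_int (X_vec M $ 2) * \<xi>\<^sup>2 - real_of_int (X_vec M $ 3) * \<xi> = - (\<xi> * y2 \<xi> M)"
  "real_of_int (X_vec M $ 3) - real_of_int (X_vec M $ 1) * \<xi>\<^sup>2 = y2 \<xi> M + \<xi> * y1 \<xi> M"
  "real_of_int (X_vec M $ 1) * \<xi> - real_of_int (X_vec M $ 2) = - y1 \<xi> M"
  by (simp_all add: y1_def y2_def m power2_eq_square algebra_simps)
 ultimately show ?thesis using y unfolding err_le_iff by linarith
qed

lemma rho_le_err:
 assumes "tr M = 0"
 shows "rho \<xi> M <= (1 + \<bar>\<xi>\<bar>) * err \<xi> (X_vec M)"
proof -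
 note m = traceless_entries[OF assms]
 let ?e = "err \<xi> (X_vec M)"
 have e: "\<bar>real_of_int (X_vec M $ 3) - real_of_int (X_vec M $ 1) * \<xi>\<^sup>2\<bar> <= ?e"
  "\<bar>real_of_int (X_vec M $ 1) * \<xi> - real_of_int (X_vec M $ 2)\<bar> <= ?e" using err_le_iff[of "X_vec M" \<xi> "err \<xi> (X_vec M)", THEN iffD1, OF order_refl] by blast+
 have 1: "\<bar>y1 \<xi> M\<bar> <= ?e" using e(2) by (simp add: y1_def algebra_simps abs_le_iff)
 have "\<bar>\<xi> * y1 \<xi> M\<bar> <= \<bar>\<xi>\<bar> * ?e" using 1 by (auto simp: abs_mult intro!: mult_left_mono)
 moreover have "y2 \<xi> M = (real_of_int (X_vec M $ 3) - real_of_int (X_vec M $ 1) * \<xi>\<^sup>2) - \<xi> * y1 \<xi> M"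
  by (simp add: y1_def y2_def m power2_eq_square algebra_simps)
 ultimately have "\<bar>y2 \<xi> M\<bar> <= ?e + \<bar>\<xi>\<bar> * ?e" using e(1) by linarith
 moreover have "0 <= \<bar>\<xi>\<bar> * ?e" by simp
 ultimately have "\<bar>y1 \<xi> M\<bar> <= ?e + \<bar>\<xi>\<bar> * ?e" "\<bar>y2 \<xi> M\<bar> <= ?e + \<bar>\<xi>\<bar> * ?e" using 1 by linarith+
 then show ?thesis unfolding rho_def distrib_right mult_1 by (intro max.boundedI)
qed

text \<open>The matching lower bound to \<open>rho_T_bound\<close>: the determinant prevents both
  errors from being too small.\<close>

lemma mdet_le_rho: "\<bar>real_of_int (mdet M)\<bar> <= 2 * nrm M * rho \<xi> M"
proof -
 have "real_of_int (mdet M) = real_of_int (m22 M) * y1 \<xi> M - real_of_int (m12 M) * y2 \<xi> M"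
  by (simp add: mdet_def y1_def y2_def algebra_simps)
 moreover have "\<bar>real_of_int (m22 M) * y1 \<xi> M\<bar> <= nrm M * rho \<xi> M" "\<bar>real_of_int (m12 M) * y2 \<xi> M\<bar> <= nrm M * rho \<xi> M"
  by (intro abs_mult_le nrm_ge rho_ge)+
 ultimately show ?thesis by linarith
qed

lemma vcont_X_vec:
 assumes "tr M = 0"
 shows "vcont (X_vec M) = cont M"
proof -
 have "m22 M = - m11 M" using assms by (simp add: tr_def)
 then have eq: "d dvd vcont (X_vec M) \<longleftrightarrow> d dvd cont M" for d by (auto simp: vcont_def dvd_cont_iff)
 have "vcont (X_vec M) dvd cont M" by (rule eq[THEN iffD1, OF dvd_refl])
 moreover have "cont M dvd vcont (X_vec M)" by (rule eq[THEN iffD2, OF dvd_refl])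
 moreover have "vcont (X_vec M) >= 0" by (simp add: vcont_def)
 ultimately show ?thesis using cont_nonneg[of M] by (intro zdvd_antisym_nonneg)
qed

lemma X_vec_nz: "tr M = 0 ==> M ~= 0 ==> X_vec M ~= 0"
 by (auto simp: mat2_eq_iff vec3_eq_iff tr_def)

lemma hgt_U_vec: "hgt (U_vec A) <= 2 * nrm A" "\<bar>real_of_int (m12 A)\<bar> <= hgt (U_vec A)"
proof -
 show "hgt (U_vec A) <= 2 * nrm A" unfolding hgt_le_iff U_vec_nth of_int_minus of_int_diff
  using nrm_ge[of A] nrm_nonneg[of A] by (intro conjI; linarith)
 show "\<bar>real_of_int (m12 A)\<bar> <= hgt (U_vec A)" using hgt_nth[of "U_vec A" 3] by simp
qed

lemma ln_exp_bounds:
 fixes x y e :: real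
 assumes "x > 0" "\<bar>ln x - y\<bar> <= e"
 shows "exp (y - e) <= x" "x <= exp (y + e)"
proof -
 have x: "exp (ln x) = x" using assms(1) by simp
 have "y - e <= ln x" "ln x <= y + e" using assms(2) by linarith+
 then have "exp (y - e) <= exp (ln x)" "exp (ln x) <= exp (y + e)" by (simp_all only: exp_le_cancel_iff)
 then show "exp (y - e) <= x" "x <= exp (y + e)" by (simp_all only: x)
qed

lemma ln_two_sided:
 fixes x y :: real
 assumes "A > 0" "x > 0" "y > 0" "x <= A * y" "y <= A * x"
 shows "\<bar>ln x - ln y\<bar> <= ln A"
proof -
 have "ln x <= ln (A * y)" "ln y <= ln (A * x)" using assms by (intro ln_le_ln; simp)+
 moreover have "ln (A * y) = ln A + ln y" "ln (A * x) = ln A + ln x" using assms by (intro ln_mult_pos; simp)+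
 ultimately show ?thesis by linarith
qed

context sturm_seq
begin

lemma affine_approx:
 assumes "(\<lambda>k. f k / q k) \<longlonglongrightarrow> c" "eta > 0"
 shows "EV k. \<forall>l\<ge>1. \<bar>(real l * f k + f (k - 1)) - c * (real l * q k + q (k - 1))\<bar> <= eta * (real l * q k)"
proof -
 have "eta / 2 > 0" using assms(2) by simp
 note e = ratio_approx[OF assms(1) this]
 show ?thesis using e eventually_previous[OF e]
 proof eventually_elim
  case (elim k)
  show ?case
  proof (intro allI impI)
   fix l :: nat assume l: "l >= 1"
   have "\<bar>real l * (f k - c * q k)\<bar> <= real l * (eta / 2 * q k)"
    using elim(1) unfolding abs_mult by (intro mult_mono) auto
   moreover have "\<bar>f (k - 1) - c * q (k - 1)\<bar> <= eta / 2 * (real l * q k)"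
   proof -
    have "q (k - 1) <= q k" using q_mono by simp
    also have "... <= real l * q k" using l q_pos[of k] by simp
    finally have "eta / 2 * q (k - 1) <= eta / 2 * (real l * q k)" using assms(2) by (intro mult_left_mono) auto
    then show ?thesis using elim(2) by linarith
   qed
   moreover have "(real l * f k + f (k - 1)) - c * (real l * q k + q (k - 1)) = real l * (f k - c * q k) + (f (k - 1) - c * q (k - 1))"
    by (simp add: algebra_simps)
   moreover have "real l * (eta / 2 * q k) + eta / 2 * (real l * q k) = eta * (real l * q k)" by simp
   ultimately show "\<bar>(real l * f k + f (k - 1)) - c * (real l * q k + q (k - 1))\<bar> <= eta * (real l * q k)" by linarith
  qed
 qed
qed

end

lemma abs_shift:
 fixes x y :: real
 assumes "\<bar>x - y\<bar> <= A" "l <= v" "v <= l + E + X" "A + E <= C" "0 <= E"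
 shows "\<bar>x - v - (y - l)\<bar> <= C + X"
 using assms by linarith

lemma add_le_sum:
 fixes x y :: real
 shows "x <= a ==> y <= b ==> 0 <= c ==> 0 <= d ==> x + y <= c + a + b + d + 1"
 by linarith

lemma abs_chain:
 fixes x y :: real
 assumes "\<bar>x - y\<bar> <= P + X" "\<bar>y - z\<bar> <= t" "X <= t" "P <= t"
 shows "\<bar>x - z\<bar> <= 4 * t"
 using assms by linarith

lemma abs_chain2:
 fixes x y :: real
 assumes "\<bar>x - (y + y')\<bar> <= P + X" "\<bar>y - (- z)\<bar> <= t" "\<bar>y' - (- z')\<bar> <= t'" "X <= t" "P <= t" "t <= t'"
 shows "\<bar>x + (z' + z)\<bar> <= 4 * t'"
 using assms by linarith

lemma lower_chain:
 fixes x y :: real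
 assumes "y - (P + X) <= x" "\<bar>y - z\<bar> <= t" "X <= t" "P <= t"
 shows "z - 4 * t <= x"
 using assms by linarith

section \<open>From the matrices to the approximation data\<close>

locale sturm_matrices = mat_limit +
 assumes irr: "r ~= 0 ==> lin \<xi> r ~= 0"
  and det_exponent: "eta > 0 ==> EV k.
   ln \<bar>real_of_int (mdet (wt k))\<bar> <= (sturm_sigma s / (1 + sturm_sigma s) + eta) * ln (nrm (wt k))"
begin

abbreviation "lW k \<equiv> ln (W k)"
abbreviation "ld k \<equiv> ln (dd k)"
abbreviation "lc k \<equiv> ln (real_of_int (cw k))"
text \<open>Expected logarithms after division by the content: \<open>a\<close> for the height and
  \<open>b\<close> for the error attached to \<open>w k\<close>. With \<open>e k\<close>, the
  logarithm of \<open>dd k / (W k)^2\<close>, the value of the primitive form at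
  \<open>\<xi>\<close> is expected to be \<open>exp (b k + e (k + 1))\<close>, in accordance with
  \<open>val_estimate\<close>.\<close>

definition "a k = lW k - lc k"
definition "b k = ld k - lW k - lc k"
definition "e k = ld k - 2 * lW k"
definition "pt k = vprim (U_vec (w k))"
definition "zt k l = vprim (X_vec (T k l))"

lemma power_bounds:
 assumes k: "k >= 1" and l: "l <= s (k + 1) + 1"
 shows "(c * W k) ^ l * W (k - 1) <= nrm (w k ^ l * w (k - 1))"
  and "nrm (w k ^ l * w (k - 1)) <= (2 * W k) ^ l * W (k - 1)"
proof -
 show "(c * W k) ^ l * W (k - 1) <= nrm (w k ^ l * w (k - 1))" using l
 proof (induction l)
  case (Suc l)
  have "(c * W k) ^ Suc l * W (k - 1) = (c * W k) * ((c * W k) ^ l * W (k - 1))" by simp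
  also have "... <= (c * W k) * nrm (w k ^ l * w (k - 1))"
   using Suc c(1) W_pos[of k] by (intro mult_left_mono) auto
  also have "... <= nrm (w k ^ (l + 1) * w (k - 1))" using growth[OF k, of l] Suc by simp
  finally show ?case by simp
 qed simp
 show "nrm (w k ^ l * w (k - 1)) <= (2 * W k) ^ l * W (k - 1)"
 proof (induction l)
  case (Suc l)
  have "nrm (w k ^ Suc l * w (k - 1)) <= 2 * W k * nrm (w k ^ l * w (k - 1))"
   using nrm_mult[of "w k" "w k ^ l * w (k - 1)"] by (simp add: mult.assoc)
  also have "... <= 2 * W k * ((2 * W k) ^ l * W (k - 1))" using Suc W_pos[of k] by (intro mult_left_mono) auto
  finally show ?case by simp
 qed simp
qed

text \<open>The factor \<open>c\<close> inside the logarithm absorbs the constant of the growth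
  condition at each multiplication.\<close>

lemma W_superadditive:
 assumes k: "k >= 1"
 shows "ln (c * W (k + 1)) >= real (s (k + 1)) * ln (c * W k) + ln (c * W (k - 1))"
proof -
 have p: "c * W j > 0" for j using c(1) W_pos[of j] by simp
 have "(c * W k) ^ s (k + 1) * W (k - 1) <= W (k + 1)" using power_bounds(1)[OF k, of "s (k + 1)"] rec[OF k] by simp
 then have "c * ((c * W k) ^ s (k + 1) * W (k - 1)) <= c * W (k + 1)" using c(1) by simp
 then have "(c * W k) ^ s (k + 1) * (c * W (k - 1)) <= c * W (k + 1)" by (simp only: mult_ac)
 then have "ln ((c * W k) ^ s (k + 1) * (c * W (k - 1))) <= ln (c * W (k + 1))"
  by (rule ln_le_ln[rotated]) (intro mult_pos_pos zero_less_power p)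
 moreover have "ln ((c * W k) ^ s (k + 1) * (c * W (k - 1))) = real (s (k + 1)) * ln (c * W k) + ln (c * W (k - 1))"
  using p by (subst ln_mult_pos) (auto intro!: zero_less_power simp: ln_realpow)
 ultimately show ?thesis by linarith
qed

lemma ld_additive:
 assumes k: "k >= 1"
 shows "ld (k + 1) = real (s (k + 1)) * ld k + ld (k - 1)"
proof -
 have "dd (k + 1) = dd k ^ s (k + 1) * dd (k - 1)" unfolding rec[OF k] by (simp add: abs_mult power_abs)
 moreover have "dd k > 0" "dd (k - 1) > 0" using dd_ge_1[of k] dd_ge_1[of "k - 1"] by linarith+
 ultimately show ?thesis by (simp only: ln_mult_pos zero_less_power ln_realpow)
qed

text \<open>The strict inequality needs more than \<open>small\<close>: the combination
  \<open>h\<close> is superadditive and eventually at least 1 because \<open>dd k / (W k)^2\<close>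
  tends to 0, so by the recurrence it stays above a positive multiple of \<open>q\<close>.\<close>

lemma limits:
 obtains \<alpha> \<beta> \<gamma> where "(\<lambda>k. ld k / q k) \<longlonglongrightarrow> \<alpha>" "(\<lambda>k. lW k / q k) \<longlonglongrightarrow> \<beta>" "(\<lambda>k. lc k / q k) \<longlonglongrightarrow> \<gamma>"
  "2 * \<beta> > \<alpha>"
proof -
 obtain C where C: "C > 0" "!!k. ln (2 * W k) <= C * q k" using ln_nrm_bound by blast
 obtain \<gamma> where \<gamma>: "(\<lambda>k. lc k / q k) \<longlonglongrightarrow> \<gamma>" using ln_cw_limit by blast
 have cW: "ln (c * W k) = ln c + lW k" for k using c(1) W_pos[of k] by (rule ln_mult_pos)
 have "ln (c * W k) <= C * q k" for k
 proof -
  have "c * W k <= 2 * W k" using c W_pos[of k] by (intro mult_right_mono) auto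
  then have "ln (c * W k) <= ln (2 * W k)" using c(1) W_pos[of k] by (intro ln_le_ln mult_pos_pos)
  then show ?thesis using C(2)[of k] by linarith
 qed
 then obtain \<beta> where \<beta>': "(\<lambda>k. ln (c * W k) / q k) \<longlonglongrightarrow> \<beta>"
  using superadditive_ratio_converges[of "\<lambda>k. ln (c * W k)" C] W_superadditive by blast
 have "(\<lambda>k. ln (c * W k) / q k - ln c / q k) \<longlonglongrightarrow> \<beta> - 0" by (intro tendsto_diff \<beta>' const_div_q)
 then have \<beta>: "(\<lambda>k. lW k / q k) \<longlonglongrightarrow> \<beta>" unfolding cW by (simp add: diff_divide_distrib[symmetric])
 have "ld k <= (2 * C) * q k" for k
 proof -
  have "(2 * W k)\<^sup>2 = 4 * (W k)\<^sup>2" by (simp add: power_mult_distrib)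
  then have "dd k <= (2 * W k)\<^sup>2" using abs_mdet_le[of "w k"] zero_le_power2[of "W k"] by linarith
  then have "ld k <= ln ((2 * W k)\<^sup>2)" using dd_ge_1[of k] by (intro ln_le_ln) linarith+
  also have "... = 2 * ln (2 * W k)" by (rule ln_square) (use W_pos[of k] in linarith)
  also have "... <= 2 * (C * q k)" using C(2)[of k] by simp
  finally show ?thesis by simp
 qed
 then obtain \<alpha> where \<alpha>: "(\<lambda>k. ld k / q k) \<longlonglongrightarrow> \<alpha>"
  using superadditive_ratio_converges[of ld "2 * C"] ld_additive by (metis order_refl)
 define h where "h k = 2 * ln (c * W k) - ld k" for k
 have hs: "h (k + 1) >= real (s (k + 1)) * h k + h (k - 1)" if "k >= 1" for k
  using W_superadditive[OF that] ld_additive[OF that] by (simp add: h_def algebra_simps)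
 have "c\<^sup>2 / exp 1 > 0" using c(1) by simp
 from order_tendstoD(2)[OF small this] have "EV k. h k >= 1"
 proof eventually_elim
  case (elim k)
  have d: "dd k > 0" using dd_ge_1[of k] by linarith
  have "exp 1 * dd k <= (c * W k)\<^sup>2" using elim W_pos[of k] by (simp add: field_simps power_mult_distrib)
  then have "ln (exp 1 * dd k) <= ln ((c * W k)\<^sup>2)" using d by (intro ln_le_ln) auto
  moreover have "ln (exp 1 * dd k) = 1 + ld k" using ln_mult_pos[of "exp 1" "dd k"] d by simp
  moreover have "ln ((c * W k)\<^sup>2) = 2 * ln (c * W k)" by (rule ln_square mult_pos_pos c(1) W_pos)+
  ultimately show ?case unfolding h_def by linarith
 qed
 then obtain K where K: "!!k. k >= K ==> h k >= 1" unfolding eventually_sequentially by blast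
 define \<epsilon> where "\<epsilon> = 1 / q (K + 1)"
 have \<epsilon>: "\<epsilon> > 0" "\<epsilon> * q (K + 1) = 1" using q_pos[of "K + 1"] by (auto simp: \<epsilon>_def)
 have h_ge: "h k >= \<epsilon> * q k & h (k + 1) >= \<epsilon> * q (k + 1)" if "k >= K" for k
  using that
 proof (induction k rule: dec_induct)
  case base
  have "\<epsilon> * q K <= \<epsilon> * q (K + 1)" using \<epsilon> q_mono_Suc by (intro mult_left_mono) auto
  then show ?case using K[of K] K[of "K + 1"] \<epsilon>(2) by linarith
 next
  case (step k)
  have "h (k + 1 + 1) >= real (s (k + 1 + 1)) * h (k + 1) + h k" using hs[of "k + 1"] by simp
  moreover have "real (s (k + 1 + 1)) * h (k + 1) >= real (s (k + 1 + 1)) * (\<epsilon> * q (k + 1))"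
   using step by (intro mult_left_mono) auto
  moreover have "\<epsilon> * q (k + 1 + 1) = real (s (k + 1 + 1)) * (\<epsilon> * q (k + 1)) + \<epsilon> * q k"
   using q_rec[of "k + 1"] by (simp add: algebra_simps)
  ultimately have "h (k + 1 + 1) >= \<epsilon> * q (k + 1 + 1)" using step.IH by linarith
  then show ?case using step.IH by simp
 qed
 have "(\<lambda>k. 2 * (ln (c * W k) / q k) - ld k / q k) \<longlonglongrightarrow> 2 * \<beta> - \<alpha>" by (intro tendsto_intros \<beta>' \<alpha>)
 then have "(\<lambda>k. h k / q k) \<longlonglongrightarrow> 2 * \<beta> - \<alpha>" by (simp add: h_def diff_divide_distrib)
 moreover have "\<epsilon> <= h k / q k" if "k >= K" for k using h_ge[OF that] q_pos[of k] by (simp add: pos_le_divide_eq)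
 ultimately have "\<epsilon> <= 2 * \<beta> - \<alpha>" by (intro LIMSEQ_le_const) auto
 then show ?thesis using that[OF \<alpha> \<beta> \<gamma>] \<epsilon>(1) by linarith
qed

lemma nrm_wt: "W k = real_of_int (cw k) * nrm (wt k)"
 using nrm_of_int_mult[of "cw k" "wt k"] w_eq[of k] cw_pos[of k] by simp

lemma nrm_wt_ge_1: "nrm (wt k) >= 1"
proof -
 have "wt k ~= 0" using mdet_wt_nz[of k] by auto
 then show ?thesis by (rule nrm_ge_1)
qed

lemma a_eq: "a k = ln (nrm (wt k))"
 unfolding a_def nrm_wt using cw_ge_1[of k] nrm_wt_ge_1[of k] by (simp add: ln_mult_pos)

lemma ln_det_wt: "ln \<bar>real_of_int (mdet (wt k))\<bar> = ld k - 2 * lc k"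
proof -
 have "dd k = (real_of_int (cw k))\<^sup>2 * \<bar>real_of_int (mdet (wt k))\<bar>" unfolding mdet_w_eq by (simp add: abs_mult)
 then show ?thesis using cw_ge_1[of k] mdet_wt_nz[of k] by (simp add: ln_mult_pos ln_realpow)
qed

text \<open>\<open>\<delta>\<close> is the quotient of the growth rates \<open>A\<close> of the
  determinants and \<open>B\<close> of the norms of the primitive matrices. Positivity of
  \<open>B\<close> follows from \<open>2 * B > A\<close> and \<open>A >= 0\<close>; the upper bound
  for \<open>\<delta>\<close> is the determinant condition in the limit.\<close>

lemma exponents:
 obtains B \<delta> where "B > 0" "0 <= \<delta>" "\<delta> <= sturm_sigma s / (1 + sturm_sigma s)"
  "(\<lambda>k. a k / q k) \<longlonglongrightarrow> B" "(\<lambda>k. b k / q k) \<longlonglongrightarrow> - ((1 - \<delta>) * B)" "(\<lambda>k. e k / q k) \<longlonglongrightarrow> - ((2 - \<delta>) * B)"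
proof -
 let ?\<theta> = "sturm_sigma s / (1 + sturm_sigma s)"
 obtain \<alpha> \<beta> \<gamma> where \<alpha>: "(\<lambda>k. ld k / q k) \<longlonglongrightarrow> \<alpha>" and \<beta>: "(\<lambda>k. lW k / q k) \<longlonglongrightarrow> \<beta>" and \<gamma>: "(\<lambda>k. lc k / q k) \<longlonglongrightarrow> \<gamma>"
  and pos: "2 * \<beta> > \<alpha>" by (rule limits)
 define B where "B = \<beta> - \<gamma>"
 define A where "A = \<alpha> - 2 * \<gamma>"
 have a: "(\<lambda>k. a k / q k) \<longlonglongrightarrow> B" unfolding B_def a_def diff_divide_distrib by (intro tendsto_diff \<beta> \<gamma>)
 have "(\<lambda>k. ld k / q k - lW k / q k - lc k / q k) \<longlonglongrightarrow> \<alpha> - \<beta> - \<gamma>" by (intro tendsto_diff \<alpha> \<beta> \<gamma>)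
 then have b: "(\<lambda>k. b k / q k) \<longlonglongrightarrow> \<alpha> - \<beta> - \<gamma>" by (simp add: b_def diff_divide_distrib)
 have "(\<lambda>k. ld k / q k - 2 * (lW k / q k)) \<longlonglongrightarrow> \<alpha> - 2 * \<beta>" by (intro tendsto_intros \<alpha> \<beta>)
 then have e: "(\<lambda>k. e k / q k) \<longlonglongrightarrow> \<alpha> - 2 * \<beta>" by (simp add: e_def diff_divide_distrib)
 have "(\<lambda>k. ld k / q k - 2 * (lc k / q k)) \<longlonglongrightarrow> \<alpha> - 2 * \<gamma>" by (intro tendsto_intros \<alpha> \<gamma>)
 then have d: "(\<lambda>k. ln \<bar>real_of_int (mdet (wt k))\<bar> / q k) \<longlonglongrightarrow> A" by (simp add: A_def ln_det_wt diff_divide_distrib)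
 have "0 <= ln \<bar>real_of_int (mdet (wt k))\<bar> / q k" for k
 proof -
  have "\<bar>real_of_int (mdet (wt k))\<bar> >= 1" using mdet_wt_nz[of k] by linarith
  then show ?thesis using q_pos[of k] by simp
 qed
 then have A0: "A >= 0" by (intro LIMSEQ_le_const[OF d]) auto
 have "0 <= a k / q k" for k using nrm_wt_ge_1[of k] q_pos[of k] by (simp add: a_eq)
 then have B0: "B >= 0" by (intro LIMSEQ_le_const[OF a]) auto
 have A_le: "A <= (?\<theta> + eta) * B" if "eta > 0" for eta
 proof (rule tendsto_le[OF _ tendsto_mult_left[OF a] d])
  show "EV k. ln \<bar>real_of_int (mdet (wt k))\<bar> / q k <= (?\<theta> + eta) * (a k / q k)"
   using det_exponent[OF that]
  proof eventually_elim
   case (elim k)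
   then have "ln \<bar>real_of_int (mdet (wt k))\<bar> / q k <= ((?\<theta> + eta) * a k) / q k"
    unfolding a_eq using q_pos[of k] by (intro divide_right_mono) auto
   then show ?case by simp
  qed
 qed simp
 have BA: "2 * B > A" using pos by (simp add: A_def B_def)
 then have B: "B > 0" using A0 B0 by linarith
 have "A <= ?\<theta> * B + \<epsilon>" if "\<epsilon> > 0" for \<epsilon>
  using A_le[of "\<epsilon> / B"] that B by (simp add: distrib_right)
 then have AB: "A <= ?\<theta> * B" by (rule field_le_epsilon)
 define \<delta> where "\<delta> = A / B"
 have dB: "\<delta> * B = A" using B by (simp add: \<delta>_def)
 have 1: "\<alpha> - \<beta> - \<gamma> = - ((1 - \<delta>) * B)" "\<alpha> - 2 * \<beta> = - ((2 - \<delta>) * B)"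
  using dB by (simp_all add: left_diff_distrib A_def B_def)
 show ?thesis
 proof (rule that[OF B _ _ a])
  show "0 <= \<delta>" "\<delta> <= ?\<theta>" using A0 B AB by (simp_all add: \<delta>_def pos_divide_le_eq)
 qed (use b e 1 in simp_all)
qed

lemma T_vec_nz: "k >= 1 ==> X_vec (T k l) ~= 0"
 by (rule X_vec_nz[OF tr_T T_nz])

lemma w_vec_nz: "k >= 1 ==> U_vec (w k) ~= 0"
proof
 assume k: "k >= 1" and "U_vec (w k) = 0"
 then have "m21 (w k) = 0" "m12 (w k) = 0" "m11 (w k) = m22 (w k)" by (auto simp: vec3_eq_iff)
 then have "w k * w (k - 1) = w (k - 1) * w k" by (simp add: mat2_eq_iff mat2_mult_entries)
 then show False using E_nz[OF k] by (simp add: E_def)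
qed

lemma cross_nz: "crossZ (U_vec (w k)) (U_vec (w (k + 1))) ~= 0"
proof
 assume "crossZ (U_vec (w k)) (U_vec (w (k + 1))) = 0"
 then have "X_vec (w k * w (k + 1) - w (k + 1) * w k) = 0" unfolding crossZ_U_U by simp
 moreover have "tr (w k * w (k + 1) - w (k + 1) * w k) = 0" by (simp add: tr_mult_commute)
 ultimately have "w k * w (k + 1) - w (k + 1) * w k = 0" using X_vec_nz by blast
 then show False using E_nz[of "k + 1"] by (simp add: E_def)
qed

text \<open>The content of \<open>T k l\<close> is the product of the known contents with that of a
  product of primitive matrices times \<open>Phi k\<close>; the factor \<open>Phi k\<close> enlarges
  the latter at most by its determinant.\<close>

lemma cont_T:
 assumes "k >= 1"
 shows "real l * lc k + lc (k - 1) <= ln (real_of_int (cont (T k l)))"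
  and "ln (real_of_int (cont (T k l))) <= real l * lc k + lc (k - 1) + LM k l + ln F"
proof -
 let ?Y = "wt k ^ l * wt (k - 1)" and ?C = "cw k ^ l * cw (k - 1)"
 have C: "?C > 0" using cw_pos[of k] cw_pos[of "k - 1"] by simp
 have TE: "T k l = of_int ?C * (?Y * Phi k)" unfolding T_def w_power_wt by (simp only: mult.assoc)
 have "cont (T k l) = \<bar>?C\<bar> * cont (?Y * Phi k)" unfolding TE by (rule cont_of_int_mult)
 moreover have "\<bar>?C\<bar> = ?C" using C by (rule abs_of_pos)
 ultimately have cT: "cont (T k l) = ?C * cont (?Y * Phi k)" by (simp only:)
 have "mdet (?Y * Phi k) ~= 0" using mdet_wt_nz mdet_Phi_nz by simp
 then have "?Y * Phi k ~= 0" by (metis mdet_0)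
 then have Y: "cont (?Y * Phi k) > 0" by (rule cont_pos)
 have lC: "ln (real_of_int ?C) = real l * lc k + lc (k - 1)"
  using cw_ge_1[of k] cw_ge_1[of "k - 1"] by (simp add: ln_mult_pos ln_realpow)
 have l: "ln (real_of_int (cont (T k l))) = real l * lc k + lc (k - 1) + ln (real_of_int (cont (?Y * Phi k)))"
  unfolding lC[symmetric] cT of_int_mult[of ?C] using C Y by (intro ln_mult_pos; simp only: of_int_0_less_iff)
 have "real_of_int (cont (?Y * Phi k)) >= 1" using Y by linarith
 then show "real l * lc k + lc (k - 1) <= ln (real_of_int (cont (T k l)))" unfolding l by simp
 have "cont (?Y * Phi k) dvd mdet (Phi k) * M k l" unfolding M_def by (rule cont_cancel_right)
 moreover have "\<bar>mdet (Phi k) * M k l\<bar> = \<bar>m0 * e0\<bar> * M k l" using M_pos[of k l] by (simp add: abs_mult mdet_Phi)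
 ultimately have "cont (?Y * Phi k) dvd \<bar>m0 * e0\<bar> * M k l" by (metis dvd_abs_iff)
 moreover have F: "\<bar>m0 * e0\<bar> > 0" using m0_nz e0_nz by simp
 ultimately have "ln (real_of_int (cont (?Y * Phi k))) <= ln (real_of_int (\<bar>m0 * e0\<bar> * M k l))"
  using Y M_pos by (intro dvd_ln_le mult_pos_pos)
 also have "... = ln F + LM k l" unfolding of_int_mult[of "\<bar>m0 * e0\<bar>"] of_int_abs[symmetric]
  using F M_pos[of k l] by (intro ln_mult_pos; simp only: of_int_0_less_iff)
 finally show "ln (real_of_int (cont (T k l))) <= real l * lc k + lc (k - 1) + LM k l + ln F" unfolding l by linarith
qed

lemma ln_nrm_T:
 assumes k: "k >= 1" and l: "l \<in> {1..s (k + 1) + 1}"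
 shows "\<bar>ln (nrm (T k l)) - (real l * lW k + lW (k - 1))\<bar> <= real l * (ln (2 * NPhi) + ln 2 - ln c)"
proof -
 let ?n = "nrm (w k ^ l * w (k - 1))" and ?N = "ln (2 * NPhi)"
 have W: "W k > 0" "W (k - 1) > 0" "c * W k > 0" using W_pos c(1) by auto
 have pb: "(c * W k) ^ l * W (k - 1) <= ?n" "?n <= (2 * W k) ^ l * W (k - 1)" using power_bounds[OF k, of l] l by auto
 have "0 < (c * W k) ^ l * W (k - 1)" using W by simp
 then have n: "?n > 0" using pb(1) by linarith
 have "ln ((c * W k) ^ l * W (k - 1)) <= ln ?n" "ln ?n <= ln ((2 * W k) ^ l * W (k - 1))"
  using pb n W by (auto intro!: ln_le_ln)
 moreover have "ln ((c * W k) ^ l * W (k - 1)) = real l * (ln c + lW k) + lW (k - 1)"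
  using W c(1) by (simp add: ln_mult_pos ln_realpow)
 moreover have "ln ((2 * W k) ^ l * W (k - 1)) = real l * (ln 2 + lW k) + lW (k - 1)"
  using W by (simp add: ln_mult_pos ln_realpow distrib_left)
 moreover have "\<bar>ln (nrm (T k l)) - ln ?n\<bar> <= ?N"
  using T_nrm_le[of k l] T_nrm_ge[of k l] T_nrm_pos[of k l] n NPhi_ge_1 by (intro ln_two_sided) auto
 moreover have "?N >= 0" using NPhi_ge_1 by simp
 moreover have "?N <= real l * ?N" using l \<open>?N >= 0\<close> mult_right_mono[of 1 "real l" ?N] by simp
 moreover have "real l * ln c <= 0" using c by (simp add: mult_nonneg_nonpos)
 moreover have "real l * ln 2 >= 0" by simp
 ultimately show ?thesis unfolding abs_le_iff by (simp only: algebra_simps; linarith)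
qed

text \<open>The error lies between constant multiples of determinant over norm, above by
  \<open>rho_T_bound\<close> and below by \<open>mdet_le_rho\<close>; the constant \<open>R\<close>
  serves both directions. Dividing by the content costs \<open>LM k l\<close>, and the constants of
  the \<open>l\<close> multiplications cost \<open>real l * C\<close>.\<close>

lemma z_estimates:
 obtains C where "C > 0" "EV k. \<forall>l\<in>{1..s (k + 1) + 1}.
   hgt (zt k l) > 0 & err \<xi> (zt k l) > 0 &
   \<bar>ln (hgt (zt k l)) - (real l * a k + a (k - 1))\<bar> <= real l * C + LM k l &
   \<bar>ln (err \<xi> (zt k l)) - (real l * b k + b (k - 1))\<bar> <= real l * C + LM k l"
proof -
 define C1 where "C1 = ln (2 * NPhi) + ln 2 - ln c"
 have C1: "C1 >= 0"
 proof -
  have "ln (2 * NPhi) >= 0" "ln c <= 0" "ln (2::real) >= 0" using NPhi_ge_1 c by simp_all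
  then show ?thesis unfolding C1_def by linarith
 qed
 define R where "R = (1 + \<bar>\<xi>\<bar>) * (2 + \<bar>c4\<bar>)"
 have R: "R >= 1" unfolding R_def using mult_mono[of 1 "1 + \<bar>\<xi>\<bar>" 1 "2 + \<bar>c4\<bar>"] by simp
 define C where "C = C1 + 2 * ln F + ln R + 1"
 have lF: "ln F >= 0" using F_ge_1 by simp
 have lR: "ln R >= 0" using R by simp
 have Cpos: "C > 0" unfolding C_def using C1 lF lR by linarith
 have "EV k. \<forall>l\<in>{1..s (k + 1) + 1}.
   hgt (zt k l) > 0 & err \<xi> (zt k l) > 0 &
   \<bar>ln (hgt (zt k l)) - (real l * a k + a (k - 1))\<bar> <= real l * C + LM k l &
   \<bar>ln (err \<xi> (zt k l)) - (real l * b k + b (k - 1))\<bar> <= real l * C + LM k l"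
  using rho_T_bound eventually_ge_at_top[of 1]
 proof eventually_elim
  case (elim k)
  show ?case
  proof
   fix l assume l: "l \<in> {1..s (k + 1) + 1}"
   let ?T = "T k l" and ?v = "real_of_int (cont (T k l))"
   have k: "k >= 1" by (rule elim)
   have v: "?v > 0" using cont_pos[OF T_nz[of k l]] by simp
   note nz = T_vec_nz[OF k, of l]
   note sc = vprim_scale(1)[OF nz, unfolded vcont_X_vec[OF tr_T[OF k]]] vprim_scale(2,3)[OF nz, unfolded vcont_X_vec[OF tr_T[OF k]], of \<xi>]
   have n: "nrm ?T > 0" by (rule T_nrm_pos)
   have h: "nrm ?T = ?v * hgt (zt k l)" using sc(1) hgt_X_vec[OF tr_T[OF k]] by (simp add: zt_def)
   have hp: "hgt (zt k l) > 0" using h n v by (simp add: zero_less_mult_iff)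
   have lh: "ln (hgt (zt k l)) = ln (nrm ?T) - ln ?v" unfolding h using hp v by (simp add: ln_mult_pos)
   define dT where "dT = \<bar>real_of_int (mdet ?T)\<bar>"
   have dT: "dT = dd k ^ l * dd (k - 1) * F" unfolding dT_def by (rule mdet_T)
   have dp: "dd k > 0" "dd (k - 1) > 0" "F > 0" using dd_ge_1[of k] dd_ge_1[of "k - 1"] F_ge_1 by linarith+
   then have dTp: "dT > 0" unfolding dT by simp
   have ldT: "ln dT = real l * ld k + ld (k - 1) + ln F" unfolding dT using dp by (simp only: ln_mult_pos mult_pos_pos zero_less_power ln_realpow)
   have up: "rho \<xi> ?T <= c4 * dT / nrm ?T" using elim(1) l unfolding dT_def by blast
   have lo: "dT <= 2 * nrm ?T * rho \<xi> ?T" unfolding dT_def by (rule mdet_le_rho)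
   define er where "er = err \<xi> (X_vec ?T)"
   have er: "er = ?v * err \<xi> (zt k l)" using sc(2) by (simp add: zt_def er_def)
   have xi: "1 + \<bar>\<xi>\<bar> > 0" by simp
   have e1: "er <= R * (dT / nrm ?T)"
   proof -
    have "er <= (1 + \<bar>\<xi>\<bar>) * rho \<xi> ?T" unfolding er_def by (rule err_X_vec_le[OF tr_T[OF k]])
    also have "... <= (1 + \<bar>\<xi>\<bar>) * ((2 + \<bar>c4\<bar>) * (dT / nrm ?T))"
    proof -
     have "c4 * (dT / nrm ?T) <= (2 + \<bar>c4\<bar>) * (dT / nrm ?T)" using dTp n by (intro mult_right_mono) auto
     then show ?thesis using up by (intro mult_left_mono) auto
    qed
    finally show ?thesis by (simp add: R_def mult.assoc)
   qed
   have e2: "dT / nrm ?T <= R * er"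
   proof -
    have "dT / nrm ?T <= 2 * rho \<xi> ?T" using lo n by (simp add: pos_divide_le_eq mult_ac)
    also have "... <= 2 * ((1 + \<bar>\<xi>\<bar>) * er)" unfolding er_def using rho_le_err[OF tr_T[OF k]] by (intro mult_left_mono) auto
    also have "... <= (2 + \<bar>c4\<bar>) * ((1 + \<bar>\<xi>\<bar>) * er)" unfolding er_def by (intro mult_right_mono) auto
    finally show ?thesis by (simp add: R_def mult_ac)
   qed
   have "0 < dT / nrm ?T" using dTp n by simp
   then have "0 < R * er" using e2 by linarith
   then have erp: "er > 0" using R by (simp add: zero_less_mult_iff)
   have ep: "err \<xi> (zt k l) > 0" using er erp v by (simp add: zero_less_mult_iff)
   have le: "ln (err \<xi> (zt k l)) = ln er - ln ?v" unfolding er using ep v by (simp add: ln_mult_pos)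
   have ler: "\<bar>ln er - (ln dT - ln (nrm ?T))\<bar> <= ln R"
    using ln_two_sided[OF _ erp \<open>0 < dT / nrm ?T\<close> e1 e2] R dTp n by (simp add: ln_div)
   note nT = ln_nrm_T[OF k l, folded C1_def]
   note cT = cont_T[OF k, of l]
   have lC: "real l * C1 + 2 * ln F + ln R <= real l * C"
   proof -
    have "1 * (2 * ln F + ln R + 1) <= real l * (2 * ln F + ln R + 1)" using l lF lR by (intro mult_right_mono) auto
    then show ?thesis unfolding C_def by (simp only: distrib_left; linarith)
   qed
   have A: "real l * a k + a (k - 1) = (real l * lW k + lW (k - 1)) - (real l * lc k + lc (k - 1))"
    by (simp add: a_def algebra_simps)
   have B: "real l * b k + b (k - 1) = (real l * ld k + ld (k - 1)) - (real l * lW k + lW (k - 1)) - (real l * lc k + lc (k - 1))"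
    by (simp add: b_def algebra_simps)
   have "\<bar>ln (hgt (zt k l)) - (real l * a k + a (k - 1))\<bar> <= real l * C + LM k l"
    unfolding A lh using nT cT lC lF lR unfolding abs_le_iff by linarith
   moreover have "\<bar>ln (err \<xi> (zt k l)) - (real l * b k + b (k - 1))\<bar> <= real l * C + LM k l"
    unfolding B le using nT cT lC lF lR ler ldT unfolding abs_le_iff by linarith
   ultimately show "hgt (zt k l) > 0 & err \<xi> (zt k l) > 0 &
    \<bar>ln (hgt (zt k l)) - (real l * a k + a (k - 1))\<bar> <= real l * C + LM k l &
    \<bar>ln (err \<xi> (zt k l)) - (real l * b k + b (k - 1))\<bar> <= real l * C + LM k l" using hp ep by blast
  qed
 qed
 then show ?thesis using that Cpos by blast
qed

lemma U_cont:
 assumes "k >= 2"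
 shows "lc k <= ln (real_of_int (vcont (U_vec (w k))))"
  and "ln (real_of_int (vcont (U_vec (w k)))) <= lc k + ln \<bar>real_of_int e0\<bar> + LX (k - 1)"
proof -
 define u where "u = vcont (U_vec (wt k))"
 have "vcont (U_vec (of_int (cw k) * wt k)) = cw k * u"
  unfolding u_def vcont_def using cw_pos[of k]
  by (simp add: mat2_mult_entries gcd_mult_left right_diff_distrib[symmetric] abs_mult)
 then have v: "vcont (U_vec (w k)) = cw k * u" using w_eq[of k] by simp
 have "vcont (U_vec (w k)) > 0" using vcont_pos[OF w_vec_nz] assms by simp
 then have u: "u > 0" using cw_pos[of k] unfolding v by (simp add: zero_less_mult_iff)
 have lv: "ln (real_of_int (vcont (U_vec (w k)))) = lc k + ln (real_of_int u)"
  unfolding v of_int_mult using u cw_pos[of k] by (intro ln_mult_pos; simp)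
 have lu: "ln (real_of_int u) >= 0" using u by simp
 then show "lc k <= ln (real_of_int (vcont (U_vec (w k))))" unfolding lv by linarith
 have j: "k - 1 >= 1" "k - 1 + 1 = k" using assms by auto
 have "\<forall>i. u dvd U_vec (wt k) $ i" unfolding u_def by (simp only: dvd_vcont_iff[symmetric] dvd_refl)
 then have "u dvd U_vec (wt k) $ 1" "u dvd U_vec (wt k) $ 2" "u dvd U_vec (wt k) $ 3" by blast+
 then have ud: "u dvd m12 (wt k)" "u dvd m21 (wt k)" "u dvd m11 (wt k) - m22 (wt k)" by simp_all
 have Xk: "X (k - 1) > 0" by (rule M_pos)
 have "u\<^sup>2 dvd e0 * (X (k - 1))\<^sup>2" using U_content_bound[OF j(1), unfolded j(2), OF ud] j(2) by simp
 moreover have "\<bar>e0 * (X (k - 1))\<^sup>2\<bar> = \<bar>e0\<bar> * (X (k - 1))\<^sup>2" by (simp add: abs_mult)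
 ultimately have "u\<^sup>2 dvd \<bar>e0\<bar> * (X (k - 1))\<^sup>2" by (metis dvd_abs_iff)
 then have "ln (real_of_int (u\<^sup>2)) <= ln (real_of_int (\<bar>e0\<bar> * (X (k - 1))\<^sup>2))"
  using u Xk e0_nz by (intro dvd_ln_le mult_pos_pos zero_less_power) auto
 moreover have "ln (real_of_int (u\<^sup>2)) = 2 * ln (real_of_int u)" using u by (simp add: ln_realpow)
 moreover have "ln (real_of_int (\<bar>e0\<bar> * (X (k - 1))\<^sup>2)) = ln \<bar>real_of_int e0\<bar> + 2 * LX (k - 1)"
  using Xk e0_nz by (simp add: ln_mult_pos ln_realpow)
 moreover have "ln \<bar>real_of_int e0\<bar> >= 0"
 proof -
  have "\<bar>real_of_int e0\<bar> >= 1" using e0_nz by linarith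
  then show ?thesis by simp
 qed
 ultimately show "ln (real_of_int (vcont (U_vec (w k)))) <= lc k + ln \<bar>real_of_int e0\<bar> + LX (k - 1)"
  unfolding lv by linarith
qed

lemma Phi_conditions: "\<xi> * m12 (Phi k) - m22 (Phi k) ~= 0" "val \<xi> (Phi k) ~= 0"
proof -
 have "vector [- m22 (Phi k), m12 (Phi k), 0] ~= (0 :: int^3)"
 proof
  assume "vector [- m22 (Phi k), m12 (Phi k), 0] = (0 :: int^3)"
  then have "m22 (Phi k) = 0" "m12 (Phi k) = 0" by (simp_all add: vec3_eq_iff)
  then show False using mdet_Phi_nz[of k] by (simp add: mdet_def)
 qed
 from irr[OF this] show "\<xi> * m12 (Phi k) - m22 (Phi k) ~= 0" unfolding lin_eq by (simp add: mult.commute)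
 from irr[OF U_vec_Phi_nz] show "val \<xi> (Phi k) ~= 0" unfolding lin_U_vec by simp
qed

text \<open>The coefficients of the form may have a common divisor beyond the content of
  \<open>w k\<close>; by \<open>U_cont\<close> its logarithm is at most \<open>LX (k - 1)\<close> up
  to a constant, which is negligible against \<open>q k\<close>.\<close>

lemma p_estimates:
 obtains C where "C > 0" "EV k.
   hgt (pt k) > 0 & lin \<xi> (pt k) > 0 & \<bar>real_of_int (pt k $ 3)\<bar> > 0 &
   \<bar>real_of_int (pt k $ 2) + 2 * real_of_int (pt k $ 3) * \<xi>\<bar> > 0 &
   \<bar>ln (hgt (pt k)) - a k\<bar> <= C + LX (k - 1) &
   \<bar>ln (lin \<xi> (pt k)) - (b k + e (k + 1))\<bar> <= C + LX (k - 1) &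
   ln \<bar>real_of_int (pt k $ 3)\<bar> >= a k - (C + LX (k - 1)) &
   ln \<bar>real_of_int (pt k $ 2) + 2 * real_of_int (pt k $ 3) * \<xi>\<bar> >= a k - (C + LX (k - 1))"
proof -
 obtain A where A: "A > 0" "EV k. A * W k <= \<bar>real_of_int (m12 (w k))\<bar>"
  "EV k. A * W k <= \<bar>real_of_int (m11 (w k) - m22 (w k)) + 2 * real_of_int (m12 (w k)) * \<xi>\<bar>"
  using lead_deriv_estimate[OF Phi_conditions] by blast
 obtain A' where A': "A' > 0"
  "EV k. dd k * dd (k + 1) <= A' * ((W (k + 1))\<^sup>2 * W k * \<bar>val \<xi> (w k)\<bar>)"
  "EV k. (W (k + 1))\<^sup>2 * W k * \<bar>val \<xi> (w k)\<bar> <= A' * (dd k * dd (k + 1))"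
  using val_estimate by blast
 define C where "C = \<bar>ln A\<bar> + \<bar>ln A'\<bar> + \<bar>ln \<bar>real_of_int e0\<bar>\<bar> + ln 2 + 1"
 have C: "C > 0" unfolding C_def by (simp add: add_nonneg_pos)
 have ln2: "ln 2 >= (0::real)" by simp
 have "\<bar>real_of_int e0\<bar> >= 1" using e0_nz by linarith
 then have ln_e0: "ln \<bar>real_of_int e0\<bar> >= 0" by simp
 have "EV k.
   hgt (pt k) > 0 & lin \<xi> (pt k) > 0 & \<bar>real_of_int (pt k $ 3)\<bar> > 0 &
   \<bar>real_of_int (pt k $ 2) + 2 * real_of_int (pt k $ 3) * \<xi>\<bar> > 0 &
   \<bar>ln (hgt (pt k)) - a k\<bar> <= C + LX (k - 1) &
   \<bar>ln (lin \<xi> (pt k)) - (b k + e (k + 1))\<bar> <= C + LX (k - 1) &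
   ln \<bar>real_of_int (pt k $ 3)\<bar> >= a k - (C + LX (k - 1)) &
   ln \<bar>real_of_int (pt k $ 2) + 2 * real_of_int (pt k $ 3) * \<xi>\<bar> >= a k - (C + LX (k - 1))"
  using A(2,3) A'(2,3) eventually_ge_at_top[of 2]
 proof eventually_elim
  case (elim k)
  let ?v = "real_of_int (vcont (U_vec (w k)))" and ?U = "U_vec (w k)"
  have k: "k >= 1" using elim by simp
  note nz = w_vec_nz[OF k]
  have v: "?v > 0" using vcont_pos[OF nz] by simp
  note uc = U_cont[OF elim(5)]
  note sc = vprim_scale(1)[OF nz, folded pt_def] vprim_scale(2,3)[OF nz, folded pt_def, of \<xi>]
  have W: "W k > 0" "W (k + 1) > 0" using W_pos by auto
  have AW: "A * W k > 0" using A(1) W by simp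
  have lAW: "ln (A * W k) = ln A + lW k" using A(1) W by (simp add: ln_mult_pos)
  have ln_v: "ln x' = ln x - ln ?v" if "x = ?v * x'" "x > 0" for x x'
  proof -
   have "x' > 0" using that v by (simp add: zero_less_mult_iff)
   then show ?thesis using that v by (simp add: ln_mult_pos)
  qed
  have pos: "x' > 0" if "x = ?v * x'" "x > 0" for x x' using that v by (simp add: zero_less_mult_iff)
  have 3: "\<bar>real_of_int (m12 (w k))\<bar> = ?v * \<bar>real_of_int (pt k $ 3)\<bar>"
   using vprim_nth[of ?U 3] v by (simp add: pt_def abs_mult)
  have 2: "real_of_int (m11 (w k) - m22 (w k)) = ?v * real_of_int (pt k $ 2)" "real_of_int (m12 (w k)) = ?v * real_of_int (pt k $ 3)"
   using vprim_nth[of ?U 2] vprim_nth[of ?U 3] by (simp_all only: pt_def U_vec_nth of_int_mult[symmetric])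
  have 4: "\<bar>real_of_int (m11 (w k) - m22 (w k)) + 2 * real_of_int (m12 (w k)) * \<xi>\<bar>
    = ?v * \<bar>real_of_int (pt k $ 2) + 2 * real_of_int (pt k $ 3) * \<xi>\<bar>"
  proof -
   have "real_of_int (m11 (w k) - m22 (w k)) + 2 * real_of_int (m12 (w k)) * \<xi>
     = ?v * (real_of_int (pt k $ 2) + 2 * real_of_int (pt k $ 3) * \<xi>)" unfolding 2 by (simp only: algebra_simps)
   then show ?thesis using v by (simp only: abs_mult abs_of_pos)
  qed
  have g3: "\<bar>real_of_int (m12 (w k))\<bar> > 0" "ln \<bar>real_of_int (m12 (w k))\<bar> >= ln A + lW k"
   using ln_le_ln[OF AW elim(1)] AW elim(1) unfolding lAW by linarith+
  have g4: "\<bar>real_of_int (m11 (w k) - m22 (w k)) + 2 * real_of_int (m12 (w k)) * \<xi>\<bar> > 0"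
   "ln \<bar>real_of_int (m11 (w k) - m22 (w k)) + 2 * real_of_int (m12 (w k)) * \<xi>\<bar> >= ln A + lW k"
   using ln_le_ln[OF AW elim(2)] AW elim(2) unfolding lAW by linarith+
  have h: "hgt ?U > 0" "ln (hgt ?U) <= ln 2 + lW k" "ln (hgt ?U) >= ln A + lW k"
  proof -
   show hp: "hgt ?U > 0" using hgt_U_vec(2)[of "w k"] g3(1) by linarith
   have "ln (hgt ?U) <= ln (2 * W k)" using hgt_U_vec(1)[of "w k"] hp by (intro ln_le_ln) auto
   then show "ln (hgt ?U) <= ln 2 + lW k" using W by (simp add: ln_mult_pos)
   have "ln \<bar>real_of_int (m12 (w k))\<bar> <= ln (hgt ?U)" using hgt_U_vec(2)[of "w k"] g3(1) by (intro ln_le_ln) auto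
   then show "ln (hgt ?U) >= ln A + lW k" using g3(2) by linarith
  qed
  have d: "dd k * dd (k + 1) > 0" using dd_ge_1[of k] dd_ge_1[of "k + 1"] by (intro mult_pos_pos) linarith+
  define V where "V = (W (k + 1))\<^sup>2 * W k * \<bar>val \<xi> (w k)\<bar>"
  have Vp: "V > 0"
  proof -
   have "0 < A' * V" using d elim(3) unfolding V_def by linarith
   then show ?thesis using A'(1) by (simp add: zero_less_mult_iff)
  qed
  have valp: "\<bar>val \<xi> (w k)\<bar> > 0" using Vp W unfolding V_def by (simp add: zero_less_mult_iff)
  have "\<bar>ln V - ln (dd k * dd (k + 1))\<bar> <= ln A'"
   by (rule ln_two_sided[OF A'(1) Vp d]) (use elim(3,4) in \<open>simp_all only: V_def\<close>)
  moreover have "ln V = 2 * lW (k + 1) + lW k + ln \<bar>val \<xi> (w k)\<bar>"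
   unfolding V_def using W valp by (simp only: ln_mult_pos mult_pos_pos zero_less_power ln_realpow of_nat_numeral)
  moreover have "ln (dd k * dd (k + 1)) = ld k + ld (k + 1)"
   using dd_ge_1[of k] dd_ge_1[of "k + 1"] by (intro ln_mult_pos) linarith+
  ultimately have val: "\<bar>ln \<bar>val \<xi> (w k)\<bar> - (ld k + ld (k + 1) - 2 * lW (k + 1) - lW k)\<bar> <= ln A'" by linarith
  have linp: "lin \<xi> ?U > 0" unfolding lin_U_vec by (rule valp)
  have be: "b k + e (k + 1) = ld k + ld (k + 1) - 2 * lW (k + 1) - lW k - lc k" by (simp add: b_def e_def)
  note q1 = ln_v[OF sc(1) h(1)] and q2 = ln_v[OF sc(3) linp] and q3 = ln_v[OF 3 g3(1)] and q4 = ln_v[OF 4 g4(1)]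
  show ?case
  proof (intro conjI)
   show "hgt (pt k) > 0" "lin \<xi> (pt k) > 0" "\<bar>real_of_int (pt k $ 3)\<bar> > 0"
    "\<bar>real_of_int (pt k $ 2) + 2 * real_of_int (pt k $ 3) * \<xi>\<bar> > 0"
    using pos[OF sc(1) h(1)] pos[OF sc(3) linp] pos[OF 3 g3(1)] pos[OF 4 g4(1)] by blast+
   show "\<bar>ln (hgt (pt k)) - a k\<bar> <= C + LX (k - 1)" unfolding q1 a_def C_def using h uc ln2 by linarith
   show "\<bar>ln (lin \<xi> (pt k)) - (b k + e (k + 1))\<bar> <= C + LX (k - 1)" unfolding q2 be lin_U_vec
    by (rule abs_shift[OF val uc _ ln_e0]) (unfold C_def, rule add_le_sum[OF abs_ge_self abs_ge_self abs_ge_zero ln2])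
   show "ln \<bar>real_of_int (pt k $ 3)\<bar> >= a k - (C + LX (k - 1))" unfolding q3 a_def C_def using g3 uc ln2 by linarith
   show "ln \<bar>real_of_int (pt k $ 2) + 2 * real_of_int (pt k $ 3) * \<xi>\<bar> >= a k - (C + LX (k - 1))"
    unfolding q4 a_def C_def using g4 uc ln2 by linarith
  qed
 qed
 then show ?thesis using that C by blast
qed

text \<open>The two limits accompany the data so that \<open>\<delta>\<close> can be computed for
  explicit matrices.\<close>

theorem sturm_points_exist:
 "\<exists>B \<delta> p z. sturm_points s B \<delta> \<xi> (\<lambda>k. B * q k) p z &
   (\<lambda>k. a k / q k) \<longlonglongrightarrow> B & (\<lambda>k. b k / q k) \<longlonglongrightarrow> - ((1 - \<delta>) * B)"
proof -
 obtain B \<delta> where B: "B > 0" and \<delta>: "0 <= \<delta>" "\<delta> <= sturm_sigma s / (1 + sturm_sigma s)"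
  and a: "(\<lambda>k. a k / q k) \<longlonglongrightarrow> B" and b: "(\<lambda>k. b k / q k) \<longlonglongrightarrow> - ((1 - \<delta>) * B)"
  and e: "(\<lambda>k. e k / q k) \<longlonglongrightarrow> - ((2 - \<delta>) * B)" by (rule exponents)
 obtain C where C: "C > 0" "EV k. \<forall>l\<in>{1..s (k + 1) + 1}.
   hgt (zt k l) > 0 & err \<xi> (zt k l) > 0 &
   \<bar>ln (hgt (zt k l)) - (real l * a k + a (k - 1))\<bar> <= real l * C + LM k l &
   \<bar>ln (err \<xi> (zt k l)) - (real l * b k + b (k - 1))\<bar> <= real l * C + LM k l" by (rule z_estimates)
 obtain P where P: "P > 0" "EV k.
   hgt (pt k) > 0 & lin \<xi> (pt k) > 0 & \<bar>real_of_int (pt k $ 3)\<bar> > 0 &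
   \<bar>real_of_int (pt k $ 2) + 2 * real_of_int (pt k $ 3) * \<xi>\<bar> > 0 &
   \<bar>ln (hgt (pt k)) - a k\<bar> <= P + LX (k - 1) &
   \<bar>ln (lin \<xi> (pt k)) - (b k + e (k + 1))\<bar> <= P + LX (k - 1) &
   ln \<bar>real_of_int (pt k $ 3)\<bar> >= a k - (P + LX (k - 1)) &
   ln \<bar>real_of_int (pt k $ 2) + 2 * real_of_int (pt k $ 3) * \<xi>\<bar> >= a k - (P + LX (k - 1))" by (rule p_estimates)
 have z: "EV k. \<forall>l\<in>{1..s (k + 1) + 1}. hgt (zt k l) > 0 & err \<xi> (zt k l) > 0 &
   \<bar>ln (hgt (zt k l)) - B * (real l * q k + q (k - 1))\<bar> <= eta * (real l * q k + q (k - 1)) &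
   \<bar>ln (err \<xi> (zt k l)) - (- ((1 - \<delta>) * B)) * (real l * q k + q (k - 1))\<bar> <= eta * (real l * q k + q (k - 1))"
  if eta: "eta > 0" for eta
 proof -
  have e3: "eta / 3 > 0" using eta by simp
  show ?thesis using C(2) affine_approx[OF a e3] affine_approx[OF b e3] LM_small[OF e3] eventually_const_le_q[OF e3, of C]
  proof eventually_elim
   case (elim k)
   show ?case
   proof
    fix l assume l: "l \<in> {1..s (k + 1) + 1}"
    let ?R = "real l * q k"
    have "real l * C <= real l * (eta / 3 * q k)" using elim(5) by (intro mult_left_mono) auto
    then have 1: "real l * C <= eta / 3 * ?R" by (simp only: mult_ac)
    have 2: "LM k l <= eta / 3 * ?R" using elim(4) l by blast
    have 3: "\<bar>(real l * a k + a (k - 1)) - B * (?R + q (k - 1))\<bar> <= eta / 3 * ?R"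
     "\<bar>(real l * b k + b (k - 1)) - (- ((1 - \<delta>) * B)) * (?R + q (k - 1))\<bar> <= eta / 3 * ?R"
     using elim(2,3) l by auto
    have 4: "hgt (zt k l) > 0" "err \<xi> (zt k l) > 0"
     "\<bar>ln (hgt (zt k l)) - (real l * a k + a (k - 1))\<bar> <= real l * C + LM k l"
     "\<bar>ln (err \<xi> (zt k l)) - (real l * b k + b (k - 1))\<bar> <= real l * C + LM k l" using elim(1) l by blast+
    have 5: "eta * (?R + q (k - 1)) = 3 * (eta / 3 * ?R) + eta * q (k - 1)" by (simp add: algebra_simps)
    have "eta * q (k - 1) >= 0" using eta q_pos[of "k - 1"] by simp
    then have "\<bar>ln (hgt (zt k l)) - B * (?R + q (k - 1))\<bar> <= eta * (?R + q (k - 1))"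
     "\<bar>ln (err \<xi> (zt k l)) - (- ((1 - \<delta>) * B)) * (?R + q (k - 1))\<bar> <= eta * (?R + q (k - 1))"
     using 1 2 3 4 unfolding 5 by linarith+
    then show "hgt (zt k l) > 0 & err \<xi> (zt k l) > 0 &
     \<bar>ln (hgt (zt k l)) - B * (?R + q (k - 1))\<bar> <= eta * (?R + q (k - 1)) &
     \<bar>ln (err \<xi> (zt k l)) - (- ((1 - \<delta>) * B)) * (?R + q (k - 1))\<bar> <= eta * (?R + q (k - 1))" using 4 by blast
   qed
  qed
 qed
 have p: "EV k.
   (hgt (pt k) > 0 & lin \<xi> (pt k) > 0 & \<bar>real_of_int (pt k $ 3)\<bar> > 0 &
   \<bar>real_of_int (pt k $ 2) + 2 * real_of_int (pt k $ 3) * \<xi>\<bar> > 0) &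
   \<bar>ln (hgt (pt k)) - B * q k\<bar> <= eta * q k &
   \<bar>ln (lin \<xi> (pt k)) + ((2 - \<delta>) * B * q (k + 1) + (1 - \<delta>) * B * q k)\<bar> <= eta * q (k + 1) &
   ln \<bar>real_of_int (pt k $ 3)\<bar> >= B * q k - eta * q k &
   ln \<bar>real_of_int (pt k $ 2) + 2 * real_of_int (pt k $ 3) * \<xi>\<bar> >= B * q k - eta * q k"
  if eta: "eta > 0" for eta
 proof -
  have e4: "eta / 4 > 0" using eta by simp
  have LX: "EV k. LX (k - 1) <= eta / 4 * q (k - 1 + 1)" by (rule eventually_previous[OF LX_small[OF e4]])
  show ?thesis
   using P(2) ratio_approx[OF a e4] ratio_approx[OF b e4] eventually_next[OF ratio_approx[OF e e4]] LX
    eventually_const_le_q[OF e4, of P] eventually_ge_at_top[of 1]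
  proof eventually_elim
   case (elim k)
   have X: "LX (k - 1) <= eta / 4 * q k" using elim(5,7) by simp
   have q: "eta / 4 * q k <= eta / 4 * q (k + 1)" using eta q_mono_Suc by (intro mult_left_mono) auto
   have qp: "eta / 4 * q k > 0" using eta q_pos[of k] by simp
   have 1: "eta * q k = 4 * (eta / 4 * q k)" "eta * q (k + 1) = 4 * (eta / 4 * q (k + 1))" by simp_all
   have 2: "- ((1 - \<delta>) * B) * q k = - ((1 - \<delta>) * B * q k)" "- ((2 - \<delta>) * B) * q (k + 1) = - ((2 - \<delta>) * B * q (k + 1))"
    by simp_all
   show ?case
    unfolding 1
   proof (intro conjI)
    note E = elim(1)
    show "hgt (pt k) > 0" "lin \<xi> (pt k) > 0" "\<bar>real_of_int (pt k $ 3)\<bar> > 0"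
     "\<bar>real_of_int (pt k $ 2) + 2 * real_of_int (pt k $ 3) * \<xi>\<bar> > 0" using E by blast+
    show "\<bar>ln (hgt (pt k)) - B * q k\<bar> <= 4 * (eta / 4 * q k)"
     by (rule abs_chain[OF _ elim(2) X elim(6)]) (use E in blast)
    show "\<bar>ln (lin \<xi> (pt k)) + ((2 - \<delta>) * B * q (k + 1) + (1 - \<delta>) * B * q k)\<bar> <= 4 * (eta / 4 * q (k + 1))"
     by (rule abs_chain2[OF _ elim(3)[unfolded 2] elim(4)[unfolded 2] X elim(6) q]) (use E in blast)
    show "B * q k - 4 * (eta / 4 * q k) <= ln \<bar>real_of_int (pt k $ 3)\<bar>"
     by (rule lower_chain[OF _ elim(2) X elim(6)]) (use E in blast)
    show "B * q k - 4 * (eta / 4 * q k) <= ln \<bar>real_of_int (pt k $ 2) + 2 * real_of_int (pt k $ 3) * \<xi>\<bar>"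
     by (rule lower_chain[OF _ elim(2) X elim(6)]) (use E in blast)
   qed
  qed
 qed
 have scale: "eta * B > 0" if "eta > 0" for eta using that B by simp
 have "sturm_points s B \<delta> \<xi> (\<lambda>k. B * q k) pt zt"
 proof (unfold_locales)
  show "B > 0" "0 <= \<delta>" "\<delta> <= sturm_sigma s / (1 + sturm_sigma s)" by fact+
  show "EV k. primitive (pt k)"
   using eventually_ge_at_top[of 1] by eventually_elim (simp add: pt_def primitive_vprim w_vec_nz)
  show "EV k. \<forall>l\<in>{1..s (k + 1) + 1}. primitive (zt k l)"
   using eventually_ge_at_top[of 1] by eventually_elim (simp add: zt_def primitive_vprim T_vec_nz)
  show "EV k. crossZ (pt k) (pt (k + 1)) ~= 0"
   unfolding pt_def by (intro always_eventually allI crossZ_vprim cross_nz)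
  show "EV k. (\<forall>l\<in>{1..s (k + 1) + 1}. dotZ (pt k) (zt k l) = 0) & dotZ (pt k) (zt (k + 1) 1) = 0"
   using eventually_ge_at_top[of 1]
  proof eventually_elim
   case (elim k)
   have k1: "k + 1 >= 1" by simp
   show ?case unfolding pt_def zt_def
   proof (intro conjI ballI dotZ_vprim w_vec_nz T_vec_nz elim k1)
    show "dotZ (U_vec (w k)) (X_vec (T k l)) = 0" for l
     unfolding dotZ_U_X[OF tr_T[OF elim]] by (rule tr_w_T[OF elim])
    show "dotZ (U_vec (w k)) (X_vec (T (k + 1) 1)) = 0"
     unfolding dotZ_U_X[OF tr_T[OF k1]] by (rule tr_w_T_next[OF elim])
   qed
  qed
 next
  fix eta :: real assume eta: "eta > 0"
  note pe = p[OF scale[OF eta]] and ze = z[OF scale[OF eta]]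
  show "EV k. exp ((1 - eta) * (B * q k)) <= hgt (pt k) & hgt (pt k) <= exp ((1 + eta) * (B * q k))"
   using pe
  proof eventually_elim
   case (elim k)
   then have "hgt (pt k) > 0" "\<bar>ln (hgt (pt k)) - B * q k\<bar> <= eta * B * q k" by blast+
   note x = ln_exp_bounds[OF this]
   have "(1 - eta) * (B * q k) = B * q k - eta * B * q k" "(1 + eta) * (B * q k) = B * q k + eta * B * q k" by (simp_all add: algebra_simps)
   then show ?case using x by (simp only:)
  qed
  show "EV k.
    exp (- ((2 - \<delta> + eta) * (B * q (k + 1)) + (1 - \<delta>) * (B * q k))) <= lin \<xi> (pt k) &
    lin \<xi> (pt k) <= exp (- ((2 - \<delta> - eta) * (B * q (k + 1)) + (1 - \<delta>) * (B * q k)))"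
   using pe
  proof eventually_elim
   case (elim k)
   let ?y = "- ((2 - \<delta>) * B * q (k + 1) + (1 - \<delta>) * B * q k)"
   from elim have "lin \<xi> (pt k) > 0" "\<bar>ln (lin \<xi> (pt k)) - ?y\<bar> <= eta * B * q (k + 1)" by (simp_all only: diff_minus_eq_add)
   note x = ln_exp_bounds[OF this]
   have "- ((2 - \<delta> + eta) * (B * q (k + 1)) + (1 - \<delta>) * (B * q k)) = ?y - eta * B * q (k + 1)"
    "- ((2 - \<delta> - eta) * (B * q (k + 1)) + (1 - \<delta>) * (B * q k)) = ?y + eta * B * q (k + 1)" by (simp_all add: algebra_simps)
   then show ?case using x by (simp only:)
  qed
  have lower: "exp ((1 - eta) * (B * q k)) <= x" if "x > 0" "ln x >= B * q k - eta * B * q k" for x k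
  proof -
   have "(1 - eta) * (B * q k) <= ln x" using that(2) by (simp add: algebra_simps)
   then have "exp ((1 - eta) * (B * q k)) <= exp (ln x)" by (simp only: exp_le_cancel_iff)
   then show ?thesis using that(1) by simp
  qed
  show "EV k. exp ((1 - eta) * (B * q k)) <= \<bar>real_of_int (pt k $ 3)\<bar>"
   using pe by eventually_elim (blast intro: lower)
  show "EV k. exp ((1 - eta) * (B * q k)) <= \<bar>real_of_int (pt k $ 2) + 2 * real_of_int (pt k $ 3) * \<xi>\<bar>"
   using pe by eventually_elim (blast intro: lower)
  show "EV k. \<forall>l\<in>{1..s (k + 1) + 1}.
    exp ((1 - eta) * (real l * (B * q k) + B * q (k - 1))) <= hgt (zt k l) &
    hgt (zt k l) <= exp ((1 + eta) * (real l * (B * q k) + B * q (k - 1)))"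
   using ze
  proof eventually_elim
   case (elim k)
   show ?case
   proof
    fix l assume "l \<in> {1..s (k + 1) + 1}"
    then have "hgt (zt k l) > 0" "\<bar>ln (hgt (zt k l)) - B * (real l * q k + q (k - 1))\<bar> <= eta * B * (real l * q k + q (k - 1))"
     using elim by blast+
    note x = ln_exp_bounds[OF this]
    have "(1 - eta) * (real l * (B * q k) + B * q (k - 1)) = B * (real l * q k + q (k - 1)) - eta * B * (real l * q k + q (k - 1))"
     "(1 + eta) * (real l * (B * q k) + B * q (k - 1)) = B * (real l * q k + q (k - 1)) + eta * B * (real l * q k + q (k - 1))"
     by (simp_all add: algebra_simps)
    then show "exp ((1 - eta) * (real l * (B * q k) + B * q (k - 1))) <= hgt (zt k l) &
     hgt (zt k l) <= exp ((1 + eta) * (real l * (B * q k) + B * q (k - 1)))" using x by (simp only:)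
   qed
  qed
  show "EV k. \<forall>l\<in>{1..s (k + 1) + 1}.
    exp (- ((1 - \<delta> + eta) * (real l * (B * q k) + B * q (k - 1)))) <= err \<xi> (zt k l) &
    err \<xi> (zt k l) <= exp (- ((1 - \<delta> - eta) * (real l * (B * q k) + B * q (k - 1))))"
   using ze
  proof eventually_elim
   case (elim k)
   show ?case
   proof
    fix l assume "l \<in> {1..s (k + 1) + 1}"
    then have "err \<xi> (zt k l) > 0"
     "\<bar>ln (err \<xi> (zt k l)) - (- ((1 - \<delta>) * B)) * (real l * q k + q (k - 1))\<bar> <= eta * B * (real l * q k + q (k - 1))"
     using elim by blast+
    note x = ln_exp_bounds[OF this]
    have "- ((1 - \<delta> + eta) * (real l * (B * q k) + B * q (k - 1)))
      = (- ((1 - \<delta>) * B)) * (real l * q k + q (k - 1)) - eta * B * (real l * q k + q (k - 1))"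
     "- ((1 - \<delta> - eta) * (real l * (B * q k) + B * q (k - 1)))
      = (- ((1 - \<delta>) * B)) * (real l * q k + q (k - 1)) + eta * B * (real l * q k + q (k - 1))"
     by (simp_all add: algebra_simps)
    then show "exp (- ((1 - \<delta> + eta) * (real l * (B * q k) + B * q (k - 1)))) <= err \<xi> (zt k l) &
     err \<xi> (zt k l) <= exp (- ((1 - \<delta> - eta) * (real l * (B * q k) + B * q (k - 1))))" using x by (simp only:)
   qed
  qed
 qed auto
 then show ?thesis using a b by blast
qed

end

section \<open>Translation of the definition of \<open>Sturm\<close>\<close>

definition of_mat :: "int^2^2 \<Rightarrow> mat2" where
 "of_mat A = Mat2 (A$1$1) (A$1$2) (A$2$1) (A$2$2)"

lemma of_mat_sel [simp]: "m11 (of_mat A) = A$1$1" "m12 (of_mat A) = A$1$2" "m21 (of_mat A) = A$2$1" "m22 (of_mat A) = A$2$2"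
 by (simp_all add: of_mat_def)

lemma of_mat_mult: "of_mat (A ** B) = of_mat A * of_mat B"
 by (simp add: mat2_eq_iff mat2_mult_entries matrix_matrix_mult_def sum_2)

lemma of_mat_diff: "of_mat (A - B) = of_mat A - of_mat B"
 by (simp add: mat2_eq_iff)

lemma of_mat_1: "of_mat (mat 1) = 1"
 by (simp add: mat2_eq_iff mat_def)

lemma of_mat_power: "of_mat (mat_power A n) = of_mat A ^ n"
 by (induction n) (simp_all add: mat_power_def of_mat_1 of_mat_mult)

lemma det_of_mat: "det A = mdet (of_mat A)"
 by (simp add: det_2 mdet_def)

lemma infnorm_mat_le_iff:
 "infnorm (A::real^2^2) <= t \<longleftrightarrow> \<bar>A$1$1\<bar> <= t & \<bar>A$1$2\<bar> <= t & \<bar>A$2$1\<bar> <= t & \<bar>A$2$2\<bar> <= t"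
proof -
 have "infnorm A <= t \<longleftrightarrow> (\<forall>b\<in>Basis. \<bar>A \<bullet> b\<bar> <= t)" unfolding infnorm_Max by simp
 also have "... \<longleftrightarrow> (\<forall>i j. \<bar>A$i$j\<bar> <= t)" by (auto simp: Basis_vec_def inner_axis)
 finally show ?thesis by (simp add: forall_2)
qed

lemma infnorm_eq_nrm:
 fixes A :: "real^2^2"
 assumes "A$1$1 = real_of_int (m11 B)" "A$1$2 = real_of_int (m12 B)"
  "A$2$1 = real_of_int (m21 B)" "A$2$2 = real_of_int (m22 B)"
 shows "infnorm A = nrm B"
proof (rule antisym)
 show "infnorm A <= nrm B" unfolding infnorm_mat_le_iff assms using nrm_ge[of B] by simp
 have "\<bar>A$1$1\<bar> <= infnorm A & \<bar>A$1$2\<bar> <= infnorm A & \<bar>A$2$1\<bar> <= infnorm A & \<bar>A$2$2\<bar> <= infnorm A"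
  using infnorm_mat_le_iff[of A "infnorm A"] by blast
 then show "nrm B <= infnorm A" unfolding assms by (intro nrm_leI) auto
qed

lemma infnorm_real_mat: "infnorm (real_mat A) = nrm (of_mat A)"
 by (rule infnorm_eq_nrm) (simp_all add: map_matrix_def)

lemma mat_content_eq: "mat_content A = cont (of_mat A)"
proof -
 have "A$i$j \<in> {A$1$1, A$1$2, A$2$1, A$2$2}" for i j using exhaust_2[of i] exhaust_2[of j] by auto
 then have "{A$i$j | i j. True} = {A$1$1, A$1$2, A$2$1, A$2$2}" by blast
 then show ?thesis by (simp add: mat_content_def cont_def gcd.assoc)
qed

lemma primitive_part_nth:
 assumes "of_mat A ~= 0"
 shows "primitive_part_mat A $ 1 $ 1 = real_of_int (m11 (prim (of_mat A)))"
  "primitive_part_mat A $ 1 $ 2 = real_of_int (m12 (prim (of_mat A)))"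
  "primitive_part_mat A $ 2 $ 1 = real_of_int (m21 (prim (of_mat A)))"
  "primitive_part_mat A $ 2 $ 2 = real_of_int (m22 (prim (of_mat A)))"
proof -
 let ?c = "cont (of_mat A)"
 have c: "real_of_int ?c > 0" using cont_pos[OF assms] by simp
 have e: "of_int ?c * prim (of_mat A) = of_mat A" by (rule cont_prim)
 have "A$1$1 = ?c * m11 (prim (of_mat A))" "A$1$2 = ?c * m12 (prim (of_mat A))"
  "A$2$1 = ?c * m21 (prim (of_mat A))" "A$2$2 = ?c * m22 (prim (of_mat A))"
  using arg_cong[OF e, of m11] arg_cong[OF e, of m12] arg_cong[OF e, of m21] arg_cong[OF e, of m22]
  by (simp_all add: mat2_mult_entries)
 then show "primitive_part_mat A $ 1 $ 1 = real_of_int (m11 (prim (of_mat A)))"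
  "primitive_part_mat A $ 1 $ 2 = real_of_int (m12 (prim (of_mat A)))"
  "primitive_part_mat A $ 2 $ 1 = real_of_int (m21 (prim (of_mat A)))"
  "primitive_part_mat A $ 2 $ 2 = real_of_int (m22 (prim (of_mat A)))"
  using c by (simp_all add: primitive_part_mat_def map_matrix_def mat_content_eq)
qed

lemma infnorm_primitive_part: "of_mat A ~= 0 ==> infnorm (primitive_part_mat A) = nrm (prim (of_mat A))"
 by (rule infnorm_eq_nrm[OF primitive_part_nth])

lemma det_primitive_part: "of_mat A ~= 0 ==> det (primitive_part_mat A) = real_of_int (mdet (prim (of_mat A)))"
 by (simp add: det_2 primitive_part_nth mdet_def)

lemma poly_U_primitive:
 assumes "of_mat A ~= 0"
 shows "poly (U_poly (primitive_part_mat A)) \<xi> = val \<xi> (prim (of_mat A))"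
 by (simp add: U_poly_def primitive_part_nth[OF assms] val_def algebra_simps power2_eq_square)

lemma height_U_primitive:
 assumes "of_mat A ~= 0"
 shows "poly_height (U_poly (primitive_part_mat A)) <= 2 * nrm (prim (of_mat A))"
  and "\<bar>real_of_int (m12 (prim (of_mat A)))\<bar> <= poly_height (U_poly (primitive_part_mat A))"
proof -
 let ?B = "prim (of_mat A)"
 have n: "\<bar>real_of_int (m11 ?B)\<bar> <= nrm ?B" "\<bar>real_of_int (m12 ?B)\<bar> <= nrm ?B" "\<bar>real_of_int (m21 ?B)\<bar> <= nrm ?B" "\<bar>real_of_int (m22 ?B)\<bar> <= nrm ?B"
  by (rule nrm_ge)+
 show "poly_height (U_poly (primitive_part_mat A)) <= 2 * nrm ?B"
 proof (rule poly_height_le)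
  fix i
  show "\<bar>coeff (U_poly (primitive_part_mat A)) i\<bar> <= 2 * nrm ?B"
   unfolding U_poly_def primitive_part_nth[OF assms] using n
   by (cases i; cases "i - 1"; cases "i - 2") (auto simp: coeff_pCons split: nat.splits)
 qed
 show "\<bar>real_of_int (m12 ?B)\<bar> <= poly_height (U_poly (primitive_part_mat A))"
  using poly_height_ge[of "U_poly (primitive_part_mat A)" 2]
  by (simp add: U_poly_def primitive_part_nth[OF assms] numeral_2_eq_2)
qed

lemma finite_bounded_vectors: "finite {r :: int^3. hgt r <= t}"
proof -
 let ?I = "{- \<lceil>\<bar>t\<bar>\<rceil>..\<lceil>\<bar>t\<bar>\<rceil>}"
 have "{r :: int^3. hgt r <= t} \<subseteq> (\<lambda>(x, y, z). vector [x, y, z]) ` (?I \<times> ?I \<times> ?I)"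
 proof
  fix r :: "int^3" assume "r \<in> {r. hgt r <= t}"
  then have h: "hgt r <= t" by simp
  have "r $ i \<in> ?I" for i
  proof -
   have "\<bar>real_of_int (r $ i)\<bar> <= \<bar>t\<bar>" using hgt_nth[of r i] h by linarith
   then have "real_of_int \<bar>r $ i\<bar> <= real_of_int \<lceil>\<bar>t\<bar>\<rceil>" using le_of_int_ceiling[of "\<bar>t\<bar>"] by linarith
   then have "\<bar>r $ i\<bar> <= \<lceil>\<bar>t\<bar>\<rceil>" by (simp only: of_int_le_iff)
   then show ?thesis by auto
  qed
  moreover have "r = vector [r $ 1, r $ 2, r $ 3]" by (simp add: vec3_eq_iff)
  ultimately show "r \<in> (\<lambda>(x, y, z). vector [x, y, z]) ` (?I \<times> ?I \<times> ?I)"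
   by (intro image_eqI[of _ _ "(r $ 1, r $ 2, r $ 3)"]) auto
 qed
 then show ?thesis by (rule finite_subset) simp
qed

text \<open>Only finitely many integral forms have bounded height, and none of the non-zero ones
  vanishes at \<open>\<xi>\<close>, so their values are bounded away from 0. Along indices with
  bounded norm the quotient could not tend to 0.\<close>

lemma (in mat_rec) nrm_wt_at_top:
 assumes irr: "!!r. r ~= 0 ==> lin \<xi> r ~= 0" and lim: "(\<lambda>k. val \<xi> (wt k) / nrm (wt k)) \<longlonglongrightarrow> 0"
 shows "filterlim (\<lambda>k. nrm (wt k)) at_top sequentially"
 unfolding filterlim_at_top
proof
 fix N0 :: real
 define N where "N = max N0 1"
 have N: "N > 0" "N0 <= N" by (auto simp: N_def)
 let ?S = "{r :: int^3. hgt r <= 2 * N} - {0}"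
 have S: "finite ?S" using finite_bounded_vectors by blast
 define \<mu> where "\<mu> = Min (insert 1 (lin \<xi> ` ?S))"
 have \<mu>: "\<mu> > 0" unfolding \<mu>_def using S irr by (subst Min_gr_iff) auto
 have \<mu>_le: "\<mu> <= lin \<xi> r" if "r \<in> ?S" for r unfolding \<mu>_def using S that by (intro Min_le) auto
 have "\<mu> / N > 0" using \<mu> N by simp
 from tendstoD[OF lim this] show "EV k. N0 <= nrm (wt k)"
  using eventually_ge_at_top[of 1]
 proof eventually_elim
  case (elim k)
  have n: "nrm (wt k) > 0"
  proof -
   have "wt k ~= 0" using mdet_wt_nz[of k] by auto
   then show ?thesis using nrm_ge_1[of "wt k"] by linarith
  qed
  show ?case
  proof (rule ccontr)
   assume "~ N0 <= nrm (wt k)"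
   then have le: "nrm (wt k) <= N" using N by linarith
   have "U_vec (wt k) ~= 0"
   proof
    assume "U_vec (wt k) = 0"
    then have "m21 (wt k) = 0" "m12 (wt k) = 0" "m11 (wt k) = m22 (wt k)" by (auto simp: vec3_eq_iff)
    then have "wt k * wt (k - 1) - wt (k - 1) * wt k = 0" by (simp add: mat2_eq_iff mat2_mult_entries)
    then have "m0 * 0 = mdet (wt k) * mdet (wt (k - 1)) * e0" using mdet_commutator_wt[OF elim(2)] by simp
    then show False using mdet_wt_nz e0_nz by simp
   qed
   moreover have "hgt (U_vec (wt k)) <= 2 * N" using hgt_U_vec(1)[of "wt k"] le by linarith
   ultimately have "\<mu> <= lin \<xi> (U_vec (wt k))" by (intro \<mu>_le) simp
   then have v: "\<mu> <= \<bar>val \<xi> (wt k)\<bar>" unfolding lin_U_vec .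
   have "\<mu> / N <= \<bar>val \<xi> (wt k)\<bar> / nrm (wt k)" using v le n \<mu> by (intro frac_le) auto
   then show False using elim(1) n by (simp add: dist_real_def)
  qed
 qed
qed

lemma linear_form_nonzero:
 assumes "\<xi> \<notin> \<rat>" "~ quadratic_real \<xi>" "r ~= 0"
 shows "lin \<xi> r ~= 0"
proof
 assume l0: "lin \<xi> r = 0"
 define f where "f = [:r $ 1, r $ 2, r $ 3:]"
 have f0: "f ~= 0" using assms(3) by (auto simp: f_def vec3_eq_iff)
 have root: "poly (map_poly of_int f) (complex_of_real \<xi>) = 0"
 proof -
  have "real_of_int (r $ 1) + real_of_int (r $ 2) * \<xi> + real_of_int (r $ 3) * \<xi>\<^sup>2 = 0" using l0 unfolding lin_eq by simp
  then have "complex_of_real (real_of_int (r $ 1) + real_of_int (r $ 2) * \<xi> + real_of_int (r $ 3) * \<xi>\<^sup>2) = 0" by simp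
  then show ?thesis by (simp add: f_def of_int_poly_quadratic power2_eq_square algebra_simps)
 qed
 obtain p where p: "p dvd f" "irreducible p" "poly (map_poly of_int p) (complex_of_real \<xi>) = 0"
  using prime_factor_root[OF f0 root] by blast
 note irp = p(2)
 have "degree p <= degree f" using p(1) f0 by (rule dvd_imp_degree_le)
 also have "degree f <= 2" by (simp add: f_def)
 finally have d: "degree p <= 2" .
 have "degree p ~= 2" using assms(2) irp p(3) unfolding quadratic_real_def is_int_minpoly_def by blast
 then have d1: "degree p <= 1" using d by linarith
 define x y where "x = coeff p 0" and "y = coeff p 1"
 have "coeff p 2 = 0" using d1 by (intro coeff_eq_0) simp
 then have xy: "p = [:x, y:]" using poly_degree_le_2[OF d] by (simp add: x_def y_def)
 have "complex_of_real (real_of_int x + real_of_int y * \<xi>) = 0"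
  using p(3) unfolding xy by (simp add: map_poly_pCons algebra_simps)
 then have z: "real_of_int x + real_of_int y * \<xi> = 0" by (simp only: of_real_eq_0_iff)
 have "y ~= 0"
 proof
  assume "y = 0"
  then have "x = 0" using z by simp
  then show False using \<open>y = 0\<close> xy irp by simp
 qed
 then have "\<xi> = - real_of_int x / real_of_int y" using z by (simp add: field_simps add_eq_0_iff)
 then have "\<xi> \<in> \<rat>" by simp
 then show False using assms(1) by simp
qed

text \<open>Converse of \<open>linear_form_nonzero\<close>; for the examples it is the non-vanishing
  of integral forms that is established directly.\<close>

lemma Sturm_irrational:
 assumes irr: "!!r. r ~= 0 ==> lin \<xi> r ~= 0"
 shows "\<xi> \<notin> \<rat>" "~ quadratic_real \<xi>"
proof -
 show "\<xi> \<notin> \<rat>"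
 proof
  assume "\<xi> \<in> \<rat>"
  then obtain x y where xy: "y ~= 0" "\<xi> = real_of_int x / real_of_int y"
   by (metis Rats_cases' less_irrefl)
  have "vector [- x, y, 0] ~= (0 :: int^3)"
  proof
   assume "vector [- x, y, 0] = (0 :: int^3)"
   then have "y = 0" by (simp add: vec3_eq_iff)
   then show False using xy by simp
  qed
  from irr[OF this] show False using xy by (simp add: lin_eq)
 qed
 show "~ quadratic_real \<xi>"
 proof
  assume "quadratic_real \<xi>"
  then obtain p where p: "poly (map_poly of_int p) (complex_of_real \<xi>) = 0" "degree p = 2"
   unfolding quadratic_real_def is_int_minpoly_def by blast
  define r :: "int^3" where "r = vector [coeff p 0, coeff p 1, coeff p 2]"
  have "coeff p 2 ~= 0" using p(2) by (metis degree_0 leading_coeff_0_iff zero_neq_numeral)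
  then have "r ~= 0" unfolding r_def by (auto simp: vec3_eq_iff)
  moreover have "lin \<xi> r = 0"
  proof -
   have pe: "p = [:coeff p 0, coeff p 1, coeff p 2:]"
    using p(2) by (intro poly_degree_le_2) simp
   have "complex_of_real (real_of_int (coeff p 0) + real_of_int (coeff p 1) * \<xi> + real_of_int (coeff p 2) * \<xi>\<^sup>2)
     = poly (map_poly of_int [:coeff p 0, coeff p 1, coeff p 2:]) (complex_of_real \<xi>)"
    by (simp add: of_int_poly_quadratic power2_eq_square algebra_simps)
   also have "... = 0" using p(1) pe by metis
   finally have "real_of_int (coeff p 0) + real_of_int (coeff p 1) * \<xi> + real_of_int (coeff p 2) * \<xi>\<^sup>2 = 0"
    by (simp only: of_real_eq_0_iff)
   then show ?thesis by (simp add: lin_eq r_def)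
  qed
  ultimately show False using irr by blast
 qed
qed

theorem sturm_points_of_Sturm:
 assumes s_pos: "!!k. k >= 1 ==> s k > 0" and \<xi>: "\<xi> \<in> Sturm s"
 shows "\<exists>B \<delta> p z. sturm_points s B \<delta> \<xi> (\<lambda>k. B * sturm_q s k) p z"
proof -
 let ?\<theta> = "sturm_sigma s / (1 + sturm_sigma s)"
 obtain w where w: "sturm_sequence s \<xi> w" and \<xi>': "\<xi> \<notin> \<rat>" "~ quadratic_real \<xi>" using \<xi> by (auto simp: Sturm_def)
 note irr = linear_form_nonzero[OF \<xi>']
 define v where "v k = of_mat (w k)" for k
 from w have inv: "!!k. invertible (map_matrix rat_of_int (w k))"
  and rec: "!!k. k >= 1 ==> w (k + 1) = mat_power (w k) (s (k + 1)) ** w (k - 1)"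
  and comm: "det (w 0 ** w 1 - w 1 ** w 0) ~= 0"
  and lim: "(\<lambda>k. poly (U_poly (primitive_part_mat (w k))) \<xi> /
      poly_height (U_poly (primitive_part_mat (w k)))) \<longlonglongrightarrow> 0"
  unfolding sturm_sequence_def by blast+
 obtain c0 where c0: "c0 > 0" "!!k l. k >= 1 ==> l <= s (k + 1) ==>
   infnorm (real_mat (mat_power (w k) (l + 1) ** w (k - 1))) >=
     c0 * infnorm (real_mat (w k)) * infnorm (real_mat (mat_power (w k) l ** w (k - 1)))"
  using w unfolding sturm_sequence_def by blast
 obtain \<epsilon> where \<epsilon>: "\<epsilon> \<longlonglongrightarrow> 0" "EV k. \<bar>det (primitive_part_mat (w k))\<bar> <=
      infnorm (primitive_part_mat (w k)) powr (?\<theta> + \<epsilon> k)"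
  using w unfolding sturm_sequence_def by blast
 have dv: "mdet (v k) ~= 0" for k
 proof -
  have "det (map_matrix rat_of_int (w k)) = rat_of_int (det (w k))" by (simp add: det_2 map_matrix_def)
  moreover have "det (map_matrix rat_of_int (w k)) ~= 0" using inv[of k] by (simp add: invertible_det_nz)
  ultimately show ?thesis unfolding v_def det_of_mat[symmetric] by (metis of_int_0)
 qed
 interpret mat_rec s v
 proof (unfold_locales)
  show "k >= 1 ==> s k > 0" for k by (rule s_pos)
  show "mdet (v k) ~= 0" for k by (rule dv)
  show "v (k + 1) = v k ^ s (k + 1) * v (k - 1)" if "k >= 1" for k
   unfolding v_def rec[OF that] by (simp add: of_mat_mult of_mat_power)
  have "mdet (of_mat (w 0 ** w 1 - w 1 ** w 0)) ~= 0" using comm unfolding det_of_mat .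
  then show "mdet (v 0 * v 1 - v 1 * v 0) ~= 0" by (simp add: v_def of_mat_diff of_mat_mult)
 qed
 have vnz: "of_mat (w k) ~= 0" for k using w_nonzero[of k] by (simp add: v_def)
 have wt: "prim (of_mat (w k)) = wt k" for k by (simp add: wt_def v_def)
 have n1: "nrm (wt k) >= 1" for k
 proof -
  have "wt k ~= 0" using mdet_wt_nz[of k] by auto
  then show ?thesis by (rule nrm_ge_1)
 qed
 define H where "H k = poly_height (U_poly (primitive_part_mat (w k)))" for k
 have limH: "(\<lambda>k. val \<xi> (wt k) / H k) \<longlonglongrightarrow> 0" using lim unfolding H_def poly_U_primitive[OF vnz] wt .
 \<comment> \<open>The definition divides by the height of the polynomial, which is at most twice
   the norm of the primitive matrix, so dividing by this norm instead costs at most a factor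
   2.\<close>
 have limn: "(\<lambda>k. val \<xi> (wt k) / nrm (wt k)) \<longlonglongrightarrow> 0"
 proof (rule Lim_null_comparison[OF always_eventually])
  show "(\<lambda>k. 2 * \<bar>val \<xi> (wt k) / H k\<bar>) \<longlonglongrightarrow> 0" using tendsto_mult_right_zero[OF tendsto_rabs_zero[OF limH]] .
  show "\<forall>k. norm (val \<xi> (wt k) / nrm (wt k)) <= 2 * \<bar>val \<xi> (wt k) / H k\<bar>"
  proof
   fix k
   have H2: "H k <= 2 * nrm (wt k)" unfolding H_def wt[symmetric] by (rule height_U_primitive(1)[OF vnz])
   have "H k >= \<bar>coeff (U_poly (primitive_part_mat (w k))) 0\<bar>" unfolding H_def by (rule poly_height_ge)
   then have H0: "H k >= 0" by linarith
   show "norm (val \<xi> (wt k) / nrm (wt k)) <= 2 * \<bar>val \<xi> (wt k) / H k\<bar>"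
   proof (cases "H k = 0")
    \<comment> \<open>A quotient with denominator 0 is 0 by convention; here the polynomial
      vanishes, hence so does its value.\<close>
    case True
    have "coeff (U_poly (primitive_part_mat (w k))) i = 0" for i
     using poly_height_ge[of "U_poly (primitive_part_mat (w k))" i] True unfolding H_def by linarith
    then have "U_poly (primitive_part_mat (w k)) = 0" by (simp add: poly_eq_iff)
    then have "val \<xi> (wt k) = 0" using poly_U_primitive[OF vnz, of k \<xi>] by (simp add: wt)
    then show ?thesis by simp
   next
    case False
    then have "H k > 0" using H0 by simp
    then have "\<bar>val \<xi> (wt k)\<bar> / nrm (wt k) <= \<bar>val \<xi> (wt k)\<bar> / (H k / 2)" using H2 n1[of k] by (intro divide_left_mono) auto
    then show ?thesis using \<open>H k > 0\<close> n1[of k] by (simp add: abs_divide mult.commute)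
   qed
  qed
 qed
 have top: "filterlim (\<lambda>k. nrm (wt k)) at_top sequentially" by (rule nrm_wt_at_top[OF irr limn])
 have nrm_v: "nrm (v k) = real_of_int (cont (v k)) * nrm (wt k)" for k
  using nrm_of_int_mult[of "cont (v k)" "wt k"] w_eq[of k] cw_pos[of k] by simp
 have \<epsilon>2: "EV k. \<bar>real_of_int (mdet (wt k))\<bar> <= nrm (wt k) powr (?\<theta> + \<epsilon> k)"
  using \<epsilon>(2) unfolding infnorm_primitive_part[OF vnz] det_primitive_part[OF vnz] wt .
 \<comment> \<open>Since this exponent is at most 1/2 and \<open>\<epsilon> k\<close> is eventually
   below 1/2, the determinants of the primitive matrices are eventually bounded by their norms,
   which is far more than the smallness asked of the ratio to the squared norm.\<close>
 have th: "?\<theta> <= 1 / 2" using sigma_nonneg sigma_less_1 by (simp add: field_simps)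
 have sm: "(\<lambda>k. \<bar>real_of_int (mdet (v k))\<bar> / (nrm (v k))\<^sup>2) \<longlonglongrightarrow> 0"
 proof (rule Lim_null_comparison)
  show "(\<lambda>k. 1 / nrm (wt k)) \<longlonglongrightarrow> 0" by (rule real_tendsto_divide_at_top[OF tendsto_const top])
  have "EV k. \<epsilon> k < 1 / 2" by (rule order_tendstoD(2)[OF \<epsilon>(1)]) simp
  with \<epsilon>2 show "EV k. norm (\<bar>real_of_int (mdet (v k))\<bar> / (nrm (v k))\<^sup>2) <= 1 / nrm (wt k)"
  proof eventually_elim
   case (elim k)
   have "nrm (wt k) powr (?\<theta> + \<epsilon> k) <= nrm (wt k) powr 1" using th elim(2) n1[of k] by (intro powr_mono) linarith+
   then have d: "\<bar>real_of_int (mdet (wt k))\<bar> <= nrm (wt k)" using elim(1) n1[of k] by simp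
   have c: "real_of_int (cont (v k)) > 0" using cw_pos[of k] by simp
   have "\<bar>real_of_int (mdet (v k))\<bar> / (nrm (v k))\<^sup>2 = \<bar>real_of_int (mdet (wt k))\<bar> / (nrm (wt k))\<^sup>2"
    unfolding mdet_w_eq nrm_v using c by (simp add: abs_mult power_mult_distrib)
   also have "... <= nrm (wt k) / (nrm (wt k))\<^sup>2" using d by (intro divide_right_mono) auto
   also have "... = 1 / nrm (wt k)" using n1[of k] by (simp add: power2_eq_square)
   finally show ?case by simp
  qed
 qed
 \<comment> \<open>Decreasing the constant preserves the growth condition and makes
   \<open>ln c\<close> non-positive.\<close>
 define c where "c = min c0 1"
 have c: "0 < c" "c <= 1" "c <= c0" using c0(1) by (auto simp: c_def)
 interpret mat_growth s v c
 proof (unfold_locales)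
  fix k l :: nat assume kl: "k >= 1" "l <= s (k + 1)"
  have "c0 * nrm (v k) * nrm (v k ^ l * v (k - 1)) <= nrm (v k ^ (l + 1) * v (k - 1))"
   using c0(2)[OF kl] unfolding infnorm_real_mat of_mat_mult of_mat_power v_def .
  moreover have "c * nrm (v k) * nrm (v k ^ l * v (k - 1)) <= c0 * nrm (v k) * nrm (v k ^ l * v (k - 1))"
   using c(3) by (intro mult_right_mono) auto
  ultimately show "c * nrm (v k) * nrm (v k ^ l * v (k - 1)) <= nrm (v k ^ (l + 1) * v (k - 1))" by linarith
 qed (fact c(1) c(2) sm)+
 have limW: "(\<lambda>k. val \<xi> (v k) / nrm (v k)) \<longlonglongrightarrow> 0"
 proof -
  have "val \<xi> (v k) / nrm (v k) = val \<xi> (wt k) / nrm (wt k)" for k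
  proof -
   have "val \<xi> (v k) = real_of_int (cont (v k)) * val \<xi> (wt k)" using val_of_int_mult[of \<xi> "cont (v k)" "wt k"] w_eq[of k] by simp
   then show ?thesis unfolding nrm_v using cw_pos[of k] by simp
  qed
  then show ?thesis using limn by simp
 qed
 interpret sturm_matrices s v c \<xi>
 proof (unfold_locales)
  show "(\<lambda>k. rho \<xi> (T (k + 1) 0) / nrm (v k)) \<longlonglongrightarrow> 0" by (rule rho_limit[OF limW irr])
  show "lin \<xi> r ~= 0" if "r ~= 0" for r by (rule irr[OF that])
  fix eta :: real assume "eta > 0"
  then have "EV k. \<epsilon> k < eta" by (rule order_tendstoD(2)[OF \<epsilon>(1)])
  with \<epsilon>2 show "EV k. ln \<bar>real_of_int (mdet (wt k))\<bar> <= (?\<theta> + eta) * ln (nrm (wt k))"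
  proof eventually_elim
   case (elim k)
   have "\<bar>real_of_int (mdet (wt k))\<bar> > 0" using mdet_wt_nz[of k] by simp
   then have "ln \<bar>real_of_int (mdet (wt k))\<bar> <= ln (nrm (wt k) powr (?\<theta> + \<epsilon> k))" using elim(1) by (rule ln_le_ln)
   also have "... = (?\<theta> + \<epsilon> k) * ln (nrm (wt k))" using n1[of k] by (simp add: ln_powr)
   also have "... <= (?\<theta> + eta) * ln (nrm (wt k))" using elim(2) n1[of k] by (intro mult_right_mono) auto
   finally show ?case .
  qed
 qed
 show ?thesis using sturm_points_exist by blast
qed

section \<open>Explicit Sturmian numbers\<close>

definition cone :: "mat2 \<Rightarrow> bool" where
 "cone A \<longleftrightarrow> 0 <= m22 A & m22 A <= m12 A & m22 A <= m21 A & m12 A <= m11 A & m21 A <= m11 A"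

text \<open>In this cone the upper left entry is the norm, and it is supermultiplicative because the
  other entries are non-negative. So the growth condition holds with constant 1.\<close>

lemma cone_mult:
 assumes "cone A" "cone B"
 shows "cone (A * B)" "m11 A * m11 B <= m11 (A * B)"
proof -
 have p: "0 <= m11 A" "0 <= m12 A" "0 <= m21 A" "0 <= m22 A" "0 <= m11 B" "0 <= m12 B" "0 <= m21 B" "0 <= m22 B"
  using assms by (auto simp: cone_def)
 have o: "m22 A <= m12 A" "m22 A <= m21 A" "m12 A <= m11 A" "m21 A <= m11 A"
  "m22 B <= m12 B" "m22 B <= m21 B" "m12 B <= m11 B" "m21 B <= m11 B" using assms by (auto simp: cone_def)
 show "cone (A * B)" unfolding cone_def mat2_mult_entries
  using p o by (intro conjI add_mono mult_left_mono mult_right_mono add_nonneg_nonneg mult_nonneg_nonneg)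
 show "m11 A * m11 B <= m11 (A * B)" unfolding mat2_mult_entries using p by simp
qed

lemma nrm_cone:
 assumes "cone A"
 shows "nrm A = real_of_int (m11 A)"
proof (rule antisym)
 show "nrm A <= real_of_int (m11 A)" using assms by (intro nrm_leI) (auto simp: cone_def)
 show "real_of_int (m11 A) <= nrm A" using nrm_ge(1)[of A] by linarith
qed

lemma cone_power_mult: "cone A ==> cone B ==> cone (A ^ l * B)"
 by (induction l) (auto simp: mult.assoc cone_mult)

lemma sqrt_le_self: "1 <= x ==> sqrt x <= (x :: real)"
 using mult_left_mono[of 1 x x] by (intro real_le_lsqrt) (auto simp: power2_eq_square)

text \<open>The values of \<open>\<delta>\<close> to be approximated are at most 1/2 and will be
  close to \<open>2 * m / n\<close>; accordingly \<open>4 * m <= n\<close>, which makes the squares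
  of the determinants at most the norms.\<close>

locale sturm_example = sturm_seq +
 fixes m n :: nat
 assumes n2: "n >= 2" and mn: "4 * m <= n"
begin

text \<open>Both initial determinants are \<open>- (4 ^ m)\<close> and both norms are close to
  \<open>2 ^ n\<close>. The different corners prevent the matrices from commuting. For positive
  \<open>m\<close>, odd corners and even off-diagonal entries keep the upper left entry odd, hence
  coprime to the determinant.\<close>

fun ww :: "nat \<Rightarrow> mat2" where
 "ww 0 = Mat2 (2 ^ n + 1) (2 ^ m) (2 ^ m) 0"
| "ww (Suc 0) = Mat2 (2 ^ n + 3) (2 ^ m) (2 ^ m) 0"
| "ww (Suc (Suc k)) = ww (Suc k) ^ s (Suc (Suc k)) * ww k"

text \<open>Same recurrence as \<open>q\<close>, but with initial values 1 and 1, since the two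
  initial matrices have the same size; only the quotient of the logarithms of determinant and norm
  matters for \<open>\<delta>\<close>.\<close>

fun qq :: "nat \<Rightarrow> nat" where
 "qq 0 = 1"
| "qq (Suc 0) = 1"
| "qq (Suc (Suc k)) = s (Suc (Suc k)) * qq (Suc k) + qq k"

lemma ww_rec: "k >= 1 ==> ww (k + 1) = ww k ^ s (k + 1) * ww (k - 1)"
 by (cases k) simp_all

lemma pow_le: "(2::int) ^ m <= 2 ^ n"
 using mn by (intro power_increasing) auto

lemma cone_ww: "cone (ww k) & cone (ww (Suc k))"
proof (induction k)
 case 0
 have "(2::int) ^ m <= 2 ^ n + 1" "(2::int) ^ m <= 2 ^ n + 3" using pow_le by linarith+
 then show ?case by (simp add: cone_def)
next
 case (Suc k)
 then show ?case by (simp add: cone_power_mult)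
qed

lemma mdet_ww: "\<bar>mdet (ww k)\<bar> = 4 ^ (m * qq k) & \<bar>mdet (ww (Suc k))\<bar> = 4 ^ (m * qq (Suc k))"
proof (induction k)
 case 0
 have "(2::int) ^ m * 2 ^ m = 4 ^ m" by (simp add: power_mult_distrib[symmetric])
 then show ?case by (simp add: mdet_def)
next
 case (Suc k)
 then show ?case by (simp add: abs_mult power_abs power_mult[symmetric] power_add[symmetric] algebra_simps)
qed

lemma m11_ww_lower: "(2 ^ n) ^ qq k <= m11 (ww k) & (2 ^ n) ^ qq (Suc k) <= m11 (ww (Suc k))"
proof (induction k)
 case (Suc k)
 let ?A = "ww (Suc k)"
 have A: "(2 ^ n) ^ qq (Suc k) <= m11 ?A" "cone ?A" "cone (ww k)" "(2 ^ n) ^ qq k <= m11 (ww k)" using Suc cone_ww[of k] by auto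
 have "((2 ^ n) ^ qq (Suc k)) ^ l * (2 ^ n) ^ qq k <= m11 (?A ^ l * ww k)" for l
 proof (induction l)
  case (Suc l)
  have "(((2::int) ^ n) ^ qq (Suc k)) ^ Suc l * (2 ^ n) ^ qq k = (2 ^ n) ^ qq (Suc k) * (((2 ^ n) ^ qq (Suc k)) ^ l * (2 ^ n) ^ qq k)"
   by (simp add: mult.assoc)
  also have "... <= m11 ?A * m11 (?A ^ l * ww k)"
  proof (rule mult_mono[OF A(1) Suc])
   have "(0::int) <= (2 ^ n) ^ qq (Suc k)" by simp
   then show "0 <= m11 ?A" using A(1) by linarith
  qed simp
  also have "... <= m11 (?A * (?A ^ l * ww k))" by (rule cone_mult(2)[OF A(2) cone_power_mult[OF A(2,3)]])
  finally show ?case by (simp add: mult.assoc)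
 qed (use A in simp)
 from this[of "s (Suc (Suc k))"] have "(2 ^ n) ^ qq (Suc (Suc k)) <= m11 (ww (Suc (Suc k)))"
  by (simp add: power_mult[symmetric] power_add algebra_simps)
 then show ?case using Suc by simp
qed simp

lemma nrm_ww: "nrm (ww k) = real_of_int (m11 (ww k))"
 using nrm_cone cone_ww by blast

lemma nrm_ww_upper: "2 * nrm (ww k) <= (2 ^ (n + 2)) ^ qq k & 2 * nrm (ww (Suc k)) <= (2 ^ (n + 2)) ^ qq (Suc k)"
proof (induction k)
 case 0
 have "(4::real) <= 2 ^ n" using power_increasing[OF n2, of "2::real"] by simp
 then show ?case unfolding nrm_ww by simp
next
 case (Suc k)
 let ?A = "ww (Suc k)" and ?b = "(2::real) ^ (n + 2)"
 have A: "2 * nrm ?A <= ?b ^ qq (Suc k)" "2 * nrm (ww k) <= ?b ^ qq k" using Suc by auto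
 have "2 * nrm (?A ^ l * ww k) <= (?b ^ qq (Suc k)) ^ l * ?b ^ qq k" for l
 proof (induction l)
  case (Suc l)
  have "2 * nrm (?A * (?A ^ l * ww k)) <= (2 * nrm ?A) * (2 * nrm (?A ^ l * ww k))"
   using nrm_mult[of ?A "?A ^ l * ww k"] by simp
  also have "... <= ?b ^ qq (Suc k) * ((?b ^ qq (Suc k)) ^ l * ?b ^ qq k)" by (rule mult_mono[OF A(1) Suc]) simp_all
  finally show ?case by (simp add: mult.assoc)
 qed (use A in simp)
 have pe: "?b ^ qq (Suc (Suc k)) = (?b ^ qq (Suc k)) ^ s (Suc (Suc k)) * ?b ^ qq k"
  by (simp only: qq.simps power_add mult.commute[of "s (Suc (Suc k))"] power_mult)
 have "2 * nrm (ww (Suc (Suc k))) <= ?b ^ qq (Suc (Suc k))"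
  unfolding pe ww.simps by (rule \<open>!!l. 2 * nrm (?A ^ l * ww k) <= (?b ^ qq (Suc k)) ^ l * ?b ^ qq k\<close>)
 then show ?case using Suc by simp
qed

lemma qq_ge: "qq k >= 1 & k <= qq k & qq (Suc k) >= 1 & Suc k <= qq (Suc k)"
proof (induction k)
 case (Suc k)
 have a: "qq (Suc k) <= s (Suc (Suc k)) * qq (Suc k)" using s_pos[of "Suc (Suc k)"] by simp
 have b: "qq (Suc (Suc k)) = s (Suc (Suc k)) * qq (Suc k) + qq k" by simp
 have i: "1 <= qq k" "1 <= qq (Suc k)" "Suc k <= qq (Suc k)" using Suc by auto
 have "1 <= qq (Suc (Suc k))" "Suc (Suc k) <= qq (Suc (Suc k))" using a i unfolding b by linarith+
 then show ?case using i by blast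
qed simp

lemma nrm_ww_ge: "nrm (ww k) >= 2 ^ k" "nrm (ww k) >= 1"
proof -
 have "(2::real) ^ k <= 2 ^ (n * qq k)"
 proof (rule power_increasing)
  have "1 * qq k <= n * qq k" using n2 by (intro mult_right_mono) auto
  then show "k <= n * qq k" using qq_ge[of k] by linarith
 qed simp
 also have "... = real_of_int ((2 ^ n) ^ qq k)" by (simp add: power_mult)
 also have "... <= nrm (ww k)" unfolding nrm_ww using m11_ww_lower[of k] by (simp only: of_int_le_iff)
 finally show "nrm (ww k) >= 2 ^ k" .
 then show "nrm (ww k) >= 1" using one_le_power[of "2::real" k] by linarith
qed

lemma ln_det_ww: "ln \<bar>real_of_int (mdet (ww k))\<bar> = real (2 * m * qq k) * ln 2"
proof -
 have "\<bar>real_of_int (mdet (ww k))\<bar> = real_of_int (4 ^ (m * qq k))" using mdet_ww[of k] by (simp only: of_int_abs[symmetric])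
 also have "... = 2 ^ (2 * m * qq k)" by (simp add: power_mult)
 finally show ?thesis by (simp add: ln_realpow)
qed

lemma ln_nrm_ww: "real (n * qq k) * ln 2 <= ln (nrm (ww k))" "ln (nrm (ww k)) <= real ((n + 2) * qq k) * ln 2"
proof -
 have "real_of_int ((2 ^ n) ^ qq k) <= nrm (ww k)" unfolding nrm_ww using m11_ww_lower[of k] by (simp only: of_int_le_iff)
 then have "(2::real) ^ (n * qq k) <= nrm (ww k)" by (simp add: power_mult)
 then have "ln (2 ^ (n * qq k)) <= ln (nrm (ww k))" by (intro ln_le_ln) auto
 then show "real (n * qq k) * ln 2 <= ln (nrm (ww k))" by (simp add: ln_realpow)
 have "nrm (ww k) <= 2 ^ ((n + 2) * qq k)" using nrm_ww_upper[of k] nrm_ww_ge(2)[of k] unfolding power_mult by linarith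
 then have "ln (nrm (ww k)) <= ln (2 ^ ((n + 2) * qq k))" using nrm_ww_ge(2)[of k] by (intro ln_le_ln) auto
 also have "... = real ((n + 2) * qq k) * ln 2" by (rule ln_realpow)
 finally show "ln (nrm (ww k)) <= real ((n + 2) * qq k) * ln 2" .
qed

text \<open>The content divides the determinant, a power of 4 up to sign. For \<open>m = 0\<close>
  this is a unit; otherwise the content also divides the odd upper left entry.\<close>

lemma cont_ww: "cont (ww k) = 1"
proof -
 have "cont (ww k) dvd mdet (ww k)" unfolding mdet_def using dvd_cont_iff[of "cont (ww k)" "ww k"] by (intro dvd_diff dvd_mult2) auto
 then have d: "cont (ww k) dvd 4 ^ (m * qq k)" using mdet_ww[of k] by (metis dvd_abs_iff)
 show ?thesis
 proof (cases "m = 0")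
  case True
  then show ?thesis using d cont_nonneg[of "ww k"] by (simp add: zdvd1_eq)
 next
  case False
  have ev: "(2::int) dvd 2 ^ m" "(2::int) dvd 2 ^ n" using False n2 by (simp_all add: dvd_power)
  have inv: "odd (m11 A * m11 B + m12 A * m21 B) & even (m11 A * m12 B + m12 A * m22 B)"
   if "odd (m11 A)" "even (m12 A)" "odd (m11 B)" "even (m12 B)" for A B :: mat2 using that by simp
  have pw: "odd (m11 (A ^ l * B)) & even (m12 (A ^ l * B))"
   if "odd (m11 A)" "even (m12 A)" "odd (m11 B)" "even (m12 B)" for A B l
   using that by (induction l) (simp_all add: mult.assoc mat2_mult_entries)
  have "(odd (m11 (ww k)) & even (m12 (ww k))) & (odd (m11 (ww (Suc k))) & even (m12 (ww (Suc k))))"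
  proof (induction k)
   case 0 then show ?case using ev by simp
  next
   case (Suc k) then show ?case using pw by simp
  qed
  then have o: "odd (m11 (ww k))" by simp
  have "cont (ww k) dvd m11 (ww k)" using dvd_cont_iff[of "cont (ww k)" "ww k"] by simp
  then have "odd (cont (ww k))" using o dvd_trans by blast
  then have "coprime (cont (ww k)) (2 ^ (2 * (m * qq k)))" by simp
  then have "coprime (cont (ww k)) (4 ^ (m * qq k))" by (simp add: power_mult)
  then have "is_unit (cont (ww k))" using d by (metis coprime_absorb_left)
  then show ?thesis using cont_nonneg[of "ww k"] by simp
 qed
qed

lemma det_sq_le: "(real_of_int (mdet (ww k)))\<^sup>2 <= nrm (ww k)"
proof -
 have "real_of_int \<bar>mdet (ww k)\<bar> = real_of_int (4 ^ (m * qq k))" using mdet_ww[of k] by (simp only:)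
 also have "... = (2 ^ 2) ^ (m * qq k)" by simp
 also have "... = 2 ^ (2 * (m * qq k))" by (rule power_mult[symmetric])
 finally have e: "real_of_int \<bar>mdet (ww k)\<bar> = 2 ^ (2 * (m * qq k))" .
 have "(real_of_int (mdet (ww k)))\<^sup>2 = (real_of_int \<bar>mdet (ww k)\<bar>)\<^sup>2" by simp
 also have "... = 2 ^ (2 * (m * qq k) * 2)" unfolding e by (rule power_mult[symmetric])
 also have "... = 2 ^ (4 * m * qq k)"
 proof -
  have "2 * (m * qq k) * 2 = 4 * m * qq k" by simp
  then show ?thesis by (simp only:)
 qed
 also have "... <= 2 ^ (n * qq k)" using mn by (intro power_increasing mult_right_mono) auto
 also have "... = real_of_int ((2 ^ n) ^ qq k)" by (simp add: power_mult)
 also have "... <= nrm (ww k)" unfolding nrm_ww using m11_ww_lower[of k] by (simp only: of_int_le_iff)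
 finally show ?thesis .
qed

lemma det_le: "\<bar>real_of_int (mdet (ww k))\<bar> <= sqrt (nrm (ww k))"
 using det_sq_le[of k] by (simp add: real_le_rsqrt)

lemma nrm_top: "filterlim (\<lambda>k. nrm (ww k)) at_top sequentially"
proof (rule filterlim_at_top_mono[OF filterlim_real_sequentially always_eventually], rule allI)
 show "real k <= nrm (ww k)" for k
  using order_trans[OF less_imp_le[OF of_nat_less_two_power] nrm_ww_ge(1)] .
qed

lemma sqrt_nrm_top: "filterlim (\<lambda>k. sqrt (nrm (ww k))) at_top sequentially"
 by (rule filterlim_compose[OF sqrt_at_top nrm_top])

lemma inv_sqrt_lim: "(\<lambda>k. C / sqrt (nrm (ww k))) \<longlonglongrightarrow> 0"
 by (rule real_tendsto_divide_at_top[OF tendsto_const sqrt_nrm_top])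

lemma det_nrm_sq: "\<bar>real_of_int (mdet (ww k))\<bar> / (nrm (ww k))\<^sup>2 <= 1 / nrm (ww k)"
proof -
 have n: "nrm (ww k) >= 1" by (rule nrm_ww_ge)
 have "sqrt (nrm (ww k)) <= nrm (ww k)" using n by (rule sqrt_le_self)
 then have "\<bar>real_of_int (mdet (ww k))\<bar> / (nrm (ww k))\<^sup>2 <= nrm (ww k) / (nrm (ww k))\<^sup>2"
  using det_le[of k] by (intro divide_right_mono) auto
 then show ?thesis using n by (simp add: power2_eq_square)
qed

lemma growth_ww:
 assumes "k >= 1"
 shows "nrm (ww k) * nrm (ww k ^ l * ww (k - 1)) <= nrm (ww k ^ (l + 1) * ww (k - 1))"
proof -
 have c: "cone (ww k)" "cone (ww k ^ l * ww (k - 1))" "cone (ww k * (ww k ^ l * ww (k - 1)))"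
  using cone_ww cone_power_mult cone_mult(1) by blast+
 have "real_of_int (m11 (ww k) * m11 (ww k ^ l * ww (k - 1))) <= real_of_int (m11 (ww k * (ww k ^ l * ww (k - 1))))"
  using cone_mult(2)[OF c(1,2)] by (simp only: of_int_le_iff)
 then show ?thesis using nrm_cone[OF c(1)] nrm_cone[OF c(2)] nrm_cone[OF c(3)] by (simp add: mult.assoc)
qed

sublocale mat_growth s ww 1
proof (unfold_locales)
 show "mdet (ww k) ~= 0" for k using mdet_ww[of k] by auto
 show "k >= 1 ==> ww (k + 1) = ww k ^ s (k + 1) * ww (k - 1)" for k by (rule ww_rec)
 show "mdet (ww 0 * ww 1 - ww 1 * ww 0) ~= 0" by (simp add: mdet_def mat2_mult_entries algebra_simps)
 show "1 * nrm (ww k) * nrm (ww k ^ l * ww (k - 1)) <= nrm (ww k ^ (l + 1) * ww (k - 1))" if "k >= 1" for k l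
  using growth_ww[OF that, of l] by simp
 show "(\<lambda>k. \<bar>real_of_int (mdet (ww k))\<bar> / (nrm (ww k))\<^sup>2) \<longlonglongrightarrow> 0"
 proof (rule Lim_null_comparison[OF always_eventually])
  show "\<forall>k. norm (\<bar>real_of_int (mdet (ww k))\<bar> / (nrm (ww k))\<^sup>2) <= 1 / sqrt (nrm (ww k))"
  proof
   fix k
   have n: "nrm (ww k) >= 1" by (rule nrm_ww_ge)
   have "sqrt (nrm (ww k)) <= nrm (ww k)" using n by (rule sqrt_le_self)
   then have "1 / nrm (ww k) <= 1 / sqrt (nrm (ww k))" using n by (intro divide_left_mono) auto
   then show "norm (\<bar>real_of_int (mdet (ww k))\<bar> / (nrm (ww k))\<^sup>2) <= 1 / sqrt (nrm (ww k))" using det_nrm_sq[of k] by simp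
  qed
  show "(\<lambda>k. 1 / sqrt (nrm (ww k))) \<longlonglongrightarrow> 0" by (rule inv_sqrt_lim)
 qed
qed simp_all

definition slope :: "nat \<Rightarrow> real" where "slope k = real_of_int (m21 (ww k)) / real_of_int (m11 (ww k))"

text \<open>\<open>ww (k + 1)\<close> is \<open>ww k\<close> times a matrix of the cone, so its
  first column is a non-negative combination of the columns of \<open>ww k\<close>. The change of
  slope is at most the determinant over the squared norm.\<close>

lemma slope_step:
 assumes k: "k >= 1"
 shows "\<bar>slope (k + 1) - slope k\<bar> <= (1 / 2) ^ k"
proof -
 define B where "B = ww k ^ (s (k + 1) - 1) * ww (k - 1)"
 have "Suc (s (k + 1) - 1) = s (k + 1)" using s_pos[of "k + 1"] by simp
 then have w: "ww (k + 1) = ww k * B" unfolding B_def mult.assoc[symmetric] power_Suc[symmetric] using ww_rec[OF k] by simp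
 have cB: "cone B" unfolding B_def using cone_ww cone_power_mult by blast
 have cA: "cone (ww k)" using cone_ww by blast
 let ?a = "real_of_int (m11 (ww k))" and ?b = "real_of_int (m12 (ww k))" and ?c = "real_of_int (m21 (ww k))" and ?d = "real_of_int (m22 (ww k))"
  and ?x = "real_of_int (m11 B)" and ?y = "real_of_int (m21 B)"
 have a: "?a >= 1" "?a >= 2 ^ k" using nrm_ww_ge[of k] nrm_ww[of k] by auto
 have b: "?b >= 0" using cA by (simp add: cone_def)
 have xy: "0 <= ?y" "?y <= ?x" using cB by (auto simp: cone_def)
 have "m11 (ww (k + 1)) = m11 (ww k) * m11 B + m12 (ww k) * m21 B" "m21 (ww (k + 1)) = m21 (ww k) * m11 B + m22 (ww k) * m21 B"
  unfolding w mat2_mult_entries by simp_all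
 then have e: "real_of_int (m11 (ww (k + 1))) = ?a * ?x + ?b * ?y" "real_of_int (m21 (ww (k + 1))) = ?c * ?x + ?d * ?y" by simp_all
 have a1: "?a * ?x + ?b * ?y >= 1" using nrm_ww_ge(2)[of "k + 1"] nrm_ww[of "k + 1"] e by simp
 have x0: "?x > 0"
 proof (rule ccontr)
  assume "~ ?x > 0"
  then have "?x = 0" "?y = 0" using xy by linarith+
  then show False using a1 by simp
 qed
 have det: "real_of_int (mdet (ww k)) = ?a * ?d - ?b * ?c" by (simp add: mdet_def)
 have "slope (k + 1) - slope k = real_of_int (mdet (ww k)) * ?y / (?a * (?a * ?x + ?b * ?y))"
  unfolding slope_def e det using a a1 by (simp add: field_simps)
 then have "\<bar>slope (k + 1) - slope k\<bar> = \<bar>real_of_int (mdet (ww k))\<bar> * ?y / (?a * (?a * ?x + ?b * ?y))"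
  using a a1 xy by (simp add: abs_mult)
 also have "... <= \<bar>real_of_int (mdet (ww k))\<bar> * ?x / (?a * (?a * ?x))"
  using a b xy x0 by (intro frac_le mult_left_mono mult_nonneg_nonneg mult_pos_pos) auto
 also have "... = \<bar>real_of_int (mdet (ww k))\<bar> / (nrm (ww k))\<^sup>2" using x0 a by (simp add: nrm_ww power2_eq_square)
 also have "... <= 1 / nrm (ww k)" by (rule det_nrm_sq)
 also have "... <= 1 / 2 ^ k" using nrm_ww_ge[of k] by (intro frac_le) auto
 finally show ?thesis by (simp add: power_one_over)
qed

lemma slope_convergent: "convergent slope"
proof -
 have "summable (\<lambda>k. slope (Suc k) - slope k)"
 proof (rule summable_comparison_test')
  show "summable (\<lambda>k. (1 / 2 :: real) ^ k)" by (rule summable_geometric) simp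
  show "norm (slope (Suc k) - slope k) <= (1 / 2) ^ k" if "k >= 1" for k using slope_step[OF that] by simp
 qed
 then have "convergent (\<lambda>k. \<Sum>j<k. slope (Suc j) - slope j)" by (simp only: summable_iff_convergent)
 then have "convergent (\<lambda>k. slope k - slope 0)" by (simp only: sum_lessThan_telescope)
 then have "convergent (\<lambda>k. (slope k - slope 0) + slope 0)" by (rule convergent_add[OF _ convergent_const])
 then show ?thesis by simp
qed

definition xi :: real where "xi = lim slope"

lemma slope_lim: "slope \<longlonglongrightarrow> xi"
 unfolding xi_def using slope_convergent by (simp only: convergent_LIMSEQ_iff)

definition col :: "mat2 \<Rightarrow> real" where
 "col A = max \<bar>real_of_int (m21 A) - xi * real_of_int (m11 A)\<bar> \<bar>real_of_int (m22 A) - xi * real_of_int (m12 A)\<bar>"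

lemma col_bound: "col (ww k) / nrm (ww k) <= \<bar>slope k - xi\<bar> + 1 / nrm (ww k)"
proof -
 let ?a = "real_of_int (m11 (ww k))" and ?b = "real_of_int (m12 (ww k))" and ?c = "real_of_int (m21 (ww k))" and ?d = "real_of_int (m22 (ww k))"
 have n: "?a = nrm (ww k)" "?a >= 1" using nrm_ww[of k] nrm_ww_ge(2)[of k] by auto
 have b: "0 <= ?b" "?b <= ?a" using cone_ww[of k] by (auto simp: cone_def)
 have "?c - xi * ?a = (slope k - xi) * ?a" unfolding slope_def using n by (simp add: field_simps)
 then have 1: "\<bar>?c - xi * ?a\<bar> = \<bar>slope k - xi\<bar> * ?a" using n by (simp add: abs_mult)
 have "?d - xi * ?b = real_of_int (mdet (ww k)) / ?a + ?b * (slope k - xi)"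
  unfolding slope_def mdet_def using n by (simp add: field_simps)
 moreover have "\<bar>real_of_int (mdet (ww k)) / ?a\<bar> <= 1"
 proof -
  have "sqrt (nrm (ww k)) <= nrm (ww k)" by (rule sqrt_le_self[OF nrm_ww_ge(2)])
  then have "\<bar>real_of_int (mdet (ww k))\<bar> <= ?a" using det_le[of k] n by linarith
  then show ?thesis using n(2) by (simp add: abs_divide)
 qed
 moreover have "\<bar>?b * (slope k - xi)\<bar> <= ?a * \<bar>slope k - xi\<bar>" using b by (simp add: abs_mult mult_right_mono)
 ultimately have 2: "\<bar>?d - xi * ?b\<bar> <= \<bar>slope k - xi\<bar> * ?a + 1" by (simp only: mult.commute[of ?a]; linarith)
 have "col (ww k) <= \<bar>slope k - xi\<bar> * ?a + 1" unfolding col_def using 1 2 by simp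
 then have "col (ww k) / ?a <= (\<bar>slope k - xi\<bar> * ?a + 1) / ?a" using n(2) by (intro divide_right_mono) auto
 also have "... = \<bar>slope k - xi\<bar> + 1 / ?a" using n(2) by (simp add: field_simps)
 finally show ?thesis unfolding n(1) .
qed

lemma col_lim: "(\<lambda>k. C * (col (ww k) / nrm (ww k))) \<longlonglongrightarrow> 0"
proof -
 have "(\<lambda>k. \<bar>slope k - xi\<bar> + 1 / nrm (ww k)) \<longlonglongrightarrow> \<bar>xi - xi\<bar> + 0"
 proof (intro tendsto_intros slope_lim)
  note nrm_top
  then show "(\<lambda>k. 1 / nrm (ww k)) \<longlonglongrightarrow> 0" by (rule real_tendsto_divide_at_top[OF tendsto_const])
 qed
 then have l: "(\<lambda>k. \<bar>slope k - xi\<bar> + 1 / nrm (ww k)) \<longlonglongrightarrow> 0" by simp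
 have "(\<lambda>k. col (ww k) / nrm (ww k)) \<longlonglongrightarrow> 0"
 proof (rule Lim_null_comparison[OF always_eventually l])
  show "\<forall>k. norm (col (ww k) / nrm (ww k)) <= \<bar>slope k - xi\<bar> + 1 / nrm (ww k)"
  proof
   fix k
   have "0 <= col (ww k) / nrm (ww k)" using nrm_nonneg[of "ww k"] by (simp add: col_def le_max_iff_disj)
   then show "norm (col (ww k) / nrm (ww k)) <= \<bar>slope k - xi\<bar> + 1 / nrm (ww k)" using col_bound[of k] by simp
  qed
 qed
 from tendsto_mult_right_zero[OF this] show ?thesis .
qed

text \<open>For a traceless matrix the rows and the columns carry the same information:
  \<open>y1\<close> and \<open>y2\<close> are, up to sign, the deviations of the columns from the
  direction \<open>(1, xi)\<close>. For a product these are combinations of the deviations of the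
  columns of the left factor.\<close>

lemma rho_le_col:
 assumes "tr (A * B) = 0"
 shows "rho xi (A * B) <= 2 * nrm B * col A"
proof -
 let ?u = "real_of_int (m21 A) - xi * real_of_int (m11 A)" and ?v = "real_of_int (m22 A) - xi * real_of_int (m12 A)"
 note t = traceless_entries[OF assms]
 have uv: "\<bar>?u\<bar> <= col A" "\<bar>?v\<bar> <= col A" by (auto simp: col_def)
 have y2: "y2 xi (A * B) = ?u * real_of_int (m11 B) + ?v * real_of_int (m21 B)"
  unfolding y2_def t by (simp add: mat2_mult_entries algebra_simps)
 have "y1 xi (A * B) = - (real_of_int (m22 (A * B)) - xi * real_of_int (m12 (A * B)))" unfolding y1_def t by simp
 then have y1: "y1 xi (A * B) = - (?u * real_of_int (m12 B) + ?v * real_of_int (m22 B))"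
  by (simp add: mat2_mult_entries algebra_simps)
 have b: "\<bar>?u * x + ?v * y\<bar> <= 2 * nrm B * col A" if "\<bar>x\<bar> <= nrm B" "\<bar>y\<bar> <= nrm B" for x y
  using abs_mult_le[OF uv(1) that(1)] abs_mult_le[OF uv(2) that(2)] by (simp only: mult_ac; linarith)
 have "\<bar>y1 xi (A * B)\<bar> <= 2 * nrm B * col A" unfolding y1 abs_minus_cancel by (rule b) (rule nrm_ge)+
 moreover have "\<bar>y2 xi (A * B)\<bar> <= 2 * nrm B * col A" unfolding y2 by (rule b) (rule nrm_ge)+
 ultimately show ?thesis by (simp add: rho_def)
qed

sublocale mat_limit s ww 1 xi
proof (unfold_locales)
 show "(\<lambda>k. rho xi (T (k + 1) 0) / nrm (ww k)) \<longlonglongrightarrow> 0"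
 proof (rule Lim_null_comparison[OF always_eventually col_lim[of "2 * NPhi"]])
  show "\<forall>k. norm (rho xi (T (k + 1) 0) / nrm (ww k)) <= 2 * NPhi * (col (ww k) / nrm (ww k))"
  proof
   fix k
   have T: "T (k + 1) 0 = ww k * Phi (k + 1)" using T_0[of k] by simp
   have "rho xi (T (k + 1) 0) <= 2 * NPhi * col (ww k)"
    using rho_le_col[of "ww k" "Phi (k + 1)"] tr_T[of "k + 1" 0] unfolding T nrm_Phi by simp
   then have "rho xi (T (k + 1) 0) / nrm (ww k) <= 2 * NPhi * col (ww k) / nrm (ww k)" by (intro divide_right_mono) auto
   then show "norm (rho xi (T (k + 1) 0) / nrm (ww k)) <= 2 * NPhi * (col (ww k) / nrm (ww k))" using rho_ge(3) by simp
  qed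
 qed
qed

text \<open>In the determinant of \<open>T k l\<close> one factor is at most the square root of
  \<open>nrm (ww k)\<close> and the others are at most the norms; so the error bound from
  \<open>rho_T_bound\<close> gains this square root.\<close>

lemma T_err_lim:
 assumes "l = 1 \<or> l = 2"
 shows "EV k. err xi (X_vec (T k l)) <= ((1 + \<bar>xi\<bar>) * (\<bar>c4\<bar> * (F * (2 * NPhi)))) / sqrt (nrm (ww k))"
 using rho_T_bound eventually_ge_at_top[of 1]
proof eventually_elim
 case (elim k)
 have "s (k + 1) >= 1" using s_pos[of "k + 1"] by simp
 then have l: "l \<in> {1..s (k + 1) + 1}" using assms by auto
 let ?n = "nrm (T k l)" and ?d = "\<bar>real_of_int (mdet (T k l))\<bar>"
 have W: "nrm (ww j) >= 1" for j by (rule nrm_ww_ge)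
 define D where "D = (\<lambda>j. \<bar>real_of_int (mdet (ww j))\<bar>)"
 have lowN: "nrm (ww k) ^ l * nrm (ww (k - 1)) <= 2 * NPhi * ?n"
 proof -
  have "nrm (ww k) ^ j * nrm (ww (k - 1)) <= nrm (ww k ^ j * ww (k - 1))" for j
  proof (induction j)
   case (Suc j)
   have "nrm (ww k) ^ Suc j * nrm (ww (k - 1)) <= nrm (ww k) * nrm (ww k ^ j * ww (k - 1))"
    using mult_left_mono[OF Suc, of "nrm (ww k)"] by (simp add: mult.assoc)
   then show ?case using growth_ww[OF elim(2), of j] by simp
  qed simp
  then show ?thesis using T_nrm_ge[of k l] by (rule order_trans)
 qed
 have dW: "D j <= nrm (ww j)" for j
 proof -
  have "sqrt (nrm (ww j)) <= nrm (ww j)" using W[of j] by (rule sqrt_le_self)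
  then show ?thesis using det_le[of j] by (simp add: D_def)
 qed
 have prod: "D k ^ l * D (k - 1) <= (nrm (ww k) ^ l * nrm (ww (k - 1))) / sqrt (nrm (ww k))"
 proof -
  obtain j where j: "l = Suc j" using assms by (cases l) auto
  have sq: "nrm (ww k) / sqrt (nrm (ww k)) = sqrt (nrm (ww k))" using W[of k] by (simp add: real_div_sqrt)
  have D0: "0 <= D i" for i by (simp add: D_def)
  have "D k ^ l * D (k - 1) = D k * (D k ^ j * D (k - 1))" by (simp add: j mult.assoc)
  also have "... <= sqrt (nrm (ww k)) * (nrm (ww k) ^ j * nrm (ww (k - 1)))"
   using D0 dW det_le[of k] by (intro mult_mono power_mono mult_nonneg_nonneg zero_le_power) (auto simp: D_def)
  also have "... = nrm (ww k) / sqrt (nrm (ww k)) * (nrm (ww k) ^ j * nrm (ww (k - 1)))" by (simp only: sq)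
  also have "... = (nrm (ww k) ^ l * nrm (ww (k - 1))) / sqrt (nrm (ww k))" by (simp add: j)
  finally show ?thesis .
 qed
 have F0: "F > 0" using F_ge_1 by linarith
 have "?d = (D k ^ l * D (k - 1)) * F" unfolding mdet_T D_def by simp
 also have "... <= ((2 * NPhi * ?n) / sqrt (nrm (ww k))) * F"
 proof -
  have "(nrm (ww k) ^ l * nrm (ww (k - 1))) / sqrt (nrm (ww k)) <= (2 * NPhi * ?n) / sqrt (nrm (ww k))"
   using lowN W[of k] by (intro divide_right_mono) auto
  then show ?thesis using prod F0 by (intro mult_right_mono) auto
 qed
 finally have "?d / ?n <= (((2 * NPhi * ?n) / sqrt (nrm (ww k))) * F) / ?n" by (intro divide_right_mono) auto
 also have "... = (F * (2 * NPhi)) / sqrt (nrm (ww k))" using T_nrm_pos[of k l] by simp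
 finally have dn: "?d / ?n <= (F * (2 * NPhi)) / sqrt (nrm (ww k))" .
 have "rho xi (T k l) <= c4 * (?d / ?n)" using elim(1) l by auto
 also have "... <= \<bar>c4\<bar> * (?d / ?n)" by (intro mult_right_mono) auto
 also have "... <= \<bar>c4\<bar> * ((F * (2 * NPhi)) / sqrt (nrm (ww k)))" using dn by (intro mult_left_mono) auto
 finally have r: "rho xi (T k l) <= \<bar>c4\<bar> * ((F * (2 * NPhi)) / sqrt (nrm (ww k)))" .
 have "err xi (X_vec (T k l)) <= (1 + \<bar>xi\<bar>) * rho xi (T k l)" by (rule err_X_vec_le[OF tr_T[OF elim(2)]])
 also have "... <= (1 + \<bar>xi\<bar>) * (\<bar>c4\<bar> * ((F * (2 * NPhi)) / sqrt (nrm (ww k))))" using r by (intro mult_left_mono) auto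
 finally show ?case by simp
qed

text \<open>If the form \<open>r\<close> vanishes at \<open>xi\<close>, its scalar products with the
  points of \<open>T k 1\<close> and \<open>T k 2\<close> are integers tending to 0, hence
  eventually 0. These two points are independent and orthogonal to the form of \<open>ww k\<close>,
  so \<open>r\<close> is parallel to that form for every large \<open>k\<close>, although
  consecutive forms are independent.\<close>

lemma irrational:
 assumes r: "r ~= 0"
 shows "lin xi r ~= 0"
proof
 assume l0: "lin xi r = 0"
 define C where "C = (1 + \<bar>xi\<bar>) * (\<bar>c4\<bar> * (F * (2 * NPhi)))"
 have ev: "EV k. dotZ r (X_vec (T k l)) = 0" if l: "l = 1 \<or> l = 2" for l
 proof -
  have "(\<lambda>k. (2 * hgt r * C) / sqrt (nrm (ww k))) \<longlonglongrightarrow> 0" by (rule inv_sqrt_lim)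
  from order_tendstoD(2)[OF this, of 1] have "EV k. (2 * hgt r * C) / sqrt (nrm (ww k)) < 1" by simp
  with T_err_lim[OF l] show ?thesis
  proof eventually_elim
   case (elim k)
   have "\<bar>real_of_int (dotZ r (X_vec (T k l)))\<bar> <= 2 * hgt r * err xi (X_vec (T k l))"
    using dotZ_bound[of r "X_vec (T k l)" xi] l0 by simp
   also have "... <= 2 * hgt r * (C / sqrt (nrm (ww k)))" using elim(1) unfolding C_def by (intro mult_left_mono) auto
   also have "... < 1" using elim(2) by simp
   finally show ?case by linarith
  qed
 qed
 have e1: "EV k. dotZ r (X_vec (T k 1)) = 0" by (rule ev) simp
 have e2: "EV k. dotZ r (X_vec (T k 2)) = 0" by (rule ev) simp
 have par: "EV k. crossZ r (U_vec (ww k)) = 0"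
  using e1 e2 eventually_ge_at_top[of 2]
 proof eventually_elim
  case (elim k)
  have k: "k >= 1" "k - 1 >= 1" "k - 1 + 1 = k" using elim(3) by auto
  let ?x = "X_vec (T k 1)" and ?y = "X_vec (T k 2)" and ?u = "U_vec (ww k)" and ?u' = "U_vec (ww (k - 1))"
  have ux: "dotZ ?u ?x = 0" "dotZ ?u ?y = 0" unfolding dotZ_U_X[OF tr_T[OF k(1)]] by (rule tr_w_T[OF k(1)])+
  have u'x: "dotZ ?u' ?x = 0" unfolding dotZ_U_X[OF tr_T[OF k(1)]] using tr_w_T_next[OF k(2)] k(3) by simp
  \<comment> \<open>The form of the preceding matrix is orthogonal to the first point but not to the
    second, which shows that the two points are independent.\<close>
  have u'y: "dotZ ?u' ?y ~= 0" unfolding dotZ_U_X[OF tr_T[OF k(1)]]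
   using tr_w_T_2[OF k(2)] det_nz e0_nz unfolding k(3) by simp
  show ?case
  proof (rule ccontr)
   assume "crossZ r ?u ~= 0"
   from crossZ_orthogonal_pair[OF _ _ _ _ this, of ?x ?y] have "crossZ ?x ?y = 0" using elim ux by simp
   then have c: "?x $ i * ?y $ j = ?x $ j * ?y $ i" for i j using crossZ_eq_0_iff by blast
   have "dotZ ?u' ?y * ?x $ i = dotZ ?u' ?x * ?y $ i" for i
    unfolding dotZ_def using c[of i 1] c[of i 2] c[of i 3] by (simp add: algebra_simps)
   then have "?x $ i = 0" for i using u'x u'y by simp
   then have "?x = 0" by (simp add: vec_eq_iff)
   then show False using X_vec_nz[OF tr_T[OF k(1)] T_nz] by blast
  qed
 qed
 then have "EV k. crossZ r (U_vec (ww k)) = 0 & crossZ r (U_vec (ww (k + 1))) = 0"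
  using eventually_next[OF par] by eventually_elim simp
 then obtain k where k: "crossZ r (U_vec (ww k)) = 0" "crossZ r (U_vec (ww (k + 1))) = 0"
  unfolding eventually_sequentially by blast
 have "crossZ (U_vec (ww k)) (U_vec (ww (k + 1))) ~= 0"
 proof
  assume "crossZ (U_vec (ww k)) (U_vec (ww (k + 1))) = 0"
  then have "X_vec (ww k * ww (k + 1) - ww (k + 1) * ww k) = 0" unfolding crossZ_U_U by simp
  moreover have "tr (ww k * ww (k + 1) - ww (k + 1) * ww k) = 0" by (simp add: tr_mult_commute)
  ultimately have "ww k * ww (k + 1) - ww (k + 1) * ww k = 0" using X_vec_nz by blast
  then show False using E_nz[of "k + 1"] by (simp add: E_def)
 qed
 from parallel_to_independent[OF k this] r show False by simp
qed

lemma wt_ww: "wt k = ww k"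
 using w_eq[of k] cont_ww[of k] by simp

lemma m_le_theta:
 assumes "real (2 * m) <= \<theta> * real n"
 shows "ln \<bar>real_of_int (mdet (ww k))\<bar> <= \<theta> * ln (nrm (ww k))"
proof -
 have t: "\<theta> >= 0"
 proof (rule ccontr)
  assume "~ \<theta> >= 0"
  then have "\<theta> * real n < 0" using n2 by (intro mult_neg_pos) auto
  then show False using assms of_nat_0_le_iff[of "2 * m"] by linarith
 qed
 have "real (2 * m * qq k) * ln 2 = real (2 * m) * (real (qq k) * ln 2)" by simp
 also have "... <= (\<theta> * real n) * (real (qq k) * ln 2)" using assms by (intro mult_right_mono) auto
 also have "... = \<theta> * (real (n * qq k) * ln 2)" by simp
 also have "... <= \<theta> * ln (nrm (ww k))" using ln_nrm_ww(1)[of k] t by (intro mult_left_mono)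
 finally show ?thesis unfolding ln_det_ww .
qed

end

section \<open>The number \<open>\<delta>\<close> of the examples, and the conclusion\<close>

definition to_mat :: "mat2 \<Rightarrow> int^2^2" where
 "to_mat A = vector [vector [m11 A, m12 A], vector [m21 A, m22 A]]"

lemma of_mat_to_mat [simp]: "of_mat (to_mat A) = A"
 by (simp add: mat2_eq_iff to_mat_def)

lemma of_mat_inj: "of_mat A = of_mat B ==> A = B"
 by (simp add: mat2_eq_iff vec_eq_iff forall_2)

context sturm_example
begin

text \<open>The hypothesis gives the determinant condition with error term 0. In the limit, the
  bounds for the logarithms of norm and determinant place \<open>\<delta>\<close> between
  \<open>2 * m / (n + 2)\<close> and \<open>2 * m / n\<close>.\<close>

lemma sturm_example_exponent:
 assumes le: "real (2 * m) <= sturm_sigma s / (1 + sturm_sigma s) * real n"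
 obtains B \<delta> p z where "sturm_points s B \<delta> xi (\<lambda>k. B * q k) p z" "xi \<in> Sturm s"
  "real n * \<delta> <= real (2 * m)" "real (2 * m) <= real (n + 2) * \<delta>"
proof -
 let ?\<theta> = "sturm_sigma s / (1 + sturm_sigma s)"
 interpret sm: sturm_matrices s ww 1 xi
 proof (unfold_locales)
  show "r ~= 0 ==> lin xi r ~= 0" for r by (rule irrational)
  fix eta :: real assume eta: "eta > 0"
  have "ln \<bar>real_of_int (mdet (wt k))\<bar> <= (?\<theta> + eta) * ln (nrm (wt k))" for k
  proof -
   have "?\<theta> * ln (nrm (ww k)) <= (?\<theta> + eta) * ln (nrm (ww k))"
    using eta nrm_ww_ge(2)[of k] by (intro mult_right_mono) auto
   then show ?thesis unfolding wt_ww using m_le_theta[OF le, of k] by linarith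
  qed
  then show "EV k. ln \<bar>real_of_int (mdet (wt k))\<bar> <= (?\<theta> + eta) * ln (nrm (wt k))"
   by (intro always_eventually allI)
 qed
 obtain A where A: "A > 0" "EV k. A * W k <= \<bar>real_of_int (m12 (ww k))\<bar>"
  using lead_deriv_estimate[OF sm.Phi_conditions] by blast
 define v where "v k = to_mat (ww k)" for k
 have ov [simp]: "of_mat (v k) = ww k" for k by (simp add: v_def)
 have vnz: "of_mat (v k) ~= 0" for k using w_nonzero[of k] by simp
 have pv: "prim (of_mat (v k)) = ww k" for k using wt_ww[of k] by (simp add: wt_def)
 have W: "W k >= 1" for k by (rule nrm_ww_ge)
 have val_col: "\<bar>val xi (ww k)\<bar> <= (1 + \<bar>xi\<bar>) * col (ww k)" for k
 proof -
  let ?u = "real_of_int (m21 (ww k)) - xi * real_of_int (m11 (ww k))" and ?t = "real_of_int (m22 (ww k)) - xi * real_of_int (m12 (ww k))"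
  have c: "\<bar>?u\<bar> <= col (ww k)" "\<bar>?t\<bar> <= col (ww k)" by (auto simp: col_def)
  have "val xi (ww k) = - ?u - xi * ?t" by (simp add: val_def power2_eq_square algebra_simps)
  moreover have "\<bar>xi * ?t\<bar> <= \<bar>xi\<bar> * col (ww k)" by (rule abs_mult_le[OF order_refl c(2)])
  ultimately show ?thesis using c(1) by (simp only: distrib_right mult_1; linarith)
 qed
 have seq: "sturm_sequence s xi v"
  unfolding sturm_sequence_def
 proof (intro conjI allI impI)
  fix k
  have "det (map_matrix rat_of_int (v k)) = rat_of_int (det (v k))" by (simp add: det_2 map_matrix_def)
  also have "... = rat_of_int (mdet (ww k))" by (simp add: det_of_mat)
  finally show "invertible (map_matrix rat_of_int (v k))" using det_nz[of k] by (simp add: invertible_det_nz)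
 next
  fix k :: nat assume "k >= 1"
  then show "v (k + 1) = mat_power (v k) (s (k + 1)) ** v (k - 1)"
   by (intro of_mat_inj) (simp only: of_mat_mult of_mat_power ov ww_rec)
 next
  show "det (v 0 ** v 1 - v 1 ** v 0) ~= 0"
   unfolding det_of_mat of_mat_diff of_mat_mult ov by (rule comm)
 next
  show "\<exists>c>0. \<forall>k\<ge>1. \<forall>l\<le>s (k + 1). c * infnorm (real_mat (v k)) * infnorm (real_mat (mat_power (v k) l ** v (k - 1)))
    <= infnorm (real_mat (mat_power (v k) (l + 1) ** v (k - 1)))"
  proof (intro exI[of _ 1] conjI allI impI)
   fix k l :: nat assume "k >= 1" "l <= s (k + 1)"
   then show "1 * infnorm (real_mat (v k)) * infnorm (real_mat (mat_power (v k) l ** v (k - 1)))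
     <= infnorm (real_mat (mat_power (v k) (l + 1) ** v (k - 1)))"
    unfolding infnorm_real_mat of_mat_mult of_mat_power ov by (rule growth)
  qed simp
 next
  show "(\<lambda>k. poly (U_poly (primitive_part_mat (v k))) xi / poly_height (U_poly (primitive_part_mat (v k)))) \<longlonglongrightarrow> 0"
   unfolding poly_U_primitive[OF vnz] pv
  proof (rule Lim_null_comparison[OF _ col_lim[of "(1 + \<bar>xi\<bar>) / A"]])
   show "EV k. norm (val xi (ww k) / poly_height (U_poly (primitive_part_mat (v k))))
     <= (1 + \<bar>xi\<bar>) / A * (col (ww k) / nrm (ww k))"
    using A(2)
   proof eventually_elim
    case (elim k)
    let ?H = "poly_height (U_poly (primitive_part_mat (v k)))"
    have H: "A * W k <= ?H" using height_U_primitive(2)[OF vnz, of k] elim unfolding pv by linarith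
    have AW: "A * W k > 0" using A(1) W[of k] by (intro mult_pos_pos) linarith+
    have "norm (val xi (ww k) / ?H) = \<bar>val xi (ww k)\<bar> / ?H" using H AW by simp
    also have "... <= ((1 + \<bar>xi\<bar>) * col (ww k)) / (A * W k)"
     using val_col[of k] H AW by (intro frac_le) (auto intro: order_trans[OF abs_ge_zero val_col])
    also have "... = (1 + \<bar>xi\<bar>) / A * (col (ww k) / nrm (ww k))" by simp
    finally show ?case .
   qed
  qed
 next
  show "\<exists>\<epsilon>. \<epsilon> \<longlonglongrightarrow> 0 & (EV k. \<bar>det (primitive_part_mat (v k))\<bar> <=
       infnorm (primitive_part_mat (v k)) powr (?\<theta> + \<epsilon> k))"
  proof (intro exI[of _ "\<lambda>_. 0"] conjI always_eventually allI)
   fix k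
   have "\<bar>real_of_int (mdet (ww k))\<bar> = exp (ln \<bar>real_of_int (mdet (ww k))\<bar>)" using det_nz[of k] by simp
   also have "... <= exp (?\<theta> * ln (nrm (ww k)))" using m_le_theta[OF le, of k] by (simp only: exp_le_cancel_iff)
   also have "... = nrm (ww k) powr ?\<theta>" unfolding powr_def using W[of k] by auto
   finally show "\<bar>det (primitive_part_mat (v k))\<bar> <= infnorm (primitive_part_mat (v k)) powr (?\<theta> + 0)"
    unfolding det_primitive_part[OF vnz] infnorm_primitive_part[OF vnz] pv by simp
  qed simp
 qed
 have St: "xi \<in> Sturm s"
  unfolding Sturm_def using Sturm_irrational[of xi] irrational seq by blast
 obtain B \<delta> p z where sp: "sturm_points s B \<delta> xi (\<lambda>k. B * q k) p z"
  and a: "(\<lambda>k. sm.a k / q k) \<longlonglongrightarrow> B" and b: "(\<lambda>k. sm.b k / q k) \<longlonglongrightarrow> - ((1 - \<delta>) * B)"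
  using sm.sturm_points_exist by blast
 have B: "B > 0" using sp by (simp add: sturm_points_def sturm_points_axioms_def)
 have ae: "sm.a k = ln (nrm (ww k))" for k unfolding sm.a_def cont_ww by simp
 have be: "sm.b k + sm.a k = ln \<bar>real_of_int (mdet (ww k))\<bar>" for k unfolding sm.b_def sm.a_def cont_ww by simp
 have "(\<lambda>k. sm.b k / q k + sm.a k / q k) \<longlonglongrightarrow> - ((1 - \<delta>) * B) + B" by (intro tendsto_add a b)
 then have d: "(\<lambda>k. ln \<bar>real_of_int (mdet (ww k))\<bar> / q k) \<longlonglongrightarrow> \<delta> * B"
  unfolding be[symmetric] add_divide_distrib by (simp add: left_diff_distrib)
 have a': "(\<lambda>k. ln (nrm (ww k)) / q k) \<longlonglongrightarrow> B" using a unfolding ae .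
 have up: "real n * ln \<bar>real_of_int (mdet (ww k))\<bar> <= real (2 * m) * ln (nrm (ww k))" for k
 proof -
  have "real n * (real (2 * m * qq k) * ln 2) = real (2 * m) * (real (n * qq k) * ln 2)" by simp
  also have "... <= real (2 * m) * ln (nrm (ww k))" using ln_nrm_ww(1)[of k] by (intro mult_left_mono) auto
  finally show ?thesis unfolding ln_det_ww .
 qed
 have lo: "real (2 * m) * ln (nrm (ww k)) <= real (n + 2) * ln \<bar>real_of_int (mdet (ww k))\<bar>" for k
 proof -
  have "real (2 * m) * ln (nrm (ww k)) <= real (2 * m) * (real ((n + 2) * qq k) * ln 2)"
   using ln_nrm_ww(2)[of k] by (intro mult_left_mono) auto
  also have "... = real (n + 2) * (real (2 * m * qq k) * ln 2)" by (simp only: of_nat_mult mult_ac)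
  finally show ?thesis unfolding ln_det_ww .
 qed
 have "real n * (\<delta> * B) <= real (2 * m) * B"
 proof (rule LIMSEQ_le[OF tendsto_mult_left[OF d] tendsto_mult_left[OF a']], intro exI allI impI)
  fix k
  have "real n * ln \<bar>real_of_int (mdet (ww k))\<bar> / q k <= real (2 * m) * ln (nrm (ww k)) / q k"
   using up[of k] q_pos[of k] by (intro divide_right_mono) auto
  then show "real n * (ln \<bar>real_of_int (mdet (ww k))\<bar> / q k) <= real (2 * m) * (ln (nrm (ww k)) / q k)"
   by (simp only: times_divide_eq_right)
 qed
 then have 1: "real n * \<delta> <= real (2 * m)" using B by (simp only: mult.assoc[symmetric] mult_le_cancel_right_pos)
 have "real (2 * m) * B <= real (n + 2) * (\<delta> * B)"
 proof (rule LIMSEQ_le[OF tendsto_mult_left[OF a'] tendsto_mult_left[OF d]], intro exI allI impI)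
  fix k
  have "real (2 * m) * ln (nrm (ww k)) / q k <= real (n + 2) * ln \<bar>real_of_int (mdet (ww k))\<bar> / q k"
   using lo[of k] q_pos[of k] by (intro divide_right_mono) auto
  then show "real (2 * m) * (ln (nrm (ww k)) / q k) <= real (n + 2) * (ln \<bar>real_of_int (mdet (ww k))\<bar> / q k)"
   by (simp only: times_divide_eq_right)
 qed
 then have 2: "real (2 * m) <= real (n + 2) * \<delta>" using B by (simp only: mult.assoc[symmetric] mult_le_cancel_right_pos)
 show ?thesis by (rule that[OF sp St 1 2])
qed

end

text \<open>\<open>omega2_hat\<close> depends on \<open>\<xi>\<close> alone, and its value
  determines \<open>\<delta>\<close> because \<open>1 + \<sigma>\<close> is not zero.\<close>

lemma sturm_points_unique:
 assumes 1: "sturm_points s B \<delta> \<xi> Q p z" and 2: "sturm_points s B' \<delta>' \<xi> Q' p' z'"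
 shows "\<delta> = \<delta>'"
proof -
 interpret sturm_points s B \<delta> \<xi> Q p z by (rule 1)
 have "ereal (1 + (1 - \<delta>) * (1 + sturm_sigma s)) = ereal (1 + (1 - \<delta>') * (1 + sturm_sigma s))"
  by (rule trans[OF omega2_hat_eq[symmetric] sturm_points.omega2_hat_eq[OF 2]])
 then have "(1 - \<delta>) * (1 + sturm_sigma s) = (1 - \<delta>') * (1 + sturm_sigma s)" by simp
 moreover have "1 + sturm_sigma s ~= 0" using sigma_nonneg by linarith
 ultimately show ?thesis by simp
qed

theorem theorem1p3:
 fixes s :: "nat \<Rightarrow> nat" and \<sigma> :: real
 assumes s_pos: "\<And>k. k \<ge> 1 \<Longrightarrow> s k > 0"
  and sigma: "\<sigma> = sturm_sigma s"
 shows "\<exists>\<delta> :: real \<Rightarrow> real.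
  \<delta> ` Sturm s \<subseteq> {0..\<sigma> / (1 + \<sigma>)} \<and>
  {0..\<sigma> / (1 + \<sigma>)} \<subseteq> closure (\<delta> ` Sturm s) \<and>
  (\<forall>\<xi>\<in>Sturm s.
    omega2_hat \<xi> = ereal (1 + (1 - \<delta> \<xi>) * (1 + \<sigma>)) \<and>
    omega2_star_hat \<xi> = ereal (1 + (1 - \<delta> \<xi>) * (1 + \<sigma>)) \<and>
    lambda2_hat \<xi> = ereal ((1 - \<delta> \<xi>) * (1 + \<sigma>) / (1 + (1 - \<delta> \<xi>) * (1 + \<sigma>))) \<and>
    omega2 \<xi> = (if \<sigma> = 0 then \<infinity> else ereal ((2 - \<delta> \<xi>) / \<sigma> + 1 - \<delta> \<xi>)) \<and>
    omega2_star \<xi> = (if \<sigma> = 0 then \<infinity> else ereal ((2 - \<delta> \<xi>) / \<sigma> + 1 - \<delta> \<xi>)) \<and>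
    ereal (1 - \<delta> \<xi>) \<le> lambda2 \<xi> \<and>
    lambda2 \<xi> \<le> ereal (max (1 - \<delta> \<xi>) (1 / (1 - \<delta> \<xi> + \<sigma>))) \<and>
    (\<delta> \<xi> < sturm_h \<sigma> \<longrightarrow>
     lambda2 \<xi> = ereal (1 - \<delta> \<xi>) \<and>
     lambda_min_hat \<xi> = ereal ((1 - \<delta> \<xi>) * (1 + \<sigma>) / (2 + \<sigma>))) \<and>
    (\<delta> \<xi> = sturm_h \<sigma> \<longrightarrow> lambda2 \<xi> = ereal (1 - \<delta> \<xi>)))"
proof -
 interpret sturm_seq s by unfold_locales (rule s_pos)
 \<comment> \<open>The matrices attached to \<open>\<xi>\<close> are not unique, so a choice is
   made; \<open>sturm_points_unique\<close> shows that every choice gives the same number.\<close>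
 define \<delta> where "\<delta> \<xi> = (SOME d. \<exists>B p z. sturm_points s B d \<xi> (\<lambda>k. B * q k) p z)" for \<xi>
 have \<delta>: "\<exists>B p z. sturm_points s B (\<delta> \<xi>) \<xi> (\<lambda>k. B * q k) p z" if "\<xi> \<in> Sturm s" for \<xi>
 proof -
  have "\<exists>d. \<exists>B p z. sturm_points s B d \<xi> (\<lambda>k. B * q k) p z" using sturm_points_of_Sturm[OF s_pos that] by blast
  then show ?thesis unfolding \<delta>_def by (rule someI_ex)
 qed
 show ?thesis
 proof (intro exI[of _ \<delta>] conjI ballI subsetI)
  fix d assume "d \<in> \<delta> ` Sturm s"
  then obtain \<xi> where \<xi>: "\<xi> \<in> Sturm s" "d = \<delta> \<xi>" by blast
  obtain B p z where "sturm_points s B (\<delta> \<xi>) \<xi> (\<lambda>k. B * q k) p z" using \<delta>[OF \<xi>(1)] by blast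
  then show "d \<in> {0..\<sigma> / (1 + \<sigma>)}" unfolding \<xi>(2) sigma by (simp add: sturm_points_def sturm_points_axioms_def)
 next
  fix \<rho> assume \<rho>: "\<rho> \<in> {0..\<sigma> / (1 + \<sigma>)}"
  have "\<sigma> / (1 + \<sigma>) <= 1 / 2" unfolding sigma using sigma_nonneg sigma_less_1 by (simp add: field_simps)
  moreover have \<rho>0: "0 <= \<rho>" "\<rho> <= \<sigma> / (1 + \<sigma>)" using \<rho> by auto
  ultimately have "\<rho> <= 1 / 2" by linarith
  note \<rho>1 = \<rho>0 this
  show "\<rho> \<in> closure (\<delta> ` Sturm s)"
   unfolding closure_approachable
  proof (intro allI impI)
   fix e :: real assume e: "e > 0"
   \<comment> \<open>The error of the approximation turns out to be below
     \<open>4 / (n + 2)\<close>, which the choice of \<open>n0\<close> makes smaller than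
     \<open>e\<close>.\<close>
   obtain n0 :: nat where n0: "4 / e < real n0" using reals_Archimedean2 by blast
   define n where "n = n0 + 2"
   define m where "m = nat \<lfloor>\<rho> * real n / 2\<rfloor>"
   have fl: "real m <= \<rho> * real n / 2" "\<rho> * real n / 2 < real m + 1"
   proof -
    have "\<lfloor>\<rho> * real n / 2\<rfloor> >= 0" using \<rho>1(1) by simp
    then have "real m = real_of_int \<lfloor>\<rho> * real n / 2\<rfloor>" by (simp add: m_def)
    then show "real m <= \<rho> * real n / 2" "\<rho> * real n / 2 < real m + 1" by linarith+
   qed
   have rn: "\<rho> * real n <= 1 / 2 * real n" using \<rho>1 by (intro mult_right_mono) auto
   then have "real (4 * m) <= real n" using fl(1) by simp
   then have m4: "4 * m <= n" by (simp only: of_nat_le_iff)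
   interpret ex: sturm_example s m n by unfold_locales (use m4 in \<open>simp_all add: n_def\<close>)
   have "\<rho> * real n <= sturm_sigma s / (1 + sturm_sigma s) * real n" using \<rho>1(2) unfolding sigma by (intro mult_right_mono) auto
   then have "real (2 * m) <= sturm_sigma s / (1 + sturm_sigma s) * real n" using fl(1) by simp
   then obtain B d p z where d: "sturm_points s B d ex.xi (\<lambda>k. B * q k) p z" "ex.xi \<in> Sturm s"
    "real n * d <= real (2 * m)" "real (2 * m) <= real (n + 2) * d"
    by (rule ex.sturm_example_exponent)
   obtain B' p' z' where "sturm_points s B' (\<delta> ex.xi) ex.xi (\<lambda>k. B' * q k) p' z'" using \<delta>[OF d(2)] by blast
   then have dd: "\<delta> ex.xi = d" using d(1) by (rule sturm_points_unique)
   have "real n * d <= real n * \<rho>" using d(3) fl(1) by (simp add: mult.commute)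
   then have up: "d <= \<rho>" by (simp add: n_def)
   \<comment> \<open>Rounding \<open>\<rho> * n / 2\<close> down to \<open>m\<close> contributes 2,
     and the gap between \<open>n\<close> and \<open>n + 2\<close> contributes
     \<open>2 * \<rho>\<close>.\<close>
   have "real (n + 2) * (\<rho> - d) <= 2 + 2 * \<rho>"
    using d(4) fl(2) by (simp add: algebra_simps)
   also have "... < 4" using \<rho>1(3) by simp
   also have "4 <= real (n + 2) * e"
   proof -
    have "4 < real n0 * e" using n0 e by (simp add: divide_less_eq)
    also have "... <= real (n + 2) * e" using e by (intro mult_right_mono) (auto simp: n_def)
    finally show ?thesis by simp
   qed
   finally have "\<rho> - d < e" by (simp only: mult_less_cancel_left_pos of_nat_0_less_iff)
   then have "dist (\<delta> ex.xi) \<rho> < e" unfolding dd dist_real_def using up by linarith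
   then show "\<exists>y\<in>\<delta> ` Sturm s. dist y \<rho> < e" using d(2) by blast
  qed
 next
  fix \<xi> assume "\<xi> \<in> Sturm s"
  then obtain B p z where "sturm_points s B (\<delta> \<xi>) \<xi> (\<lambda>k. B * q k) p z" using \<delta> by blast
  then interpret sp: sturm_points s B "\<delta> \<xi>" \<xi> "\<lambda>k. B * q k" p z .
  show "omega2_hat \<xi> = ereal (1 + (1 - \<delta> \<xi>) * (1 + \<sigma>))" unfolding sigma by (rule sp.omega2_hat_eq)
  show "omega2_star_hat \<xi> = ereal (1 + (1 - \<delta> \<xi>) * (1 + \<sigma>))" unfolding sigma by (rule sp.omega2_star_hat_eq)
  show "lambda2_hat \<xi> = ereal ((1 - \<delta> \<xi>) * (1 + \<sigma>) / (1 + (1 - \<delta> \<xi>) * (1 + \<sigma>)))"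
   unfolding sigma by (rule sp.lambda2_hat_eq)
  show "omega2 \<xi> = (if \<sigma> = 0 then \<infinity> else ereal ((2 - \<delta> \<xi>) / \<sigma> + 1 - \<delta> \<xi>))" unfolding sigma by (rule sp.omega2_eq)
  show "omega2_star \<xi> = (if \<sigma> = 0 then \<infinity> else ereal ((2 - \<delta> \<xi>) / \<sigma> + 1 - \<delta> \<xi>))" unfolding sigma by (rule sp.omega2_star_eq)
  show "ereal (1 - \<delta> \<xi>) <= lambda2 \<xi>" by (rule sp.lambda2_lower)
  show "lambda2 \<xi> <= ereal (max (1 - \<delta> \<xi>) (1 / (1 - \<delta> \<xi> + \<sigma>)))" unfolding sigma by (rule sp.lambda2_upper)
  show "\<delta> \<xi> < sturm_h \<sigma> --> lambda2 \<xi> = ereal (1 - \<delta> \<xi>) &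
     lambda_min_hat \<xi> = ereal ((1 - \<delta> \<xi>) * (1 + \<sigma>) / (2 + \<sigma>))"
   unfolding sigma using sp.lambda2_eq sp.lambda_min_hat_eq by simp
  show "\<delta> \<xi> = sturm_h \<sigma> --> lambda2 \<xi> = ereal (1 - \<delta> \<xi>)"
   unfolding sigma using sp.lambda2_eq by simp
 qed
qed

end
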